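(* Suppose that $(A,\alpha,L)$ is an Exel system, and let $(j,t)$ be the canonical maps into the Exel crossed product $A\rtimes_{\alpha,L}\mathbb{N}$ (so $j:A\to A\rtimes_{\alpha,L}\mathbb{N}$ and $t\in M(A\rtimes_{\alpha,L}\mathbb{N})$), with dual action $\hat\alpha$ of $\mathbb{T}$. Then there is an injective endomorphism $\beta$ of $(A\rtimes_{\alpha,L}\mathbb{N})^{\hat\alpha}$ such that $$\beta(j(a)t^it^{*i}j(b))=j(\alpha(a))t^{i+1}t^{*(i+1)}j(\alpha(b))\quad\text{for }a,b\in A,\ i\in\mathbb{N}.$$ The endomorphism $\beta$ is extendible with $\overline\beta(1)=tt^*$ and has range $tt^*(A\rtimes_{\alpha,L}\mathbb{N})^{\hat\alpha}tt^*$. The pair $(\operatorname{id},t)$ is a Stacey-covariant representation of $\big((A\rtimes_{\alpha,L}\mathbb{N})^{\hat\alpha},\beta\big)$, and $\operatorname{id}\times t$ is an isomorphism of the Stacey crossed product $(A\rtimes_{\alpha,L}\mathbb{N})^{\hat\alpha}\times_\beta\mathbb{N}$ onto the Exel crossed product $A\rtimes_{\alpha,L}\mathbb{N}$.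
   Context: $M(A)$ is the multiplier algebra of $A$; $0\in\mathbb{N}$. An endomorphism $\alpha$ of a $C^*$-algebra $A$ is extendible if it extends to a strictly continuous endomorphism $\overline{\alpha}$ of $M(A)$. Exel system $(A,\alpha,L)$: $\alpha$ is an extendible endomorphism of a $C^*$-algebra $A$ (possibly nonunital), and $L:A\to A$ (the transfer operator) is a positive linear map which extends to a positive linear map $\overline{L}:M(A)\to M(A)$ such that $L(\alpha(a)m)=a\overline{L}(m)$ for $a\in A$, $m\in M(A)$, and $\overline{L}(1)=1$ ($\overline{\alpha}$ is not assumed unital). The bimodule $M_L$: give $A$ the bimodule structure $a\cdot m=am$, $m\cdot b=m\alpha(b)$ and the $A$-valued pre-inner product $\langle m,n\rangle=L(m^*n)$; quotient by $\{m:\langle m,m\rangle=0\}$ and complete to get a right-Hilbert $A$-$A$ bimodule $M_L$. Write $q:A\to M_L$ for the canonical map and $\phi:A\to\mathcal{L}(M_L)$ for the left action by adjointable operators. $\mathcal{K}(M_L)$ is the closed span of the operators $\Theta_{m,n}:p\mapsto m\cdot\langle n,p\rangle$. Exel crossed product: a Toeplitz-covariant representation of $(A,\alpha,L)$ in a $C^*$-algebra $B$ is a nondegenerate homomorphism $\pi:A\to B$ and an element $S\in M(B)$ with $S\pi(a)=\pi(\alpha(a))S$ and $S^*\pi(a)S=\pi(L(a))$. The Toeplitz crossed product $\mathcal{T}(A,\alpha,L)$ is the $C^*$-algebra generated by $i(A)\cup i(A)s$ for a universal Toeplitz-covariant representation $(i,s)$. There is a linear map $\psi_s:M_L\to\mathcal{T}(A,\alpha,L)$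 with $\psi_s(q(a))=i(a)s$, satisfying $\psi_s(m\cdot a)=\psi_s(m)i(a)$, $\psi_s(m)^*\psi_s(n)=i(\langle m,n\rangle)$, $\psi_s(a\cdot m)=i(a)\psi_s(m)$, and it induces a homomorphism $(\psi_s,i)^{(1)}:\mathcal{K}(M_L)\to\mathcal{T}(A,\alpha,L)$ with $(\psi_s,i)^{(1)}(\Theta_{m,n})=\psi_s(m)\psi_s(n)^*$. Set $K_\alpha:=\overline{A\alpha(A)A}\cap\phi^{-1}(\mathcal{K}(M_L))$ (where $\overline{A\alpha(A)A}$ is the closed linear span). The Exel crossed product $A\rtimes_{\alpha,L}\mathbb{N}$ is the quotient of $\mathcal{T}(A,\alpha,L)$ by the ideal generated by $\{i(a)-(\psi_s,i)^{(1)}(\phi(a)):a\in K_\alpha\}$. With $\mathcal{Q}$ the quotient map, $(j,t):=(\mathcal{Q}\circ i,\overline{\mathcal{Q}}(s))$. The dual action $\hat\alpha$ of $\mathbb{T}$ satisfies $\hat\alpha_z(j(a))=j(a)$, $\hat\alpha_z(t)=zt$. Its fixed-point algebra is $(A\rtimes_{\alpha,L}\mathbb{N})^{\hat\alpha}=\overline{\operatorname{span}}\{j(a)t^it^{*i}j(b):a,b\in A,\ i\in\mathbb{N}\}$. Stacey crossed products: for an endomorphism $\beta$ of a $C^*$-algebra $B$, a Stacey-covariant representation of $(B,\beta)$ in a $C^*$-algebra $D$ is a nondegenerate homomorphism $\pi:B\to D$ and an isometry $W\in M(D)$ with $\pi(\beta(b))=W\pi(b)W^*$. The Stacey crossed product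 $B\times_\beta\mathbb{N}$ is the $C^*$-algebra generated by a universal Stacey-covariant representation $(i_B,v)$; $\pi\times W:B\times_\beta\mathbb{N}\to D$ is the nondegenerate homomorphism with $(\pi\times W)\circ i_B=\pi$ and (after extension to multipliers) $(\pi\times W)(v)=W$. Here $\operatorname{id}$ is the inclusion of the fixed-point algebra in $A\rtimes_{\alpha,L}\mathbb{N}$. *)

theory Defs
  imports "HOL-Analysis.Analysis"
begin

section \<open>Complex vector spaces and C*-algebras on a carrier\<close>

text \<open>
  Structures are records with an explicit carrier, so that one can quantify over all C*-algebras
  carried by subsets of a given type. Values of operations and maps off the carriers are irrelevant.
\<close>

record 'a cvec =
  carrier :: "'a set"
  vzero :: 'a  (\<open>\<zero>\<index>\<close>)
  vadd :: "'a \<Rightarrow> 'a \<Rightarrow> 'a"  (infixl \<open>\<oplus>\<index>\<close> 65)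
  vscale :: "complex \<Rightarrow> 'a \<Rightarrow> 'a"  (infixr \<open>\<odot>\<index>\<close> 75)

record 'a cstar = "'a cvec" +
  cmul :: "'a \<Rightarrow> 'a \<Rightarrow> 'a"  (infixl \<open>\<otimes>\<index>\<close> 70)
  adj :: "'a \<Rightarrow> 'a"
  nrm :: "'a \<Rightarrow> real"

definition vdiff :: "('a, 'm) cvec_scheme \<Rightarrow> 'a \<Rightarrow> 'a \<Rightarrow> 'a"  (infixl \<open>\<ominus>\<index>\<close> 65)
  where "x \<ominus>\<^bsub>V\<^esub> y = x \<oplus>\<^bsub>V\<^esub> ((-1) \<odot>\<^bsub>V\<^esub> y)"

text \<open>The distance is cut off outside the carrier because \<^locale>\<open>Metric_space\<close> demands
  non-negativity and symmetry on the whole type.\<close>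

definition norm_dist :: "('a, 'm) cvec_scheme \<Rightarrow> ('a \<Rightarrow> real) \<Rightarrow> 'a \<Rightarrow> 'a \<Rightarrow> real"
  where "norm_dist V N x y =
    (if x \<in> carrier V \<and> y \<in> carrier V then N (x \<ominus>\<^bsub>V\<^esub> y) else 0)"

definition norm_topology :: "('a, 'm) cvec_scheme \<Rightarrow> ('a \<Rightarrow> real) \<Rightarrow> 'a topology"
  where "norm_topology V N = Metric_space.mtopology (carrier V) (norm_dist V N)"

definition operator_norm :: "('a, 'm) cvec_scheme \<Rightarrow> ('a \<Rightarrow> real) \<Rightarrow> ('a \<Rightarrow> 'a) \<Rightarrow> real"
  where "operator_norm V N f = (SUP x \<in> {x \<in> carrier V. N x \<le> 1}. N (f x))"

locale complex_vector_space =
  fixes V :: "('a, 'm) cvec_scheme" (structure)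
  assumes zero_closed: "\<zero> \<in> carrier V"
    and add_closed: "\<lbrakk>x \<in> carrier V; y \<in> carrier V\<rbrakk> \<Longrightarrow> x \<oplus> y \<in> carrier V"
    and scale_closed: "x \<in> carrier V \<Longrightarrow> c \<odot> x \<in> carrier V"
    and add_assoc: "\<lbrakk>x \<in> carrier V; y \<in> carrier V; z \<in> carrier V\<rbrakk> \<Longrightarrow> (x \<oplus> y) \<oplus> z = x \<oplus> (y \<oplus> z)"
    and add_commute: "\<lbrakk>x \<in> carrier V; y \<in> carrier V\<rbrakk> \<Longrightarrow> x \<oplus> y = y \<oplus> x"
    and add_zero: "x \<in> carrier V \<Longrightarrow> x \<oplus> \<zero> = x"
    and add_neg: "x \<in> carrier V \<Longrightarrow> x \<oplus> ((-1) \<odot> x) = \<zero>"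
    and scale_one: "x \<in> carrier V \<Longrightarrow> 1 \<odot> x = x"
    and scale_scale: "x \<in> carrier V \<Longrightarrow> c \<odot> (d \<odot> x) = (c * d) \<odot> x"
    and scale_add_left: "x \<in> carrier V \<Longrightarrow> (c + d) \<odot> x = c \<odot> x \<oplus> d \<odot> x"
    and scale_add_right: "\<lbrakk>x \<in> carrier V; y \<in> carrier V\<rbrakk> \<Longrightarrow> c \<odot> (x \<oplus> y) = c \<odot> x \<oplus> c \<odot> y"

locale cstar_algebra = complex_vector_space A for A :: "'a cstar" (structure) +
  assumes mult_closed: "\<lbrakk>x \<in> carrier A; y \<in> carrier A\<rbrakk> \<Longrightarrow> x \<otimes> y \<in> carrier A"
    and mult_assoc: "\<lbrakk>x \<in> carrier A; y \<in> carrier A; z \<in> carrier A\<rbrakk> \<Longrightarrow> (x \<otimes> y) \<otimes> z = x \<otimes> (y \<otimes> z)"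
    and mult_add_left: "\<lbrakk>x \<in> carrier A; y \<in> carrier A; z \<in> carrier A\<rbrakk> \<Longrightarrow> (x \<oplus> y) \<otimes> z = x \<otimes> z \<oplus> y \<otimes> z"
    and mult_add_right: "\<lbrakk>x \<in> carrier A; y \<in> carrier A; z \<in> carrier A\<rbrakk> \<Longrightarrow> x \<otimes> (y \<oplus> z) = x \<otimes> y \<oplus> x \<otimes> z"
    and mult_scale_left: "\<lbrakk>x \<in> carrier A; y \<in> carrier A\<rbrakk> \<Longrightarrow> (c \<odot> x) \<otimes> y = c \<odot> (x \<otimes> y)"
    and mult_scale_right: "\<lbrakk>x \<in> carrier A; y \<in> carrier A\<rbrakk> \<Longrightarrow> x \<otimes> (c \<odot> y) = c \<odot> (x \<otimes> y)"
    and adj_closed: "x \<in> carrier A \<Longrightarrow> adj A x \<in> carrier A"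
    and adj_adj: "x \<in> carrier A \<Longrightarrow> adj A (adj A x) = x"
    and adj_add: "\<lbrakk>x \<in> carrier A; y \<in> carrier A\<rbrakk> \<Longrightarrow> adj A (x \<oplus> y) = adj A x \<oplus> adj A y"
    and adj_scale: "x \<in> carrier A \<Longrightarrow> adj A (c \<odot> x) = cnj c \<odot> adj A x"
    and adj_mult: "\<lbrakk>x \<in> carrier A; y \<in> carrier A\<rbrakk> \<Longrightarrow> adj A (x \<otimes> y) = adj A y \<otimes> adj A x"
    and norm_nonneg: "x \<in> carrier A \<Longrightarrow> 0 \<le> nrm A x"
    and norm_eq_zero: "x \<in> carrier A \<Longrightarrow> nrm A x = 0 \<longleftrightarrow> x = \<zero>"
    and norm_triangle: "\<lbrakk>x \<in> carrier A; y \<in> carrier A\<rbrakk> \<Longrightarrow> nrm A (x \<oplus> y) \<le> nrm A x + nrm A y"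
    and norm_scale: "x \<in> carrier A \<Longrightarrow> nrm A (c \<odot> x) = cmod c * nrm A x"
    and norm_mult: "\<lbrakk>x \<in> carrier A; y \<in> carrier A\<rbrakk> \<Longrightarrow> nrm A (x \<otimes> y) \<le> nrm A x * nrm A y"
    and cstar_identity: "x \<in> carrier A \<Longrightarrow> nrm A (adj A x \<otimes> x) = (nrm A x)\<^sup>2"
    and complete: "Metric_space.mcomplete (carrier A) (norm_dist A (nrm A))"

definition linear_map :: "('a, 'm) cvec_scheme \<Rightarrow> ('b, 'n) cvec_scheme \<Rightarrow> ('a \<Rightarrow> 'b) \<Rightarrow> bool"
  where "linear_map V W f \<longleftrightarrow>
    f \<in> carrier V \<rightarrow> carrier W \<and>
    (\<forall>x\<in>carrier V. \<forall>y\<in>carrier V. f (x \<oplus>\<^bsub>V\<^esub> y) = f x \<oplus>\<^bsub>W\<^esub> f y) \<and>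
    (\<forall>c. \<forall>x\<in>carrier V. f (c \<odot>\<^bsub>V\<^esub> x) = c \<odot>\<^bsub>W\<^esub> f x)"

definition star_hom :: "'a cstar \<Rightarrow> 'b cstar \<Rightarrow> ('a \<Rightarrow> 'b) \<Rightarrow> bool"
  where "star_hom A B f \<longleftrightarrow>
    linear_map A B f \<and>
    (\<forall>x\<in>carrier A. \<forall>y\<in>carrier A. f (x \<otimes>\<^bsub>A\<^esub> y) = f x \<otimes>\<^bsub>B\<^esub> f y) \<and>
    (\<forall>x\<in>carrier A. f (adj A x) = adj B (f x))"

definition star_iso :: "'a cstar \<Rightarrow> 'b cstar \<Rightarrow> ('a \<Rightarrow> 'b) \<Rightarrow> bool"
  where "star_iso A B f \<longleftrightarrow> star_hom A B f \<and> bij_betw f (carrier A) (carrier B)"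

definition positive :: "'a cstar \<Rightarrow> 'a \<Rightarrow> bool"
  where "positive A x \<longleftrightarrow> (\<exists>y\<in>carrier A. x = adj A y \<otimes>\<^bsub>A\<^esub> y)"

definition positive_linear_map :: "'a cstar \<Rightarrow> 'b cstar \<Rightarrow> ('a \<Rightarrow> 'b) \<Rightarrow> bool"
  where "positive_linear_map A B f \<longleftrightarrow>
    linear_map A B f \<and> (\<forall>x\<in>carrier A. positive A x \<longrightarrow> positive B (f x))"

definition closed_subspace :: "'a cstar \<Rightarrow> 'a set \<Rightarrow> bool"
  where "closed_subspace A W \<longleftrightarrow>
    closedin (norm_topology A (nrm A)) W \<and> \<zero>\<^bsub>A\<^esub> \<in> W \<and>
    (\<forall>x\<in>W. \<forall>y\<in>W. x \<oplus>\<^bsub>A\<^esub> y \<in> W) \<and> (\<forall>c. \<forall>x\<in>W. c \<odot>\<^bsub>A\<^esub> x \<in> W)"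

definition cstar_subalgebra :: "'a cstar \<Rightarrow> 'a set \<Rightarrow> bool"
  where "cstar_subalgebra A B \<longleftrightarrow>
    closed_subspace A B \<and>
    (\<forall>x\<in>B. \<forall>y\<in>B. x \<otimes>\<^bsub>A\<^esub> y \<in> B) \<and> (\<forall>x\<in>B. adj A x \<in> B)"

definition closed_ideal :: "'a cstar \<Rightarrow> 'a set \<Rightarrow> bool"
  where "closed_ideal A I \<longleftrightarrow>
    closed_subspace A I \<and>
    (\<forall>x\<in>I. \<forall>a\<in>carrier A. a \<otimes>\<^bsub>A\<^esub> x \<in> I \<and> x \<otimes>\<^bsub>A\<^esub> a \<in> I)"

text \<open>Closed linear spans, generated C*-subalgebras and generated ideals are the hulls
  \<^term>\<open>closed_subspace A hull S\<close>, \<^term>\<open>cstar_subalgebra A hull S\<close> and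
  \<^term>\<open>closed_ideal A hull S\<close>.\<close>

definition nondegenerate_hom :: "'a cstar \<Rightarrow> 'b cstar \<Rightarrow> ('a \<Rightarrow> 'b) \<Rightarrow> bool"
  where "nondegenerate_hom A B f \<longleftrightarrow>
    star_hom A B f \<and>
    closed_subspace B hull {f a \<otimes>\<^bsub>B\<^esub> b | a b. a \<in> carrier A \<and> b \<in> carrier B} = carrier B"

definition cstar_quotient :: "'a cstar \<Rightarrow> 'a set \<Rightarrow> 'b cstar \<Rightarrow> ('a \<Rightarrow> 'b) \<Rightarrow> bool"
  where "cstar_quotient A I B Q \<longleftrightarrow>
    cstar_algebra B \<and> star_hom A B Q \<and> Q ` carrier A = carrier B \<and>
    {x \<in> carrier A. Q x = \<zero>\<^bsub>B\<^esub>} = I"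


section \<open>Multiplier algebras\<close>

text \<open>
  \<open>M(A)\<close> is the algebra of double centralizers: \<open>(l, r)\<close> stands for the multiplier \<open>m\<close> with
  \<open>m a = l a\<close> and \<open>a m = r a\<close>. The maps are extensional on the carrier of \<open>A\<close>, so that
  equality of multipliers is equality of pairs.
\<close>

type_synonym 'a multiplier = "('a \<Rightarrow> 'a) \<times> ('a \<Rightarrow> 'a)"

definition bounded_operators :: "'a cstar \<Rightarrow> ('a \<Rightarrow> 'a) set"
  where "bounded_operators A = {f \<in> extensional (carrier A).
    linear_map A A f \<and> (\<exists>K. \<forall>a\<in>carrier A. nrm A (f a) \<le> K * nrm A a)}"

definition multiplier_algebra :: "'a cstar \<Rightarrow> 'a multiplier cstar"
  where "multiplier_algebra A = \<lparr>
    carrier = {(l, r). l \<in> bounded_operators A \<and> r \<in> bounded_operators A \<and>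
      (\<forall>a\<in>carrier A. \<forall>b\<in>carrier A.
        l (a \<otimes>\<^bsub>A\<^esub> b) = l a \<otimes>\<^bsub>A\<^esub> b \<and>
        r (a \<otimes>\<^bsub>A\<^esub> b) = a \<otimes>\<^bsub>A\<^esub> r b \<and>
        r a \<otimes>\<^bsub>A\<^esub> b = a \<otimes>\<^bsub>A\<^esub> l b)},
    vzero = (\<lambda>a\<in>carrier A. \<zero>\<^bsub>A\<^esub>, \<lambda>a\<in>carrier A. \<zero>\<^bsub>A\<^esub>),
    vadd = (\<lambda>(l, r) (l', r'). (\<lambda>a\<in>carrier A. l a \<oplus>\<^bsub>A\<^esub> l' a, \<lambda>a\<in>carrier A. r a \<oplus>\<^bsub>A\<^esub> r' a)),
    vscale = (\<lambda>c (l, r). (\<lambda>a\<in>carrier A. c \<odot>\<^bsub>A\<^esub> l a, \<lambda>a\<in>carrier A. c \<odot>\<^bsub>A\<^esub> r a)),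
    cmul = (\<lambda>(l, r) (l', r'). (\<lambda>a\<in>carrier A. l (l' a), \<lambda>a\<in>carrier A. r' (r a))),
    adj = (\<lambda>(l, r). (\<lambda>a\<in>carrier A. adj A (r (adj A a)), \<lambda>a\<in>carrier A. adj A (l (adj A a)))),
    nrm = (\<lambda>(l, r). operator_norm A (nrm A) l) \<rparr>"

definition mult_one :: "'a cstar \<Rightarrow> 'a multiplier"
  where "mult_one A = (\<lambda>a\<in>carrier A. a, \<lambda>a\<in>carrier A. a)"

text \<open>The canonical embedding of \<open>A\<close> in \<open>M(A)\<close>.\<close>

definition mult_of :: "'a cstar \<Rightarrow> 'a \<Rightarrow> 'a multiplier"
  where "mult_of A x = (\<lambda>a\<in>carrier A. x \<otimes>\<^bsub>A\<^esub> a, \<lambda>a\<in>carrier A. a \<otimes>\<^bsub>A\<^esub> x)"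

text \<open>Products \<open>m a\<close> and \<open>a m\<close> of a multiplier and an element, as elements of \<open>A\<close>.\<close>

definition mult_left :: "'a multiplier \<Rightarrow> 'a \<Rightarrow> 'a"
  where "mult_left m a = fst m a"

definition mult_right :: "'a \<Rightarrow> 'a multiplier \<Rightarrow> 'a"
  where "mult_right a m = snd m a"

definition mult_power :: "'a cstar \<Rightarrow> 'a multiplier \<Rightarrow> nat \<Rightarrow> 'a multiplier"
  where "mult_power A m n = ((\<lambda>x. m \<otimes>\<^bsub>multiplier_algebra A\<^esub> x) ^^ n) (mult_one A)"

definition strict_topology :: "'a cstar \<Rightarrow> 'a multiplier topology"
  where "strict_topology A = topology_generated_by
    {{n \<in> carrier (multiplier_algebra A).
        nrm A (mult_left n a \<ominus>\<^bsub>A\<^esub> mult_left m a) < e \<and>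
        nrm A (mult_right a n \<ominus>\<^bsub>A\<^esub> mult_right a m) < e}
      | m a e. m \<in> carrier (multiplier_algebra A) \<and> a \<in> carrier A \<and> 0 < e}"

definition strict_extension ::
    "'a cstar \<Rightarrow> ('a \<Rightarrow> 'a) \<Rightarrow> ('a multiplier \<Rightarrow> 'a multiplier) \<Rightarrow> bool"
  where "strict_extension A \<alpha> \<alpha>' \<longleftrightarrow>
    star_hom (multiplier_algebra A) (multiplier_algebra A) \<alpha>' \<and>
    continuous_map (strict_topology A) (strict_topology A) \<alpha>' \<and>
    (\<forall>a\<in>carrier A. \<alpha>' (mult_of A a) = mult_of A (\<alpha> a))"

definition extendible :: "'a cstar \<Rightarrow> ('a \<Rightarrow> 'a) \<Rightarrow> bool"
  where "extendible A \<alpha> \<longleftrightarrow> (\<exists>\<alpha>'. strict_extension A \<alpha> \<alpha>')"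

text \<open>The extension \<open>M(A) \<rightarrow> M(B)\<close> of a nondegenerate homomorphism \<open>A \<rightarrow> B\<close>; nondegeneracy makes
  it exist and be unique.\<close>

definition mult_extension ::
    "'a cstar \<Rightarrow> 'b cstar \<Rightarrow> ('a \<Rightarrow> 'b) \<Rightarrow> 'a multiplier \<Rightarrow> 'b multiplier"
  where "mult_extension A B f = (THE f'.
    f' \<in> extensional (carrier (multiplier_algebra A)) \<and>
    star_hom (multiplier_algebra A) (multiplier_algebra B) f' \<and>
    (\<forall>a\<in>carrier A. f' (mult_of A a) = mult_of B (f a)))"


section \<open>Exel systems and the bimodule \<open>M\<^sub>L\<close>\<close>

definition exel_system :: "'a cstar \<Rightarrow> ('a \<Rightarrow> 'a) \<Rightarrow> ('a \<Rightarrow> 'a) \<Rightarrow> bool"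
  where "exel_system A \<alpha> L \<longleftrightarrow>
    cstar_algebra A \<and> star_hom A A \<alpha> \<and> extendible A \<alpha> \<and> positive_linear_map A A L \<and>
    (\<exists>L'. positive_linear_map (multiplier_algebra A) (multiplier_algebra A) L' \<and>
      (\<forall>a\<in>carrier A. L' (mult_of A a) = mult_of A (L a)) \<and>
      (\<forall>a\<in>carrier A. \<forall>m\<in>carrier (multiplier_algebra A).
        L (mult_right (\<alpha> a) m) = mult_right a (L' m)) \<and>
      L' (mult_one A) = mult_one A)"

record ('a, 'x) bimodule = "'x cvec" +
  ract :: "'x \<Rightarrow> 'a \<Rightarrow> 'x"
  lact :: "'a \<Rightarrow> 'x \<Rightarrow> 'x"
  ip :: "'x \<Rightarrow> 'x \<Rightarrow> 'a"

definition module_norm :: "'a cstar \<Rightarrow> ('a, 'x) bimodule \<Rightarrow> 'x \<Rightarrow> real"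
  where "module_norm A X x = sqrt (nrm A (ip X x x))"

text \<open>Inner products are linear in the second variable.\<close>

locale right_hilbert_module = complex_vector_space X for A :: "'a cstar" and X :: "('a, 'x) bimodule" +
  assumes base: "cstar_algebra A"
    and ract_closed: "\<lbrakk>x \<in> carrier X; a \<in> carrier A\<rbrakk> \<Longrightarrow> ract X x a \<in> carrier X"
    and ract_add_left: "\<lbrakk>x \<in> carrier X; y \<in> carrier X; a \<in> carrier A\<rbrakk> \<Longrightarrow>
      ract X (x \<oplus>\<^bsub>X\<^esub> y) a = ract X x a \<oplus>\<^bsub>X\<^esub> ract X y a"
    and ract_add_right: "\<lbrakk>x \<in> carrier X; a \<in> carrier A; b \<in> carrier A\<rbrakk> \<Longrightarrow>
      ract X x (a \<oplus>\<^bsub>A\<^esub> b) = ract X x a \<oplus>\<^bsub>X\<^esub> ract X x b"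
    and ract_scale_left: "\<lbrakk>x \<in> carrier X; a \<in> carrier A\<rbrakk> \<Longrightarrow>
      ract X (c \<odot>\<^bsub>X\<^esub> x) a = c \<odot>\<^bsub>X\<^esub> ract X x a"
    and ract_scale_right: "\<lbrakk>x \<in> carrier X; a \<in> carrier A\<rbrakk> \<Longrightarrow>
      ract X x (c \<odot>\<^bsub>A\<^esub> a) = c \<odot>\<^bsub>X\<^esub> ract X x a"
    and ract_mult: "\<lbrakk>x \<in> carrier X; a \<in> carrier A; b \<in> carrier A\<rbrakk> \<Longrightarrow>
      ract X x (a \<otimes>\<^bsub>A\<^esub> b) = ract X (ract X x a) b"
    and ip_closed: "\<lbrakk>x \<in> carrier X; y \<in> carrier X\<rbrakk> \<Longrightarrow> ip X x y \<in> carrier A"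
    and ip_add: "\<lbrakk>x \<in> carrier X; y \<in> carrier X; z \<in> carrier X\<rbrakk> \<Longrightarrow>
      ip X x (y \<oplus>\<^bsub>X\<^esub> z) = ip X x y \<oplus>\<^bsub>A\<^esub> ip X x z"
    and ip_scale: "\<lbrakk>x \<in> carrier X; y \<in> carrier X\<rbrakk> \<Longrightarrow> ip X x (c \<odot>\<^bsub>X\<^esub> y) = c \<odot>\<^bsub>A\<^esub> ip X x y"
    and ip_ract: "\<lbrakk>x \<in> carrier X; y \<in> carrier X; a \<in> carrier A\<rbrakk> \<Longrightarrow>
      ip X x (ract X y a) = ip X x y \<otimes>\<^bsub>A\<^esub> a"
    and ip_adj: "\<lbrakk>x \<in> carrier X; y \<in> carrier X\<rbrakk> \<Longrightarrow> adj A (ip X x y) = ip X y x"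
    and ip_positive: "x \<in> carrier X \<Longrightarrow> positive A (ip X x x)"
    and ip_definite: "\<lbrakk>x \<in> carrier X; ip X x x = \<zero>\<^bsub>A\<^esub>\<rbrakk> \<Longrightarrow> x = \<zero>\<^bsub>X\<^esub>"
    and complete: "Metric_space.mcomplete (carrier X) (norm_dist X (module_norm A X))"

definition is_adjoint :: "('a, 'x) bimodule \<Rightarrow> ('x \<Rightarrow> 'x) \<Rightarrow> ('x \<Rightarrow> 'x) \<Rightarrow> bool"
  where "is_adjoint X R R' \<longleftrightarrow>
    R' \<in> carrier X \<rightarrow> carrier X \<and>
    (\<forall>x\<in>carrier X. \<forall>y\<in>carrier X. ip X (R x) y = ip X x (R' y))"

text \<open>The C*-algebra \<open>\<L>(X)\<close>; linearity and boundedness of adjointable maps are automatic.\<close>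

definition adjointables :: "'a cstar \<Rightarrow> ('a, 'x) bimodule \<Rightarrow> ('x \<Rightarrow> 'x) cstar"
  where "adjointables A X = \<lparr>
    carrier = {R \<in> carrier X \<rightarrow>\<^sub>E carrier X. \<exists>R'. is_adjoint X R R'},
    vzero = (\<lambda>x\<in>carrier X. \<zero>\<^bsub>X\<^esub>),
    vadd = (\<lambda>R R'. \<lambda>x\<in>carrier X. R x \<oplus>\<^bsub>X\<^esub> R' x),
    vscale = (\<lambda>c R. \<lambda>x\<in>carrier X. c \<odot>\<^bsub>X\<^esub> R x),
    cmul = (\<lambda>R R'. \<lambda>x\<in>carrier X. R (R' x)),
    adj = (\<lambda>R. THE R'. R' \<in> extensional (carrier X) \<and> is_adjoint X R R'),
    nrm = operator_norm X (module_norm A X) \<rparr>"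

definition left_op :: "('a, 'x) bimodule \<Rightarrow> 'a \<Rightarrow> 'x \<Rightarrow> 'x"
  where "left_op X a = (\<lambda>x\<in>carrier X. lact X a x)"

definition theta :: "('a, 'x) bimodule \<Rightarrow> 'x \<Rightarrow> 'x \<Rightarrow> 'x \<Rightarrow> 'x"
  where "theta X m n = (\<lambda>p\<in>carrier X. ract X m (ip X n p))"

definition compacts :: "'a cstar \<Rightarrow> ('a, 'x) bimodule \<Rightarrow> ('x \<Rightarrow> 'x) cstar"
  where "compacts A X = (adjointables A X)\<lparr>carrier :=
    closed_subspace (adjointables A X) hull
      {theta X m n | m n. m \<in> carrier X \<and> n \<in> carrier X}\<rparr>"

definition right_hilbert_bimodule :: "'a cstar \<Rightarrow> ('a, 'x) bimodule \<Rightarrow> bool"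
  where "right_hilbert_bimodule A X \<longleftrightarrow>
    right_hilbert_module A X \<and>
    (\<forall>a\<in>carrier A. lact X a \<in> carrier X \<rightarrow> carrier X) \<and>
    star_hom A (adjointables A X) (left_op X)"

text \<open>
  \<open>(X, q)\<close> is the bimodule \<open>M\<^sub>L\<close> with its canonical map. A complete \<open>X\<close> with a dense image of \<open>q\<close>
  carrying the given pre-inner product is the completion of the quotient of \<open>A\<close> by the vectors
  of length zero, and is unique up to isomorphism; the two actions are determined on the
  image of \<open>q\<close>.
\<close>

definition exel_bimodule ::
    "'a cstar \<Rightarrow> ('a \<Rightarrow> 'a) \<Rightarrow> ('a \<Rightarrow> 'a) \<Rightarrow> ('a, 'x) bimodule \<Rightarrow> ('a \<Rightarrow> 'x) \<Rightarrow> bool"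
  where "exel_bimodule A \<alpha> L X q \<longleftrightarrow>
    right_hilbert_bimodule A X \<and> linear_map A X q \<and>
    norm_topology X (module_norm A X) closure_of (q ` carrier A) = carrier X \<and>
    (\<forall>a\<in>carrier A. \<forall>m\<in>carrier A. lact X a (q m) = q (a \<otimes>\<^bsub>A\<^esub> m)) \<and>
    (\<forall>m\<in>carrier A. \<forall>b\<in>carrier A. ract X (q m) b = q (m \<otimes>\<^bsub>A\<^esub> \<alpha> b)) \<and>
    (\<forall>m\<in>carrier A. \<forall>n\<in>carrier A. ip X (q m) (q n) = L (adj A m \<otimes>\<^bsub>A\<^esub> n))"


section \<open>The Toeplitz and Exel crossed products\<close>

definition toeplitz_rep ::
    "'a cstar \<Rightarrow> ('a \<Rightarrow> 'a) \<Rightarrow> ('a \<Rightarrow> 'a) \<Rightarrow> 'b cstar \<Rightarrow> ('a \<Rightarrow> 'b) \<Rightarrow> 'b multiplier \<Rightarrow> bool"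
  where "toeplitz_rep A \<alpha> L B \<pi> S \<longleftrightarrow>
    nondegenerate_hom A B \<pi> \<and> S \<in> carrier (multiplier_algebra B) \<and>
    (\<forall>a\<in>carrier A.
      S \<otimes>\<^bsub>multiplier_algebra B\<^esub> mult_of B (\<pi> a) =
        mult_of B (\<pi> (\<alpha> a)) \<otimes>\<^bsub>multiplier_algebra B\<^esub> S \<and>
      adj (multiplier_algebra B) S \<otimes>\<^bsub>multiplier_algebra B\<^esub> mult_of B (\<pi> a)
        \<otimes>\<^bsub>multiplier_algebra B\<^esub> S = mult_of B (\<pi> (L a)))"

text \<open>\<open>\<Phi>\<close> is the homomorphism \<open>\<pi> \<times> W\<close> of the algebra \<open>C\<close> with canonical maps \<open>(i, s)\<close> into \<open>D\<close>.\<close>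

definition integrated_form ::
    "'a cstar \<Rightarrow> 'b cstar \<Rightarrow> ('a \<Rightarrow> 'b) \<Rightarrow> 'b multiplier \<Rightarrow>
     'c cstar \<Rightarrow> ('a \<Rightarrow> 'c) \<Rightarrow> 'c multiplier \<Rightarrow> ('b \<Rightarrow> 'c) \<Rightarrow> bool"
  where "integrated_form A C i s D \<pi> W \<Phi> \<longleftrightarrow>
    nondegenerate_hom C D \<Phi> \<and> (\<forall>a\<in>carrier A. \<Phi> (i a) = \<pi> a) \<and> mult_extension C D \<Phi> s = W"

definition generated_by_rep ::
    "'a cstar \<Rightarrow> 'b cstar \<Rightarrow> ('a \<Rightarrow> 'b) \<Rightarrow> 'b multiplier \<Rightarrow> bool"
  where "generated_by_rep A C i s \<longleftrightarrow>
    cstar_subalgebra C hull (i ` carrier A \<union> {mult_right (i a) s | a. a \<in> carrier A}) = carrier C"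

text \<open>
  HOL cannot quantify over types inside a definition, so here and for Stacey crossed products the
  test algebras \<open>B\<close> range over all C*-algebras carried by subsets of a fixed type \<open>'u\<close>, the
  universe, which also carries the universal algebra. An algebra with the unrestricted universal
  property satisfies these definitions for any \<open>'u\<close> in which it is realised.
\<close>

definition toeplitz_crossed_product ::
    "'a cstar \<Rightarrow> ('a \<Rightarrow> 'a) \<Rightarrow> ('a \<Rightarrow> 'a) \<Rightarrow> 'u cstar \<Rightarrow> ('a \<Rightarrow> 'u) \<Rightarrow> 'u multiplier \<Rightarrow> bool"
  where "toeplitz_crossed_product A \<alpha> L T i s \<longleftrightarrow>
    cstar_algebra T \<and> toeplitz_rep A \<alpha> L T i s \<and> generated_by_rep A T i s \<and>
    (\<forall>(B :: 'u cstar) \<pi> S. cstar_algebra B \<longrightarrow> toeplitz_rep A \<alpha> L B \<pi> S \<longrightarrow>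
      (\<exists>\<Phi>. integrated_form A T i s B \<pi> S \<Phi>))"

text \<open>The map \<open>\<psi>\<^sub>s\<close>.\<close>

definition psi ::
    "'a cstar \<Rightarrow> ('a, 'x) bimodule \<Rightarrow> ('a \<Rightarrow> 'x) \<Rightarrow> 'u cstar \<Rightarrow> ('a \<Rightarrow> 'u) \<Rightarrow> 'u multiplier \<Rightarrow> 'x \<Rightarrow> 'u"
  where "psi A X q T i s = (THE \<psi>.
    \<psi> \<in> extensional (carrier X) \<and> linear_map X T \<psi> \<and>
    (\<forall>a\<in>carrier A. \<psi> (q a) = mult_right (i a) s) \<and>
    (\<forall>m\<in>carrier X. \<forall>a\<in>carrier A. \<psi> (ract X m a) = \<psi> m \<otimes>\<^bsub>T\<^esub> i a) \<and>
    (\<forall>m\<in>carrier X. \<forall>n\<in>carrier X. adj T (\<psi> m) \<otimes>\<^bsub>T\<^esub> \<psi> n = i (ip X m n)) \<and>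
    (\<forall>a\<in>carrier A. \<forall>m\<in>carrier X. \<psi> (lact X a m) = i a \<otimes>\<^bsub>T\<^esub> \<psi> m))"

text \<open>The homomorphism \<open>(\<psi>\<^sub>s, i)\<^sup>(\<^sup>1\<^sup>)\<close> on the compact operators.\<close>

definition psi_compacts ::
    "'a cstar \<Rightarrow> ('a, 'x) bimodule \<Rightarrow> ('a \<Rightarrow> 'x) \<Rightarrow> 'u cstar \<Rightarrow> ('a \<Rightarrow> 'u) \<Rightarrow> 'u multiplier \<Rightarrow>
     ('x \<Rightarrow> 'x) \<Rightarrow> 'u"
  where "psi_compacts A X q T i s = (THE \<Psi>.
    \<Psi> \<in> extensional (carrier (compacts A X)) \<and> star_hom (compacts A X) T \<Psi> \<and>
    (\<forall>m\<in>carrier X. \<forall>n\<in>carrier X.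
      \<Psi> (theta X m n) = psi A X q T i s m \<otimes>\<^bsub>T\<^esub> adj T (psi A X q T i s n)))"

definition K_alpha :: "'a cstar \<Rightarrow> ('a \<Rightarrow> 'a) \<Rightarrow> ('a, 'x) bimodule \<Rightarrow> 'a set"
  where "K_alpha A \<alpha> X =
    (closed_subspace A hull {a \<otimes>\<^bsub>A\<^esub> \<alpha> b \<otimes>\<^bsub>A\<^esub> c | a b c.
       a \<in> carrier A \<and> b \<in> carrier A \<and> c \<in> carrier A}) \<inter>
    {a \<in> carrier A. left_op X a \<in> carrier (compacts A X)}"

definition exel_ideal ::
    "'a cstar \<Rightarrow> ('a \<Rightarrow> 'a) \<Rightarrow> ('a, 'x) bimodule \<Rightarrow> ('a \<Rightarrow> 'x) \<Rightarrow>
     'u cstar \<Rightarrow> ('a \<Rightarrow> 'u) \<Rightarrow> 'u multiplier \<Rightarrow> 'u set"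
  where "exel_ideal A \<alpha> X q T i s = closed_ideal T hull
    {i a \<ominus>\<^bsub>T\<^esub> psi_compacts A X q T i s (left_op X a) | a. a \<in> K_alpha A \<alpha> X}"

text \<open>The automorphism \<open>\<alpha>\<^sub>z\<close> of the dual action on an algebra \<open>E\<close> generated by \<open>(j, t)\<close>.\<close>

definition dual_action ::
    "'a cstar \<Rightarrow> 'u cstar \<Rightarrow> ('a \<Rightarrow> 'u) \<Rightarrow> 'u multiplier \<Rightarrow> complex \<Rightarrow> 'u \<Rightarrow> 'u"
  where "dual_action A E j t z = (THE \<gamma>.
    \<gamma> \<in> extensional (carrier E) \<and> star_iso E E \<gamma> \<and> (\<forall>a\<in>carrier A. \<gamma> (j a) = j a) \<and>
    mult_extension E E \<gamma> t = z \<odot>\<^bsub>multiplier_algebra E\<^esub> t)"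

definition fixed_point_algebra ::
    "'a cstar \<Rightarrow> 'u cstar \<Rightarrow> ('a \<Rightarrow> 'u) \<Rightarrow> 'u multiplier \<Rightarrow> 'u cstar"
  where "fixed_point_algebra A E j t =
    E\<lparr>carrier := {x \<in> carrier E. \<forall>z. cmod z = 1 \<longrightarrow> dual_action A E j t z x = x}\<rparr>"

text \<open>The element \<open>j(a) t\<^sup>n t\<^sup>*\<^sup>n j(b)\<close> of \<open>E\<close>.\<close>

definition core_element ::
    "'u cstar \<Rightarrow> ('a \<Rightarrow> 'u) \<Rightarrow> 'u multiplier \<Rightarrow> 'a \<Rightarrow> nat \<Rightarrow> 'a \<Rightarrow> 'u"
  where "core_element E j t a n b =
    mult_right (j a) (mult_power E t n \<otimes>\<^bsub>multiplier_algebra E\<^esub>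
      mult_power E (adj (multiplier_algebra E) t) n) \<otimes>\<^bsub>E\<^esub> j b"


section \<open>Stacey crossed products\<close>

definition stacey_rep ::
    "'b cstar \<Rightarrow> ('b \<Rightarrow> 'b) \<Rightarrow> 'c cstar \<Rightarrow> ('b \<Rightarrow> 'c) \<Rightarrow> 'c multiplier \<Rightarrow> bool"
  where "stacey_rep B \<beta> D \<pi> W \<longleftrightarrow>
    nondegenerate_hom B D \<pi> \<and> W \<in> carrier (multiplier_algebra D) \<and>
    adj (multiplier_algebra D) W \<otimes>\<^bsub>multiplier_algebra D\<^esub> W = mult_one D \<and>
    (\<forall>b\<in>carrier B. mult_of D (\<pi> (\<beta> b)) =
      W \<otimes>\<^bsub>multiplier_algebra D\<^esub> mult_of D (\<pi> b)
        \<otimes>\<^bsub>multiplier_algebra D\<^esub> adj (multiplier_algebra D) W)"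

definition stacey_crossed_product ::
    "'b cstar \<Rightarrow> ('b \<Rightarrow> 'b) \<Rightarrow> 'u cstar \<Rightarrow> ('b \<Rightarrow> 'u) \<Rightarrow> 'u multiplier \<Rightarrow> bool"
  where "stacey_crossed_product B \<beta> C i v \<longleftrightarrow>
    cstar_algebra C \<and> stacey_rep B \<beta> C i v \<and> generated_by_rep B C i v \<and>
    (\<forall>(D :: 'u cstar) \<pi> W. cstar_algebra D \<longrightarrow> stacey_rep B \<beta> D \<pi> W \<longrightarrow>
      (\<exists>\<Phi>. integrated_form B C i v D \<pi> W \<Phi>))"

end

theory Submission
  imports Defs
begin

text \<open>
  Write \<open>E\<close> for the Exel crossed product, \<open>F\<close> for its fixed-point algebra and \<open>\<beta>(x) = t x t\<^sup>*\<close>. As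
  \<open>L(\<alpha>(a)) = a\<close>, the multiplier \<open>t\<close> is an isometry. Hence \<open>\<beta>\<close> is a homomorphism with left inverse
  \<open>x \<mapsto> t\<^sup>* x t\<close> and image \<open>t t\<^sup>* F t t\<^sup>*\<close>, and \<open>t j(a) = j(\<alpha>(a)) t\<close> yields its values on core elements. Its
  extension to \<open>M(F)\<close> is \<open>m \<mapsto> t m t\<^sup>*\<close>; that this is strictly continuous is a consequence of exact
  (Cohen) factorisation.

  The substance is that \<open>E\<close> with \<open>(id, t)\<close> has the universal property of the Stacey crossed product.
  Let \<open>(\<pi>, W)\<close> be a Stacey-covariant representation of \<open>(F, \<beta>)\<close>. Then \<open>(\<pi> \<circ> j, W)\<close> is Toeplitz-covariant.
  The relations that define \<open>E\<close> only involve \<open>i(a)\<close> and limits of sums of elements \<open>i(a) s s\<^sup>* i(b)\<^sup>*\<close>.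
  These are sent to \<open>\<pi>(j(a))\<close> and to \<open>\<pi>(j(a) t t\<^sup>* j(b)\<^sup>*)\<close>, the latter because \<open>\<pi>(t t\<^sup>* x) = W W\<^sup>* \<pi>(x)\<close> for
  all \<open>x \<in> F\<close>. So whatever vanishes in \<open>E\<close> is sent to zero, and there is a homomorphism \<open>\<Psi>\<close> on \<open>E\<close>
  that extends \<open>(\<pi> \<circ> j, W)\<close> (\<open>crossed_product_factor\<close>, \<open>pi_projection\<close>). A priori \<open>\<Psi>\<close> agrees with \<open>\<pi>\<close>
  on \<open>j(A)\<close> only. The set where they agree is a C*-subalgebra that contains \<open>x\<close> if and only if it
  contains \<open>\<beta>(x)\<close>, and averaging over the dual action shows that such a subalgebra is all of \<open>F\<close>
  (\<open>fixed_point_algebra_minimal\<close>). Thus \<open>\<Psi>\<close> integrates \<open>(\<pi>, W)\<close>, and the comparison with any other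
  Stacey crossed product is the uniqueness of universal objects.

  The sections before the crossed products develop the theory of C*-algebras on carriers that this
  needs. Three devices keep it elementary. Linear identities are checked after applying linear
  functionals (\<open>vec_eqI\<close>). Square roots come from iterating \<open>2g = k + g\<^sup>2\<close>, which also works without a
  unit; they give contractivity of homomorphisms and, by the argument of Kelley and Vaught, positivity
  of \<open>y\<^sup>* y\<close> without spectral theory. Finally \<open>M(A)\<close> is a C*-algebra because its elements are the
  adjointable operators of \<open>A\<close> as a Hilbert module over itself.
\<close>

section \<open>Linear identities on carriers\<close>

definition linear_functional :: "('a, 'm) cvec_scheme \<Rightarrow> ('a \<Rightarrow> complex) \<Rightarrow> bool"
  where "linear_functional V \<phi> \<longleftrightarrow>
    (\<forall>x\<in>carrier V. \<forall>y\<in>carrier V. \<phi> (x \<oplus>\<^bsub>V\<^esub> y) = \<phi> x + \<phi> y) \<and>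
    (\<forall>c. \<forall>x\<in>carrier V. \<phi> (c \<odot>\<^bsub>V\<^esub> x) = c * \<phi> x)"

lemma functional_add:
  "\<lbrakk>linear_functional V \<phi>; x \<in> carrier V; y \<in> carrier V\<rbrakk> \<Longrightarrow> \<phi> (x \<oplus>\<^bsub>V\<^esub> y) = \<phi> x + \<phi> y"
  by (simp add: linear_functional_def)

lemma functional_scale:
  "\<lbrakk>linear_functional V \<phi>; x \<in> carrier V\<rbrakk> \<Longrightarrow> \<phi> (c \<odot>\<^bsub>V\<^esub> x) = c * \<phi> x"
  by (simp add: linear_functional_def)

definition linear_subspace :: "('a, 'm) cvec_scheme \<Rightarrow> 'a set \<Rightarrow> bool"
  where "linear_subspace V W \<longleftrightarrow> W \<subseteq> carrier V \<and> \<zero>\<^bsub>V\<^esub> \<in> W \<and>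
    (\<forall>x\<in>W. \<forall>y\<in>W. x \<oplus>\<^bsub>V\<^esub> y \<in> W) \<and> (\<forall>c. \<forall>x\<in>W. c \<odot>\<^bsub>V\<^esub> x \<in> W)"

context complex_vector_space
begin

declare zero_closed [simp, intro] add_closed [simp, intro] scale_closed [simp, intro]

lemma scale_0: "x \<in> carrier V \<Longrightarrow> 0 \<odot> x = \<zero>"
  using scale_add_left[of x 1 "-1"] by (simp add: scale_one add_neg)

lemma scale_zero: "c \<odot> \<zero> = \<zero>"
  by (metis scale_0 scale_scale mult_zero_right zero_closed)

lemma zero_add: "x \<in> carrier V \<Longrightarrow> \<zero> \<oplus> x = x"
  by (metis add_commute add_zero zero_closed)

lemma add_left_commute:
  "\<lbrakk>x \<in> carrier V; y \<in> carrier V; z \<in> carrier V\<rbrakk> \<Longrightarrow> x \<oplus> (y \<oplus> z) = y \<oplus> (x \<oplus> z)"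
  by (metis add_assoc add_commute)

lemmas add_ac = add_assoc add_commute add_left_commute

lemma vdiff_closed [simp, intro]: "\<lbrakk>x \<in> carrier V; y \<in> carrier V\<rbrakk> \<Longrightarrow> x \<ominus> y \<in> carrier V"
  by (simp add: vdiff_def)

text \<open>A subspace that is maximal among those avoiding \<open>x0\<close>, which exists by Zorn's lemma, has
  codimension one; the functional reads off the coefficient of \<open>x0\<close> modulo it.\<close>

lemma exists_functional:
  assumes x0: "x0 \<in> carrier V" "x0 \<noteq> \<zero>"
  shows "\<exists>\<phi>. linear_functional V \<phi> \<and> \<phi> x0 \<noteq> 0"
proof -
  define \<A> where "\<A> = {W. linear_subspace V W \<and> x0 \<notin> W}"
  have "{\<zero>} \<in> \<A>"
    using x0 by (simp add: \<A>_def linear_subspace_def scale_zero add_zero)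
  then have ne: "\<A> \<noteq> {}" by blast
  have ch: "\<Union>\<C> \<in> \<A>" if C: "\<C> \<noteq> {}" "subset.chain \<A> \<C>" for \<C>
  proof -
    have sub: "\<And>W. W \<in> \<C> \<Longrightarrow> linear_subspace V W \<and> x0 \<notin> W"
      using C(2) by (auto simp: subset.chain_def \<A>_def)
    have "x \<oplus> y \<in> \<Union>\<C>" if xy: "x \<in> \<Union>\<C>" "y \<in> \<Union>\<C>" for x y
    proof -
      obtain W1 W2 where W: "W1 \<in> \<C>" "W2 \<in> \<C>" "x \<in> W1" "y \<in> W2" using xy by blast
      then have "W1 \<subseteq> W2 \<or> W2 \<subseteq> W1" using C(2) by (auto simp: subset.chain_def)
      then obtain W where "W \<in> \<C>" "x \<in> W" "y \<in> W" using W by blast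
      then show ?thesis using sub[of W] unfolding linear_subspace_def by blast
    qed
    moreover have "\<zero> \<in> \<Union>\<C>" using C(1) sub unfolding linear_subspace_def by blast
    ultimately have "linear_subspace V (\<Union>\<C>)"
      using sub unfolding linear_subspace_def by blast
    then show ?thesis using sub by (auto simp: \<A>_def)
  qed
  obtain W where W: "linear_subspace V W" "x0 \<notin> W"
    and max: "\<And>Y. \<lbrakk>linear_subspace V Y; x0 \<notin> Y; W \<subseteq> Y\<rbrakk> \<Longrightarrow> Y = W"
    using subset_Zorn_nonempty[OF ne ch] unfolding \<A>_def by blast
  have WV: "\<And>x. x \<in> W \<Longrightarrow> x \<in> carrier V"
    and W0: "\<zero> \<in> W" and Wadd: "\<And>x y. \<lbrakk>x \<in> W; y \<in> W\<rbrakk> \<Longrightarrow> x \<oplus> y \<in> W"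
    and Wsc: "\<And>c x. x \<in> W \<Longrightarrow> c \<odot> x \<in> W"
    using W(1) unfolding linear_subspace_def by blast+
  have ex: "\<exists>c. y \<ominus> c \<odot> x0 \<in> W" if y: "y \<in> carrier V" for y
  proof (cases "y \<in> W")
    case True
    then have "y \<ominus> 0 \<odot> x0 \<in> W"
      using x0 y by (simp add: vdiff_def scale_0 scale_zero add_zero)
    then show ?thesis ..
  next
    case False
    define Y where "Y = {w \<oplus> d \<odot> y | w d. w \<in> W}"
    have "linear_subspace V Y"
      unfolding linear_subspace_def
    proof (intro conjI ballI allI)
      show "Y \<subseteq> carrier V" using WV y by (auto simp: Y_def)
      have "\<zero> = \<zero> \<oplus> 0 \<odot> y" using y by (simp add: scale_0 add_zero)
      then show "\<zero> \<in> Y" using W0 unfolding Y_def by blast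
    next
      fix a b assume "a \<in> Y" "b \<in> Y"
      then obtain w d w' d' where "w \<in> W" "w' \<in> W" "a = w \<oplus> d \<odot> y" "b = w' \<oplus> d' \<odot> y"
        unfolding Y_def by blast
      moreover from this have "a \<oplus> b = (w \<oplus> w') \<oplus> (d + d') \<odot> y"
        using y WV by (simp add: add_ac scale_add_left)
      ultimately show "a \<oplus> b \<in> Y" using Wadd unfolding Y_def by blast
    next
      fix c a assume "a \<in> Y"
      then obtain w d where "w \<in> W" "a = w \<oplus> d \<odot> y" unfolding Y_def by blast
      moreover from this have "c \<odot> a = (c \<odot> w) \<oplus> (c * d) \<odot> y"
        using y WV by (simp add: scale_add_right scale_scale)
      ultimately show "c \<odot> a \<in> Y" using Wsc unfolding Y_def by blast
    qed
    moreover have "W \<subseteq> Y"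
    proof
      fix w assume "w \<in> W"
      moreover from this have "w = w \<oplus> 0 \<odot> y" using y WV by (simp add: scale_0 add_zero)
      ultimately show "w \<in> Y" unfolding Y_def by blast
    qed
    moreover have "y \<in> Y"
      unfolding Y_def mem_Collect_eq
      by (intro exI[of _ \<zero>] exI[of _ 1]) (simp add: W0 y zero_add scale_one)
    ultimately have "x0 \<in> Y" using max[of Y] False by blast
    then obtain w d where w: "w \<in> W" and x0w: "x0 = w \<oplus> d \<odot> y" unfolding Y_def by blast
    have d: "d \<noteq> 0"
    proof
      assume "d = 0"
      then have "x0 = w" using x0w y w WV by (simp add: scale_0 add_zero)
      then show False using w W(2) by simp
    qed
    have "y \<ominus> (1/d) \<odot> x0 = (- 1 / d) \<odot> w \<oplus> (y \<oplus> (-1) \<odot> y)"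
      using y w WV d by (simp add: x0w vdiff_def scale_add_right scale_scale add_left_commute)
    also have "\<dots> = (- 1 / d) \<odot> w" using y w WV by (simp add: add_neg add_zero)
    finally show ?thesis using Wsc[OF w] by metis
  qed
  have uniq: "c = d" if "y \<in> carrier V" "y \<ominus> c \<odot> x0 \<in> W" "y \<ominus> d \<odot> x0 \<in> W" for y c d
  proof (rule ccontr)
    assume cd: "c \<noteq> d"
    have "(y \<ominus> c \<odot> x0) \<oplus> (-1) \<odot> (y \<ominus> d \<odot> x0)
      = (y \<oplus> (-1) \<odot> y) \<oplus> (d \<odot> x0 \<oplus> (- c) \<odot> x0)"
      using that(1) x0(1) by (simp add: vdiff_def scale_add_right scale_scale add_ac)
    also have "\<dots> = (d - c) \<odot> x0"
      using that(1) x0(1) scale_add_left[of x0 d "- c"] by (simp add: add_neg zero_add)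
    finally have "(d - c) \<odot> x0 \<in> W" using that Wadd Wsc by metis
    then have "(1 / (d - c)) \<odot> (d - c) \<odot> x0 \<in> W" by (rule Wsc)
    then show False using cd x0(1) W(2) by (simp add: scale_scale scale_one)
  qed
  define \<phi> where "\<phi> = (\<lambda>y. THE c. y \<ominus> c \<odot> x0 \<in> W)"
  have phi: "\<phi> y = c" if "y \<in> carrier V" "y \<ominus> c \<odot> x0 \<in> W" for y c
    unfolding \<phi>_def using that uniq by (intro the_equality) auto
  have phi_in: "y \<ominus> \<phi> y \<odot> x0 \<in> W" if "y \<in> carrier V" for y
    using ex[OF that] phi[OF that] by auto
  have "linear_functional V \<phi>"
    unfolding linear_functional_def
  proof (intro conjI ballI allI)
    fix x y assume xy: "x \<in> carrier V" "y \<in> carrier V"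
    have "(x \<oplus> y) \<ominus> (\<phi> x + \<phi> y) \<odot> x0 = (x \<ominus> \<phi> x \<odot> x0) \<oplus> (y \<ominus> \<phi> y \<odot> x0)"
      using xy x0(1) by (simp add: vdiff_def scale_add_left scale_add_right scale_scale add_ac)
    then show "\<phi> (x \<oplus> y) = \<phi> x + \<phi> y" using xy phi phi_in Wadd by simp
  next
    fix c x assume x: "x \<in> carrier V"
    have "(c \<odot> x) \<ominus> (c * \<phi> x) \<odot> x0 = c \<odot> (x \<ominus> \<phi> x \<odot> x0)"
      using x x0(1) by (simp add: vdiff_def scale_add_right scale_scale)
    then show "\<phi> (c \<odot> x) = c * \<phi> x" using x phi phi_in Wsc by simp
  qed
  moreover have "\<phi> x0 = 1"
    using x0(1) W0 by (intro phi) (simp_all add: vdiff_def scale_one add_neg)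
  ultimately show ?thesis by (intro exI[of _ \<phi>]) simp
qed

lemma functional_zero: "linear_functional V \<phi> \<Longrightarrow> \<phi> \<zero> = 0"
  using functional_scale[of V \<phi> \<zero> 0] by (simp add: scale_0)

lemma functional_vdiff:
  "\<lbrakk>linear_functional V \<phi>; x \<in> carrier V; y \<in> carrier V\<rbrakk> \<Longrightarrow> \<phi> (x \<ominus> y) = \<phi> x - \<phi> y"
  by (simp add: vdiff_def functional_add functional_scale)

lemmas functional_simps = functional_add functional_scale functional_zero functional_vdiff

text \<open>Functionals separate points. Hence a linear identity between carrier elements reduces to one
  between complex numbers, where no side conditions impede the arithmetic.\<close>

lemma vec_eqI:
  assumes "x \<in> carrier V" "y \<in> carrier V" "\<And>\<phi>. linear_functional V \<phi> \<Longrightarrow> \<phi> x = \<phi> y"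
  shows "x = y"
proof -
  have "x \<ominus> y = \<zero>"
  proof (rule ccontr)
    assume "x \<ominus> y \<noteq> \<zero>"
    then obtain \<phi> where "linear_functional V \<phi>" "\<phi> (x \<ominus> y) \<noteq> 0"
      using exists_functional[of "x \<ominus> y"] assms(1,2) by blast
    then show False using assms(3)[of \<phi>] functional_vdiff[of \<phi> x y] assms(1,2) by simp
  qed
  then have "(x \<ominus> y) \<oplus> y = y" using assms(2) by (simp add: zero_add)
  moreover have "(x \<ominus> y) \<oplus> y = x \<oplus> (y \<oplus> (-1) \<odot> y)"
    using assms(1,2) by (simp add: vdiff_def add_ac)
  ultimately show ?thesis using assms by (simp add: add_neg add_zero)
qed

lemma vdiff_self: "x \<in> carrier V \<Longrightarrow> x \<ominus> x = \<zero>"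
  by (simp add: vdiff_def add_neg)

lemma vdiff_zero: "x \<in> carrier V \<Longrightarrow> x \<ominus> \<zero> = x"
  by (simp add: vdiff_def scale_zero add_zero)

lemma vdiff_eq_zero: "\<lbrakk>x \<in> carrier V; y \<in> carrier V\<rbrakk> \<Longrightarrow> x \<ominus> y = \<zero> \<longleftrightarrow> x = y"
proof
  assume *: "x \<in> carrier V" "y \<in> carrier V" "x \<ominus> y = \<zero>"
  show "x = y"
  proof (rule vec_eqI)
    fix \<phi> assume "linear_functional V \<phi>"
    then show "\<phi> x = \<phi> y" using * functional_vdiff[of \<phi> x y] functional_zero[of \<phi>] by simp
  qed (use * in auto)
qed (simp add: vdiff_self)

lemma scale_vdiff:
  "\<lbrakk>x \<in> carrier V; y \<in> carrier V\<rbrakk> \<Longrightarrow> c \<odot> (x \<ominus> y) = c \<odot> x \<ominus> c \<odot> y"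
  by (rule vec_eqI) (simp_all add: functional_simps algebra_simps)

end

lemma linear_mapD:
  assumes "linear_map V W f"
  shows "\<And>x. x \<in> carrier V \<Longrightarrow> f x \<in> carrier W"
    and "\<And>x y. \<lbrakk>x \<in> carrier V; y \<in> carrier V\<rbrakk> \<Longrightarrow> f (x \<oplus>\<^bsub>V\<^esub> y) = f x \<oplus>\<^bsub>W\<^esub> f y"
    and "\<And>c x. x \<in> carrier V \<Longrightarrow> f (c \<odot>\<^bsub>V\<^esub> x) = c \<odot>\<^bsub>W\<^esub> f x"
  using assms unfolding linear_map_def by auto

lemma (in complex_vector_space) linear_vdiff:
  assumes "linear_map V W f" "x \<in> carrier V" "y \<in> carrier V"
  shows "f (x \<ominus>\<^bsub>V\<^esub> y) = f x \<ominus>\<^bsub>W\<^esub> f y"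
  using assms linear_mapD[OF assms(1)] by (simp add: vdiff_def)

lemma (in complex_vector_space) linear_map_zero:
  assumes "complex_vector_space W" "linear_map V W f"
  shows "f \<zero>\<^bsub>V\<^esub> = \<zero>\<^bsub>W\<^esub>"
  by (metis assms scale_0 zero_closed complex_vector_space.scale_0 linear_mapD(1,3))


section \<open>Normed spaces on carriers\<close>

locale carrier_normed_space = complex_vector_space V
  for V :: "('a, 'm) cvec_scheme" (structure) +
  fixes N :: "'a \<Rightarrow> real"
  assumes N_nonneg: "x \<in> carrier V \<Longrightarrow> 0 \<le> N x"
    and N_eq_zero: "x \<in> carrier V \<Longrightarrow> N x = 0 \<longleftrightarrow> x = \<zero>"
    and N_triangle: "\<lbrakk>x \<in> carrier V; y \<in> carrier V\<rbrakk> \<Longrightarrow> N (x \<oplus> y) \<le> N x + N y"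
    and N_scale: "x \<in> carrier V \<Longrightarrow> N (c \<odot> x) = cmod c * N x"
begin

lemma N_zero: "N \<zero> = 0" by (simp add: N_eq_zero)

lemma N_vdiff_commute: "\<lbrakk>x \<in> carrier V; y \<in> carrier V\<rbrakk> \<Longrightarrow> N (x \<ominus> y) = N (y \<ominus> x)"
proof -
  assume xy: "x \<in> carrier V" "y \<in> carrier V"
  have "x \<ominus> y = (-1) \<odot> (y \<ominus> x)"
    using xy by (intro vec_eqI) (simp_all add: functional_simps)
  then show ?thesis using xy by (simp add: N_scale)
qed

lemma N_vdiff_le: "\<lbrakk>x \<in> carrier V; y \<in> carrier V\<rbrakk> \<Longrightarrow> N (x \<ominus> y) \<le> N x + N y"
  using N_triangle[of x "(-1) \<odot> y"] by (simp add: vdiff_def N_scale)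

lemma N_triangle_vdiff:
  assumes "x \<in> carrier V" "y \<in> carrier V" "z \<in> carrier V"
  shows "N (x \<ominus> z) \<le> N (x \<ominus> y) + N (y \<ominus> z)"
proof -
  have "x \<ominus> z = (x \<ominus> y) \<oplus> (y \<ominus> z)"
    using assms by (intro vec_eqI) (simp_all add: functional_simps)
  then show ?thesis using assms N_triangle[of "x \<ominus> y" "y \<ominus> z"] by simp
qed

lemma N_le_add_vdiff: "\<lbrakk>x \<in> carrier V; y \<in> carrier V\<rbrakk> \<Longrightarrow> N x \<le> N y + N (x \<ominus> y)"
  using N_triangle_vdiff[of x y \<zero>] N_vdiff_commute by (simp add: vdiff_zero)

lemma N_vdiff_eq_zero: "\<lbrakk>x \<in> carrier V; y \<in> carrier V\<rbrakk> \<Longrightarrow> N (x \<ominus> y) = 0 \<longleftrightarrow> x = y"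
  by (simp add: N_eq_zero vdiff_eq_zero)

lemma N_eqI:
  assumes "x \<in> carrier V" "y \<in> carrier V" "\<And>e. e > 0 \<Longrightarrow> N (x \<ominus> y) \<le> e"
  shows "x = y"
proof -
  have "N (x \<ominus> y) \<le> 0" using assms(3) by (rule field_le_epsilon[where y = 0, simplified])
  then show ?thesis using assms(1,2) N_nonneg[of "x \<ominus> y"] N_vdiff_eq_zero by force
qed

sublocale metric: Metric_space "carrier V" "norm_dist V N"
proof
  show "0 \<le> norm_dist V N x y" for x y by (simp add: norm_dist_def N_nonneg)
  show "norm_dist V N x y = norm_dist V N y x" for x y
    by (simp add: norm_dist_def N_vdiff_commute)
  show "\<lbrakk>x \<in> carrier V; y \<in> carrier V\<rbrakk> \<Longrightarrow> (norm_dist V N x y = 0) = (x = y)" for x y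
    by (simp add: norm_dist_def N_vdiff_eq_zero)
  show "\<lbrakk>x \<in> carrier V; y \<in> carrier V; z \<in> carrier V\<rbrakk> \<Longrightarrow>
      norm_dist V N x z \<le> norm_dist V N x y + norm_dist V N y z" for x y z
    by (simp add: norm_dist_def N_triangle_vdiff)
qed

lemma closedin_norm_iff:
  "closedin (norm_topology V N) W \<longleftrightarrow> W \<subseteq> carrier V \<and>
    (\<forall>x\<in>carrier V. (\<forall>e>0. \<exists>w\<in>W. N (x \<ominus> w) < e) \<longrightarrow> x \<in> W)"
  unfolding norm_topology_def metric.closedin_metric disjnt_iff metric.in_mball
  by (auto simp: norm_dist_def subset_iff not_less) (meson not_less)+

lemma in_closure_norm_iff:
  "x \<in> norm_topology V N closure_of S \<longleftrightarrow>
    x \<in> carrier V \<and> (\<forall>e>0. \<exists>w\<in>S. w \<in> carrier V \<and> N (x \<ominus> w) < e)"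
  by (auto simp: norm_topology_def metric.metric_closure_of norm_dist_def; metis)

definition vlim :: "(nat \<Rightarrow> 'a) \<Rightarrow> 'a \<Rightarrow> bool"
  where "vlim xs l \<longleftrightarrow> (\<lambda>n. N (xs n \<ominus> l)) \<longlonglongrightarrow> 0"

lemma vlim_D:
  assumes "vlim xs l" "e > 0"
  shows "\<exists>K. \<forall>n\<ge>K. N (xs n \<ominus> l) < e"
proof -
  obtain K where "\<forall>n\<ge>K. norm (N (xs n \<ominus> l) - 0) < e"
    using LIMSEQ_D[OF assms(1)[unfolded vlim_def] assms(2)] by blast
  then have "\<forall>n\<ge>K. N (xs n \<ominus> l) < e" by (simp add: abs_less_iff)
  then show ?thesis ..
qed

lemma vlim_const: "x \<in> carrier V \<Longrightarrow> vlim (\<lambda>n. x) x"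
  by (simp add: vlim_def vdiff_self N_zero)

lemma vlim_I:
  assumes "\<And>n. xs n \<in> carrier V" "l \<in> carrier V" "\<And>n. N (xs n \<ominus> l) \<le> r n" "r \<longlonglongrightarrow> 0"
  shows "vlim xs l"
  unfolding vlim_def
  by (rule tendsto_sandwich[OF _ _ tendsto_const assms(4)])
    (use assms N_nonneg in \<open>auto intro!: always_eventually\<close>)

lemma vlim_add:
  assumes "vlim xs l" "vlim ys m" "\<And>n. xs n \<in> carrier V" "\<And>n. ys n \<in> carrier V"
    "l \<in> carrier V" "m \<in> carrier V"
  shows "vlim (\<lambda>n. xs n \<oplus> ys n) (l \<oplus> m)"
proof (rule vlim_I)
  show "(\<lambda>n. N (xs n \<ominus> l) + N (ys n \<ominus> m)) \<longlonglongrightarrow> 0"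
    using tendsto_add[OF assms(1,2)[unfolded vlim_def]] by simp
  fix n
  have "(xs n \<oplus> ys n) \<ominus> (l \<oplus> m) = (xs n \<ominus> l) \<oplus> (ys n \<ominus> m)"
    using assms by (intro vec_eqI) (simp_all add: functional_simps)
  then show "N ((xs n \<oplus> ys n) \<ominus> (l \<oplus> m)) \<le> N (xs n \<ominus> l) + N (ys n \<ominus> m)"
    using assms by (simp add: N_triangle)
qed (use assms in auto)

lemma vlim_scale:
  assumes "vlim xs l" "\<And>n. xs n \<in> carrier V" "l \<in> carrier V"
  shows "vlim (\<lambda>n. c \<odot> xs n) (c \<odot> l)"
proof (rule vlim_I)
  show "(\<lambda>n. cmod c * N (xs n \<ominus> l)) \<longlonglongrightarrow> 0"
    using tendsto_mult_left[OF assms(1)[unfolded vlim_def], of "cmod c"] by simp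
  fix n show "N (c \<odot> xs n \<ominus> c \<odot> l) \<le> cmod c * N (xs n \<ominus> l)"
    using assms by (simp add: scale_vdiff[symmetric] N_scale)
qed (use assms in auto)

lemma vlim_unique:
  assumes "vlim xs l" "vlim xs m" "\<And>n. xs n \<in> carrier V" "l \<in> carrier V" "m \<in> carrier V"
  shows "l = m"
proof -
  have "(\<lambda>n. N (xs n \<ominus> l) + N (xs n \<ominus> m)) \<longlonglongrightarrow> 0"
    using tendsto_add[OF assms(1,2)[unfolded vlim_def]] by simp
  moreover have "N (l \<ominus> m) \<le> N (xs n \<ominus> l) + N (xs n \<ominus> m)" for n
    using N_triangle_vdiff[of l "xs n" m] assms by (simp add: N_vdiff_commute)
  ultimately have "N (l \<ominus> m) \<le> 0"
    by (intro LIMSEQ_le_const) auto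
  then show ?thesis using assms N_nonneg[of "l \<ominus> m"] N_vdiff_eq_zero[of l m] by force
qed

lemma vlim_N_le:
  assumes "vlim xs l" "\<And>n. xs n \<in> carrier V" "l \<in> carrier V" "\<And>n. N (xs n) \<le> K"
  shows "N l \<le> K"
proof (rule LIMSEQ_le_const)
  show "(\<lambda>n. K + N (xs n \<ominus> l)) \<longlonglongrightarrow> K"
    using tendsto_add[OF tendsto_const assms(1)[unfolded vlim_def], of K] by simp
  have "N l \<le> K + N (xs n \<ominus> l)" for n
    using N_le_add_vdiff[OF assms(3) assms(2)[of n]] assms(4)[of n]
      N_vdiff_commute[OF assms(3) assms(2)[of n]] by linarith
  then show "\<exists>k. \<forall>n\<ge>k. N l \<le> K + N (xs n \<ominus> l)" by blast
qed

lemma vlim_in_closed: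
  assumes "vlim xs l" "\<And>n. xs n \<in> W" "l \<in> carrier V" "closedin (norm_topology V N) W"
  shows "l \<in> W"
proof -
  have "\<exists>w\<in>W. N (l \<ominus> w) < e" if "e > 0" for e
  proof -
    have "\<exists>n. N (xs n \<ominus> l) < e" using vlim_D[OF assms(1) that] by blast
    then obtain n where "N (xs n \<ominus> l) < e" ..
    then show ?thesis
      using assms(2)[of n] N_vdiff_commute[OF assms(3), of "xs n"] assms(4)
      unfolding closedin_norm_iff by (intro bexI[of _ "xs n"]) (auto simp: subset_iff)
  qed
  then show ?thesis using assms(3,4) by (simp add: closedin_norm_iff)
qed

lemma approx_sequence:
  assumes "x \<in> carrier V" "W \<subseteq> carrier V" "\<And>e. e > 0 \<Longrightarrow> \<exists>w\<in>W. N (x \<ominus> w) < e"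
  shows "\<exists>xs. (\<forall>n. xs n \<in> W) \<and> vlim xs x"
proof -
  have "\<forall>n. \<exists>w. w \<in> W \<and> N (x \<ominus> w) < 1 / real (Suc n)" using assms(3) by (simp add: Bex_def)
  then obtain xs where s: "\<And>n. xs n \<in> W \<and> N (x \<ominus> xs n) < 1 / real (Suc n)" by metis
  then have sV: "\<And>n. xs n \<in> carrier V" using assms(2) by blast
  have "vlim xs x"
  proof (rule vlim_I[OF sV assms(1)])
    show "(\<lambda>n. 1 / real (Suc n)) \<longlonglongrightarrow> 0" by (rule LIMSEQ_Suc) (rule lim_1_over_n)
    show "N (xs n \<ominus> x) \<le> 1 / real (Suc n)" for n
      using s[of n] sV[of n] assms(1) by (metis N_vdiff_commute less_imp_le)
  qed
  then show ?thesis using s by blast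
qed

lemma mcomplete_vlim:
  assumes "metric.mcomplete" "\<And>n. xs n \<in> carrier V"
    "\<And>e. e > 0 \<Longrightarrow> \<exists>M. \<forall>m\<ge>M. \<forall>n\<ge>M. N (xs m \<ominus> xs n) < e"
  obtains l where "l \<in> carrier V" "vlim xs l"
proof -
  have "metric.MCauchy xs"
    unfolding metric.MCauchy_def using assms(2,3) by (auto simp: norm_dist_def)
  then obtain l where l: "limitin metric.mtopology xs l sequentially"
    using assms(1) unfolding metric.mcomplete_def by blast
  then have "l \<in> carrier V" by (simp add: metric.limitin_metric)
  moreover from this have "vlim xs l"
    using l assms(2) by (simp add: metric.limitin_metric_dist_null vlim_def norm_dist_def)
  ultimately show ?thesis using that by blast
qed

lemma mcomplete_summable:
  assumes "metric.mcomplete" "\<And>n. xs n \<in> carrier V"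
    "\<And>n. N (xs (Suc n) \<ominus> xs n) \<le> r n" "summable r"
  obtains l where "l \<in> carrier V" "vlim xs l"
proof (rule mcomplete_vlim[OF assms(1,2)])
  have r0: "0 \<le> r n" for n using assms(2,3) N_nonneg by (meson order_trans vdiff_closed)
  have tele: "N (xs (m + k) \<ominus> xs m) \<le> sum r {m..<m+k}" for m k
  proof (induction k)
    case 0 show ?case using assms(2) by (simp add: vdiff_self N_zero)
  next
    case (Suc k)
    have "N (xs (Suc (m + k)) \<ominus> xs m) \<le> r (m + k) + N (xs (m + k) \<ominus> xs m)"
      using N_triangle_vdiff[of "xs (Suc (m + k))" "xs (m + k)" "xs m"] assms(2) assms(3)[of "m + k"]
      by force
    then show ?case using Suc by simp
  qed
  fix e :: real assume "e > 0"
  then obtain M where M: "\<And>m n. m \<ge> M \<Longrightarrow> norm (sum r {m..<n}) < e"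
    using assms(4) unfolding summable_Cauchy by blast
  have "N (xs m \<ominus> xs n) < e" if "m \<ge> M" "n \<ge> m" for m n
    using tele[of m "n - m"] M[of m n] that assms(2) by (simp add: N_vdiff_commute[of "xs m"])
  then have "N (xs m \<ominus> xs n) < e" if "m \<ge> M" "n \<ge> M" for m n
    using that assms(2) N_vdiff_commute by (cases "n \<ge> m") (auto, metis nat_le_linear)
  then show "\<exists>M. \<forall>m\<ge>M. \<forall>n\<ge>M. N (xs m \<ominus> xs n) < e" by blast
qed (use that in blast)

lemma contraction_fixed_point:
  assumes "metric.mcomplete" "\<And>x. x \<in> carrier V \<Longrightarrow> f x \<in> carrier V" "r < 1"
    "\<And>x y. \<lbrakk>x \<in> carrier V; y \<in> carrier V\<rbrakk> \<Longrightarrow> N (f x \<ominus> f y) \<le> r * N (x \<ominus> y)" "0 \<le> r"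
  obtains x where "x \<in> carrier V" "f x = x"
proof -
  define xs where "xs = (\<lambda>n. (f ^^ n) \<zero>)"
  have s: "xs n \<in> carrier V" for n by (induction n) (simp_all add: xs_def assms(2))
  have step: "N (xs (Suc n) \<ominus> xs n) \<le> r ^ n * N (xs 1 \<ominus> xs 0)" for n
  proof (induction n)
    case (Suc n)
    have "N (xs (Suc (Suc n)) \<ominus> xs (Suc n)) \<le> r * N (xs (Suc n) \<ominus> xs n)"
      using assms(4)[OF s[of "Suc n"] s[of n]] by (simp add: xs_def)
    also have "\<dots> \<le> r * (r ^ n * N (xs 1 \<ominus> xs 0))" using Suc assms(5) by (rule mult_left_mono)
    finally show ?case by simp
  qed simp
  have "summable (\<lambda>n. r ^ n * N (xs 1 \<ominus> xs 0))"
    using assms(3,5) by (intro summable_mult2 summable_geometric) simp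
  then obtain l where l: "l \<in> carrier V" "vlim xs l"
    by (rule mcomplete_summable[OF assms(1), where xs = xs, rotated 2]) (use s step in auto)
  have "vlim (\<lambda>n. xs (Suc n)) (f l)"
  proof (rule vlim_I)
    show "(\<lambda>n. r * N (xs n \<ominus> l)) \<longlonglongrightarrow> 0"
      using tendsto_mult_left[OF l(2)[unfolded vlim_def], of r] by simp
    show "N (xs (Suc n) \<ominus> f l) \<le> r * N (xs n \<ominus> l)" for n
      using assms(4)[OF s[of n] l(1)] by (simp add: xs_def)
  qed (use s l assms(2) in auto)
  moreover have "vlim (\<lambda>n. xs (Suc n)) l"
    using l(2) unfolding vlim_def by (rule LIMSEQ_Suc)
  ultimately have "f l = l" using vlim_unique s l(1) assms(2) by blast
  then show ?thesis using that l(1) by blast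
qed

end

text \<open>A bounded linear relation with dense domain extends to a bounded linear map on the whole
  space: the values along an approximating sequence form a Cauchy sequence.\<close>

lemma extend_bounded_relation:
  assumes V: "carrier_normed_space V N" and W: "carrier_normed_space W M"
    and comp: "Metric_space.mcomplete (carrier W) (norm_dist W M)"
    and RV: "\<And>x y. (x, y) \<in> R \<Longrightarrow> x \<in> carrier V \<and> y \<in> carrier W"
    and Radd: "\<And>x y x' y'. \<lbrakk>(x, y) \<in> R; (x', y') \<in> R\<rbrakk> \<Longrightarrow> (x \<oplus>\<^bsub>V\<^esub> x', y \<oplus>\<^bsub>W\<^esub> y') \<in> R"
    and Rscale: "\<And>c x y. (x, y) \<in> R \<Longrightarrow> (c \<odot>\<^bsub>V\<^esub> x, c \<odot>\<^bsub>W\<^esub> y) \<in> R"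
    and Rbound: "\<And>x y. (x, y) \<in> R \<Longrightarrow> M y \<le> N x"
    and dense: "\<And>x e. \<lbrakk>x \<in> carrier V; e > 0\<rbrakk> \<Longrightarrow> \<exists>x' y'. (x', y') \<in> R \<and> N (x \<ominus>\<^bsub>V\<^esub> x') < e"
  obtains f where "linear_map V W f" "\<And>x y. (x, y) \<in> R \<Longrightarrow> f x = y"
    "\<And>x. x \<in> carrier V \<Longrightarrow> M (f x) \<le> N x"
proof -
  interpret V: carrier_normed_space V N by (rule V)
  interpret W: carrier_normed_space W M by (rule W)
  have Rdiff: "M (y \<ominus>\<^bsub>W\<^esub> y') \<le> N (x \<ominus>\<^bsub>V\<^esub> x')" if "(x, y) \<in> R" "(x', y') \<in> R" for x y x' y'
    using Rbound[OF Radd[OF that(1) Rscale[OF that(2), of "-1"]]] by (simp add: vdiff_def)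
  define G where "G = (\<lambda>x y. y \<in> carrier W \<and>
    (\<exists>xs ys. (\<forall>n. (xs n, ys n) \<in> R) \<and> V.vlim xs x \<and> W.vlim ys y))"
  have ex: "\<exists>y. G x y" if x: "x \<in> carrier V" for x
  proof -
    have "Domain R \<subseteq> carrier V" using RV by blast
    moreover have "\<exists>w\<in>Domain R. N (x \<ominus>\<^bsub>V\<^esub> w) < e" if "e > 0" for e using dense[OF x that] by blast
    ultimately have "\<exists>xs. (\<forall>n. xs n \<in> Domain R) \<and> V.vlim xs x"
      by (rule V.approx_sequence[OF x])
    then obtain xs where s: "\<forall>n. xs n \<in> Domain R" "V.vlim xs x" by blast
    have "\<forall>n. \<exists>y. (xs n, y) \<in> R" using s(1) by blast
    then obtain ys where t: "\<And>n. (xs n, ys n) \<in> R" by metis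
    have sV: "xs n \<in> carrier V" and tW: "ys n \<in> carrier W" for n using RV[OF t[of n]] by simp_all
    have "\<exists>K. \<forall>m\<ge>K. \<forall>n\<ge>K. M (ys m \<ominus>\<^bsub>W\<^esub> ys n) < e" if "e > 0" for e
    proof -
      have "e / 2 > 0" using that by simp
      from V.vlim_D[OF s(2) this] obtain K where "\<forall>n\<ge>K. N (xs n \<ominus>\<^bsub>V\<^esub> x) < e / 2" ..
      then have K: "\<And>n. n \<ge> K \<Longrightarrow> N (xs n \<ominus>\<^bsub>V\<^esub> x) < e / 2" by simp
      have "M (ys m \<ominus>\<^bsub>W\<^esub> ys n) < e" if "m \<ge> K" "n \<ge> K" for m n
        using Rdiff[OF t[of m] t[of n]] V.N_triangle_vdiff[OF sV[of m] x sV[of n]] K[OF that(1)]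
          K[OF that(2)] V.N_vdiff_commute[OF x sV[of n]] by linarith
      then show ?thesis by blast
    qed
    then have "\<exists>y. y \<in> carrier W \<and> W.vlim ys y"
      by (rule W.mcomplete_vlim[where xs = ys, OF comp tW]) auto
    then obtain y where "y \<in> carrier W" "W.vlim ys y" by blast
    then have "G x y"
      unfolding G_def using s(2) t by (intro conjI exI[of _ xs] exI[of _ ys]) auto
    then show ?thesis ..
  qed
  define f where "f = (\<lambda>x. SOME y. G x y)"
  have f: "G x (f x)" if "x \<in> carrier V" for x
    unfolding f_def using ex[OF that] by (rule someI_ex)
  have Gle: "M y \<le> N x" if xs: "G x y" "x \<in> carrier V" for x y
  proof -
    obtain xs ys where st: "\<forall>n. (xs n, ys n) \<in> R" "V.vlim xs x" "W.vlim ys y" "y \<in> carrier W"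
      using xs(1) unfolding G_def by blast
    have sV: "xs n \<in> carrier V" and tW: "ys n \<in> carrier W" for n using RV[OF st(1)[rule_format, of n]] by simp_all
    have "(\<lambda>n. N x + N (xs n \<ominus>\<^bsub>V\<^esub> x) + M (ys n \<ominus>\<^bsub>W\<^esub> y)) \<longlonglongrightarrow> N x + 0 + 0"
      using st(2,3) unfolding V.vlim_def W.vlim_def by (intro tendsto_intros)
    moreover have "M y \<le> N x + N (xs n \<ominus>\<^bsub>V\<^esub> x) + M (ys n \<ominus>\<^bsub>W\<^esub> y)" for n
      using W.N_le_add_vdiff[OF st(4) tW[of n]] Rbound[OF st(1)[rule_format, of n]]
        V.N_le_add_vdiff[OF sV[of n] xs(2)] W.N_vdiff_commute[OF st(4) tW[of n]] by linarith
    ultimately show ?thesis by (intro LIMSEQ_le_const[where a = "M y"]) auto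
  qed
  have Gadd: "G (x \<oplus>\<^bsub>V\<^esub> x') (y \<oplus>\<^bsub>W\<^esub> y')"
    if xs: "G x y" "G x' y'" "x \<in> carrier V" "x' \<in> carrier V" for x y x' y'
  proof -
    obtain xs ys where st: "\<forall>n. (xs n, ys n) \<in> R" "V.vlim xs x" "W.vlim ys y" "y \<in> carrier W"
      using xs(1) unfolding G_def by blast
    obtain xs' ys' where st': "\<forall>n. (xs' n, ys' n) \<in> R" "V.vlim xs' x'" "W.vlim ys' y'" "y' \<in> carrier W"
      using xs(2) unfolding G_def by blast
    have in_V: "xs n \<in> carrier V" "xs' n \<in> carrier V" "ys n \<in> carrier W" "ys' n \<in> carrier W" for n
      using RV[OF st(1)[rule_format, of n]] RV[OF st'(1)[rule_format, of n]] by simp_all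
    have "V.vlim (\<lambda>n. xs n \<oplus>\<^bsub>V\<^esub> xs' n) (x \<oplus>\<^bsub>V\<^esub> x')"
      by (rule V.vlim_add[OF st(2) st'(2) in_V(1,2) xs(3,4)])
    moreover have "W.vlim (\<lambda>n. ys n \<oplus>\<^bsub>W\<^esub> ys' n) (y \<oplus>\<^bsub>W\<^esub> y')"
      by (rule W.vlim_add[OF st(3) st'(3) in_V(3,4) st(4) st'(4)])
    moreover have "\<forall>n. (xs n \<oplus>\<^bsub>V\<^esub> xs' n, ys n \<oplus>\<^bsub>W\<^esub> ys' n) \<in> R"
      using Radd[OF st(1)[rule_format] st'(1)[rule_format]] by simp
    ultimately show ?thesis unfolding G_def using st(4) st'(4)
      by (intro conjI exI[of _ "\<lambda>n. xs n \<oplus>\<^bsub>V\<^esub> xs' n"] exI[of _ "\<lambda>n. ys n \<oplus>\<^bsub>W\<^esub> ys' n"]) auto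
  qed
  have Gscale: "G (c \<odot>\<^bsub>V\<^esub> x) (c \<odot>\<^bsub>W\<^esub> y)" if xs: "G x y" "x \<in> carrier V" for c x y
  proof -
    obtain xs ys where st: "\<forall>n. (xs n, ys n) \<in> R" "V.vlim xs x" "W.vlim ys y" "y \<in> carrier W"
      using xs(1) unfolding G_def by blast
    have in_V: "xs n \<in> carrier V" "ys n \<in> carrier W" for n using RV[OF st(1)[rule_format, of n]] by simp_all
    have "V.vlim (\<lambda>n. c \<odot>\<^bsub>V\<^esub> xs n) (c \<odot>\<^bsub>V\<^esub> x)" by (rule V.vlim_scale[OF st(2) in_V(1) xs(2)])
    moreover have "W.vlim (\<lambda>n. c \<odot>\<^bsub>W\<^esub> ys n) (c \<odot>\<^bsub>W\<^esub> y)" by (rule W.vlim_scale[OF st(3) in_V(2) st(4)])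
    moreover have "\<forall>n. (c \<odot>\<^bsub>V\<^esub> xs n, c \<odot>\<^bsub>W\<^esub> ys n) \<in> R" using Rscale[OF st(1)[rule_format]] by simp
    ultimately show ?thesis unfolding G_def using st(4)
      by (intro conjI exI[of _ "\<lambda>n. c \<odot>\<^bsub>V\<^esub> xs n"] exI[of _ "\<lambda>n. c \<odot>\<^bsub>W\<^esub> ys n"]) auto
  qed
  have Guniq: "y = y'" if xs: "G x y" "G x y'" "x \<in> carrier V" for x y y'
  proof -
    have "G (x \<ominus>\<^bsub>V\<^esub> x) (y \<ominus>\<^bsub>W\<^esub> y')"
      using Gadd[OF xs(1) Gscale[OF xs(2,3), of "-1"]] xs(3) by (simp add: vdiff_def)
    then have "M (y \<ominus>\<^bsub>W\<^esub> y') \<le> 0"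
      using Gle[of "x \<ominus>\<^bsub>V\<^esub> x"] xs(3) by (simp add: V.vdiff_self V.N_zero)
    moreover have "y \<in> carrier W" "y' \<in> carrier W" using xs by (simp_all add: G_def)
    ultimately show ?thesis by (intro W.N_eqI) auto
  qed
  have "linear_map V W f"
    unfolding linear_map_def
  proof (intro conjI ballI allI)
    show "f \<in> carrier V \<rightarrow> carrier W" using f by (auto simp: G_def)
  next
    fix x y assume "x \<in> carrier V" "y \<in> carrier V"
    then show "f (x \<oplus>\<^bsub>V\<^esub> y) = f x \<oplus>\<^bsub>W\<^esub> f y"
      using Guniq[OF f Gadd[OF f f]] by simp
  next
    fix c x assume "x \<in> carrier V"
    then show "f (c \<odot>\<^bsub>V\<^esub> x) = c \<odot>\<^bsub>W\<^esub> f x" using Guniq[OF f Gscale[OF f]] by simp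
  qed
  moreover have "f x = y" if "(x, y) \<in> R" for x y
  proof -
    have "G x y" unfolding G_def
      using RV[OF that] that V.vlim_const W.vlim_const
      by (intro conjI exI[of _ "\<lambda>n. x"] exI[of _ "\<lambda>n. y"]) auto
    then show ?thesis using Guniq f RV[OF that] by blast
  qed
  moreover have "M (f x) \<le> N x" if "x \<in> carrier V" for x using Gle f that by blast
  ultimately show ?thesis by (rule that)
qed

section \<open>Elementary C*-algebra\<close>

sublocale cstar_algebra \<subseteq> carrier_normed_space A "nrm A"
  by unfold_locales (simp_all add: norm_nonneg norm_eq_zero norm_triangle norm_scale)

context cstar_algebra
begin

declare mult_closed [simp, intro] adj_closed [simp, intro]

lemma mult_zero_right: "x \<in> carrier A \<Longrightarrow> x \<otimes> \<zero> = \<zero>"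
  by (metis mult_scale_right scale_0 mult_closed zero_closed)

lemma mult_zero_left: "x \<in> carrier A \<Longrightarrow> \<zero> \<otimes> x = \<zero>"
  by (metis mult_scale_left scale_0 mult_closed zero_closed)

lemma adj_zero: "adj A \<zero> = \<zero>"
  by (metis adj_scale adj_closed complex_cnj_zero scale_0 zero_closed)

lemma mult_vdiff_left:
  "\<lbrakk>x \<in> carrier A; y \<in> carrier A; z \<in> carrier A\<rbrakk> \<Longrightarrow> (x \<ominus> y) \<otimes> z = x \<otimes> z \<ominus> y \<otimes> z"
  by (simp add: vdiff_def mult_add_left mult_scale_left)

lemma mult_vdiff_right:
  "\<lbrakk>x \<in> carrier A; y \<in> carrier A; z \<in> carrier A\<rbrakk> \<Longrightarrow> x \<otimes> (y \<ominus> z) = x \<otimes> y \<ominus> x \<otimes> z"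
  by (simp add: vdiff_def mult_add_right mult_scale_right)

lemma adj_vdiff:
  "\<lbrakk>x \<in> carrier A; y \<in> carrier A\<rbrakk> \<Longrightarrow> adj A (x \<ominus> y) = adj A x \<ominus> adj A y"
  by (simp add: vdiff_def adj_add adj_scale)

text \<open>Rules that turn products into sums of scaled monomials, for use before \<open>vec_eqI\<close>.\<close>

lemmas expand_simps = mult_add_left mult_add_right mult_scale_left mult_scale_right mult_assoc
  mult_vdiff_left mult_vdiff_right adj_vdiff adj_add adj_scale adj_mult adj_adj
  mult_zero_left mult_zero_right adj_zero

lemma norm_adj: "x \<in> carrier A \<Longrightarrow> nrm A (adj A x) = nrm A x"
proof -
  have le: "nrm A x \<le> nrm A (adj A x)" if x: "x \<in> carrier A" for x
  proof (cases "nrm A x = 0")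
    case False
    then have "0 < nrm A x" using norm_nonneg[OF x] by simp
    moreover have "nrm A x * nrm A x \<le> nrm A (adj A x) * nrm A x"
      using cstar_identity[OF x] norm_mult[of "adj A x" x] x by (simp add: power2_eq_square)
    ultimately show ?thesis by simp
  qed (simp add: norm_nonneg x)
  assume "x \<in> carrier A"
  then show ?thesis using le[of x] le[of "adj A x"] by (simp add: adj_adj)
qed

lemma cstar_identity': "x \<in> carrier A \<Longrightarrow> nrm A (x \<otimes> adj A x) = (nrm A x)\<^sup>2"
  using cstar_identity[of "adj A x"] by (simp add: adj_adj norm_adj)

lemma adj_mult_self_eq_zero: "\<lbrakk>x \<in> carrier A; adj A x \<otimes> x = \<zero>\<rbrakk> \<Longrightarrow> x = \<zero>"
  using cstar_identity[of x] N_zero by (simp add: norm_eq_zero)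

lemma eq_by_left_mult:
  assumes "x \<in> carrier A" "y \<in> carrier A" "\<And>z. z \<in> carrier A \<Longrightarrow> z \<otimes> x = z \<otimes> y"
  shows "x = y"
proof -
  have "adj A (x \<ominus> y) \<otimes> (x \<ominus> y) = \<zero>"
    using assms(1,2) assms(3)[of "adj A (x \<ominus> y)"] by (simp add: mult_vdiff_right vdiff_self)
  then have "x \<ominus> y = \<zero>" by (rule adj_mult_self_eq_zero[rotated]) (use assms(1,2) in simp)
  then show ?thesis using assms(1,2) by (simp add: vdiff_eq_zero)
qed

lemma eq_by_right_mult:
  assumes "x \<in> carrier A" "y \<in> carrier A" "\<And>z. z \<in> carrier A \<Longrightarrow> x \<otimes> z = y \<otimes> z"
  shows "x = y"
proof -
  have "adj A x = adj A y"
  proof (rule eq_by_left_mult)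
    fix z assume "z \<in> carrier A"
    then have "adj A (x \<otimes> adj A z) = adj A (y \<otimes> adj A z)" using assms(3)[of "adj A z"] by simp
    then show "z \<otimes> adj A x = z \<otimes> adj A y"
      using assms(1,2) \<open>z \<in> carrier A\<close> by (simp add: adj_mult adj_adj)
  qed (use assms(1,2) in auto)
  then show ?thesis using assms(1,2) adj_adj by metis
qed

lemma vlim_mult:
  assumes "vlim xs l" "vlim ys m" "\<And>n. xs n \<in> carrier A" "\<And>n. ys n \<in> carrier A"
    "l \<in> carrier A" "m \<in> carrier A"
  shows "vlim (\<lambda>n. xs n \<otimes> ys n) (l \<otimes> m)"
proof (rule vlim_I)
  let ?r = "\<lambda>n. nrm A (xs n \<ominus> l) * (nrm A (ys n \<ominus> m) + nrm A m) + nrm A l * nrm A (ys n \<ominus> m)"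
  have "?r \<longlonglongrightarrow> 0 * (0 + nrm A m) + nrm A l * 0"
    using assms(1,2) unfolding vlim_def by (intro tendsto_intros)
  then show "?r \<longlonglongrightarrow> 0" by simp
  fix n
  have "xs n \<otimes> ys n \<ominus> l \<otimes> m = (xs n \<ominus> l) \<otimes> ys n \<oplus> l \<otimes> (ys n \<ominus> m)"
    using assms by (intro vec_eqI) (simp_all add: expand_simps functional_simps)
  then have "nrm A (xs n \<otimes> ys n \<ominus> l \<otimes> m)
    \<le> nrm A ((xs n \<ominus> l) \<otimes> ys n) + nrm A (l \<otimes> (ys n \<ominus> m))"
    using assms by (simp add: norm_triangle)
  also have "\<dots> \<le> nrm A (xs n \<ominus> l) * nrm A (ys n) + nrm A l * nrm A (ys n \<ominus> m)"
    using assms by (intro add_mono norm_mult) auto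
  also have "\<dots> \<le> ?r n"
    using N_le_add_vdiff[of "ys n" m] assms norm_nonneg
    by (intro add_mono mult_left_mono) (auto simp: add.commute)
  finally show "nrm A (xs n \<otimes> ys n \<ominus> l \<otimes> m) \<le> ?r n" .
qed (use assms in auto)

lemma vlim_adj:
  assumes "vlim xs l" "\<And>n. xs n \<in> carrier A" "l \<in> carrier A"
  shows "vlim (\<lambda>n. adj A (xs n)) (adj A l)"
proof (rule vlim_I)
  show "(\<lambda>n. nrm A (xs n \<ominus> l)) \<longlonglongrightarrow> 0" using assms(1) by (simp add: vlim_def)
  show "nrm A (adj A (xs n) \<ominus> adj A l) \<le> nrm A (xs n \<ominus> l)" for n
    using assms norm_adj[of "xs n \<ominus> l"] by (simp add: adj_vdiff)
qed (use assms in auto)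

lemma closed_subspaceD:
  assumes "closed_subspace A W"
  shows "W \<subseteq> carrier A" "\<zero> \<in> W"
    "\<And>x y. \<lbrakk>x \<in> W; y \<in> W\<rbrakk> \<Longrightarrow> x \<oplus> y \<in> W" "\<And>c x. x \<in> W \<Longrightarrow> c \<odot> x \<in> W"
    "\<And>x y. \<lbrakk>x \<in> W; y \<in> W\<rbrakk> \<Longrightarrow> x \<ominus> y \<in> W"
    "\<And>x. \<lbrakk>x \<in> carrier A; \<And>e. e > 0 \<Longrightarrow> \<exists>w\<in>W. nrm A (x \<ominus> w) < e\<rbrakk> \<Longrightarrow> x \<in> W"
  using assms unfolding closed_subspace_def closedin_norm_iff vdiff_def by blast+

lemma closed_subspaceI:
  assumes "W \<subseteq> carrier A" "\<zero> \<in> W"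
    "\<And>x y. \<lbrakk>x \<in> W; y \<in> W\<rbrakk> \<Longrightarrow> x \<oplus> y \<in> W" "\<And>c x. x \<in> W \<Longrightarrow> c \<odot> x \<in> W"
    "\<And>x. \<lbrakk>x \<in> carrier A; \<And>e. e > 0 \<Longrightarrow> \<exists>w\<in>W. nrm A (x \<ominus> w) < e\<rbrakk> \<Longrightarrow> x \<in> W"
  shows "closed_subspace A W"
  using assms unfolding closed_subspace_def closedin_norm_iff by blast

lemma closed_subspace_carrier: "closed_subspace A (carrier A)"
  by (rule closed_subspaceI) auto

lemma closed_subspace_closure:
  assumes "linear_subspace A W"
  shows "closed_subspace A {x \<in> carrier A. \<forall>e>0. \<exists>w\<in>W. nrm A (x \<ominus> w) < e}" (is "closed_subspace A ?C")
proof (rule closed_subspaceI)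
  have W: "W \<subseteq> carrier A" "\<zero> \<in> W" and Wadd: "\<And>x y. \<lbrakk>x \<in> W; y \<in> W\<rbrakk> \<Longrightarrow> x \<oplus> y \<in> W"
    and Wsc: "\<And>c x. x \<in> W \<Longrightarrow> c \<odot> x \<in> W"
    using assms unfolding linear_subspace_def by blast+
  show "\<zero> \<in> ?C" using W(2) by (auto intro!: bexI[of _ \<zero>] simp: vdiff_self N_zero)
  show "x \<oplus> y \<in> ?C" if xy: "x \<in> ?C" "y \<in> ?C" for x y
  proof -
    have "\<exists>w\<in>W. nrm A ((x \<oplus> y) \<ominus> w) < e" if e: "e > 0" for e
    proof -
      obtain v w where v: "v \<in> W" "w \<in> W" "nrm A (x \<ominus> v) < e/2" "nrm A (y \<ominus> w) < e/2"
        using xy half_gt_zero[OF e] by blast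
      then have vw: "v \<in> carrier A" "w \<in> carrier A" using W by blast+
      have "(x \<oplus> y) \<ominus> (v \<oplus> w) = (x \<ominus> v) \<oplus> (y \<ominus> w)"
        using xy vw by (intro vec_eqI) (simp_all add: functional_simps)
      then have "nrm A ((x \<oplus> y) \<ominus> (v \<oplus> w)) < e"
        using norm_triangle[of "x \<ominus> v" "y \<ominus> w"] v vw xy by simp
      then show ?thesis using Wadd v by blast
    qed
    then show ?thesis using xy by simp
  qed
  show "c \<odot> x \<in> ?C" if x: "x \<in> ?C" for c x
  proof -
    have "\<exists>w\<in>W. nrm A ((c \<odot> x) \<ominus> w) < e" if e: "e > 0" for e
    proof -
      have "0 < e / (cmod c + 1)" using e by (intro divide_pos_pos) (auto intro: add_nonneg_pos)
      then obtain v where v: "v \<in> W" "nrm A (x \<ominus> v) < e / (cmod c + 1)"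
        using x by blast
      then have vw: "v \<in> carrier A" using W by blast
      have "nrm A (c \<odot> x \<ominus> c \<odot> v) = cmod c * nrm A (x \<ominus> v)"
        using x vw by (simp add: scale_vdiff[symmetric] norm_scale)
      also have "\<dots> \<le> (cmod c + 1) * nrm A (x \<ominus> v)"
        using x vw norm_nonneg by (intro mult_right_mono) auto
      also have "\<dots> < e" using v(2) by (simp add: pos_less_divide_eq add_nonneg_pos mult.commute)
      finally show ?thesis using Wsc v(1) by blast
    qed
    then show ?thesis using x by simp
  qed
  show "x \<in> ?C" if x: "x \<in> carrier A" "\<And>e. e > 0 \<Longrightarrow> \<exists>w\<in>?C. nrm A (x \<ominus> w) < e" for x
  proof -
    have "\<exists>w\<in>W. nrm A (x \<ominus> w) < e" if e: "e > 0" for e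
    proof -
      obtain v where v: "v \<in> ?C" "nrm A (x \<ominus> v) < e/2" using x(2) half_gt_zero[OF e] by blast
      then obtain w where w: "w \<in> W" "nrm A (v \<ominus> w) < e/2" using half_gt_zero[OF e] by blast
      then have "nrm A (x \<ominus> w) < e"
        using N_triangle_vdiff[of x v w] x(1) v W(1) by (simp add: subset_iff)
      then show ?thesis using w(1) by blast
    qed
    then show ?thesis using x(1) by simp
  qed
qed auto

lemma hull_closed_subspace_subset:
  "S \<subseteq> carrier A \<Longrightarrow> closed_subspace A hull S \<subseteq> carrier A"
  using hull_minimal[of S "carrier A" "closed_subspace A"] closed_subspace_carrier by blast

lemma closed_subspace_hull:
  assumes "S \<subseteq> carrier A"
  shows "closed_subspace A (closed_subspace A hull S)"
proof (rule closed_subspaceI)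
  show "closed_subspace A hull S \<subseteq> carrier A" using assms by (rule hull_closed_subspace_subset)
  show "x \<in> closed_subspace A hull S" if "x \<in> carrier A"
    "\<And>e. e > 0 \<Longrightarrow> \<exists>w\<in>closed_subspace A hull S. nrm A (x \<ominus> w) < e" for x
    unfolding hull_def
  proof (intro InterI; clarify)
    fix W assume W: "closed_subspace A W" "S \<subseteq> W"
    then have "closed_subspace A hull S \<subseteq> W" by (rule hull_minimal[rotated])
    then show "x \<in> W" using closed_subspaceD(6)[OF W(1) that(1)] that(2) by blast
  qed
qed (auto simp: hull_def dest: closed_subspaceD)

lemma cstar_subalgebra_carrier: "cstar_subalgebra A (carrier A)"
  unfolding cstar_subalgebra_def using closed_subspace_carrier by simp

text \<open>The solution \<open>g = 1 - (1 - k)\<^bsup>1/2\<^esup>\<close> of \<open>2g = k + g\<^sup>2\<close> exists inside the (possibly nonunital)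
  algebra already for \<open>\<parallel>k\<parallel> \<le> 1\<close>. The iteration starting at \<open>0\<close> converges because its steps are
  dominated by those of the scalar iteration with \<open>k = 1\<close>, which increases to \<open>1\<close>. Every closed
  property that the iteration preserves passes to \<open>g\<close>.\<close>

lemma quadratic_solution:
  assumes k: "k \<in> carrier A" "nrm A k \<le> 1"
  obtains g where "g \<in> carrier A" "nrm A g \<le> 1" "k \<oplus> g \<otimes> g = 2 \<odot> g"
    "\<And>S. \<lbrakk>closedin (norm_topology A (nrm A)) S; \<zero> \<in> S; \<And>x. x \<in> S \<Longrightarrow> (1/2) \<odot> (k \<oplus> x \<otimes> x) \<in> S\<rbrakk>
      \<Longrightarrow> g \<in> S"
proof -
  define f where "f = (\<lambda>x. (1/2) \<odot> (k \<oplus> x \<otimes> x))"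
  define G where "G = (\<lambda>n. (f ^^ n) \<zero>)"
  define s where "s = (\<lambda>n. ((\<lambda>x::real. (1 + x * x) / 2) ^^ n) 0)"
  have GS: "G (Suc n) = f (G n)" and sS: "s (Suc n) = (1 + s n * s n) / 2" for n
    by (simp_all add: G_def s_def)
  have G: "G n \<in> carrier A" for n
    by (induction n) (simp_all add: G_def f_def k)
  have s: "0 \<le> s n \<and> s n \<le> 1" for n
  proof (induction n)
    case 0 show ?case by (simp add: s_def)
  next
    case (Suc n)
    then have "s n * s n \<le> 1 * 1" by (intro mult_mono) auto
    then show ?case using Suc by (simp add: sS)
  qed
  have Gs: "nrm A (G n) \<le> s n" for n
  proof (induction n)
    case 0 show ?case by (simp add: G_def s_def N_zero)
  next
    case (Suc n)
    have "nrm A (G n \<otimes> G n) \<le> s n * s n"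
      using norm_mult[OF G G] Suc s norm_nonneg[OF G] by (meson mult_mono order_trans)
    then have "nrm A (k \<oplus> G n \<otimes> G n) \<le> 1 + s n * s n"
      using norm_triangle[of k "G n \<otimes> G n"] k G by force
    then show ?case using G k by (simp add: GS sS f_def norm_scale)
  qed
  have diff: "nrm A (G (Suc n) \<ominus> G n) \<le> s (Suc n) - s n" for n
  proof (induction n)
    case 0 show ?case using Gs[of 1] by (simp add: G_def s_def vdiff_zero f_def k mult_zero_left)
  next
    case (Suc n)
    let ?d = "G (Suc n) \<ominus> G n"
    have "G (Suc (Suc n)) \<ominus> G (Suc n) = f (G (Suc n)) \<ominus> f (G n)" by (simp only: GS)
    also have "\<dots> = (1/2) \<odot> (G (Suc n) \<otimes> ?d \<oplus> ?d \<otimes> G n)"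
      unfolding f_def using G k
      by (intro vec_eqI) (simp_all add: expand_simps functional_simps algebra_simps)
    finally have half: "nrm A (G (Suc (Suc n)) \<ominus> G (Suc n)) = nrm A (G (Suc n) \<otimes> ?d \<oplus> ?d \<otimes> G n) / 2"
      using G by (simp add: norm_scale)
    have "nrm A (G (Suc n) \<otimes> ?d \<oplus> ?d \<otimes> G n)
      \<le> nrm A (G (Suc n)) * nrm A ?d + nrm A ?d * nrm A (G n)"
      using norm_triangle[of "G (Suc n) \<otimes> ?d" "?d \<otimes> G n"] norm_mult[of "G (Suc n)" ?d]
        norm_mult[of ?d "G n"] G by force
    also have "\<dots> \<le> s (Suc n) * (s (Suc n) - s n) + (s (Suc n) - s n) * s n"
    proof (intro add_mono mult_mono)
      have "0 \<le> nrm A ?d" using norm_nonneg G by simp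
      then show "0 \<le> s (Suc n) - s n" using Suc by simp
    qed (use Suc Gs s G norm_nonneg in auto)
    also have "\<dots> = s (Suc n) * s (Suc n) - s n * s n" by (simp add: algebra_simps)
    finally show ?case using half sS[of "Suc n"] sS[of n] by argo
  qed
  have "summable (\<lambda>n. s (Suc n) - s n)"
  proof -
    have "s n \<le> s (Suc n)" for n using diff[of n] norm_nonneg G by (smt (verit) vdiff_closed)
    then have "convergent s" using s by (intro Bseq_mono_convergent BseqI'[of _ 1] incseq_SucI[unfolded incseq_def]) auto
    then obtain L where "s \<longlonglongrightarrow> L" unfolding convergent_def by blast
    then show ?thesis using telescope_summable by blast
  qed
  then obtain g where g: "g \<in> carrier A" "vlim G g"
    by (rule mcomplete_summable[OF complete, where xs = G, rotated 2]) (use G diff in auto)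
  show ?thesis
  proof
    show "g \<in> carrier A" by fact
    show "nrm A g \<le> 1" using vlim_N_le[OF g(2) G g(1)] Gs s by (meson order_trans)
    have "vlim (\<lambda>n. f (G n)) (f g)"
      unfolding f_def using g G k by (intro vlim_scale vlim_add vlim_mult vlim_const) auto
    moreover have "vlim (\<lambda>n. f (G n)) g"
      using LIMSEQ_Suc[OF g(2)[unfolded vlim_def]] by (simp add: vlim_def GS)
    ultimately have "f g = g" by (rule vlim_unique) (use G g k in \<open>simp_all add: f_def\<close>)
    then have "2 \<odot> g = 2 \<odot> f g" by simp
    also have "\<dots> = k \<oplus> g \<otimes> g" using g k by (simp add: f_def scale_scale scale_one)
    finally show "k \<oplus> g \<otimes> g = 2 \<odot> g" by simp
    fix S assume S: "closedin (norm_topology A (nrm A)) S" "\<zero> \<in> S"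
      "\<And>x. x \<in> S \<Longrightarrow> (1/2) \<odot> (k \<oplus> x \<otimes> x) \<in> S"
    have "G n \<in> S" for n by (induction n) (simp_all add: G_def f_def S)
    then show "g \<in> S" using vlim_in_closed g S(1) by blast
  qed
qed

lemma closedin_commutant:
  "y \<in> carrier A \<Longrightarrow> closedin (norm_topology A (nrm A)) {x \<in> carrier A. x \<otimes> y = y \<otimes> x}"
  unfolding closedin_norm_iff
proof (intro conjI ballI impI)
  fix x assume y: "y \<in> carrier A" and x: "x \<in> carrier A"
    and ap: "\<forall>e>0. \<exists>w\<in>{x \<in> carrier A. x \<otimes> y = y \<otimes> x}. nrm A (x \<ominus> w) < e"
  have "\<exists>xs. (\<forall>n. xs n \<in> {x \<in> carrier A. x \<otimes> y = y \<otimes> x}) \<and> vlim xs x"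
    by (rule approx_sequence[OF x]) (use ap in auto)
  then obtain xs where s: "\<And>n. xs n \<in> {x \<in> carrier A. x \<otimes> y = y \<otimes> x}" "vlim xs x" by blast
  have "vlim (\<lambda>n. xs n \<otimes> y) (x \<otimes> y)" "vlim (\<lambda>n. y \<otimes> xs n) (y \<otimes> x)"
    by (rule vlim_mult[OF s(2) vlim_const] vlim_mult[OF vlim_const s(2)]; use s(1) x y in simp)+
  then have "x \<otimes> y = y \<otimes> x" using s(1) x y by (intro vlim_unique[of "\<lambda>n. xs n \<otimes> y"]) auto
  then show "x \<in> {x \<in> carrier A. x \<otimes> y = y \<otimes> x}" using x by simp
qed auto

lemma closedin_selfadjoint:
  "closedin (norm_topology A (nrm A)) {x \<in> carrier A. adj A x = x}"
  unfolding closedin_norm_iff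
proof (intro conjI ballI impI)
  fix x assume x: "x \<in> carrier A"
    and ap: "\<forall>e>0. \<exists>w\<in>{x \<in> carrier A. adj A x = x}. nrm A (x \<ominus> w) < e"
  have "\<exists>xs. (\<forall>n. xs n \<in> {x \<in> carrier A. adj A x = x}) \<and> vlim xs x"
    by (rule approx_sequence[OF x]) (use ap in auto)
  then obtain xs where s: "\<And>n. xs n \<in> {x \<in> carrier A. adj A x = x}" "vlim xs x" by blast
  have "vlim (\<lambda>n. adj A (xs n)) (adj A x)" using s x by (intro vlim_adj) auto
  then have "adj A x = x" using s x by (intro vlim_unique[of xs]) auto
  then show "x \<in> {x \<in> carrier A. adj A x = x}" using x by simp
qed auto

lemma quadratic_solution_selfadjoint:
  assumes k: "k \<in> carrier A" "nrm A k \<le> 1" "adj A k = k"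
  obtains g where "g \<in> carrier A" "nrm A g \<le> 1" "k \<oplus> g \<otimes> g = 2 \<odot> g" "adj A g = g"
    "\<And>y. \<lbrakk>y \<in> carrier A; k \<otimes> y = y \<otimes> k\<rbrakk> \<Longrightarrow> g \<otimes> y = y \<otimes> g"
proof -
  obtain g where g: "g \<in> carrier A" "nrm A g \<le> 1" "k \<oplus> g \<otimes> g = 2 \<odot> g"
    and S: "\<And>S. \<lbrakk>closedin (norm_topology A (nrm A)) S; \<zero> \<in> S; \<And>x. x \<in> S \<Longrightarrow> (1/2) \<odot> (k \<oplus> x \<otimes> x) \<in> S\<rbrakk>
      \<Longrightarrow> g \<in> S"
    using quadratic_solution[OF k(1,2)] by metis
  have "g \<in> {x \<in> carrier A. adj A x = x}"
    using k by (intro S closedin_selfadjoint) (auto simp: expand_simps)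
  then have "adj A g = g" by simp
  moreover have "g \<otimes> y = y \<otimes> g" if y: "y \<in> carrier A" "k \<otimes> y = y \<otimes> k" for y
  proof -
    have "x \<otimes> (x \<otimes> y) = y \<otimes> (x \<otimes> x)" if "x \<in> carrier A" "x \<otimes> y = y \<otimes> x" for x
      using that y(1) by (metis mult_assoc)
    then have "g \<in> {x \<in> carrier A. x \<otimes> y = y \<otimes> x}"
      using k y by (intro S closedin_commutant) (auto simp: expand_simps)
    then show ?thesis by simp
  qed
  ultimately show ?thesis using that g by blast
qed

text \<open>If \<open>h\<close> and \<open>g\<close> are commuting self-adjoint elements with \<open>h\<^sup>2 + (1 - g)\<^sup>2 = 1\<close>, then
  \<open>h \<plusminus> \<i>(1 - g)\<close> are unitary, hence \<open>h\<close> and \<open>1 - g\<close>, being halved sums of unitaries up to phases,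
  are contractions. The unitaries act on the algebra itself, so no unit is needed.\<close>

lemma unitary_parts_contractive:
  assumes c: "h \<in> carrier A" "g \<in> carrier A" "b \<in> carrier A"
    and sa: "adj A h = h" "adj A g = g"
    and comm: "g \<otimes> h = h \<otimes> g" and eq: "h \<otimes> h \<oplus> g \<otimes> g = 2 \<odot> g"
  shows "nrm A (h \<otimes> b) \<le> nrm A b" "nrm A (b \<ominus> g \<otimes> b) \<le> nrm A b"
proof -
  have hh: "h \<otimes> h = 2 \<odot> g \<ominus> g \<otimes> g"
    using c by (simp add: eq[symmetric]) (intro vec_eqI, simp_all add: functional_simps)
  have hhz: "h \<otimes> (h \<otimes> z) = 2 \<odot> (g \<otimes> z) \<ominus> g \<otimes> (g \<otimes> z)" if "z \<in> carrier A" for z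
    using c that hh by (simp add: mult_assoc[symmetric]) (simp add: mult_vdiff_left mult_scale_left)
  have ghz: "g \<otimes> (h \<otimes> z) = h \<otimes> (g \<otimes> z)" if "z \<in> carrier A" for z
    using c that comm by (simp add: mult_assoc[symmetric])
  define U where "U = (\<lambda>c. h \<otimes> b \<oplus> c \<odot> (b \<ominus> g \<otimes> b))"
  have Uc: "U z \<in> carrier A" for z using c by (simp add: U_def)
  have U: "nrm A (U z) = nrm A b" if z: "z = \<i> \<or> z = - \<i>" for z
  proof -
    have "adj A (U z) \<otimes> U z = adj A b \<otimes> b"
      unfolding U_def using c z
      by (intro vec_eqI) (auto simp: expand_simps functional_simps sa hhz ghz algebra_simps)
    then have "(nrm A (U z))\<^sup>2 = (nrm A b)\<^sup>2" using cstar_identity[of "U z"] cstar_identity[of b] Uc c by simp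
    then show ?thesis using norm_nonneg Uc c by simp
  qed
  have "h \<otimes> b = (1/2) \<odot> (U \<i> \<oplus> U (- \<i>))"
    unfolding U_def using c by (intro vec_eqI) (simp_all add: functional_simps field_simps)
  then have "nrm A (h \<otimes> b) \<le> (1/2) * (nrm A b + nrm A b)"
    using norm_triangle[of "U \<i>" "U (- \<i>)"] U[of \<i>] U[of "- \<i>"] Uc by (simp add: norm_scale)
  then show "nrm A (h \<otimes> b) \<le> nrm A b" by simp
  have "b \<ominus> g \<otimes> b = (1 / (2 * \<i>)) \<odot> (U \<i> \<ominus> U (- \<i>))"
    unfolding U_def using c by (intro vec_eqI) (simp_all add: functional_simps field_simps)
  then have "nrm A (b \<ominus> g \<otimes> b) \<le> (1/2) * (nrm A b + nrm A b)"
    using N_vdiff_le[of "U \<i>" "U (- \<i>)"] U[of \<i>] U[of "- \<i>"] Uc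
    by (simp add: norm_scale norm_mult norm_divide)
  then show "nrm A (b \<ominus> g \<otimes> b) \<le> nrm A b" by simp
qed

text \<open>There is a self-adjoint \<open>g\<close> with \<open>(1 - g)\<^sup>2 = 1 - h\<^sup>2\<close>, and \<open>1 - g\<close> is a contraction.\<close>

lemma contractive_complement_square:
  assumes h: "h \<in> carrier A" "adj A h = h" "nrm A h \<le> 1" and b: "b \<in> carrier A"
  shows "nrm A (b \<ominus> h \<otimes> (h \<otimes> b)) \<le> nrm A b"
proof -
  have "nrm A (h \<otimes> h) \<le> 1"
    using norm_mult[OF h(1,1)] h norm_nonneg[OF h(1)] by (metis mult_le_one order_trans)
  then obtain g where g: "g \<in> carrier A" "h \<otimes> h \<oplus> g \<otimes> g = 2 \<odot> g" "adj A g = g"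
    "g \<otimes> h = h \<otimes> g"
    using quadratic_solution_selfadjoint[of "h \<otimes> h"] h by (metis adj_mult mult_assoc mult_closed)
  have "b \<ominus> h \<otimes> (h \<otimes> b) = b \<ominus> (h \<otimes> h) \<otimes> b" using h b by (simp add: mult_assoc)
  also have "h \<otimes> h = 2 \<odot> g \<ominus> g \<otimes> g"
    using h g(1) by (simp add: g(2)[symmetric]) (intro vec_eqI, simp_all add: functional_simps)
  also have "b \<ominus> (2 \<odot> g \<ominus> g \<otimes> g) \<otimes> b = (b \<ominus> g \<otimes> b) \<ominus> g \<otimes> (b \<ominus> g \<otimes> b)"
    using b g(1) by (intro vec_eqI) (simp_all add: expand_simps functional_simps)
  finally have eq: "b \<ominus> h \<otimes> (h \<otimes> b) = (b \<ominus> g \<otimes> b) \<ominus> g \<otimes> (b \<ominus> g \<otimes> b)" .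
  have "b \<ominus> g \<otimes> b \<in> carrier A" using b g(1) by simp
  then show ?thesis
    unfolding eq using unitary_parts_contractive(2)[OF h(1) g(1) _ h(2) g(3,4,2)] b by (blast intro: order_trans)
qed

end

lemma star_homD:
  assumes "star_hom A B f"
  shows "linear_map A B f" "\<And>x. x \<in> carrier A \<Longrightarrow> f x \<in> carrier B"
    and "\<And>x y. \<lbrakk>x \<in> carrier A; y \<in> carrier A\<rbrakk> \<Longrightarrow> f (x \<oplus>\<^bsub>A\<^esub> y) = f x \<oplus>\<^bsub>B\<^esub> f y"
    and "\<And>c x. x \<in> carrier A \<Longrightarrow> f (c \<odot>\<^bsub>A\<^esub> x) = c \<odot>\<^bsub>B\<^esub> f x"
    and "\<And>x y. \<lbrakk>x \<in> carrier A; y \<in> carrier A\<rbrakk> \<Longrightarrow> f (x \<otimes>\<^bsub>A\<^esub> y) = f x \<otimes>\<^bsub>B\<^esub> f y"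
    and "\<And>x. x \<in> carrier A \<Longrightarrow> f (adj A x) = adj B (f x)"
  using assms unfolding star_hom_def by (auto dest: linear_mapD)

text \<open>Homomorphisms are contractive: the equation \<open>h\<^sup>2 + (1 - g)\<^sup>2 = 1\<close>, which forces
  \<open>\<parallel>h\<parallel> \<le> 1\<close>, is algebraic and hence survives any homomorphism.\<close>

lemma star_hom_norm_le:
  assumes "cstar_algebra A" "cstar_algebra B" "star_hom A B f" "x \<in> carrier A"
  shows "nrm B (f x) \<le> nrm A x"
proof -
  interpret A: cstar_algebra A by fact
  interpret B: cstar_algebra B by fact
  note f = star_homD[OF assms(3)]
  have unit: "nrm B (f h) \<le> 1" if h: "h \<in> carrier A" "adj A h = h" "nrm A h \<le> 1" for h
  proof -
    have "nrm A (h \<otimes>\<^bsub>A\<^esub> h) \<le> 1"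
      using A.norm_mult[OF h(1,1)] h A.norm_nonneg[OF h(1)] by (metis mult_le_one order_trans)
    then obtain g where g: "g \<in> carrier A" "(h \<otimes>\<^bsub>A\<^esub> h) \<oplus>\<^bsub>A\<^esub> (g \<otimes>\<^bsub>A\<^esub> g) = 2 \<odot>\<^bsub>A\<^esub> g"
      "adj A g = g" "g \<otimes>\<^bsub>A\<^esub> h = h \<otimes>\<^bsub>A\<^esub> g"
      using A.quadratic_solution_selfadjoint[of "h \<otimes>\<^bsub>A\<^esub> h"] h
      by (metis A.adj_mult A.mult_assoc A.mult_closed)
    have "nrm B (f h \<otimes>\<^bsub>B\<^esub> f h) \<le> nrm B (f h)"
    proof (rule B.unitary_parts_contractive(1))
      show "f g \<otimes>\<^bsub>B\<^esub> f h = f h \<otimes>\<^bsub>B\<^esub> f g" using f(5) g(1,4) h(1) by metis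
      have "f ((h \<otimes>\<^bsub>A\<^esub> h) \<oplus>\<^bsub>A\<^esub> (g \<otimes>\<^bsub>A\<^esub> g)) = f (2 \<odot>\<^bsub>A\<^esub> g)" using g by simp
      then show "(f h \<otimes>\<^bsub>B\<^esub> f h) \<oplus>\<^bsub>B\<^esub> (f g \<otimes>\<^bsub>B\<^esub> f g) = 2 \<odot>\<^bsub>B\<^esub> f g"
        using f g(1) h(1) by simp
    qed (use f g h in \<open>auto simp: f(6)[symmetric]\<close>)
    moreover have "nrm B (f h \<otimes>\<^bsub>B\<^esub> f h) = (nrm B (f h))\<^sup>2"
      using B.cstar_identity[of "f h"] f h by (metis (full_types))
    ultimately have "nrm B (f h) * nrm B (f h) \<le> 1 * nrm B (f h)" by (simp add: power2_eq_square)
    then show ?thesis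
      using B.norm_nonneg[of "f h"] f(2)[OF h(1)] by (cases "nrm B (f h) = 0") auto
  qed
  show ?thesis
  proof (cases "nrm A x = 0")
    case True
    then have "x = \<zero>\<^bsub>A\<^esub>" using assms(4) A.norm_eq_zero by simp
    then have "f x = \<zero>\<^bsub>B\<^esub>"
      using A.linear_map_zero B.complex_vector_space_axioms f(1) by blast
    then show ?thesis using True B.N_zero by simp
  next
    case False
    define r where "r = (nrm A x)\<^sup>2"
    have r: "r > 0" using False by (simp add: r_def)
    let ?h = "of_real (1 / r) \<odot>\<^bsub>A\<^esub> (adj A x \<otimes>\<^bsub>A\<^esub> x)"
    have "nrm B (f ?h) \<le> 1"
      using assms(4) r by (intro unit) (simp_all add: A.expand_simps A.norm_scale A.cstar_identity r_def norm_divide norm_power)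
    moreover have "f ?h = of_real (1 / r) \<odot>\<^bsub>B\<^esub> (adj B (f x) \<otimes>\<^bsub>B\<^esub> f x)"
      using f assms(4) by simp
    moreover have "nrm B \<dots> = (1 / r) * (nrm B (f x))\<^sup>2"
      using f(2)[OF assms(4)] r by (simp add: B.norm_scale B.cstar_identity norm_divide)
    ultimately have "(nrm B (f x))\<^sup>2 \<le> r" using r by (simp add: pos_divide_le_eq)
    then show ?thesis using A.norm_nonneg[OF assms(4)] by (simp add: r_def power2_le_iff_abs_le)
  qed
qed

section \<open>Hilbert modules and their adjointable operators\<close>

lemma (in carrier_normed_space) mcompleteI:
  assumes "\<And>xs :: nat \<Rightarrow> 'a. \<lbrakk>\<And>n. xs n \<in> carrier V; \<And>e. e > 0 \<Longrightarrow> \<exists>M. \<forall>m\<ge>M. \<forall>n\<ge>M. N (xs m \<ominus> xs n) < e\<rbrakk>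
    \<Longrightarrow> \<exists>l\<in>carrier V. \<forall>e>0. \<exists>M. \<forall>n\<ge>M. N (xs n \<ominus> l) \<le> e"
  shows "metric.mcomplete"
  unfolding metric.mcomplete_def
proof (intro allI impI)
  fix xs assume c: "metric.MCauchy xs"
  then have s: "\<And>n. xs n \<in> carrier V" unfolding metric.MCauchy_def by blast
  have "\<exists>M. \<forall>m\<ge>M. \<forall>n\<ge>M. N (xs m \<ominus> xs n) < e" if e: "e > 0" for e
  proof -
    obtain M where "\<forall>n n'. M \<le> n \<longrightarrow> M \<le> n' \<longrightarrow> norm_dist V N (xs n) (xs n') < e"
      using c e unfolding metric.MCauchy_def by blast
    then show ?thesis using s by (intro exI[of _ M]) (simp add: norm_dist_def)
  qed
  then have "\<exists>l\<in>carrier V. \<forall>e>0. \<exists>M. \<forall>n\<ge>M. N (xs n \<ominus> l) \<le> e" by (rule assms[OF s])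
  then obtain l where l: "l \<in> carrier V" "\<forall>e>0. \<exists>M. \<forall>n\<ge>M. N (xs n \<ominus> l) \<le> e" by blast
  have "\<exists>M. \<forall>n\<ge>M. N (xs n \<ominus> l) < e" if "e > 0" for e
    using l(2) dense[OF that] by (meson le_less_trans)
  then show "\<exists>x. limitin metric.mtopology xs x sequentially"
    using l(1) s by (intro exI[of _ l]) (simp add: metric.limitin_metric eventually_sequentially norm_dist_def)
qed

sublocale right_hilbert_module \<subseteq> base: cstar_algebra A
  by (rule base)

context right_hilbert_module
begin

declare ract_closed [simp, intro] ip_closed [simp, intro]

abbreviation "MN \<equiv> module_norm A X"

lemma ip_add_left: "\<lbrakk>x \<in> carrier X; y \<in> carrier X; z \<in> carrier X\<rbrakk> \<Longrightarrow>
    ip X (x \<oplus>\<^bsub>X\<^esub> y) z = ip X x z \<oplus>\<^bsub>A\<^esub> ip X y z"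
  by (metis add_closed base.adj_add ip_add ip_adj ip_closed)

lemma ip_scale_left: "\<lbrakk>x \<in> carrier X; y \<in> carrier X\<rbrakk> \<Longrightarrow>
    ip X (c \<odot>\<^bsub>X\<^esub> x) y = cnj c \<odot>\<^bsub>A\<^esub> ip X x y"
  by (metis scale_closed base.adj_scale ip_scale ip_adj ip_closed)

lemma ip_ract_left: "\<lbrakk>x \<in> carrier X; y \<in> carrier X; a \<in> carrier A\<rbrakk> \<Longrightarrow>
    ip X (ract X x a) y = adj A a \<otimes>\<^bsub>A\<^esub> ip X x y"
  by (metis ract_closed base.adj_mult ip_ract ip_adj ip_closed)

lemma ip_vdiff: "\<lbrakk>x \<in> carrier X; y \<in> carrier X; z \<in> carrier X\<rbrakk> \<Longrightarrow>
    ip X x (y \<ominus>\<^bsub>X\<^esub> z) = ip X x y \<ominus>\<^bsub>A\<^esub> ip X x z"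
  by (simp add: vdiff_def ip_add ip_scale)

lemma ip_vdiff_left: "\<lbrakk>x \<in> carrier X; y \<in> carrier X; z \<in> carrier X\<rbrakk> \<Longrightarrow>
    ip X (x \<ominus>\<^bsub>X\<^esub> y) z = ip X x z \<ominus>\<^bsub>A\<^esub> ip X y z"
  by (simp add: vdiff_def ip_add_left ip_scale_left)

lemma ip_zero: "x \<in> carrier X \<Longrightarrow> ip X x \<zero>\<^bsub>X\<^esub> = \<zero>\<^bsub>A\<^esub>"
  by (metis base.scale_0 ip_closed ip_scale scale_0 zero_closed)

lemma ip_zero_left: "x \<in> carrier X \<Longrightarrow> ip X \<zero>\<^bsub>X\<^esub> x = \<zero>\<^bsub>A\<^esub>"
  by (metis base.adj_zero ip_adj ip_zero zero_closed)

lemmas ip_simps = ip_add ip_scale ip_ract ip_add_left ip_scale_left ip_ract_left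
  ip_vdiff ip_vdiff_left ip_zero ip_zero_left

lemma ip_eqI:
  assumes "x \<in> carrier X" "y \<in> carrier X" "\<And>z. z \<in> carrier X \<Longrightarrow> ip X z x = ip X z y"
  shows "x = y"
proof -
  have "ip X (x \<ominus>\<^bsub>X\<^esub> y) (x \<ominus>\<^bsub>X\<^esub> y) = \<zero>\<^bsub>A\<^esub>"
    using assms(1,2) assms(3)[of "x \<ominus>\<^bsub>X\<^esub> y"] by (simp add: ip_vdiff base.vdiff_self)
  then have "x \<ominus>\<^bsub>X\<^esub> y = \<zero>\<^bsub>X\<^esub>" using ip_definite assms(1,2) by blast
  then show ?thesis using assms(1,2) vdiff_eq_zero by blast
qed

lemma MN_square: "x \<in> carrier X \<Longrightarrow> (MN x)\<^sup>2 = nrm A (ip X x x)"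
  by (simp add: module_norm_def base.norm_nonneg)

lemma MN_nonneg: "x \<in> carrier X \<Longrightarrow> 0 \<le> MN x"
  by (simp add: module_norm_def base.norm_nonneg)

lemma MN_le_iff: "x \<in> carrier X \<Longrightarrow> 0 \<le> r \<Longrightarrow> MN x \<le> r \<longleftrightarrow> nrm A (ip X x x) \<le> r\<^sup>2"
  by (metis MN_nonneg MN_square abs_of_nonneg abs_le_square_iff)

end

text \<open>The Cauchy--Schwarz inequality is kept as a separate assumption: it is immediate for a
  C*-algebra as a module over itself, while for a general module its proof uses positivity in the
  multiplier algebra, which is constructed from that special case.\<close>

locale cauchy_schwarz_module = right_hilbert_module +
  assumes cauchy_schwarz: "\<lbrakk>x \<in> carrier X; y \<in> carrier X\<rbrakk> \<Longrightarrow>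
    nrm A (ip X x y) \<le> module_norm A X x * module_norm A X y"

sublocale cauchy_schwarz_module \<subseteq> carrier_normed_space X "module_norm A X"
proof
  show "0 \<le> MN x" if "x \<in> carrier X" for x using that by (rule MN_nonneg)
  show "(MN x = 0) = (x = \<zero>\<^bsub>X\<^esub>)" if "x \<in> carrier X" for x
    using that ip_definite by (auto simp: module_norm_def base.norm_eq_zero ip_zero)
  show "MN (x \<oplus>\<^bsub>X\<^esub> y) \<le> MN x + MN y" if xy: "x \<in> carrier X" "y \<in> carrier X" for x y
  proof -
    have "ip X (x \<oplus>\<^bsub>X\<^esub> y) (x \<oplus>\<^bsub>X\<^esub> y) = (ip X x x \<oplus>\<^bsub>A\<^esub> ip X x y) \<oplus>\<^bsub>A\<^esub> (ip X y x \<oplus>\<^bsub>A\<^esub> ip X y y)"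
      using xy by (intro base.vec_eqI) (simp_all add: ip_simps base.functional_simps)
    then have "nrm A (ip X (x \<oplus>\<^bsub>X\<^esub> y) (x \<oplus>\<^bsub>X\<^esub> y))
      \<le> (nrm A (ip X x x) + nrm A (ip X x y)) + (nrm A (ip X y x) + nrm A (ip X y y))"
      using base.norm_triangle[of "ip X x x \<oplus>\<^bsub>A\<^esub> ip X x y" "ip X y x \<oplus>\<^bsub>A\<^esub> ip X y y"]
        base.norm_triangle[of "ip X x x" "ip X x y"] base.norm_triangle[of "ip X y x" "ip X y y"] xy
      by simp
    also have "\<dots> \<le> (MN x + MN y)\<^sup>2"
      using cauchy_schwarz[OF xy] cauchy_schwarz[OF xy(2,1)] xy
      by (simp add: MN_square[symmetric] power2_eq_square algebra_simps)
    finally show ?thesis using xy MN_nonneg by (simp add: MN_le_iff)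
  qed
  show "MN (c \<odot>\<^bsub>X\<^esub> x) = cmod c * MN x" if "x \<in> carrier X" for c x
  proof -
    have "nrm A (ip X (c \<odot>\<^bsub>X\<^esub> x) (c \<odot>\<^bsub>X\<^esub> x)) = (cmod c)\<^sup>2 * nrm A (ip X x x)"
      using that by (simp add: ip_simps base.scale_scale base.norm_scale norm_mult power2_eq_square)
    then show ?thesis by (simp add: module_norm_def real_sqrt_mult)
  qed
qed

context cauchy_schwarz_module
begin

lemma MN_le_by_ip:
  assumes "x \<in> carrier X" "0 \<le> K" "\<And>y. y \<in> carrier X \<Longrightarrow> nrm A (ip X y x) \<le> K * MN y"
  shows "MN x \<le> K"
proof (cases "MN x = 0")
  case False
  then have "0 < MN x" using N_nonneg[OF assms(1)] by simp
  moreover have "MN x * MN x \<le> K * MN x"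
    using assms(3)[OF assms(1)] MN_square[OF assms(1)] by (simp add: power2_eq_square)
  ultimately show ?thesis by simp
qed (simp add: assms)

lemma is_adjointD:
  assumes "is_adjoint X R R'" "x \<in> carrier X" "y \<in> carrier X"
  shows "ip X (R x) y = ip X x (R' y)" "R' y \<in> carrier X"
  using assms unfolding is_adjoint_def by auto

lemma is_adjoint_sym:
  assumes "is_adjoint X R R'" "R \<in> carrier X \<rightarrow> carrier X"
  shows "is_adjoint X R' R"
  unfolding is_adjoint_def
proof (intro conjI ballI)
  fix x y assume xy: "x \<in> carrier X" "y \<in> carrier X"
  have "adj A (ip X (R y) x) = adj A (ip X y (R' x))" using is_adjointD[OF assms(1)] xy by simp
  then show "ip X (R' x) y = ip X x (R y)"
    using xy is_adjointD(2)[OF assms(1)] assms(2) ip_adj by (metis PiE)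
qed (rule assms)

lemma adjointable_linear:
  assumes "is_adjoint X R R'" "R \<in> carrier X \<rightarrow> carrier X"
  shows "\<lbrakk>x \<in> carrier X; y \<in> carrier X\<rbrakk> \<Longrightarrow> R (x \<oplus>\<^bsub>X\<^esub> y) = R x \<oplus>\<^bsub>X\<^esub> R y"
    and "x \<in> carrier X \<Longrightarrow> R (c \<odot>\<^bsub>X\<^esub> x) = c \<odot>\<^bsub>X\<^esub> R x"
    and "\<lbrakk>x \<in> carrier X; a \<in> carrier A\<rbrakk> \<Longrightarrow> R (ract X x a) = ract X (R x) a"
proof -
  have R: "\<And>x. x \<in> carrier X \<Longrightarrow> R x \<in> carrier X" using assms(2) by blast
  note sym = is_adjointD(1)[OF is_adjoint_sym[OF assms], symmetric]
  have R': "\<And>x. x \<in> carrier X \<Longrightarrow> R' x \<in> carrier X" using is_adjointD(2)[OF assms(1)] .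
  show "R (x \<oplus>\<^bsub>X\<^esub> y) = R x \<oplus>\<^bsub>X\<^esub> R y" if "x \<in> carrier X" "y \<in> carrier X"
    using that by (intro ip_eqI) (simp_all add: sym R R' ip_simps)
  show "R (c \<odot>\<^bsub>X\<^esub> x) = c \<odot>\<^bsub>X\<^esub> R x" if "x \<in> carrier X"
    using that by (intro ip_eqI) (simp_all add: sym R R' ip_simps)
  show "R (ract X x a) = ract X (R x) a" if "x \<in> carrier X" "a \<in> carrier A"
    using that by (intro ip_eqI) (simp_all add: sym R R' ip_simps)
qed

text \<open>Adjointable maps are bounded: the sets \<open>{y. \<parallel>R y\<parallel> \<le> n}\<close> are closed because
  \<open>\<parallel>R y\<parallel>\<close> is a supremum of the continuous functions \<open>\<parallel>\<langle>R' x, y\<rangle>\<parallel>\<close>, and by Baire's theorem one of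
  them contains a ball.\<close>

lemma adjointable_bounded:
  assumes "is_adjoint X R R'" "R \<in> carrier X \<rightarrow> carrier X"
  shows "\<exists>K\<ge>0. \<forall>x\<in>carrier X. MN (R x) \<le> K * MN x"
proof -
  have R: "\<And>x. x \<in> carrier X \<Longrightarrow> R x \<in> carrier X" using assms(2) by blast
  have R': "\<And>x. x \<in> carrier X \<Longrightarrow> R' x \<in> carrier X" using is_adjointD(2)[OF assms(1)] .
  note lin = adjointable_linear[OF assms]
  have Rdiff: "R (x \<ominus>\<^bsub>X\<^esub> y) = R x \<ominus>\<^bsub>X\<^esub> R y" if "x \<in> carrier X" "y \<in> carrier X" for x y
    using that by (simp add: vdiff_def lin)
  define C where "C = (\<lambda>n::nat. {y \<in> carrier X. MN (R y) \<le> real n})"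
  have closed: "closedin (norm_topology X MN) (C n)" for n
    unfolding closedin_norm_iff
  proof (intro conjI ballI impI)
    fix y assume y: "y \<in> carrier X" and ap: "\<forall>e>0. \<exists>w\<in>C n. MN (y \<ominus>\<^bsub>X\<^esub> w) < e"
    have "MN (R y) \<le> real n"
    proof (rule MN_le_by_ip)
      fix x assume x: "x \<in> carrier X"
      have le: "nrm A (ip X x (R y)) \<le> MN x * real n + MN (R' x) * e" if e: "e > 0" for e
      proof -
        obtain w where w: "w \<in> carrier X" "MN (R w) \<le> real n" "MN (y \<ominus>\<^bsub>X\<^esub> w) < e"
          using ap e unfolding C_def by blast
        have yw: "y = w \<oplus>\<^bsub>X\<^esub> (y \<ominus>\<^bsub>X\<^esub> w)" using y w(1) by (intro vec_eqI) (simp_all add: functional_simps)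
        have "ip X x (R y) = ip X x (R w) \<oplus>\<^bsub>A\<^esub> ip X x (R (y \<ominus>\<^bsub>X\<^esub> w))"
          using x y w(1) lin(1)[of w "y \<ominus>\<^bsub>X\<^esub> w"] yw by (simp add: R ip_add)
        also have "ip X x (R (y \<ominus>\<^bsub>X\<^esub> w)) = ip X (R' x) (y \<ominus>\<^bsub>X\<^esub> w)"
          using is_adjointD(1)[OF is_adjoint_sym[OF assms]] x y w(1) by simp
        finally have "nrm A (ip X x (R y)) \<le> nrm A (ip X x (R w)) + nrm A (ip X (R' x) (y \<ominus>\<^bsub>X\<^esub> w))"
          using base.norm_triangle x y w(1) R R' by simp
        also have "\<dots> \<le> MN x * MN (R w) + MN (R' x) * MN (y \<ominus>\<^bsub>X\<^esub> w)"
          using x y w(1) R R' by (intro add_mono cauchy_schwarz) auto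
        also have "\<dots> \<le> MN x * real n + MN (R' x) * e"
          using x w R' N_nonneg by (intro add_mono mult_left_mono) auto
        finally show ?thesis .
      qed
      have "((\<lambda>e. MN x * real n + MN (R' x) * e) \<longlongrightarrow> MN x * real n + MN (R' x) * 0) (at_right 0)"
        by (intro tendsto_intros)
      then have "nrm A (ip X x (R y)) \<le> MN x * real n + MN (R' x) * 0"
        by (rule tendsto_lowerbound) (use le in \<open>auto simp: eventually_at_right_less intro: eventually_mono[OF eventually_at_right_less]\<close>)
      then show "nrm A (ip X x (R y)) \<le> real n * MN x" by (simp add: mult.commute)
    qed (use R y in auto)
    then show "y \<in> C n" using y by (simp add: C_def)
  qed (auto simp: C_def)
  have "\<exists>n. norm_topology X MN interior_of C n \<noteq> {}"
  proof (rule ccontr)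
    assume "\<not> ?thesis"
    then have "metric.mtopology interior_of \<Union>(range C) = {}"
      using closed complete unfolding norm_topology_def
      by (intro metric.metric_Baire_category_alt) auto
    moreover have "\<Union>(range C) = carrier X"
    proof -
      have "\<exists>n. MN (R y) \<le> real n" for y by (rule real_arch_simple)
      then show ?thesis by (auto simp: C_def)
    qed
    ultimately show False using zero_closed by (metis empty_iff interior_of_topspace metric.topspace_mtopology)
  qed
  then obtain n y where "y \<in> metric.mtopology interior_of C n" unfolding norm_topology_def by blast
  then obtain r where y: "y \<in> carrier X" and r: "r > 0" "metric.mball y r \<subseteq> C n"
    unfolding metric.metric_interior_of by blast
  have small: "MN (R x) \<le> 2 * real n" if x: "x \<in> carrier X" "MN x < r" for x
  proof -
    have "y \<oplus>\<^bsub>X\<^esub> x \<in> metric.mball y r"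
    proof -
      have "y \<ominus>\<^bsub>X\<^esub> (y \<oplus>\<^bsub>X\<^esub> x) = (-1) \<odot>\<^bsub>X\<^esub> x" using x y by (intro vec_eqI) (simp_all add: functional_simps)
      then show ?thesis using x y by (simp add: norm_dist_def N_scale)
    qed
    moreover have "y \<in> metric.mball y r" using y r by simp
    ultimately have "MN (R (y \<oplus>\<^bsub>X\<^esub> x)) \<le> real n" "MN (R y) \<le> real n" using r(2) unfolding C_def by blast+
    moreover have "R x = R (y \<oplus>\<^bsub>X\<^esub> x) \<ominus>\<^bsub>X\<^esub> R y"
      using x y R by (simp add: lin) (intro vec_eqI, simp_all add: functional_simps)
    ultimately show ?thesis using N_vdiff_le[of "R (y \<oplus>\<^bsub>X\<^esub> x)" "R y"] x y R by simp
  qed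
  have "MN (R x) \<le> (4 * real n / r) * MN x" if x: "x \<in> carrier X" for x
  proof (cases "MN x = 0")
    case True
    then have "x = \<zero>\<^bsub>X\<^esub>" using x N_eq_zero by simp
    moreover have "R \<zero>\<^bsub>X\<^esub> = \<zero>\<^bsub>X\<^esub>" using Rdiff[of "\<zero>\<^bsub>X\<^esub>" "\<zero>\<^bsub>X\<^esub>"] R by (simp add: vdiff_self)
    ultimately show ?thesis using N_zero by simp
  next
    case False
    then have pos: "0 < MN x" using N_nonneg[OF x] by simp
    let ?c = "of_real (r / (2 * MN x))"
    have "MN (R (?c \<odot>\<^bsub>X\<^esub> x)) \<le> 2 * real n"
      using x pos r by (intro small) (simp_all add: N_scale norm_divide norm_mult)
    then have "r / (2 * MN x) * MN (R x) \<le> 2 * real n"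
      using x pos r R by (simp add: lin N_scale norm_divide norm_mult)
    then show ?thesis using pos r by (simp add: field_simps)
  qed
  then show ?thesis using r by (intro exI[of _ "4 * real n / r"]) auto
qed

abbreviation "L \<equiv> adjointables A X"

lemma adjointables_iff:
  "R \<in> carrier L \<longleftrightarrow> R \<in> extensional (carrier X) \<and> R \<in> carrier X \<rightarrow> carrier X \<and> (\<exists>R'. is_adjoint X R R')"
  by (auto simp: adjointables_def PiE_def)

lemma adjointables_ops:
  "\<zero>\<^bsub>L\<^esub> = (\<lambda>x\<in>carrier X. \<zero>\<^bsub>X\<^esub>)" "R \<oplus>\<^bsub>L\<^esub> S = (\<lambda>x\<in>carrier X. R x \<oplus>\<^bsub>X\<^esub> S x)"
  "c \<odot>\<^bsub>L\<^esub> R = (\<lambda>x\<in>carrier X. c \<odot>\<^bsub>X\<^esub> R x)" "R \<otimes>\<^bsub>L\<^esub> S = (\<lambda>x\<in>carrier X. R (S x))"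
  "nrm L R = operator_norm X MN R"
  by (simp_all add: adjointables_def)

lemma adjointables_closed: "\<lbrakk>R \<in> carrier L; x \<in> carrier X\<rbrakk> \<Longrightarrow> R x \<in> carrier X"
  by (auto simp: adjointables_iff)

lemma adjointables_eqI:
  "\<lbrakk>R \<in> carrier L; S \<in> carrier L; \<And>x. x \<in> carrier X \<Longrightarrow> R x = S x\<rbrakk> \<Longrightarrow> R = S"
  by (rule extensionalityI[of _ "carrier X"]) (auto simp: adjointables_iff)

lemma adjointables_linear:
  assumes "R \<in> carrier L"
  shows "\<lbrakk>x \<in> carrier X; y \<in> carrier X\<rbrakk> \<Longrightarrow> R (x \<oplus>\<^bsub>X\<^esub> y) = R x \<oplus>\<^bsub>X\<^esub> R y"
    and "x \<in> carrier X \<Longrightarrow> R (c \<odot>\<^bsub>X\<^esub> x) = c \<odot>\<^bsub>X\<^esub> R x"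
    and "\<lbrakk>x \<in> carrier X; a \<in> carrier A\<rbrakk> \<Longrightarrow> R (ract X x a) = ract X (R x) a"
    and "\<lbrakk>x \<in> carrier X; y \<in> carrier X\<rbrakk> \<Longrightarrow> R (x \<ominus>\<^bsub>X\<^esub> y) = R x \<ominus>\<^bsub>X\<^esub> R y"
  using assms adjointable_linear unfolding adjointables_iff vdiff_def by (metis scale_closed)+

lemma adjointablesI:
  assumes "R \<in> extensional (carrier X)" "\<And>x. x \<in> carrier X \<Longrightarrow> R x \<in> carrier X"
    "\<And>x. x \<in> carrier X \<Longrightarrow> S x \<in> carrier X"
    "\<And>x y. \<lbrakk>x \<in> carrier X; y \<in> carrier X\<rbrakk> \<Longrightarrow> ip X (R x) y = ip X x (S y)"
  shows "R \<in> carrier L"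
proof -
  have "is_adjoint X R S" unfolding is_adjoint_def using assms(3,4) by simp
  then show ?thesis unfolding adjointables_iff using assms(1,2) by (intro conjI exI[of _ S]) auto
qed

lemma adjointables_adj:
  assumes "R \<in> carrier L"
  shows "adj L R \<in> carrier L" "\<lbrakk>x \<in> carrier X; y \<in> carrier X\<rbrakk> \<Longrightarrow> ip X (R x) y = ip X x (adj L R y)"
proof -
  obtain R' where R': "is_adjoint X R R'" and R: "R \<in> carrier X \<rightarrow> carrier X"
    using assms unfolding adjointables_iff by blast
  let ?S = "restrict R' (carrier X)"
  have S: "is_adjoint X R ?S" using R' unfolding is_adjoint_def by auto
  have "adj L R = (THE R'. R' \<in> extensional (carrier X) \<and> is_adjoint X R R')" by (simp add: adjointables_def)
  also have "\<dots> = ?S"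
  proof (rule the_equality)
    fix U assume U: "U \<in> extensional (carrier X) \<and> is_adjoint X R U"
    show "U = ?S"
    proof (rule extensionalityI[of _ "carrier X"])
      fix x assume x: "x \<in> carrier X"
      show "U x = ?S x"
        by (rule ip_eqI) (use x U S is_adjointD[of R U] is_adjointD[of R ?S] in \<open>auto simp del: restrict_apply\<close>)
    qed (use U in auto)
  qed (use S in auto)
  finally have eq: "adj L R = ?S" .
  show "adj L R \<in> carrier L"
    unfolding eq
  proof (rule adjointablesI[where S = R])
    show "ip X (?S x) y = ip X x (R y)" if "x \<in> carrier X" "y \<in> carrier X" for x y
      using is_adjointD(1)[OF is_adjoint_sym[OF S R] that] .
  qed (use R is_adjointD(2)[OF R'] in auto)
  show "ip X (R x) y = ip X x (adj L R y)" if "x \<in> carrier X" "y \<in> carrier X"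
    unfolding eq using is_adjointD(1)[OF S that] .
qed

lemma adjointables_adj':
  "\<lbrakk>R \<in> carrier L; x \<in> carrier X; y \<in> carrier X\<rbrakk> \<Longrightarrow> ip X (adj L R x) y = ip X x (R y)"
  using adjointables_adj(2)[of R y x] ip_adj adjointables_adj(1) adjointables_closed by metis

lemma adj_adjointables_eqI:
  assumes "R \<in> carrier L" "S \<in> carrier L"
    "\<And>x y. \<lbrakk>x \<in> carrier X; y \<in> carrier X\<rbrakk> \<Longrightarrow> ip X (R x) y = ip X x (S y)"
  shows "adj L R = S"
proof (rule adjointables_eqI)
  fix x assume x: "x \<in> carrier X"
  show "adj L R x = S x"
    using x assms adjointables_adj(2)[OF assms(1)]
    by (intro ip_eqI) (auto intro: adjointables_closed adjointables_adj)
qed (use assms adjointables_adj in auto)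

lemma opnorm_le:
  assumes "0 \<le> K" "\<And>x. x \<in> carrier X \<Longrightarrow> MN (R x) \<le> K * MN x"
  shows "operator_norm X MN R \<le> K"
  unfolding operator_norm_def
proof (rule cSUP_least)
  show "{x \<in> carrier X. MN x \<le> 1} \<noteq> {}" using N_zero zero_closed by (metis (mono_tags, lifting) empty_iff mem_Collect_eq zero_le_one)
  show "MN (R x) \<le> K" if "x \<in> {x \<in> carrier X. MN x \<le> 1}" for x
    using assms(2)[of x] that mult_left_mono[of "MN x" 1 K] assms(1) by simp
qed

lemma opnorm_bound:
  assumes "R \<in> carrier L" "x \<in> carrier X"
  shows "MN (R x) \<le> nrm L R * MN x"
proof (cases "MN x = 0")
  case True
  then have "x = \<zero>\<^bsub>X\<^esub>" using assms(2) N_eq_zero by simp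
  moreover have "R \<zero>\<^bsub>X\<^esub> = \<zero>\<^bsub>X\<^esub>"
    using adjointables_linear(4)[OF assms(1), of "\<zero>\<^bsub>X\<^esub>" "\<zero>\<^bsub>X\<^esub>"] adjointables_closed[OF assms(1)]
    by (simp add: vdiff_self)
  ultimately show ?thesis using N_zero by simp
next
  case False
  then have pos: "0 < MN x" using N_nonneg[OF assms(2)] by simp
  obtain K where K: "K \<ge> 0" "\<And>x. x \<in> carrier X \<Longrightarrow> MN (R x) \<le> K * MN x"
    using adjointable_bounded assms(1) unfolding adjointables_iff by blast
  have "bdd_above ((\<lambda>x. MN (R x)) ` {x \<in> carrier X. MN x \<le> 1})"
    using K mult_left_mono[of _ 1 K] by (intro bdd_aboveI2[of _ _ K]) force
  moreover let ?y = "of_real (1 / MN x) \<odot>\<^bsub>X\<^esub> x"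
  have "?y \<in> {x \<in> carrier X. MN x \<le> 1}" using assms(2) pos by (simp add: N_scale norm_divide)
  ultimately have "MN (R ?y) \<le> nrm L R"
    unfolding adjointables_ops operator_norm_def by (rule cSUP_upper[rotated])
  then show ?thesis
    using assms pos adjointables_closed[OF assms] adjointables_linear(2)[OF assms(1)]
    by (simp add: N_scale norm_divide field_simps)
qed

lemma opnorm_nonneg: "R \<in> carrier L \<Longrightarrow> 0 \<le> nrm L R"
proof -
  assume R: "R \<in> carrier L"
  obtain K where K: "K \<ge> 0" "\<And>x. x \<in> carrier X \<Longrightarrow> MN (R x) \<le> K * MN x"
    using adjointable_bounded R unfolding adjointables_iff by blast
  have "bdd_above ((\<lambda>x. MN (R x)) ` {x \<in> carrier X. MN x \<le> 1})"
    using K mult_left_mono[of _ 1 K] by (intro bdd_aboveI2[of _ _ K]) force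
  moreover have "\<zero>\<^bsub>X\<^esub> \<in> {x \<in> carrier X. MN x \<le> 1}" by (simp add: N_zero)
  ultimately have "MN (R \<zero>\<^bsub>X\<^esub>) \<le> nrm L R"
    unfolding adjointables_ops operator_norm_def by (rule cSUP_upper[rotated])
  then show ?thesis using N_nonneg adjointables_closed[OF R] zero_closed by (meson order_trans)
qed

lemma opnorm_le': "\<lbrakk>0 \<le> K; \<And>x. x \<in> carrier X \<Longrightarrow> MN (R x) \<le> K * MN x\<rbrakk> \<Longrightarrow> nrm L R \<le> K"
  by (simp add: adjointables_ops(5) opnorm_le)

lemma opnorm_adj_le:
  assumes "R \<in> carrier L"
  shows "nrm L (adj L R) \<le> nrm L R"
proof (rule opnorm_le')
  fix x assume x: "x \<in> carrier X"
  show "MN (adj L R x) \<le> nrm L R * MN x"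
  proof (rule MN_le_by_ip)
    fix y assume y: "y \<in> carrier X"
    have "nrm A (ip X y (adj L R x)) = nrm A (ip X (R y) x)" using adjointables_adj(2)[OF assms y x] by simp
    also have "\<dots> \<le> MN (R y) * MN x" using adjointables_closed[OF assms y] x by (rule cauchy_schwarz)
    also have "\<dots> \<le> (nrm L R * MN y) * MN x"
      using opnorm_bound[OF assms y] N_nonneg[OF x] by (rule mult_right_mono)
    finally show "nrm A (ip X y (adj L R x)) \<le> nrm L R * MN x * MN y" by (simp add: mult_ac)
  qed (use adjointables_adj(1)[OF assms] adjointables_closed x opnorm_nonneg[OF assms] N_nonneg in auto)
qed (rule opnorm_nonneg[OF assms])


lemma adjointables_ops_closed:
  "\<zero>\<^bsub>L\<^esub> \<in> carrier L"
  "\<lbrakk>R \<in> carrier L; S \<in> carrier L\<rbrakk> \<Longrightarrow> R \<oplus>\<^bsub>L\<^esub> S \<in> carrier L"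
  "R \<in> carrier L \<Longrightarrow> c \<odot>\<^bsub>L\<^esub> R \<in> carrier L"
  "\<lbrakk>R \<in> carrier L; S \<in> carrier L\<rbrakk> \<Longrightarrow> R \<otimes>\<^bsub>L\<^esub> S \<in> carrier L"
proof -
  note simps = adjointables_ops ip_simps adjointables_closed adjointables_adj adjointables_adj'
  show "\<zero>\<^bsub>L\<^esub> \<in> carrier L"
    by (rule adjointablesI[where S = "\<lambda>x. \<zero>\<^bsub>X\<^esub>"]) (simp_all add: simps)
  show "R \<oplus>\<^bsub>L\<^esub> S \<in> carrier L" if "R \<in> carrier L" "S \<in> carrier L"
    by (rule adjointablesI[where S = "\<lambda>x. adj L R x \<oplus>\<^bsub>X\<^esub> adj L S x"]) (use that in \<open>simp_all add: simps\<close>)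
  show "c \<odot>\<^bsub>L\<^esub> R \<in> carrier L" if "R \<in> carrier L"
    by (rule adjointablesI[where S = "\<lambda>x. cnj c \<odot>\<^bsub>X\<^esub> adj L R x"]) (use that in \<open>simp_all add: simps\<close>)
  show "R \<otimes>\<^bsub>L\<^esub> S \<in> carrier L" if "R \<in> carrier L" "S \<in> carrier L"
    by (rule adjointablesI[where S = "\<lambda>x. adj L S (adj L R x)"]) (use that in \<open>simp_all add: simps\<close>)
qed

lemma adjointables_normed_space: "carrier_normed_space L (nrm L)"
proof
  note cl = adjointables_closed and ops = adjointables_ops and closed = adjointables_ops_closed
  show "nrm L (R \<oplus>\<^bsub>L\<^esub> S) \<le> nrm L R + nrm L S" if RS: "R \<in> carrier L" "S \<in> carrier L" for R S
  proof (rule opnorm_le')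
    fix x assume x: "x \<in> carrier X"
    have "MN ((R \<oplus>\<^bsub>L\<^esub> S) x) \<le> MN (R x) + MN (S x)" using RS x by (simp add: ops cl N_triangle)
    also have "\<dots> \<le> nrm L R * MN x + nrm L S * MN x" using RS x by (intro add_mono opnorm_bound)
    finally show "MN ((R \<oplus>\<^bsub>L\<^esub> S) x) \<le> (nrm L R + nrm L S) * MN x" by (simp add: distrib_right)
  qed (use RS opnorm_nonneg in auto)
  have scle: "nrm L (c \<odot>\<^bsub>L\<^esub> R) \<le> cmod c * nrm L R" if R: "R \<in> carrier L" for R c
  proof (rule opnorm_le')
    fix x assume x: "x \<in> carrier X"
    have "MN ((c \<odot>\<^bsub>L\<^esub> R) x) = cmod c * MN (R x)" using R x by (simp add: ops cl N_scale)
    also have "\<dots> \<le> cmod c * (nrm L R * MN x)" using R x by (intro mult_left_mono opnorm_bound) auto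
    finally show "MN ((c \<odot>\<^bsub>L\<^esub> R) x) \<le> (cmod c * nrm L R) * MN x" by (simp add: mult.assoc)
  qed (use R opnorm_nonneg in auto)
  show "nrm L (c \<odot>\<^bsub>L\<^esub> R) = cmod c * nrm L R" if R: "R \<in> carrier L" for R c
  proof (rule antisym)
    show "cmod c * nrm L R \<le> nrm L (c \<odot>\<^bsub>L\<^esub> R)"
    proof (cases "c = 0")
      case False
      have "(1/c) \<odot>\<^bsub>L\<^esub> (c \<odot>\<^bsub>L\<^esub> R) = R"
        using R False by (intro adjointables_eqI closed) (simp_all add: ops cl scale_scale scale_one)
      then have "nrm L R \<le> cmod (1/c) * nrm L (c \<odot>\<^bsub>L\<^esub> R)"
        using scle[OF closed(3)[OF R], of "1/c" c] by simp
      then show ?thesis using False by (simp add: norm_divide field_simps)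
    qed (use opnorm_nonneg[OF closed(3)[OF R]] in simp)
  qed (rule scle[OF R])
  show "nrm L R = 0 \<longleftrightarrow> R = \<zero>\<^bsub>L\<^esub>" if R: "R \<in> carrier L" for R
  proof
    assume "nrm L R = 0"
    show "R = \<zero>\<^bsub>L\<^esub>"
    proof (rule adjointables_eqI[OF R closed(1)])
      fix x assume x: "x \<in> carrier X"
      have "MN (R x) \<le> 0" using opnorm_bound[OF R x] \<open>nrm L R = 0\<close> by simp
      then show "R x = \<zero>\<^bsub>L\<^esub> x"
        using N_nonneg[OF cl[OF R x]] N_eq_zero[OF cl[OF R x]] x by (simp add: ops)
    qed
  next
    assume "R = \<zero>\<^bsub>L\<^esub>"
    then have "nrm L R \<le> 0" by (intro opnorm_le') (simp_all add: ops N_zero)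
    then show "nrm L R = 0" using opnorm_nonneg[OF R] by simp
  qed
qed ((rule adjointables_ops_closed opnorm_nonneg; assumption?) | (intro adjointables_eqI adjointables_ops_closed;
    simp add: adjointables_ops adjointables_closed add_ac add_zero add_neg scale_one scale_scale
      scale_add_left scale_add_right; fail))+

lemma ip_vlim:
  assumes "vlim xs x" "\<And>n. xs n \<in> carrier X" "x \<in> carrier X" "y \<in> carrier X"
  shows "base.vlim (\<lambda>n. ip X y (xs n)) (ip X y x)"
proof (rule base.vlim_I)
  show "(\<lambda>n. MN y * MN (xs n \<ominus>\<^bsub>X\<^esub> x)) \<longlonglongrightarrow> 0"
    using tendsto_mult_left[OF assms(1)[unfolded vlim_def], of "MN y"] by simp
  show "nrm A (ip X y (xs n) \<ominus>\<^bsub>A\<^esub> ip X y x) \<le> MN y * MN (xs n \<ominus>\<^bsub>X\<^esub> x)" for n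
    using cauchy_schwarz[of y "xs n \<ominus>\<^bsub>X\<^esub> x"] assms(2)[of n] assms(3,4) by (simp add: ip_vdiff)
qed (use assms(2-4) in auto)

lemma ip_vlim_left:
  assumes "vlim xs x" "\<And>n. xs n \<in> carrier X" "x \<in> carrier X" "y \<in> carrier X"
  shows "base.vlim (\<lambda>n. ip X (xs n) y) (ip X x y)"
  using base.vlim_adj[OF ip_vlim[OF assms]] assms(2-4) ip_adj by simp

text \<open>For a Cauchy sequence of operators \<open>R\<^sub>n\<close> the limits of \<open>R\<^sub>n x\<close> and of \<open>R\<^sub>n\<^sup>* x\<close> exist, and the two
  limit maps are adjoint to each other.\<close>

lemma adjointables_complete: "Metric_space.mcomplete (carrier L) (norm_dist L (nrm L))"
proof -
  interpret Ln: carrier_normed_space L "nrm L" by (rule adjointables_normed_space)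
  note cl = adjointables_closed
  have diff: "(R \<ominus>\<^bsub>L\<^esub> S) x = R x \<ominus>\<^bsub>X\<^esub> S x" if "x \<in> carrier X" for R S x
    using that by (simp add: vdiff_def adjointables_ops)
  show ?thesis
  proof (rule Ln.mcompleteI)
    fix xs :: "nat \<Rightarrow> 'b \<Rightarrow> 'b"
    assume s: "\<And>n. xs n \<in> carrier L"
      and cauchy: "\<And>e. e > 0 \<Longrightarrow> \<exists>M. \<forall>m\<ge>M. \<forall>n\<ge>M. nrm L (xs m \<ominus>\<^bsub>L\<^esub> xs n) < e"
    have ex: "\<exists>y. y \<in> carrier X \<and> vlim (\<lambda>n. ys n x) y"
      if t: "\<And>n. ys n \<in> carrier L" and x: "x \<in> carrier X"
        and tc: "\<And>m n. nrm L (ys m \<ominus>\<^bsub>L\<^esub> ys n) \<le> nrm L (xs m \<ominus>\<^bsub>L\<^esub> xs n)" for ys x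
    proof -
      have "\<exists>M. \<forall>m\<ge>M. \<forall>n\<ge>M. MN (ys m x \<ominus>\<^bsub>X\<^esub> ys n x) < e" if e: "e > 0" for e
      proof -
        have pos: "0 < MN x + 1" using N_nonneg[OF x] by simp
        then have "0 < e / (MN x + 1)" using e by simp
        then obtain M where M: "\<forall>m\<ge>M. \<forall>n\<ge>M. nrm L (xs m \<ominus>\<^bsub>L\<^esub> xs n) < e / (MN x + 1)"
          using cauchy by blast
        have "MN (ys m x \<ominus>\<^bsub>X\<^esub> ys n x) < e" if "m \<ge> M" "n \<ge> M" for m n
        proof -
          have "MN (ys m x \<ominus>\<^bsub>X\<^esub> ys n x) \<le> nrm L (ys m \<ominus>\<^bsub>L\<^esub> ys n) * MN x"
            using opnorm_bound[OF Ln.vdiff_closed[OF t t] x] diff[OF x] by simp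
          also have "\<dots> \<le> nrm L (xs m \<ominus>\<^bsub>L\<^esub> xs n) * MN x" using tc N_nonneg[OF x] by (rule mult_right_mono)
          also have "\<dots> \<le> nrm L (xs m \<ominus>\<^bsub>L\<^esub> xs n) * (MN x + 1)"
            using Ln.N_nonneg[OF Ln.vdiff_closed[OF s s]] by (intro mult_left_mono) auto
          also have "\<dots> < e" using M that pos by (simp add: pos_less_divide_eq)
          finally show ?thesis .
        qed
        then show ?thesis by blast
      qed
      then show ?thesis
        by (rule mcomplete_vlim[where xs = "\<lambda>n. ys n x", OF complete cl[OF t x]]) blast+
    qed
    have "\<forall>x\<in>carrier X. \<exists>y. y \<in> carrier X \<and> vlim (\<lambda>n. xs n x) y"
      by (intro ballI, rule ex[of xs]) (use s in auto)
    then have "\<exists>R. \<forall>x\<in>carrier X. R x \<in> carrier X \<and> vlim (\<lambda>n. xs n x) (R x)" by (rule bchoice)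
    then obtain R where R: "\<And>x. x \<in> carrier X \<Longrightarrow> R x \<in> carrier X \<and> vlim (\<lambda>n. xs n x) (R x)" by blast
    have "nrm L (adj L (xs m) \<ominus>\<^bsub>L\<^esub> adj L (xs n)) \<le> nrm L (xs m \<ominus>\<^bsub>L\<^esub> xs n)" for m n
    proof -
      have "adj L (xs m \<ominus>\<^bsub>L\<^esub> xs n) = adj L (xs m) \<ominus>\<^bsub>L\<^esub> adj L (xs n)"
        using s by (intro adj_adjointables_eqI Ln.vdiff_closed adjointables_adj(1))
          (simp_all add: diff ip_simps cl adjointables_adj)
      then show ?thesis using opnorm_adj_le[OF Ln.vdiff_closed[OF s s]] by metis
    qed
    then have "\<forall>x\<in>carrier X. \<exists>y. y \<in> carrier X \<and> vlim (\<lambda>n. adj L (xs n) x) y"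
      by (intro ballI, rule_tac ex[of "\<lambda>n. adj L (xs n)"]) (use s adjointables_adj(1) in auto)
    then have "\<exists>R'. \<forall>x\<in>carrier X. R' x \<in> carrier X \<and> vlim (\<lambda>n. adj L (xs n) x) (R' x)" by (rule bchoice)
    then obtain R' where R': "\<And>x. x \<in> carrier X \<Longrightarrow> R' x \<in> carrier X \<and> vlim (\<lambda>n. adj L (xs n) x) (R' x)" by blast
    let ?R = "\<lambda>x\<in>carrier X. R x"
    have RL: "?R \<in> carrier L"
    proof (rule adjointablesI[where S = R'])
      fix x y assume xy: "x \<in> carrier X" "y \<in> carrier X"
      have "base.vlim (\<lambda>n. ip X (xs n x) y) (ip X (R x) y)"
        using R xy cl[OF s] by (intro ip_vlim_left) auto
      moreover have "base.vlim (\<lambda>n. ip X (xs n x) y) (ip X x (R' y))"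
        using ip_vlim[of "\<lambda>n. adj L (xs n) y" "R' y" x] R' xy cl[OF adjointables_adj(1)[OF s]]
          adjointables_adj(2)[OF s xy] by simp
      ultimately show "ip X (?R x) y = ip X x (R' y)"
        using base.vlim_unique[of "\<lambda>n. ip X (xs n x) y"] R R' xy cl[OF s xy(1)] by simp
    qed (use R R' in auto)
    have "\<exists>M. \<forall>n\<ge>M. nrm L (xs n \<ominus>\<^bsub>L\<^esub> ?R) \<le> e" if e: "e > 0" for e
    proof -
      obtain M where M: "\<forall>m\<ge>M. \<forall>n\<ge>M. nrm L (xs m \<ominus>\<^bsub>L\<^esub> xs n) < e" using cauchy[OF e] by blast
      have "nrm L (xs n \<ominus>\<^bsub>L\<^esub> ?R) \<le> e" if n: "n \<ge> M" for n
      proof (rule opnorm_le')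
        fix x assume x: "x \<in> carrier X"
        have lim: "vlim (\<lambda>k. xs n x \<ominus>\<^bsub>X\<^esub> xs (k + M) x) (xs n x \<ominus>\<^bsub>X\<^esub> R x)"
        proof -
          have "vlim (\<lambda>k. xs (k + M) x) (R x)"
            using R[OF x] LIMSEQ_ignore_initial_segment unfolding vlim_def by blast
          then show ?thesis unfolding vdiff_def using x R cl[OF s x]
            by (intro vlim_add vlim_scale vlim_const) auto
        qed
        have le: "MN (xs n x \<ominus>\<^bsub>X\<^esub> xs (k + M) x) \<le> e * MN x" for k
        proof -
          have "MN (xs n x \<ominus>\<^bsub>X\<^esub> xs (k + M) x) \<le> nrm L (xs n \<ominus>\<^bsub>L\<^esub> xs (k + M)) * MN x"
            using opnorm_bound[OF Ln.vdiff_closed[OF s s] x] diff[OF x] by simp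
          also have "\<dots> \<le> e * MN x" using M n N_nonneg[OF x] by (intro mult_right_mono) (auto intro: less_imp_le)
          finally show ?thesis .
        qed
        have "MN (xs n x \<ominus>\<^bsub>X\<^esub> R x) \<le> e * MN x"
          by (rule vlim_N_le[OF lim _ _ le]) (use x R cl[OF s x] in auto)
        then show "MN ((xs n \<ominus>\<^bsub>L\<^esub> ?R) x) \<le> e * MN x" using x by (simp add: diff)
      qed (use e in simp)
      then show ?thesis by blast
    qed
    then show "\<exists>l\<in>carrier L. \<forall>e>0. \<exists>M. \<forall>n\<ge>M. nrm L (xs n \<ominus>\<^bsub>L\<^esub> l) \<le> e" using RL by blast
  qed
qed

theorem adjointables_cstar_algebra: "cstar_algebra L"
proof -
  interpret Ln: carrier_normed_space L "nrm L" by (rule adjointables_normed_space)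
  note cl = adjointables_closed and lin = adjointables_linear and ops = adjointables_ops
    and adjc = adjointables_adj(1) and adjd = adjointables_adj(2) adjointables_adj'
    and closed = adjointables_ops_closed
  have nm: "nrm L (R \<otimes>\<^bsub>L\<^esub> S) \<le> nrm L R * nrm L S" if RS: "R \<in> carrier L" "S \<in> carrier L" for R S
  proof (rule opnorm_le')
    fix x assume x: "x \<in> carrier X"
    have "MN ((R \<otimes>\<^bsub>L\<^esub> S) x) \<le> nrm L R * MN (S x)" using RS x by (simp add: ops(4) cl opnorm_bound)
    also have "\<dots> \<le> nrm L R * (nrm L S * MN x)" using RS x by (intro mult_left_mono opnorm_bound opnorm_nonneg)
    finally show "MN ((R \<otimes>\<^bsub>L\<^esub> S) x) \<le> (nrm L R * nrm L S) * MN x" by (simp add: mult.assoc)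
  qed (use RS opnorm_nonneg in auto)
  show ?thesis
  proof
    show "nrm L (R \<otimes>\<^bsub>L\<^esub> S) \<le> nrm L R * nrm L S" if RS: "R \<in> carrier L" "S \<in> carrier L" for R S
      using that by (rule nm)
    show "nrm L (adj L R \<otimes>\<^bsub>L\<^esub> R) = (nrm L R)\<^sup>2" if R: "R \<in> carrier L" for R
    proof (rule antisym)
      have "nrm L (adj L R \<otimes>\<^bsub>L\<^esub> R) \<le> nrm L (adj L R) * nrm L R" using R by (intro nm adjc)
      also have "\<dots> \<le> nrm L R * nrm L R" using R by (intro mult_right_mono opnorm_adj_le opnorm_nonneg)
      finally show "nrm L (adj L R \<otimes>\<^bsub>L\<^esub> R) \<le> (nrm L R)\<^sup>2" by (simp add: power2_eq_square)
      let ?S = "adj L R \<otimes>\<^bsub>L\<^esub> R"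
      have S: "?S \<in> carrier L" using R by (intro closed adjc)
      have "nrm L R \<le> sqrt (nrm L ?S)"
      proof (rule opnorm_le')
        fix x assume x: "x \<in> carrier X"
        have "(MN (R x))\<^sup>2 = nrm A (ip X x (?S x))"
          using R x adjd(1)[OF R x cl[OF R x]] by (simp add: MN_square cl ops(4))
        also have "\<dots> \<le> MN x * MN (?S x)" by (rule cauchy_schwarz[OF x cl[OF S x]])
        also have "\<dots> \<le> MN x * (nrm L ?S * MN x)" by (rule mult_left_mono[OF opnorm_bound[OF S x] N_nonneg[OF x]])
        also have "\<dots> = (sqrt (nrm L ?S) * MN x)\<^sup>2"
          using opnorm_nonneg[OF S] by (simp add: power_mult_distrib) (simp add: power2_eq_square)
        finally show "MN (R x) \<le> sqrt (nrm L ?S) * MN x"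
          by (rule power2_le_imp_le) (simp add: N_nonneg[OF x] opnorm_nonneg[OF S])
      qed (simp add: opnorm_nonneg[OF S])
      then have "(nrm L R)\<^sup>2 \<le> (sqrt (nrm L ?S))\<^sup>2" using opnorm_nonneg[OF R] by (intro power_mono)
      then show "(nrm L R)\<^sup>2 \<le> nrm L ?S" using opnorm_nonneg[OF S] by simp
    qed
    show "adj L (adj L R) = R" if "R \<in> carrier L" for R
      by (rule adj_adjointables_eqI[OF adjc[OF that] that adjointables_adj'[OF that]])
  qed ((rule Ln.N_nonneg Ln.N_eq_zero Ln.N_triangle Ln.N_scale closed adjc adjointables_complete; assumption?) |
      (intro adj_adjointables_eqI closed adjc; simp add: ops ip_simps cl adjc adjd; fail) |
      (intro adjointables_eqI closed; simp add: ops cl lin; fail))+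
qed

end

section \<open>The multiplier algebra\<close>

lemma cstar_algebra_transport:
  assumes B: "cstar_algebra B" and bij: "bij_betw \<phi> (carrier C) (carrier B)"
    and closed: "\<zero>\<^bsub>C\<^esub> \<in> carrier C"
      "\<And>x y. \<lbrakk>x \<in> carrier C; y \<in> carrier C\<rbrakk> \<Longrightarrow> x \<oplus>\<^bsub>C\<^esub> y \<in> carrier C"
      "\<And>c x. x \<in> carrier C \<Longrightarrow> c \<odot>\<^bsub>C\<^esub> x \<in> carrier C"
      "\<And>x y. \<lbrakk>x \<in> carrier C; y \<in> carrier C\<rbrakk> \<Longrightarrow> x \<otimes>\<^bsub>C\<^esub> y \<in> carrier C"
      "\<And>x. x \<in> carrier C \<Longrightarrow> adj C x \<in> carrier C"
    and pres: "\<phi> \<zero>\<^bsub>C\<^esub> = \<zero>\<^bsub>B\<^esub>"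
      "\<And>x y. \<lbrakk>x \<in> carrier C; y \<in> carrier C\<rbrakk> \<Longrightarrow> \<phi> (x \<oplus>\<^bsub>C\<^esub> y) = \<phi> x \<oplus>\<^bsub>B\<^esub> \<phi> y"
      "\<And>c x. x \<in> carrier C \<Longrightarrow> \<phi> (c \<odot>\<^bsub>C\<^esub> x) = c \<odot>\<^bsub>B\<^esub> \<phi> x"
      "\<And>x y. \<lbrakk>x \<in> carrier C; y \<in> carrier C\<rbrakk> \<Longrightarrow> \<phi> (x \<otimes>\<^bsub>C\<^esub> y) = \<phi> x \<otimes>\<^bsub>B\<^esub> \<phi> y"
      "\<And>x. x \<in> carrier C \<Longrightarrow> \<phi> (adj C x) = adj B (\<phi> x)"
    and nrm: "\<And>x. x \<in> carrier C \<Longrightarrow> nrm C x = nrm B (\<phi> x)"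
  shows "cstar_algebra C"
proof -
  interpret B: cstar_algebra B by (rule B)
  have img: "\<phi> x \<in> carrier B" if "x \<in> carrier C" for x using bij that by (auto simp: bij_betw_def)
  have eqI: "x = y" if "x \<in> carrier C" "y \<in> carrier C" "\<phi> x = \<phi> y" for x y
    using bij that by (auto simp: bij_betw_def inj_on_def)
  note transport = closed pres img nrm
  interpret C: carrier_normed_space C "nrm C"
  proof
    show "nrm C x = 0 \<longleftrightarrow> x = \<zero>\<^bsub>C\<^esub>" if "x \<in> carrier C" for x
      using that eqI[OF that closed(1)] by (auto simp: nrm img B.norm_eq_zero pres)
  qed (((rule eqI)?; simp add: transport B.add_zero B.add_neg B.scale_one B.scale_scale B.scale_add_left
      B.scale_add_right B.norm_nonneg B.norm_triangle B.norm_scale; fail) | (rule eqI; simp add: transport B.add_ac; fail))+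
  show ?thesis
  proof
    have diff: "nrm C (x \<ominus>\<^bsub>C\<^esub> y) = nrm B (\<phi> x \<ominus>\<^bsub>B\<^esub> \<phi> y)" if "x \<in> carrier C" "y \<in> carrier C" for x y
      using that by (simp add: nrm closed pres vdiff_def)
    show "Metric_space.mcomplete (carrier C) (norm_dist C (nrm C))"
    proof (rule C.mcompleteI)
      fix xs :: "nat \<Rightarrow> 'b"
      assume s: "\<And>n. xs n \<in> carrier C"
        and c: "\<And>e. e > 0 \<Longrightarrow> \<exists>M. \<forall>m\<ge>M. \<forall>n\<ge>M. nrm C (xs m \<ominus>\<^bsub>C\<^esub> xs n) < e"
      have "\<And>e. e > 0 \<Longrightarrow> \<exists>M. \<forall>m\<ge>M. \<forall>n\<ge>M. nrm B (\<phi> (xs m) \<ominus>\<^bsub>B\<^esub> \<phi> (xs n)) < e"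
        using c by (simp add: diff s)
      then obtain l where l: "l \<in> carrier B" "B.vlim (\<lambda>n. \<phi> (xs n)) l"
        by (rule B.mcomplete_vlim[where xs = "\<lambda>n. \<phi> (xs n)", OF B.complete img[OF s]]) blast+
      have "l \<in> \<phi> ` carrier C" using l(1) bij by (simp add: bij_betw_def)
      then obtain y where y: "y \<in> carrier C" "\<phi> y = l" by blast
      have "\<exists>M. \<forall>n\<ge>M. nrm C (xs n \<ominus>\<^bsub>C\<^esub> y) \<le> e" if "e > 0" for e
        using B.vlim_D[OF l(2) that] y by (auto simp: diff s intro: less_imp_le)
      then show "\<exists>l\<in>carrier C. \<forall>e>0. \<exists>M. \<forall>n\<ge>M. nrm C (xs n \<ominus>\<^bsub>C\<^esub> l) \<le> e" using y(1) by blast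
    qed
  qed ((rule C.N_nonneg C.N_eq_zero C.N_triangle C.N_scale; assumption) |
      ((rule eqI)?; simp add: transport B.expand_simps B.norm_mult B.cstar_identity; fail))+
qed

text \<open>A C*-algebra as a right Hilbert module over itself. Its adjointable operators are the left
  halves of the multipliers, which transports the C*-algebra structure to \<open>M(A)\<close>.\<close>

definition self_module :: "'a cstar \<Rightarrow> ('a, 'a) bimodule"
  where "self_module A = \<lparr>carrier = carrier A, vzero = \<zero>\<^bsub>A\<^esub>, vadd = vadd A, vscale = vscale A,
    ract = cmul A, lact = cmul A, ip = (\<lambda>x y. adj A x \<otimes>\<^bsub>A\<^esub> y)\<rparr>"

lemma self_module_simps [simp]:
  "carrier (self_module A) = carrier A" "vzero (self_module A) = vzero A"
  "vadd (self_module A) = vadd A" "vscale (self_module A) = vscale A"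
  "ract (self_module A) = cmul A" "ip (self_module A) = (\<lambda>x y. adj A x \<otimes>\<^bsub>A\<^esub> y)"
  "x \<ominus>\<^bsub>self_module A\<^esub> y = x \<ominus>\<^bsub>A\<^esub> y"
  by (simp_all add: self_module_def vdiff_def)

context cstar_algebra
begin

lemma self_module_norm: "x \<in> carrier A \<Longrightarrow> module_norm A (self_module A) x = nrm A x"
  by (simp add: module_norm_def cstar_identity norm_nonneg)

lemma self_module_cauchy_schwarz: "cauchy_schwarz_module A (self_module A)"
proof
  show "Metric_space.mcomplete (carrier (self_module A))
      (norm_dist (self_module A) (module_norm A (self_module A)))"
  proof -
    have "norm_dist (self_module A) (module_norm A (self_module A)) = norm_dist A (nrm A)"
      by (intro ext) (simp add: norm_dist_def self_module_norm)
    then show ?thesis using complete by simp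
  qed
  show "positive A (ip (self_module A) x x)" if "x \<in> carrier (self_module A)" for x
    using that by (auto simp: positive_def)
  show "nrm A (ip (self_module A) x y) \<le> module_norm A (self_module A) x * module_norm A (self_module A) y"
    if "x \<in> carrier (self_module A)" "y \<in> carrier (self_module A)" for x y
    using that norm_mult[of "adj A x" y] by (simp add: self_module_norm norm_adj)
  show "x = \<zero>\<^bsub>self_module A\<^esub>" if "x \<in> carrier (self_module A)" "ip (self_module A) x x = \<zero>" for x
    using that adj_mult_self_eq_zero[of x] by simp
qed (simp_all add: expand_simps zero_closed add_closed scale_closed add_ac add_zero
    add_neg scale_one scale_scale scale_add_left scale_add_right)

sublocale self: cauchy_schwarz_module A "self_module A"
  by (rule self_module_cauchy_schwarz)

abbreviation "MA \<equiv> multiplier_algebra A"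

lemma self_operator_norm:
  assumes "R \<in> carrier A \<rightarrow> carrier A"
  shows "operator_norm (self_module A) (module_norm A (self_module A)) R = operator_norm A (nrm A) R"
proof -
  have "(\<lambda>x. module_norm A (self_module A) (R x)) ` {x \<in> carrier A. module_norm A (self_module A) x \<le> 1}
    = (\<lambda>x. nrm A (R x)) ` {x \<in> carrier A. nrm A x \<le> 1}"
    using assms by (intro image_cong) (auto simp: self_module_norm Pi_iff)
  then show ?thesis by (simp add: operator_norm_def)
qed

lemma multiplier_carrierD:
  assumes "m \<in> carrier MA"
  shows "a \<in> carrier A \<Longrightarrow> fst m a \<in> carrier A" "a \<in> carrier A \<Longrightarrow> snd m a \<in> carrier A"
    "\<lbrakk>a \<in> carrier A; b \<in> carrier A\<rbrakk> \<Longrightarrow> fst m (a \<otimes> b) = fst m a \<otimes> b"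
    "\<lbrakk>a \<in> carrier A; b \<in> carrier A\<rbrakk> \<Longrightarrow> snd m (a \<otimes> b) = a \<otimes> snd m b"
    "\<lbrakk>a \<in> carrier A; b \<in> carrier A\<rbrakk> \<Longrightarrow> snd m a \<otimes> b = a \<otimes> fst m b"
    "fst m \<in> extensional (carrier A)" "snd m \<in> extensional (carrier A)"
    "linear_map A A (fst m)" "linear_map A A (snd m)"
  using assms by (auto simp: multiplier_algebra_def bounded_operators_def linear_map_def Pi_iff)

lemma multiplier_adjointable:
  assumes "m \<in> carrier MA"
  shows "fst m \<in> carrier self.L" "adj self.L (fst m) = (\<lambda>a\<in>carrier A. adj A (snd m (adj A a)))"
proof -
  note mD = multiplier_carrierD[OF assms]
  have ip: "adj A (fst m x) \<otimes> y = adj A x \<otimes> adj A (snd m (adj A y))"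
    if "x \<in> carrier A" "y \<in> carrier A" for x y
  proof -
    have "adj A (fst m x) \<otimes> y = adj A (adj A y \<otimes> fst m x)"
      using that mD(1) by (simp add: adj_mult adj_adj)
    also have "\<dots> = adj A (snd m (adj A y) \<otimes> x)" using that mD(5) by simp
    finally show ?thesis using that mD(2) by (simp add: adj_mult)
  qed
  show L: "fst m \<in> carrier self.L"
    by (rule self.adjointablesI[where S = "\<lambda>a. adj A (snd m (adj A a))"])
      (use mD(1,2,6) ip in auto)
  have "(\<lambda>a\<in>carrier A. adj A (snd m (adj A a))) \<in> carrier self.L"
  proof (rule self.adjointablesI[where S = "fst m"])
    fix x y assume xy: "x \<in> carrier (self_module A)" "y \<in> carrier (self_module A)"
    have "adj A (adj A (fst m y) \<otimes> x) = adj A (adj A y \<otimes> adj A (snd m (adj A x)))"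
      using ip[of y x] xy by simp
    then show "ip (self_module A) ((\<lambda>a\<in>carrier A. adj A (snd m (adj A a))) x) y =
        ip (self_module A) x (fst m y)"
      using xy mD(1,2) by (simp add: adj_mult adj_adj)
  qed (use mD(1,2) in auto)
  then show "adj self.L (fst m) = (\<lambda>a\<in>carrier A. adj A (snd m (adj A a)))"
    by (intro self.adj_adjointables_eqI L) (use ip in auto)
qed

text \<open>The centralizer identity makes \<open>l\<close> adjointable, with adjoint \<open>a \<mapsto> r(a\<^sup>*)\<^sup>*\<close>, so that linearity
  and boundedness are automatic.\<close>

lemma multiplierI:
  assumes "l \<in> extensional (carrier A)" "r \<in> extensional (carrier A)"
    "\<And>a. a \<in> carrier A \<Longrightarrow> l a \<in> carrier A" "\<And>a. a \<in> carrier A \<Longrightarrow> r a \<in> carrier A"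
    "\<And>a b. \<lbrakk>a \<in> carrier A; b \<in> carrier A\<rbrakk> \<Longrightarrow> r a \<otimes> b = a \<otimes> l b"
  shows "(l, r) \<in> carrier MA"
proof -
  have l: "l \<in> carrier self.L"
  proof (rule self.adjointablesI[where S = "\<lambda>a. adj A (r (adj A a))"])
    fix x y assume xy: "x \<in> carrier (self_module A)" "y \<in> carrier (self_module A)"
    have "adj A (l x) \<otimes> y = adj A (adj A y \<otimes> l x)"
      using xy assms(3) by (simp add: adj_mult adj_adj)
    also have "\<dots> = adj A (r (adj A y) \<otimes> x)" using xy assms(5)[of "adj A y" x] by simp
    finally show "ip (self_module A) (l x) y = ip (self_module A) x (adj A (r (adj A y)))"
      using xy assms(4) by (simp add: adj_mult)
  qed (use assms(1,3,4) in auto)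
  have adjl: "adj self.L l a = adj A (r (adj A a))" if a: "a \<in> carrier A" for a
  proof (rule eq_by_left_mult)
    fix z assume z: "z \<in> carrier A"
    have "ip (self_module A) (l (adj A z)) a = ip (self_module A) (adj A z) (adj self.L l a)"
      using self.adjointables_adj(2)[OF l] z a by simp
    moreover have "adj A (l (adj A z)) \<otimes> a = adj A (adj A a \<otimes> l (adj A z))"
      using z a assms(3) by (simp add: adj_mult adj_adj)
    moreover have "\<dots> = adj A (r (adj A a) \<otimes> adj A z)" using z a assms(5) by simp
    ultimately show "z \<otimes> adj self.L l a = z \<otimes> adj A (r (adj A a))"
      using z a assms(4) by (simp add: adj_mult adj_adj)
  qed (use a assms(4) self.adjointables_adj(1)[OF l, THEN self.adjointables_closed] in auto)
  have rl: "r a = adj A (adj self.L l (adj A a))" if "a \<in> carrier A" for a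
    using that adjl[of "adj A a"] assms(4) by (simp add: adj_adj)
  note L' = self.adjointables_adj(1)[OF l]
  have "r (a \<oplus> b) = r a \<oplus> r b" "r (c \<odot> a) = c \<odot> r a" "r (a \<otimes> b) = a \<otimes> r b"
    if "a \<in> carrier A" "b \<in> carrier A" for a b c
    using that self.adjointables_linear(1-3)[OF L'] self.adjointables_closed[OF L']
    by (simp_all add: rl expand_simps)
  moreover have "nrm A (l a) \<le> nrm self.L l * nrm A a" if "a \<in> carrier A" for a
    using self.opnorm_bound[OF l] that assms(3) by (simp add: self_module_norm)
  moreover have "nrm A (r a) \<le> nrm self.L (adj self.L l) * nrm A a" if "a \<in> carrier A" for a
    using self.opnorm_bound[OF L', of "adj A a"] that self.adjointables_closed[OF L']
    by (simp add: self_module_norm rl norm_adj)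
  ultimately show ?thesis
    using assms self.adjointables_linear(1-3)[OF l]
    by (auto simp: multiplier_algebra_def bounded_operators_def linear_map_def
        intro: exI[of _ "nrm self.L l"] exI[of _ "nrm self.L (adj self.L l)"])
qed

lemma multiplier_fst_eqI:
  assumes "m \<in> carrier MA" "n \<in> carrier MA" "\<And>a. a \<in> carrier A \<Longrightarrow> fst m a = fst n a"
  shows "m = n"
proof (rule prod_eqI)
  note mD = multiplier_carrierD[OF assms(1)] and nD = multiplier_carrierD[OF assms(2)]
  show "fst m = fst n" by (rule extensionalityI[OF mD(6) nD(6) assms(3)])
  show "snd m = snd n"
  proof (rule extensionalityI[OF mD(7) nD(7)])
    fix a assume a: "a \<in> carrier A"
    show "snd m a = snd n a"
      by (rule eq_by_right_mult) (use a mD(2,5) nD(2,5) assms(3) in auto)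
  qed
qed

lemma multiplier_ops:
  assumes "a \<in> carrier A"
  shows "fst (m \<oplus>\<^bsub>MA\<^esub> n) a = fst m a \<oplus> fst n a" "snd (m \<oplus>\<^bsub>MA\<^esub> n) a = snd m a \<oplus> snd n a"
    "fst (c \<odot>\<^bsub>MA\<^esub> m) a = c \<odot> fst m a" "snd (c \<odot>\<^bsub>MA\<^esub> m) a = c \<odot> snd m a"
    "fst (m \<otimes>\<^bsub>MA\<^esub> n) a = fst m (fst n a)" "snd (m \<otimes>\<^bsub>MA\<^esub> n) a = snd n (snd m a)"
    "fst (adj MA m) a = adj A (snd m (adj A a))" "snd (adj MA m) a = adj A (fst m (adj A a))"
    "fst \<zero>\<^bsub>MA\<^esub> a = \<zero>" "snd \<zero>\<^bsub>MA\<^esub> a = \<zero>"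
    "fst (mult_one A) a = a" "snd (mult_one A) a = a"
    "fst (mult_of A x) a = x \<otimes> a" "snd (mult_of A x) a = a \<otimes> x"
  using assms by (simp_all add: multiplier_algebra_def mult_one_def mult_of_def case_prod_beta)

lemma multiplier_ops_closed:
  "\<zero>\<^bsub>MA\<^esub> \<in> carrier MA" "mult_one A \<in> carrier MA" "x \<in> carrier A \<Longrightarrow> mult_of A x \<in> carrier MA"
  "\<lbrakk>m \<in> carrier MA; n \<in> carrier MA\<rbrakk> \<Longrightarrow> m \<oplus>\<^bsub>MA\<^esub> n \<in> carrier MA"
  "m \<in> carrier MA \<Longrightarrow> c \<odot>\<^bsub>MA\<^esub> m \<in> carrier MA"
  "\<lbrakk>m \<in> carrier MA; n \<in> carrier MA\<rbrakk> \<Longrightarrow> m \<otimes>\<^bsub>MA\<^esub> n \<in> carrier MA"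
  "m \<in> carrier MA \<Longrightarrow> adj MA m \<in> carrier MA"
proof -
  note D = multiplier_carrierD(1,2,5)
  show "\<zero>\<^bsub>MA\<^esub> \<in> carrier MA"
    using multiplierI[of "\<lambda>a\<in>carrier A. \<zero>" "\<lambda>a\<in>carrier A. \<zero>"]
    by (simp add: multiplier_algebra_def expand_simps)
  show "mult_one A \<in> carrier MA" unfolding mult_one_def by (rule multiplierI) auto
  show "mult_of A x \<in> carrier MA" if "x \<in> carrier A"
    unfolding mult_of_def by (rule multiplierI) (use that in \<open>auto simp: mult_assoc\<close>)
  show "m \<oplus>\<^bsub>MA\<^esub> n \<in> carrier MA" if "m \<in> carrier MA" "n \<in> carrier MA"
  proof -
    have "(\<lambda>a\<in>carrier A. fst m a \<oplus> fst n a, \<lambda>a\<in>carrier A. snd m a \<oplus> snd n a) \<in> carrier MA"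
      by (rule multiplierI) (use D[OF that(1)] D[OF that(2)] in \<open>simp_all add: expand_simps\<close>)
    then show ?thesis by (simp add: multiplier_algebra_def case_prod_beta)
  qed
  show "c \<odot>\<^bsub>MA\<^esub> m \<in> carrier MA" if "m \<in> carrier MA"
  proof -
    have "(\<lambda>a\<in>carrier A. c \<odot> fst m a, \<lambda>a\<in>carrier A. c \<odot> snd m a) \<in> carrier MA"
      by (rule multiplierI) (use D[OF that] in \<open>simp_all add: expand_simps\<close>)
    then show ?thesis by (simp add: multiplier_algebra_def case_prod_beta)
  qed
  show "m \<otimes>\<^bsub>MA\<^esub> n \<in> carrier MA" if "m \<in> carrier MA" "n \<in> carrier MA"
  proof -
    have "(\<lambda>a\<in>carrier A. fst m (fst n a), \<lambda>a\<in>carrier A. snd n (snd m a)) \<in> carrier MA"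
      by (rule multiplierI) (use D[OF that(1)] D[OF that(2)] in simp_all)
    then show ?thesis by (simp add: multiplier_algebra_def case_prod_beta)
  qed
  show "adj MA m \<in> carrier MA" if "m \<in> carrier MA"
  proof -
    have eq: "adj A (fst m (adj A a)) \<otimes> b = a \<otimes> adj A (snd m (adj A b))"
      if "a \<in> carrier A" "b \<in> carrier A" for a b
    proof -
      have "adj A (snd m (adj A b) \<otimes> adj A a) = adj A (adj A b \<otimes> fst m (adj A a))"
        using that D(3)[OF \<open>m \<in> carrier MA\<close>, of "adj A b" "adj A a"] by simp
      then show ?thesis using that D(1,2)[OF \<open>m \<in> carrier MA\<close>] by (simp add: adj_mult adj_adj)
    qed
    have "(\<lambda>a\<in>carrier A. adj A (snd m (adj A a)), \<lambda>a\<in>carrier A. adj A (fst m (adj A a))) \<in> carrier MA"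
      by (rule multiplierI) (use D(1,2)[OF that] eq in simp_all)
    then show ?thesis by (simp add: multiplier_algebra_def case_prod_beta)
  qed
qed

theorem multiplier_cstar_algebra: "cstar_algebra MA"
proof (rule cstar_algebra_transport[where \<phi> = fst and B = "self.L"])
  show "cstar_algebra self.L" by (rule self.adjointables_cstar_algebra)
  show "bij_betw fst (carrier MA) (carrier self.L)"
    unfolding bij_betw_def
  proof
    show "inj_on fst (carrier MA)" by (rule inj_onI) (rule multiplier_fst_eqI, auto)
    show "fst ` carrier MA = carrier self.L"
    proof
      show "fst ` carrier MA \<subseteq> carrier self.L" using multiplier_adjointable(1) by blast
      show "carrier self.L \<subseteq> fst ` carrier MA"
      proof
        fix l assume l: "l \<in> carrier self.L"
        note L' = self.adjointables_adj(1)[OF l]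
        have "(l, \<lambda>a\<in>carrier A. adj A (adj self.L l (adj A a))) \<in> carrier MA"
        proof (rule multiplierI)
          fix a b assume ab: "a \<in> carrier A" "b \<in> carrier A"
          have "adj A (adj self.L l (adj A a)) \<otimes> b = adj A (adj A a) \<otimes> l b"
            using self.adjointables_adj'[OF l, of "adj A a" b] ab by simp
          then show "(\<lambda>a\<in>carrier A. adj A (adj self.L l (adj A a))) a \<otimes> b = a \<otimes> l b"
            using ab by (simp add: adj_adj)
        qed (use l L' self.adjointables_closed[OF l] self.adjointables_closed[OF L'] in
            \<open>auto simp: self.adjointables_iff[of l]\<close>)
        then show "l \<in> fst ` carrier MA" by force
      qed
    qed
  qed
  show "fst (adj MA m) = adj self.L (fst m)" if "m \<in> carrier MA" for m
    using multiplier_adjointable(2)[OF that] by (simp add: multiplier_algebra_def case_prod_beta)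
  show "nrm MA m = nrm self.L (fst m)" if "m \<in> carrier MA" for m
    using self_operator_norm[of "fst m"] multiplier_carrierD(1)[OF that]
    by (simp add: self.adjointables_ops) (simp add: multiplier_algebra_def case_prod_beta)
qed (use multiplier_ops_closed in \<open>simp_all add: self.adjointables_ops\<close>,
    simp_all add: multiplier_algebra_def case_prod_beta)

end

text \<open>The locale \<^locale>\<open>cstar_algebra\<close> provides the multiplier algebra of \<open>A\<close> as a C*-algebra
  under the prefix \<open>M\<close>.\<close>

sublocale cstar_algebra \<subseteq> M: complex_vector_space "multiplier_algebra A"
  using multiplier_cstar_algebra by (rule cstar_algebra.axioms(1))

context cstar_algebra
begin

lemma multiplier_norm_le:
  assumes "m \<in> carrier MA" "a \<in> carrier A"
  shows "nrm A (fst m a) \<le> nrm MA m * nrm A a" "nrm A (snd m a) \<le> nrm MA m * nrm A a"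
proof -
  have *: "nrm A (fst n a) \<le> nrm MA n * nrm A a" if "n \<in> carrier MA" "a \<in> carrier A" for n a
  proof -
    have "nrm MA n = nrm self.L (fst n)"
      using self_operator_norm[of "fst n"] multiplier_carrierD(1)[OF that(1)]
      by (simp add: self.adjointables_ops) (simp add: multiplier_algebra_def case_prod_beta)
    then show ?thesis
      using self.opnorm_bound[OF multiplier_adjointable(1)[OF that(1)]] that
        multiplier_carrierD(1)[OF that(1)] by (simp add: self_module_norm)
  qed
  show "nrm A (fst m a) \<le> nrm MA m * nrm A a" by (rule *[OF assms])
  have "nrm A (snd m a) = nrm A (fst (adj MA m) (adj A a))"
    using assms multiplier_carrierD(2)[OF assms(1)] by (simp add: multiplier_ops adj_adj norm_adj)
  also have "\<dots> \<le> nrm MA (adj MA m) * nrm A (adj A a)"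
    using assms by (intro * multiplier_ops_closed) auto
  finally show "nrm A (snd m a) \<le> nrm MA m * nrm A a"
    using assms cstar_algebra.norm_adj[OF multiplier_cstar_algebra] by (simp add: norm_adj)
qed

lemma multiplier_norm_leI:
  assumes "m \<in> carrier MA" "0 \<le> K" "\<And>a. a \<in> carrier A \<Longrightarrow> nrm A (fst m a) \<le> K * nrm A a"
  shows "nrm MA m \<le> K"
proof -
  have "nrm MA m = nrm self.L (fst m)"
    using self_operator_norm[of "fst m"] multiplier_carrierD(1)[OF assms(1)]
    by (simp add: self.adjointables_ops) (simp add: multiplier_algebra_def case_prod_beta)
  also have "\<dots> \<le> K"
    by (rule self.opnorm_le') (use assms multiplier_carrierD(1)[OF assms(1)] in \<open>simp_all add: self_module_norm\<close>)
  finally show ?thesis .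
qed

lemma mult_of_star_hom: "star_hom A MA (mult_of A)"
  unfolding star_hom_def linear_map_def
  by (auto intro!: multiplier_fst_eqI multiplier_ops_closed simp: multiplier_ops expand_simps)

lemma norm_mult_of: "x \<in> carrier A \<Longrightarrow> nrm MA (mult_of A x) = nrm A x"
proof (rule antisym)
  assume x: "x \<in> carrier A"
  show "nrm MA (mult_of A x) \<le> nrm A x"
    using x by (intro multiplier_norm_leI multiplier_ops_closed) (simp_all add: multiplier_ops norm_mult norm_nonneg)
  have "(nrm A x)\<^sup>2 \<le> nrm MA (mult_of A x) * nrm A x"
    using multiplier_norm_le(1)[OF multiplier_ops_closed(3)[OF x], of "adj A x"] x
    by (simp add: multiplier_ops cstar_identity' norm_adj)
  then show "nrm A x \<le> nrm MA (mult_of A x)"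
    using norm_nonneg[OF x] cstar_algebra.norm_nonneg[OF multiplier_cstar_algebra multiplier_ops_closed(3)[OF x]]
    by (cases "nrm A x = 0") (auto simp: power2_eq_square)
qed

lemma multiplier_fst_snd_commute:
  assumes "m \<in> carrier MA" "n \<in> carrier MA" "a \<in> carrier A"
  shows "fst m (snd n a) = snd n (fst m a)"
proof (rule eq_by_left_mult)
  note mD = multiplier_carrierD[OF assms(1)] and nD = multiplier_carrierD[OF assms(2)]
  fix z assume z: "z \<in> carrier A"
  have "z \<otimes> fst m (snd n a) = snd m z \<otimes> snd n a" using z assms(3) mD(5) nD(2) by simp
  also have "\<dots> = snd n (snd m z \<otimes> a)" using z assms(3) mD(2) nD(4) by simp
  also have "\<dots> = snd n (z \<otimes> fst m a)" using z assms(3) mD(5) by simp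
  also have "\<dots> = z \<otimes> snd n (fst m a)" using z assms(3) mD(1) nD(4) by simp
  finally show "z \<otimes> fst m (snd n a) = z \<otimes> snd n (fst m a)" .
qed (use assms multiplier_carrierD in auto)

end

section \<open>Positivity and the Cauchy--Schwarz inequality\<close>

locale unital_cstar_algebra = cstar_algebra U for U :: "'a cstar" (structure) +
  fixes e :: 'a
  assumes one_closed [simp, intro]: "e \<in> carrier U"
    and one_left: "x \<in> carrier U \<Longrightarrow> e \<otimes> x = x"
    and one_right: "x \<in> carrier U \<Longrightarrow> x \<otimes> e = x"
begin

lemma adj_one: "adj U e = e"
  by (metis adj_adj adj_closed adj_mult one_closed one_left one_right)

lemma norm_one_le: "nrm U e \<le> 1"
proof -
  have "(nrm U e)\<^sup>2 = nrm U e" using cstar_identity[OF one_closed] by (simp add: adj_one one_left)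
  then show ?thesis by (auto simp add: power2_eq_square)
qed

text \<open>Positivity in terms of the norm: for self-adjoint \<open>x\<close> the spectrum lies in \<open>[0, 2l]\<close> iff
  \<open>\<parallel>l - x\<parallel> \<le> l\<close>. In this form sums of positive elements are visibly positive.\<close>

definition psd :: "'a \<Rightarrow> bool"
  where "psd x \<longleftrightarrow> x \<in> carrier U \<and> adj U x = x \<and>
    (\<exists>l\<ge>0. nrm U (of_real l \<odot> e \<ominus> x) \<le> l)"

lemma psdD: "psd x \<Longrightarrow> x \<in> carrier U" "psd x \<Longrightarrow> adj U x = x"
  by (simp_all add: psd_def)

lemma psdI:
  "\<lbrakk>x \<in> carrier U; adj U x = x; 0 \<le> l; nrm U (of_real l \<odot> e \<ominus> x) \<le> l\<rbrakk> \<Longrightarrow> psd x"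
  unfolding psd_def by blast

lemma psd_bound:
  assumes "psd x"
  obtains l where "0 < l" "nrm U (of_real l \<odot> e \<ominus> x) \<le> l"
proof -
  obtain l where l: "0 \<le> l" "nrm U (of_real l \<odot> e \<ominus> x) \<le> l" and x: "x \<in> carrier U"
    using assms unfolding psd_def by blast
  have "of_real (l + 1) \<odot> e \<ominus> x = (of_real l \<odot> e \<ominus> x) \<oplus> e"
    using x by (intro vec_eqI) (simp_all add: functional_simps algebra_simps)
  then have "nrm U (of_real (l + 1) \<odot> e \<ominus> x) \<le> l + 1"
    using norm_triangle[of "of_real l \<odot> e \<ominus> x" e] l(2) x norm_one_le by simp
  then show ?thesis using l(1) by (intro that[of "l + 1"]) auto
qed

lemma psd_add: assumes "psd x" "psd y" shows "psd (x \<oplus> y)"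
proof -
  obtain l m where l: "0 < l" "nrm U (of_real l \<odot> e \<ominus> x) \<le> l"
    and m: "0 < m" "nrm U (of_real m \<odot> e \<ominus> y) \<le> m"
    using psd_bound[OF assms(1)] psd_bound[OF assms(2)] by metis
  note c = psdD[OF assms(1)] psdD[OF assms(2)]
  have "of_real (l + m) \<odot> e \<ominus> (x \<oplus> y)
    = (of_real l \<odot> e \<ominus> x) \<oplus> (of_real m \<odot> e \<ominus> y)"
    using c by (intro vec_eqI) (simp_all add: functional_simps algebra_simps)
  then have "nrm U (of_real (l + m) \<odot> e \<ominus> (x \<oplus> y)) \<le> l + m"
    using norm_triangle[of "of_real l \<odot> e \<ominus> x" "of_real m \<odot> e \<ominus> y"] l m c by simp
  then show ?thesis using l m c by (intro psdI[where l = "l + m"]) (auto simp: adj_add)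
qed

lemma psd_scale: assumes "psd x" "0 \<le> r" shows "psd (of_real r \<odot> x)"
proof -
  obtain l where l: "0 < l" "nrm U (of_real l \<odot> e \<ominus> x) \<le> l"
    using psd_bound[OF assms(1)] by metis
  note c = psdD[OF assms(1)]
  have "of_real (r * l) \<odot> e \<ominus> of_real r \<odot> x
    = of_real r \<odot> (of_real l \<odot> e \<ominus> x)"
    using c by (intro vec_eqI) (simp_all add: functional_simps algebra_simps)
  then have "nrm U (of_real (r * l) \<odot> e \<ominus> of_real r \<odot> x) \<le> r * l"
    using l c assms(2) by (simp add: norm_scale mult_left_mono)
  then show ?thesis using l c assms(2) by (intro psdI[where l = "r * l"]) (auto simp: adj_scale)
qed

lemma psd_norm_minus:
  assumes "v \<in> carrier U" "adj U v = v" "nrm U v \<le> \<mu>"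
  shows "psd (of_real \<mu> \<odot> e \<ominus> v)"
proof (rule psdI[where l = \<mu>])
  have "of_real \<mu> \<odot> e \<ominus> (of_real \<mu> \<odot> e \<ominus> v) = v"
    using assms(1) by (intro vec_eqI) (simp_all add: functional_simps)
  then show "nrm U (of_real \<mu> \<odot> e \<ominus> (of_real \<mu> \<odot> e \<ominus> v)) \<le> \<mu>" using assms(3) by simp
  show "0 \<le> \<mu>" using norm_nonneg[OF assms(1)] assms(3) by simp
qed (use assms in \<open>auto simp: adj_vdiff adj_scale adj_one\<close>)

lemma psd_square: assumes h: "h \<in> carrier U" "adj U h = h" shows "psd (h \<otimes> h)"
proof -
  define r where "r = nrm U h + 1"
  have r: "0 < r" "nrm U h \<le> r" using norm_nonneg[OF h(1)] by (simp_all add: r_def)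
  define k where "k = of_real (1 / r) \<odot> h"
  have k: "k \<in> carrier U" "adj U k = k" "nrm U k \<le> 1"
    using h r by (simp_all add: k_def adj_scale norm_scale norm_divide)
  have "of_real (r\<^sup>2) \<odot> e \<ominus> h \<otimes> h = of_real (r\<^sup>2) \<odot> (e \<ominus> k \<otimes> (k \<otimes> e))"
    using h r by (intro vec_eqI)
      (simp_all add: k_def expand_simps functional_simps one_right field_simps power2_eq_square)
  moreover have "nrm U (e \<ominus> k \<otimes> (k \<otimes> e)) \<le> 1"
    using contractive_complement_square[OF k one_closed] norm_one_le by simp
  ultimately have "nrm U (of_real (r\<^sup>2) \<odot> e \<ominus> h \<otimes> h) \<le> r\<^sup>2"
    using k(1) by (simp add: norm_scale norm_power mult_left_le)
  then show ?thesis using h by (intro psdI[where l = "r\<^sup>2"]) (auto simp: adj_mult)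
qed

text \<open>The root is \<open>l\<^bsup>1/2\<^esup> (1 - g)\<close>, where \<open>2g = k + g\<^sup>2\<close> for the contraction \<open>k = 1 - x/l\<close>.\<close>

lemma psd_sqrt:
  assumes "psd x"
  obtains r where "psd r" "r \<otimes> r = x" "\<And>y. \<lbrakk>y \<in> carrier U; x \<otimes> y = y \<otimes> x\<rbrakk> \<Longrightarrow> r \<otimes> y = y \<otimes> r"
proof -
  obtain l where l: "0 < l" "nrm U (of_real l \<odot> e \<ominus> x) \<le> l"
    using psd_bound[OF assms(1)] by metis
  note x = psdD[OF assms(1)]
  define k where "k = e \<ominus> of_real (1 / l) \<odot> x"
  have k: "k \<in> carrier U" "adj U k = k"
    using x by (simp_all add: k_def adj_vdiff adj_scale adj_one)
  have "k = of_real (1 / l) \<odot> (of_real l \<odot> e \<ominus> x)"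
    using x l by (intro vec_eqI) (simp_all add: k_def functional_simps field_simps)
  then have "nrm U k = (1 / l) * nrm U (of_real l \<odot> e \<ominus> x)"
    using x l by (simp add: norm_scale norm_divide)
  also have "\<dots> \<le> 1" using l by simp
  finally have k1: "nrm U k \<le> 1" .
  obtain g where g: "g \<in> carrier U" "nrm U g \<le> 1" "k \<oplus> g \<otimes> g = 2 \<odot> g" "adj U g = g"
    and comm: "\<And>y. \<lbrakk>y \<in> carrier U; k \<otimes> y = y \<otimes> k\<rbrakk> \<Longrightarrow> g \<otimes> y = y \<otimes> g"
    using quadratic_solution_selfadjoint[OF k(1) k1 k(2)] by metis
  define r where "r = of_real (sqrt l) \<odot> (e \<ominus> g)"
  have rc: "r \<in> carrier U" "adj U r = r"
    using g by (simp_all add: r_def adj_scale adj_vdiff adj_one)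
  show ?thesis
  proof
    have "of_real (sqrt l) \<odot> e \<ominus> r = of_real (sqrt l) \<odot> g"
      using g by (intro vec_eqI) (simp_all add: r_def functional_simps algebra_simps)
    then have "nrm U (of_real (sqrt l) \<odot> e \<ominus> r) \<le> sqrt l"
      using g l by (simp add: norm_scale mult_left_le)
    then show "psd r" using rc l by (intro psdI[where l = "sqrt l"]) auto
    have gg: "g \<otimes> g = 2 \<odot> g \<ominus> k"
      using g k by (simp add: g(3)[symmetric]) (intro vec_eqI, simp_all add: functional_simps)
    have sq: "of_real (sqrt l) * (of_real (sqrt l) * z) = of_real l * z" for z
      using l by (simp add: mult.assoc[symmetric] of_real_mult[symmetric])
    have sq1: "of_real (sqrt l) * of_real (sqrt l) = of_real l"
      using sq[of 1] by simp
    have "r \<otimes> r = of_real l \<odot> (e \<ominus> k)"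
      using g k by (intro vec_eqI)
        (simp_all add: r_def expand_simps functional_simps one_left one_right gg sq sq1 algebra_simps)
    also have "\<dots> = x"
      using x l by (intro vec_eqI) (simp_all add: k_def functional_simps field_simps)
    finally show "r \<otimes> r = x" .
    fix y assume y: "y \<in> carrier U" "x \<otimes> y = y \<otimes> x"
    have "g \<otimes> y = y \<otimes> g"
      using x y by (intro comm) (simp_all add: k_def expand_simps one_left one_right)
    then show "r \<otimes> y = y \<otimes> r"
      using g y by (simp add: r_def expand_simps one_left one_right)
  qed
qed

text \<open>The norm is monotone on positive elements. With \<open>\<mu> = \<parallel>x + y\<parallel>\<close> both \<open>\<mu> - x\<close> and \<open>\<mu> + x\<close>
  are squares of commuting elements, so \<open>x\<^sup>2 + c\<^sup>2 = \<mu>\<^sup>2\<close> for some \<open>c\<close> commuting with \<open>x\<close>, and \<open>x\<close> is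
  the real part of the multiple \<open>x + \<i>c\<close> of a unitary.\<close>

lemma psd_norm_mono:
  assumes "psd x" "psd y"
  shows "nrm U x \<le> nrm U (x \<oplus> y)"
proof -
  note x = psdD[OF assms(1)] and y = psdD[OF assms(2)]
  define \<mu> where "\<mu> = nrm U (x \<oplus> y)"
  have mu: "0 \<le> \<mu>" using norm_nonneg x y by (simp add: \<mu>_def)
  let ?m = "of_real \<mu> \<odot> e"
  have "psd (?m \<ominus> (x \<oplus> y))"
    by (rule psd_norm_minus) (use x y in \<open>auto simp: adj_add \<mu>_def\<close>)
  from psd_add[OF this assms(2)] have "psd ((?m \<ominus> (x \<oplus> y)) \<oplus> y)" .
  moreover have "(?m \<ominus> (x \<oplus> y)) \<oplus> y = ?m \<ominus> x"
    using x y by (intro vec_eqI) (simp_all add: functional_simps)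
  ultimately have "psd (?m \<ominus> x)" by simp
  then obtain a where a: "psd a" "a \<otimes> a = ?m \<ominus> x"
    and ac: "\<And>z. \<lbrakk>z \<in> carrier U; (?m \<ominus> x) \<otimes> z = z \<otimes> (?m \<ominus> x)\<rbrakk> \<Longrightarrow> a \<otimes> z = z \<otimes> a"
    using psd_sqrt by metis
  have "psd ?m" using mu by (intro psdI[where l = \<mu>]) (auto simp: adj_scale adj_one vdiff_self N_zero)
  then have "psd (?m \<oplus> x)" using assms(1) by (rule psd_add)
  then obtain b where b: "psd b" "b \<otimes> b = ?m \<oplus> x"
    and bc: "\<And>z. \<lbrakk>z \<in> carrier U; (?m \<oplus> x) \<otimes> z = z \<otimes> (?m \<oplus> x)\<rbrakk> \<Longrightarrow> b \<otimes> z = z \<otimes> b"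
    using psd_sqrt by metis
  note a' = psdD[OF a(1)] and b' = psdD[OF b(1)]
  have bx: "b \<otimes> x = x \<otimes> b" using x by (intro bc) (simp_all add: expand_simps one_left one_right)
  have ax: "a \<otimes> x = x \<otimes> a" using x by (intro ac) (simp_all add: expand_simps one_left one_right)
  have ab: "a \<otimes> b = b \<otimes> a"
    using x b' bx by (intro ac) (simp_all add: expand_simps one_left one_right)
  define c where "c = a \<otimes> b"
  have c: "c \<in> carrier U" "adj U c = c" using a' b' ab by (simp_all add: c_def adj_mult)
  have cx: "x \<otimes> c = c \<otimes> x"
    using a' b' x ax bx by (simp add: c_def) (metis mult_assoc)
  have cc: "c \<otimes> c = of_real (\<mu>\<^sup>2) \<odot> e \<ominus> x \<otimes> x"
  proof -
    have "c \<otimes> c = (a \<otimes> a) \<otimes> (b \<otimes> b)"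
      using a' b' ab by (simp add: c_def) (metis mult_assoc mult_closed)
    also have "\<dots> = of_real (\<mu>\<^sup>2) \<odot> e \<ominus> x \<otimes> x"
      unfolding a b using x by (intro vec_eqI)
        (simp_all add: expand_simps functional_simps one_left one_right power2_eq_square algebra_simps)
    finally show ?thesis .
  qed
  define u where "u = x \<oplus> \<i> \<odot> c"
  have u: "u \<in> carrier U" "adj U u = x \<ominus> \<i> \<odot> c"
    using x c by (simp_all add: u_def adj_add adj_scale vdiff_def scale_scale)
  have "adj U u \<otimes> u = of_real (\<mu>\<^sup>2) \<odot> e"
    unfolding u(2) using x c by (intro vec_eqI)
      (simp_all add: u_def expand_simps functional_simps cx cc algebra_simps)
  then have "(nrm U u)\<^sup>2 = \<mu>\<^sup>2 * nrm U e"
    using cstar_identity[OF u(1)] by (simp add: norm_scale norm_power)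
  then have "(nrm U u)\<^sup>2 \<le> \<mu>\<^sup>2" using mult_left_le[OF norm_one_le, of "\<mu>\<^sup>2"] by simp
  then have "nrm U u \<le> \<mu>" using mu by (simp add: power2_le_iff_abs_le)
  moreover have "x = (1/2) \<odot> (u \<oplus> adj U u)"
    unfolding u(2) using x c by (intro vec_eqI) (simp_all add: u_def functional_simps)
  then have "nrm U x = (1/2) * nrm U (u \<oplus> adj U u)" using u(1) by (metis norm_scale add_closed adj_closed norm_divide norm_numeral norm_one)
  moreover have "nrm U (u \<oplus> adj U u) \<le> nrm U u + nrm U u"
    using norm_triangle[of u "adj U u"] u(1) by (simp add: norm_adj)
  ultimately show ?thesis by (simp add: \<mu>_def)
qed

lemma psd_mult_square:
  assumes "psd q" "w \<in> carrier U" "adj U w = w" "q \<otimes> w = w \<otimes> q"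
  shows "psd (q \<otimes> (w \<otimes> w))"
proof -
  obtain r where r: "psd r" "r \<otimes> r = q" and rc: "\<And>y. \<lbrakk>y \<in> carrier U; q \<otimes> y = y \<otimes> q\<rbrakk> \<Longrightarrow> r \<otimes> y = y \<otimes> r"
    using psd_sqrt[OF assms(1)] by metis
  note r' = psdD[OF r(1)]
  have rw: "r \<otimes> w = w \<otimes> r" using assms(2,4) by (rule rc)
  have "psd ((r \<otimes> w) \<otimes> (r \<otimes> w))" using r' assms(2,3) rw by (intro psd_square) (auto simp: adj_mult)
  moreover have "(r \<otimes> w) \<otimes> (r \<otimes> w) = q \<otimes> (w \<otimes> w)"
    using r' assms(2) rw r(2) by (metis mult_assoc mult_closed)
  ultimately show ?thesis by simp
qed

text \<open>The heart of the Kelley--Vaught theorem. Put \<open>W = w\<^sup>2 = - z\<^sup>* z\<close>. The element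
  \<open>z z\<^sup>* = (z z\<^sup>* + z\<^sup>* z) + W\<close> is positive, so \<open>d = 1 - z z\<^sup>*/l\<close> is a contraction for large \<open>l\<close> and
  \<open>(1 + W/l)\<^sup>n W = - z\<^sup>* d\<^sup>n z\<close> stays bounded in \<open>n\<close>. But it dominates \<open>(n/l) W\<^sup>2\<close>, whence \<open>W = 0\<close>.\<close>

lemma adj_mult_self_negative:
  assumes z: "z \<in> carrier U" and w: "w \<in> carrier U" "adj U w = w"
    and eq: "adj U z \<otimes> z = (-1) \<odot> (w \<otimes> w)"
  shows "z = \<zero>"
proof -
  define W where "W = w \<otimes> w"
  have W: "W \<in> carrier U" "adj U W = W" "psd W"
    using w psd_square by (simp_all add: W_def adj_mult)
  define a where "a = (1/2) \<odot> (z \<oplus> adj U z)"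
  define b where "b = (\<i>/2) \<odot> (z \<ominus> adj U z)"
  have a: "a \<in> carrier U" "adj U a = a"
    using z by (simp_all add: a_def adj_scale adj_add adj_adj add_commute)
  have b: "b \<in> carrier U" "adj U b = b"
  proof -
    show "adj U b = b"
      using z by (intro vec_eqI) (simp_all add: b_def expand_simps functional_simps algebra_simps)
  qed (use z in \<open>simp add: b_def\<close>)
  define Z where "Z = z \<otimes> adj U z"
  have Z: "Z \<in> carrier U" "adj U Z = Z" using z by (simp_all add: Z_def adj_mult adj_adj)
  have "Z = of_real 2 \<odot> (a \<otimes> a) \<oplus> (of_real 2 \<odot> (b \<otimes> b) \<oplus> W)"
    using z w eq by (intro vec_eqI)
      (simp_all add: Z_def a_def b_def W_def expand_simps functional_simps algebra_simps)
  then have "psd Z" using a b W by (simp only:) (intro psd_add psd_scale psd_square, auto)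
  then obtain l where l: "0 < l" "nrm U (of_real l \<odot> e \<ominus> Z) \<le> l" using psd_bound by metis
  define E where "E = (\<lambda>n. ((\<lambda>x. x \<ominus> of_real (1/l) \<odot> (Z \<otimes> x)) ^^ n) z)"
  have E0: "E 0 = z" and ES: "E (Suc n) = E n \<ominus> of_real (1/l) \<odot> (Z \<otimes> E n)" for n
    by (simp_all add: E_def)
  have E: "E n \<in> carrier U" for n by (induction n) (simp_all add: E0 ES z Z)
  have En: "nrm U (E n) \<le> nrm U z" for n
  proof (induction n)
    case (Suc n)
    have "E (Suc n) = of_real (1/l) \<odot> ((of_real l \<odot> e \<ominus> Z) \<otimes> E n)"
      using E[of n] Z l by (intro vec_eqI) (simp_all add: ES expand_simps functional_simps one_left field_simps)
    then have "nrm U (E (Suc n)) = (1/l) * nrm U ((of_real l \<odot> e \<ominus> Z) \<otimes> E n)"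
      using E[of n] Z l by (simp add: norm_scale norm_divide)
    also have "nrm U ((of_real l \<odot> e \<ominus> Z) \<otimes> E n) \<le> nrm U (of_real l \<odot> e \<ominus> Z) * nrm U (E n)"
      using E[of n] Z by (intro norm_mult) auto
    also have "\<dots> \<le> l * nrm U z" using l Suc norm_nonneg[OF E[of n]] by (intro mult_mono) auto
    finally show ?case using l by (simp add: divide_right_mono)
  qed (simp add: E0)
  define c where "c = (\<lambda>n. (-1) \<odot> (adj U z \<otimes> E n))"
  have c: "c n \<in> carrier U" for n using z E by (simp add: c_def)
  have c0: "c 0 = W" using z w eq by (simp add: c_def E0 W_def scale_scale scale_one)
  have cS: "c (Suc n) = c n \<oplus> of_real (1/l) \<odot> (W \<otimes> c n)" for n
  proof -
    have "adj U z \<otimes> (Z \<otimes> E n) = (adj U z \<otimes> z) \<otimes> (adj U z \<otimes> E n)"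
      using z E[of n] by (simp add: Z_def mult_assoc)
    also have "\<dots> = (-1) \<odot> (W \<otimes> (adj U z \<otimes> E n))"
      unfolding eq using z E[of n] w by (simp add: W_def mult_scale_left)
    finally have zZ: "adj U z \<otimes> (Z \<otimes> E n) = (-1) \<odot> (W \<otimes> (adj U z \<otimes> E n))" .
    show ?thesis
      using z E[of n] W Z by (intro vec_eqI)
        (simp_all add: c_def ES mult_vdiff_right mult_scale_right functional_simps zZ)
  qed
  have inv: "psd (c n) \<and> c n \<otimes> w = w \<otimes> c n \<and> psd (c n \<ominus> W) \<and>
    psd ((c n \<ominus> W) \<ominus> of_real (real n / l) \<odot> (W \<otimes> W))" for n
  proof (induction n)
    case 0
    have "psd (0 \<odot> W)" using psd_scale[OF W(3), of 0] by simp
    then have z0: "psd \<zero>" using W by (simp add: scale_0)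
    then show ?case using W w by (simp add: c0 vdiff_self scale_0 vdiff_zero) (simp add: W_def mult_assoc)
  next
    case (Suc n)
    then have IH: "psd (c n)" "c n \<otimes> w = w \<otimes> c n" "psd (c n \<ominus> W)"
      "psd ((c n \<ominus> W) \<ominus> of_real (real n / l) \<odot> (W \<otimes> W))" by auto
    have cW: "c n \<otimes> W = W \<otimes> c n" using IH(2) c[of n] w by (simp add: W_def) (metis mult_assoc)
    have Wc: "psd (of_real (1/l) \<odot> (W \<otimes> c n))"
      using psd_scale[OF psd_mult_square[OF IH(1) w IH(2)], of "1/l"] l cW by (simp add: W_def)
    have "(c n \<ominus> W) \<otimes> w = w \<otimes> (c n \<ominus> W)"
      using IH(2) c[of n] w by (simp add: W_def expand_simps)
    from psd_scale[OF psd_mult_square[OF IH(3) w this], of "1/l"]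
    have cWW: "psd (of_real (1/l) \<odot> ((c n \<ominus> W) \<otimes> W))" using l by (simp add: W_def)
    have "psd (c (Suc n))" unfolding cS by (rule psd_add[OF IH(1) Wc])
    moreover have "c (Suc n) \<otimes> w = w \<otimes> c (Suc n)"
    proof -
      have "(W \<otimes> c n) \<otimes> w = w \<otimes> (W \<otimes> c n)"
        using IH(2) c[of n] w by (simp add: W_def) (metis mult_assoc mult_closed)
      then show ?thesis unfolding cS using IH(2) c[of n] w W
        by (simp add: mult_add_left mult_add_right mult_scale_left mult_scale_right)
    qed
    moreover have "c (Suc n) \<ominus> W = (c n \<ominus> W) \<oplus> of_real (1/l) \<odot> (W \<otimes> c n)"
      unfolding cS using c[of n] W by (intro vec_eqI) (simp_all add: functional_simps)
    then have "psd (c (Suc n) \<ominus> W)" using psd_add[OF IH(3) Wc] by simp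
    moreover have "(c (Suc n) \<ominus> W) \<ominus> of_real (real (Suc n) / l) \<odot> (W \<otimes> W)
      = ((c n \<ominus> W) \<ominus> of_real (real n / l) \<odot> (W \<otimes> W)) \<oplus> of_real (1/l) \<odot> ((c n \<ominus> W) \<otimes> W)"
      unfolding cS using c[of n] W l by (intro vec_eqI)
        (simp_all add: functional_simps mult_vdiff_left cW field_simps)
    then have "psd ((c (Suc n) \<ominus> W) \<ominus> of_real (real (Suc n) / l) \<odot> (W \<otimes> W))"
      using psd_add[OF IH(4) cWW] by simp
    ultimately show ?case by blast
  qed
  define C where "C = nrm U z * nrm U z + nrm U W"
  have bound: "real n * nrm U (W \<otimes> W) \<le> l * C" for n
  proof -
    let ?P = "of_real (real n / l) \<odot> (W \<otimes> W)"
    have "psd ?P" using psd_scale[OF psd_square[OF W(1,2)], of "real n / l"] l by simp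
    then have "nrm U ?P \<le> nrm U (?P \<oplus> ((c n \<ominus> W) \<ominus> ?P))" using inv[of n] by (intro psd_norm_mono) auto
    also have "?P \<oplus> ((c n \<ominus> W) \<ominus> ?P) = c n \<ominus> W"
      using c[of n] W by (intro vec_eqI) (simp_all add: functional_simps)
    also have "nrm U (c n \<ominus> W) \<le> nrm U (c n) + nrm U W" using c W by (intro N_vdiff_le)
    also have "nrm U (c n) = nrm U (adj U z \<otimes> E n)" using z E by (simp add: c_def norm_scale)
    also have "\<dots> \<le> nrm U (adj U z) * nrm U (E n)" using z E by (intro norm_mult) auto
    also have "\<dots> \<le> nrm U z * nrm U z" using z En[of n] by (simp add: norm_adj norm_nonneg mult_left_mono)
    finally have "(real n / l) * nrm U (W \<otimes> W) \<le> C" using W l by (simp add: norm_scale norm_divide C_def)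
    then show ?thesis using l by (simp add: field_simps)
  qed
  have "nrm U (W \<otimes> W) = 0"
  proof (rule ccontr)
    assume "nrm U (W \<otimes> W) \<noteq> 0"
    then have pos: "0 < nrm U (W \<otimes> W)" using norm_nonneg[of "W \<otimes> W"] W by simp
    obtain n where "l * C < real n * nrm U (W \<otimes> W)" using reals_Archimedean3[OF pos] by blast
    then show False using bound[of n] by simp
  qed
  then have "adj U W \<otimes> W = \<zero>" using W by (simp add: norm_eq_zero)
  then have "W = \<zero>" using W(1) adj_mult_self_eq_zero by blast
  then have "adj U z \<otimes> z = \<zero>" using eq by (simp add: W_def[symmetric] scale_zero)
  then show ?thesis using z adj_mult_self_eq_zero by blast
qed

text \<open>Let \<open>h = y\<^sup>* y\<close> and \<open>r = |h|\<close>. The element \<open>z = y (r - h)\<close> satisfies \<open>z\<^sup>* z = - r (r - h)\<^sup>2\<close>,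
  hence vanishes, which forces \<open>h = r\<close>.\<close>

theorem psd_adj_mult_self:
  assumes y: "y \<in> carrier U"
  shows "psd (adj U y \<otimes> y)"
proof -
  define h where "h = adj U y \<otimes> y"
  have h: "h \<in> carrier U" "adj U h = h" using y by (simp_all add: h_def adj_mult adj_adj)
  obtain r where r: "psd r" "r \<otimes> r = h \<otimes> h"
    and rc: "\<And>x. \<lbrakk>x \<in> carrier U; (h \<otimes> h) \<otimes> x = x \<otimes> (h \<otimes> h)\<rbrakk> \<Longrightarrow> r \<otimes> x = x \<otimes> r"
    using psd_sqrt[OF psd_square[OF h]] by metis
  obtain s where s: "psd s" "s \<otimes> s = r"
    and sc: "\<And>x. \<lbrakk>x \<in> carrier U; r \<otimes> x = x \<otimes> r\<rbrakk> \<Longrightarrow> s \<otimes> x = x \<otimes> s"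
    using psd_sqrt[OF r(1)] by metis
  note r' = psdD[OF r(1)] and s' = psdD[OF s(1)]
  have rh: "r \<otimes> h = h \<otimes> r" using h by (intro rc) (simp_all add: mult_assoc)
  define n where "n = r \<ominus> h"
  have n: "n \<in> carrier U" "adj U n = n" using r' h by (simp_all add: n_def adj_vdiff)
  have rn: "r \<otimes> n = n \<otimes> r" using r' h rh by (simp add: n_def expand_simps)
  have sn: "s \<otimes> n = n \<otimes> s" using n(1) rn by (rule sc)
  have hn: "h \<otimes> n = (-1) \<odot> (r \<otimes> n)"
    using r' h r(2) rh by (intro vec_eqI) (simp_all add: n_def expand_simps functional_simps)
  have nh: "n \<otimes> h = (-1) \<odot> (r \<otimes> n)"
    using r' h r(2) rh by (intro vec_eqI) (simp_all add: n_def expand_simps functional_simps)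
  have sq: "(s \<otimes> n) \<otimes> (s \<otimes> n) = r \<otimes> (n \<otimes> n)"
    using s' n sn s(2) by (metis mult_assoc mult_closed)
  have "adj U (y \<otimes> n) \<otimes> (y \<otimes> n) = (n \<otimes> h) \<otimes> n"
    using y n by (simp add: h_def adj_mult mult_assoc)
  also have "\<dots> = (-1) \<odot> ((s \<otimes> n) \<otimes> (s \<otimes> n))"
    unfolding nh sq using r' n by (simp add: mult_scale_left mult_assoc)
  finally have "y \<otimes> n = \<zero>"
    by (intro adj_mult_self_negative[where w = "s \<otimes> n"]) (use y n s' sn in \<open>auto simp: adj_mult\<close>)
  then have "(n \<otimes> h) \<otimes> n = \<zero>"
    using y n by (simp add: h_def mult_assoc mult_zero_right)
  moreover have "r \<otimes> (n \<otimes> n) = (-1) \<odot> ((n \<otimes> h) \<otimes> n)"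
    unfolding nh using r' n by (simp add: mult_scale_left mult_assoc scale_scale scale_one)
  ultimately have rnn: "r \<otimes> (n \<otimes> n) = \<zero>" by (simp add: scale_zero)
  have nn: "n \<otimes> n = 2 \<odot> (r \<otimes> n)"
    using r' h r(2) rh by (intro vec_eqI) (simp_all add: n_def expand_simps functional_simps)
  have "(n \<otimes> n) \<otimes> n = \<zero>"
    unfolding nn using r' n rnn by (simp add: mult_scale_left mult_assoc scale_zero)
  then have "adj U (n \<otimes> n) \<otimes> (n \<otimes> n) = \<zero>"
    using n by (simp add: adj_mult mult_assoc mult_zero_right)
  then have "adj U n \<otimes> n = \<zero>" using n adj_mult_self_eq_zero[of "n \<otimes> n"] by simp
  then have "n = \<zero>" using n(1) adj_mult_self_eq_zero by blast
  then have "h = r" using r' h by (simp add: n_def vdiff_eq_zero)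
  then show ?thesis using r(1) by (simp add: h_def)
qed

end

context cstar_algebra
begin

lemma multiplier_unital: "unital_cstar_algebra MA (mult_one A)"
proof -
  interpret M: cstar_algebra MA by (rule multiplier_cstar_algebra)
  show ?thesis
  proof
    show "mult_one A \<in> carrier MA" by (rule multiplier_ops_closed)
    show "mult_one A \<otimes>\<^bsub>MA\<^esub> m = m" if "m \<in> carrier MA" for m
      using that multiplier_carrierD[OF that] multiplier_ops_closed
      by (intro multiplier_fst_eqI) (auto simp: multiplier_ops)
    show "m \<otimes>\<^bsub>MA\<^esub> mult_one A = m" if "m \<in> carrier MA" for m
      using that multiplier_carrierD[OF that] multiplier_ops_closed
      by (intro multiplier_fst_eqI) (auto simp: multiplier_ops)
  qed
qed

end

text \<open>With \<open>a = \<langle>x, x\<rangle>\<close>, \<open>b = \<langle>x, y\<rangle>\<close> and \<open>l = \<parallel>a\<parallel>\<close>, the positive elements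
  \<open>\<langle>l y - x b, l y - x b\<rangle>\<close>, \<open>l b\<^sup>* b\<close> and \<open>b\<^sup>* (l - a) b\<close> add up to \<open>l\<^sup>2 \<langle>y, y\<rangle>\<close>.\<close>

theorem hilbert_module_cauchy_schwarz:
  assumes "right_hilbert_module A X"
  shows "cauchy_schwarz_module A X"
proof -
  interpret right_hilbert_module A X by fact
  interpret U: unital_cstar_algebra "multiplier_algebra A" "mult_one A" by (rule base.multiplier_unital)
  note \<iota> = star_homD[OF base.mult_of_star_hom]
  show ?thesis
  proof
    fix x y assume xy: "x \<in> carrier X" "y \<in> carrier X"
    define a where "a = ip X x x"
    define b where "b = ip X x y"
    define c where "c = ip X y y"
    define l where "l = nrm A a"
    have abc: "a \<in> carrier A" "b \<in> carrier A" "c \<in> carrier A" using xy by (simp_all add: a_def b_def c_def)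
    have asa: "adj A a = a" using xy by (simp add: a_def ip_adj)
    have yx: "ip X y x = adj A b" using xy by (simp add: b_def ip_adj)
    have l0: "0 \<le> l" using base.norm_nonneg abc by (simp add: l_def)
    have sq: "(nrm A b)\<^sup>2 \<le> l * nrm A c"
    proof (cases "l = 0")
      case True
      then have "x = \<zero>\<^bsub>X\<^esub>" using abc xy ip_definite by (simp add: l_def base.norm_eq_zero a_def)
      then show ?thesis using xy True by (simp add: b_def ip_zero_left base.N_zero)
    next
      case False
      then have l: "0 < l" using l0 by simp
      define v where "v = (of_real l \<odot>\<^bsub>X\<^esub> y) \<ominus>\<^bsub>X\<^esub> ract X x b"
      define p1 where "p1 = ip X v v"
      define p2 where "p2 = of_real l \<odot>\<^bsub>A\<^esub> (adj A b \<otimes>\<^bsub>A\<^esub> b)"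
      define p3 where "p3 = p2 \<ominus>\<^bsub>A\<^esub> (adj A b \<otimes>\<^bsub>A\<^esub> (a \<otimes>\<^bsub>A\<^esub> b))"
      have v: "v \<in> carrier X" using xy abc by (simp add: v_def)
      have p: "p1 \<in> carrier A" "p2 \<in> carrier A" "p3 \<in> carrier A"
        using v abc by (simp_all add: p1_def p2_def p3_def)
      have sum: "of_real (l\<^sup>2) \<odot>\<^bsub>A\<^esub> c = p2 \<oplus>\<^bsub>A\<^esub> (p1 \<oplus>\<^bsub>A\<^esub> p3)"
        using xy abc
        by (intro base.vec_eqI) (simp_all add: p1_def p2_def p3_def v_def ip_simps yx
            a_def[symmetric] b_def[symmetric] c_def[symmetric] base.expand_simps base.functional_simps
            power2_eq_square algebra_simps)
      have pos: "U.psd (mult_of A (adj A d \<otimes>\<^bsub>A\<^esub> d))" if "d \<in> carrier A" for d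
        using U.psd_adj_mult_self[OF \<iota>(2)[OF that]] that by (simp add: \<iota>)
      have "U.psd (mult_of A p1)"
        using ip_positive[OF v] pos unfolding positive_def p1_def by metis
      moreover have p2: "U.psd (mult_of A p2)"
        using U.psd_scale[OF pos[OF abc(2)], of l] l0 abc by (simp add: p2_def \<iota>)
      moreover have "U.psd (mult_of A p3)"
      proof -
        let ?d = "of_real l \<odot>\<^bsub>base.MA\<^esub> mult_one A \<ominus>\<^bsub>base.MA\<^esub> mult_of A a"
        have "U.psd ?d"
          by (rule U.psd_norm_minus)
            (use abc asa \<iota>(6)[of a] \<iota>(2)[of a] in \<open>simp_all add: base.norm_mult_of l_def\<close>)
        then obtain r where r: "U.psd r" "r \<otimes>\<^bsub>base.MA\<^esub> r = ?d" using U.psd_sqrt by metis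
        note r' = U.psdD[OF r(1)]
        let ?B = "mult_of A b"
        have B: "?B \<in> carrier base.MA" "mult_of A a \<in> carrier base.MA" using abc \<iota> by auto
        have "U.psd (adj base.MA (r \<otimes>\<^bsub>base.MA\<^esub> ?B) \<otimes>\<^bsub>base.MA\<^esub> (r \<otimes>\<^bsub>base.MA\<^esub> ?B))"
          using r' B by (intro U.psd_adj_mult_self) auto
        also have "adj base.MA (r \<otimes>\<^bsub>base.MA\<^esub> ?B) \<otimes>\<^bsub>base.MA\<^esub> (r \<otimes>\<^bsub>base.MA\<^esub> ?B)
          = adj base.MA ?B \<otimes>\<^bsub>base.MA\<^esub> ((r \<otimes>\<^bsub>base.MA\<^esub> r) \<otimes>\<^bsub>base.MA\<^esub> ?B)"
          using r' B by (simp add: U.adj_mult U.mult_assoc)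
        also have "\<dots> = mult_of A p3"
          unfolding r(2) using B abc
          by (simp add: U.expand_simps U.one_left p3_def p2_def \<iota> base.linear_vdiff[OF \<iota>(1)])
        finally show ?thesis .
      qed
      ultimately have "nrm base.MA (mult_of A p2)
          \<le> nrm base.MA (mult_of A p2 \<oplus>\<^bsub>base.MA\<^esub> (mult_of A p1 \<oplus>\<^bsub>base.MA\<^esub> mult_of A p3))"
        by (intro U.psd_norm_mono U.psd_add)
      also have "mult_of A p2 \<oplus>\<^bsub>base.MA\<^esub> (mult_of A p1 \<oplus>\<^bsub>base.MA\<^esub> mult_of A p3)
        = mult_of A (of_real (l\<^sup>2) \<odot>\<^bsub>A\<^esub> c)"
        unfolding sum using p by (simp add: \<iota>)
      finally have "nrm A p2 \<le> nrm A (of_real (l\<^sup>2) \<odot>\<^bsub>A\<^esub> c)"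
        using p abc base.norm_mult_of by simp
      then have "l * (nrm A b)\<^sup>2 \<le> l * (l * nrm A c)"
        using l abc by (simp add: p2_def base.norm_scale base.cstar_identity norm_power norm_mult power2_eq_square mult.assoc)
      then show ?thesis using l by simp
    qed
    have "(nrm A (ip X x y))\<^sup>2 \<le> (MN x * MN y)\<^sup>2"
      using sq xy by (simp add: power_mult_distrib MN_square l_def a_def b_def c_def)
    then show "nrm A (ip X x y) \<le> MN x * MN y"
      by (rule power2_le_imp_le) (simp add: MN_nonneg xy)
  qed
qed

section \<open>Approximate units and factorisation\<close>

lemma (in complex_vector_space) vdiff_right_cancel:
  assumes "x \<in> carrier V" "y \<in> carrier V" "z \<in> carrier V"
  shows "x \<ominus> z = y \<ominus> z \<longleftrightarrow> x = y"
proof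
  assume "x \<ominus> z = y \<ominus> z"
  then have "(x \<ominus> z) \<oplus> z = (y \<ominus> z) \<oplus> z" by simp
  moreover have "(x \<ominus> z) \<oplus> z = x" "(y \<ominus> z) \<oplus> z = y"
    using assms by (auto intro!: vec_eqI simp: functional_simps)
  ultimately show "x = y" by simp
qed simp

context cstar_algebra
begin

text \<open>The equation says \<open>e = h\<^sup>2 (h\<^sup>2 + eta)\<^sup>-\<^sup>1\<close>. It implies \<open>(1 + eta) k = eta b + (1 - h\<^sup>2) k\<close> for \<open>k = (1 - e) b\<close>,
  where \<open>1 - h\<^sup>2\<close> is a contraction.\<close>

lemma regularisation_contractive:
  assumes c: "e \<in> carrier A" "h \<in> carrier A" "b \<in> carrier A" and d: "eta > 0"
    and h: "adj A h = h" "nrm A h \<le> 1"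
    and eq: "of_real (1 + eta) \<odot> e = h \<otimes> h \<oplus> (e \<ominus> h \<otimes> (h \<otimes> e))"
  shows "nrm A (b \<ominus> e \<otimes> b) \<le> nrm A b"
proof -
  define k where "k = b \<ominus> e \<otimes> b"
  have k: "k \<in> carrier A" using c by (simp add: k_def)
  have eqb: "of_real (1 + eta) \<odot> (e \<otimes> b) = (h \<otimes> h \<oplus> (e \<ominus> h \<otimes> (h \<otimes> e))) \<otimes> b"
    using c by (simp add: eq[symmetric] mult_scale_left)
  have "of_real (1 + eta) \<odot> k = of_real eta \<odot> b \<oplus> (k \<ominus> h \<otimes> (h \<otimes> k))"
  proof -
    have "of_real (1 + eta) \<odot> k
      = of_real (1 + eta) \<odot> b \<ominus> of_real (1 + eta) \<odot> (e \<otimes> b)"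
      using c by (simp add: k_def scale_vdiff)
    also have "\<dots> = of_real eta \<odot> b \<oplus> (k \<ominus> h \<otimes> (h \<otimes> k))"
      unfolding eqb using c
      by (intro vec_eqI) (simp_all add: k_def expand_simps functional_simps algebra_simps)
    finally show ?thesis .
  qed
  then have "(1 + eta) * nrm A k = nrm A (of_real eta \<odot> b \<oplus> (k \<ominus> h \<otimes> (h \<otimes> k)))"
    using norm_scale[OF k, of "of_real (1 + eta)"] d by (simp del: of_real_add)
  also have "\<dots> \<le> nrm A (of_real eta \<odot> b) + nrm A (k \<ominus> h \<otimes> (h \<otimes> k))"
    using c k by (intro norm_triangle) auto
  also have "\<dots> \<le> eta * nrm A b + nrm A k"
    using contractive_complement_square[OF c(2) h k] c d by (simp add: norm_scale)
  finally show ?thesis using d by (simp add: k_def algebra_simps)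
qed

end

locale star_homomorphism = A: cstar_algebra A + B: cstar_algebra B
  for A :: "'a cstar" and B :: "'b cstar" (structure) and f :: "'a \<Rightarrow> 'b" +
  assumes hom: "star_hom A B f"
begin

lemmas f_simps = star_homD(3-6)[OF hom]

lemma f_closed [simp, intro]: "a \<in> carrier A \<Longrightarrow> f a \<in> carrier B"
  by (rule star_homD(2)[OF hom])

lemma f_vdiff: "\<lbrakk>a \<in> carrier A; b \<in> carrier A\<rbrakk> \<Longrightarrow> f (a \<ominus>\<^bsub>A\<^esub> b) = f a \<ominus> f b"
  using A.linear_vdiff[OF star_homD(1)[OF hom]] .

lemma f_zero: "f \<zero>\<^bsub>A\<^esub> = \<zero>"
  by (rule A.linear_map_zero[OF B.complex_vector_space_axioms
        star_homD(1)[OF hom]])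

lemma f_norm_le: "a \<in> carrier A \<Longrightarrow> nrm B (f a) \<le> nrm A a"
  by (rule star_hom_norm_le[OF A.cstar_algebra_axioms B.cstar_algebra_axioms hom])

lemma f_vlim:
  assumes "A.vlim xs a" "\<And>n. xs n \<in> carrier A" "a \<in> carrier A"
  shows "B.vlim (\<lambda>n. f (xs n)) (f a)"
proof (rule B.vlim_I)
  show "(\<lambda>n. nrm A (xs n \<ominus>\<^bsub>A\<^esub> a)) \<longlonglongrightarrow> 0" using assms(1) by (simp add: A.vlim_def)
  show "nrm B (f (xs n) \<ominus> f a) \<le> nrm A (xs n \<ominus>\<^bsub>A\<^esub> a)" for n
    using f_norm_le[of "xs n \<ominus>\<^bsub>A\<^esub> a"] assms(2)[of n] assms(3) by (simp add: f_vdiff)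
qed (use assms in auto)

text \<open>The actions of \<open>1 - e\<close> on \<open>A\<close> and of \<open>1 - f(e)\<close> on \<open>B\<close>.\<close>

abbreviation "resA e a \<equiv> a \<ominus>\<^bsub>A\<^esub> e \<otimes>\<^bsub>A\<^esub> a"

abbreviation "resB e b \<equiv> b \<ominus> f e \<otimes> b"

text \<open>The condition says \<open>\<parallel>1 - e\<parallel> \<le> 1\<close> on \<open>A\<close> and \<open>\<parallel>1 - f(e)\<parallel> \<le> 1\<close> on \<open>B\<close>. It is kept
  for both algebras at once because the same \<open>e\<close> has to serve in both.\<close>

definition co_contraction :: "'a \<Rightarrow> bool"
  where "co_contraction e \<longleftrightarrow> e \<in> carrier A \<and>
    (\<forall>a\<in>carrier A. nrm A (resA e a) \<le> nrm A a) \<and>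
    (\<forall>b\<in>carrier B. nrm B (resB e b) \<le> nrm B b)"

lemma co_contractionD:
  assumes "co_contraction e"
  shows "e \<in> carrier A" "a \<in> carrier A \<Longrightarrow> nrm A (resA e a) \<le> nrm A a"
    "b \<in> carrier B \<Longrightarrow> nrm B (resB e b) \<le> nrm B b"
  using assms unfolding co_contraction_def by auto

lemma co_contraction_zero: "co_contraction \<zero>\<^bsub>A\<^esub>"
  by (simp add: co_contraction_def A.mult_zero_left B.mult_zero_left f_zero A.vdiff_zero B.vdiff_zero)

text \<open>\<open>1 - (e' + (e - e' e)) = (1 - e') (1 - e)\<close>.\<close>

lemma co_contraction_compose:
  assumes "co_contraction e" "co_contraction e'"
  shows "co_contraction (e' \<oplus>\<^bsub>A\<^esub> resA e' e)"
    and "b \<in> carrier B \<Longrightarrow> resB (e' \<oplus>\<^bsub>A\<^esub> resA e' e) b = resB e' (resB e b)"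
proof -
  note c = co_contractionD(1)[OF assms(1)] co_contractionD(1)[OF assms(2)]
  have eqA: "resA (e' \<oplus>\<^bsub>A\<^esub> resA e' e) a = resA e' (resA e a)" if "a \<in> carrier A" for a
    using that c by (intro A.vec_eqI) (simp_all add: A.expand_simps A.functional_simps)
  show eqB: "resB (e' \<oplus>\<^bsub>A\<^esub> resA e' e) b = resB e' (resB e b)" if "b \<in> carrier B" for b
    using that c by (intro B.vec_eqI)
      (simp_all add: f_simps f_vdiff B.expand_simps B.functional_simps)
  have "nrm A (resA e' (resA e a)) \<le> nrm A a" if "a \<in> carrier A" for a
    using co_contractionD(2)[OF assms(2), of "resA e a"] co_contractionD(2)[OF assms(1) that] that c by simp
  moreover have "nrm B (resB e' (resB e b)) \<le> nrm B b" if "b \<in> carrier B" for b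
    using co_contractionD(3)[OF assms(2), of "resB e b"] co_contractionD(3)[OF assms(1) that] that c by simp
  ultimately show "co_contraction (e' \<oplus>\<^bsub>A\<^esub> resA e' e)"
    unfolding co_contraction_def using c by (auto simp: eqA eqB)
qed

lemma co_contraction_norm: "co_contraction e \<Longrightarrow> nrm A e \<le> 2"
proof -
  assume e: "co_contraction e"
  note c = co_contractionD(1)[OF e]
  have "nrm A (e \<otimes>\<^bsub>A\<^esub> adj A e) \<le> nrm A (adj A e) + nrm A (e \<otimes>\<^bsub>A\<^esub> adj A e \<ominus>\<^bsub>A\<^esub> adj A e)"
    using c by (intro A.N_le_add_vdiff) auto
  also have "\<dots> \<le> 2 * nrm A e"
    using co_contractionD(2)[OF e, of "adj A e"] c
      A.N_vdiff_commute[of "e \<otimes>\<^bsub>A\<^esub> adj A e" "adj A e"] by (simp add: A.norm_adj)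
  finally have "nrm A e * nrm A e \<le> 2 * nrm A e" using c by (simp add: A.cstar_identity' power2_eq_square)
  then show ?thesis using A.norm_nonneg[OF c] by (cases "nrm A e = 0") auto
qed

text \<open>With \<open>h = w w\<^sup>*/s\<close> of norm at most one, \<open>e = h\<^sup>2 (h\<^sup>2 + eta)\<^sup>-\<^sup>1\<close> is the fixed point of a contraction.
  Then \<open>(1 - e) h\<^sup>2 = eta e\<close> is small, and \<open>\<parallel>(1 - e) x\<parallel>\<^sup>2 \<le> \<parallel>(1 - e) x x\<^sup>*\<parallel>\<close> carries smallness from \<open>h\<^sup>2\<close>
  to \<open>h\<close> and from \<open>w w\<^sup>*\<close> to \<open>w\<close>.\<close>

lemma approximate_unit:
  assumes w: "w \<in> carrier A" and eps: "eps > 0"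
  shows "\<exists>e. co_contraction e \<and> nrm A (resA e w) < eps"
proof -
  define s where "s = (nrm A w)\<^sup>2 + 1"
  have s: "0 < s" by (simp add: s_def add_nonneg_pos)
  define h where "h = of_real (1 / s) \<odot>\<^bsub>A\<^esub> (w \<otimes>\<^bsub>A\<^esub> adj A w)"
  have h: "h \<in> carrier A" "adj A h = h" using w by (simp_all add: h_def A.expand_simps)
  have h1: "nrm A h \<le> 1"
    using w s by (simp add: h_def A.norm_scale A.cstar_identity' norm_divide) (simp add: s_def)
  define eta where "eta = eps ^ 4 / (4 * s\<^sup>2)"
  have d: "eta > 0" using eps s by (simp add: eta_def)
  let ?h2 = "\<lambda>x. h \<otimes>\<^bsub>A\<^esub> (h \<otimes>\<^bsub>A\<^esub> x)"
  let ?T = "\<lambda>x. of_real (1 / (1 + eta)) \<odot>\<^bsub>A\<^esub> (h \<otimes>\<^bsub>A\<^esub> h \<oplus>\<^bsub>A\<^esub> (x \<ominus>\<^bsub>A\<^esub> ?h2 x))"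
  obtain e where e: "e \<in> carrier A" "?T e = e"
  proof (rule A.contraction_fixed_point[where f = ?T and r = "1 / (1 + eta)", OF A.complete])
    fix x y assume xy: "x \<in> carrier A" "y \<in> carrier A"
    have "?T x \<ominus>\<^bsub>A\<^esub> ?T y = of_real (1 / (1 + eta)) \<odot>\<^bsub>A\<^esub> ((x \<ominus>\<^bsub>A\<^esub> y) \<ominus>\<^bsub>A\<^esub> ?h2 (x \<ominus>\<^bsub>A\<^esub> y))"
      using xy h by (intro A.vec_eqI) (simp_all add: A.expand_simps A.functional_simps algebra_simps)
    then have "nrm A (?T x \<ominus>\<^bsub>A\<^esub> ?T y)
      = cmod (of_real (1 / (1 + eta))) * nrm A ((x \<ominus>\<^bsub>A\<^esub> y) \<ominus>\<^bsub>A\<^esub> ?h2 (x \<ominus>\<^bsub>A\<^esub> y))"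
      using xy h by (simp add: A.norm_scale del: of_real_divide)
    also have "cmod (of_real (1 / (1 + eta))) = 1 / (1 + eta)" using d by (simp del: of_real_divide)
    also have "1 / (1 + eta) * nrm A ((x \<ominus>\<^bsub>A\<^esub> y) \<ominus>\<^bsub>A\<^esub> ?h2 (x \<ominus>\<^bsub>A\<^esub> y)) \<le> 1 / (1 + eta) * nrm A (x \<ominus>\<^bsub>A\<^esub> y)"
      using A.contractive_complement_square[OF h h1, of "x \<ominus>\<^bsub>A\<^esub> y"] xy d
      by (intro mult_left_mono) auto
    finally show "nrm A (?T x \<ominus>\<^bsub>A\<^esub> ?T y) \<le> 1 / (1 + eta) * nrm A (x \<ominus>\<^bsub>A\<^esub> y)" .
  qed (use h d in auto)
  have "of_real (1 + eta) \<odot>\<^bsub>A\<^esub> ?T e = h \<otimes>\<^bsub>A\<^esub> h \<oplus>\<^bsub>A\<^esub> (e \<ominus>\<^bsub>A\<^esub> ?h2 e)"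
    using e(1) h d by (simp add: A.scale_scale A.scale_one of_real_mult[symmetric] del: of_real_divide of_real_add of_real_mult)
  then have eq: "of_real (1 + eta) \<odot>\<^bsub>A\<^esub> e = h \<otimes>\<^bsub>A\<^esub> h \<oplus>\<^bsub>A\<^esub> (e \<ominus>\<^bsub>A\<^esub> ?h2 e)"
    by (simp only: e(2))
  have "co_contraction e"
    unfolding co_contraction_def
  proof (intro conjI ballI)
    show "nrm A (resA e a) \<le> nrm A a" if "a \<in> carrier A" for a
      by (rule A.regularisation_contractive[OF e(1) h(1) that d h(2) h1 eq])
    show "nrm B (resB e b) \<le> nrm B b" if b: "b \<in> carrier B" for b
    proof (rule B.regularisation_contractive[OF f_closed[OF e(1)] f_closed[OF h(1)] b d])
      show "adj B (f h) = f h" using h by (metis f_simps(4))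
      show "nrm B (f h) \<le> 1" using f_norm_le[OF h(1)] h1 by simp
      have "f (of_real (1 + eta) \<odot>\<^bsub>A\<^esub> e) = f (h \<otimes>\<^bsub>A\<^esub> h \<oplus>\<^bsub>A\<^esub> (e \<ominus>\<^bsub>A\<^esub> ?h2 e))" by (simp only: eq)
      then show "of_real (1 + eta) \<odot> f e
          = (f h \<otimes> f h) \<oplus> (f e \<ominus> f h \<otimes> (f h \<otimes> f e))"
        using e(1) h(1) by (simp add: f_simps f_vdiff)
    qed
  qed (rule e(1))
  have hhe: "of_real eta \<odot>\<^bsub>A\<^esub> e = h \<otimes>\<^bsub>A\<^esub> h \<ominus>\<^bsub>A\<^esub> ?h2 e"
  proof -
    have "of_real eta \<odot>\<^bsub>A\<^esub> e = of_real (1 + eta) \<odot>\<^bsub>A\<^esub> e \<ominus>\<^bsub>A\<^esub> e"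
      using e(1) by (intro A.vec_eqI) (simp_all add: A.functional_simps algebra_simps)
    also have "\<dots> = h \<otimes>\<^bsub>A\<^esub> h \<ominus>\<^bsub>A\<^esub> ?h2 e"
      unfolding eq using e(1) h(1) by (intro A.vec_eqI) (simp_all add: A.functional_simps)
    finally show ?thesis .
  qed
  define e' where "e' = adj A e"
  have e': "e' \<in> carrier A" using e(1) by (simp add: e'_def)
  have "adj A (of_real eta \<odot>\<^bsub>A\<^esub> e) = adj A (h \<otimes>\<^bsub>A\<^esub> h \<ominus>\<^bsub>A\<^esub> ?h2 e)" by (simp only: hhe)
  then have e'hh: "of_real eta \<odot>\<^bsub>A\<^esub> e' = h \<otimes>\<^bsub>A\<^esub> h \<ominus>\<^bsub>A\<^esub> e' \<otimes>\<^bsub>A\<^esub> (h \<otimes>\<^bsub>A\<^esub> h)"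
    using e(1) h by (simp add: A.expand_simps e'_def)
  \<comment> \<open>Both \<open>e\<close> and \<open>e\<^sup>*\<close> are \<open>h\<^sup>2 (h\<^sup>2 + eta)\<^sup>-\<^sup>1\<close>: compare \<open>e\<^sup>* (h\<^sup>2 + eta) e\<close> computed in two ways.\<close>
  have "e' = e"
  proof -
    have hh_eq: "?h2 e = h \<otimes>\<^bsub>A\<^esub> h \<ominus>\<^bsub>A\<^esub> of_real eta \<odot>\<^bsub>A\<^esub> e"
      unfolding hhe using e(1) h(1) by (intro A.vec_eqI) (simp_all add: A.functional_simps)
    have e'hh_eq: "e' \<otimes>\<^bsub>A\<^esub> (h \<otimes>\<^bsub>A\<^esub> h) = h \<otimes>\<^bsub>A\<^esub> h \<ominus>\<^bsub>A\<^esub> of_real eta \<odot>\<^bsub>A\<^esub> e'"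
      unfolding e'hh using e' h(1) by (intro A.vec_eqI) (simp_all add: A.functional_simps)
    have "(e' \<otimes>\<^bsub>A\<^esub> (h \<otimes>\<^bsub>A\<^esub> h)) \<otimes>\<^bsub>A\<^esub> e = e' \<otimes>\<^bsub>A\<^esub> ?h2 e" using e(1) e' h(1) by (simp add: A.mult_assoc)
    then have "?h2 e \<ominus>\<^bsub>A\<^esub> of_real eta \<odot>\<^bsub>A\<^esub> (e' \<otimes>\<^bsub>A\<^esub> e)
        = e' \<otimes>\<^bsub>A\<^esub> (h \<otimes>\<^bsub>A\<^esub> h) \<ominus>\<^bsub>A\<^esub> of_real eta \<odot>\<^bsub>A\<^esub> (e' \<otimes>\<^bsub>A\<^esub> e)"
      unfolding e'hh_eq hh_eq using e(1) e' h(1)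
      by (simp add: A.mult_vdiff_left A.mult_vdiff_right A.mult_scale_left A.mult_scale_right A.mult_assoc hh_eq e'hh_eq)
    then have "?h2 e = e' \<otimes>\<^bsub>A\<^esub> (h \<otimes>\<^bsub>A\<^esub> h)" using e(1) e' h(1) by (simp add: A.vdiff_right_cancel)
    then have "of_real eta \<odot>\<^bsub>A\<^esub> e' = of_real eta \<odot>\<^bsub>A\<^esub> e" unfolding e'hh hhe by simp
    then have "of_real (1/eta) \<odot>\<^bsub>A\<^esub> (of_real eta \<odot>\<^bsub>A\<^esub> e') = of_real (1/eta) \<odot>\<^bsub>A\<^esub> (of_real eta \<odot>\<^bsub>A\<^esub> e)" by simp
    then show ?thesis using e(1) e' d by (simp add: A.scale_scale A.scale_one)
  qed
  then have ehh: "of_real eta \<odot>\<^bsub>A\<^esub> e = h \<otimes>\<^bsub>A\<^esub> h \<ominus>\<^bsub>A\<^esub> e \<otimes>\<^bsub>A\<^esub> (h \<otimes>\<^bsub>A\<^esub> h)" using e'hh by simp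
  have kk: "(nrm A (resA e x))\<^sup>2 \<le> nrm A (x \<otimes>\<^bsub>A\<^esub> adj A x \<ominus>\<^bsub>A\<^esub> e \<otimes>\<^bsub>A\<^esub> (x \<otimes>\<^bsub>A\<^esub> adj A x))"
    if x: "x \<in> carrier A" for x
  proof -
    let ?y = "x \<otimes>\<^bsub>A\<^esub> adj A x \<ominus>\<^bsub>A\<^esub> e \<otimes>\<^bsub>A\<^esub> (x \<otimes>\<^bsub>A\<^esub> adj A x)"
    have y: "?y \<in> carrier A" using x e(1) by simp
    have "(resA e x) \<otimes>\<^bsub>A\<^esub> adj A (resA e x) = adj A (adj A ?y \<ominus>\<^bsub>A\<^esub> e \<otimes>\<^bsub>A\<^esub> adj A ?y)"
      using x e(1) by (intro A.vec_eqI) (simp_all add: A.expand_simps A.functional_simps)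
    then have "(nrm A (resA e x))\<^sup>2 = nrm A (adj A ?y \<ominus>\<^bsub>A\<^esub> e \<otimes>\<^bsub>A\<^esub> adj A ?y)"
      using x e(1) y A.cstar_identity'[of "resA e x"] A.norm_adj[of "adj A ?y \<ominus>\<^bsub>A\<^esub> e \<otimes>\<^bsub>A\<^esub> adj A ?y"] by simp
    also have "\<dots> \<le> nrm A (adj A ?y)"
      using y by (intro co_contractionD(2)[OF \<open>co_contraction e\<close>]) simp
    finally show ?thesis using A.norm_adj[OF y] by simp
  qed
  have "(nrm A (resA e h))\<^sup>2 \<le> eta * nrm A e"
    using kk[OF h(1)] A.norm_scale[OF e(1), of "of_real eta"] d by (simp add: h(2) ehh)
  also have "\<dots> \<le> eta * 2" using co_contraction_norm[OF \<open>co_contraction e\<close>] d by simp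
  finally have hk: "(nrm A (resA e h))\<^sup>2 \<le> 2 * eta" by simp
  have wh: "w \<otimes>\<^bsub>A\<^esub> adj A w = of_real s \<odot>\<^bsub>A\<^esub> h"
    using w s by (simp add: h_def A.scale_scale A.scale_one)
  have "(nrm A (resA e w))\<^sup>2 \<le> s * nrm A (resA e h)"
    using kk[OF w] e(1) h(1) s
    by (simp add: wh A.mult_scale_right A.scale_vdiff[symmetric] A.norm_scale)
  then have "((nrm A (resA e w))\<^sup>2)\<^sup>2 \<le> (s * nrm A (resA e h))\<^sup>2"
    by (intro power_mono) auto
  also have "\<dots> \<le> s\<^sup>2 * (2 * eta)"
    using mult_left_mono[OF hk, of "s\<^sup>2"] by (simp only: power_mult_distrib zero_le_power2)
  also have "\<dots> = eps ^ 4 / 2" using s by (simp add: eta_def)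
  also have "\<dots> < eps ^ 4" using eps by simp
  finally have "nrm A (resA e w) ^ 4 < eps ^ 4" by simp
  then have "nrm A (resA e w) < eps" using eps by (meson less_imp_le power_less_imp_less_base)
  then show ?thesis using \<open>co_contraction e\<close> by blast
qed

end

locale nondegenerate_homomorphism = star_homomorphism +
  assumes nondegenerate: "nondegenerate_hom A B f"
begin

text \<open>The elements \<open>y\<close> that can be made small by some \<open>1 - f(e)\<close> after any previous application of
  \<open>1 - f(d)\<close> form a closed subspace, because co-contractions compose: what made the first summand
  small does no harm to the treatment of the second.\<close>

lemma approximate_unit_range:
  assumes y: "y \<in> carrier B" and eps: "eps > 0"
  shows "\<exists>e. co_contraction e \<and> nrm B (resB e y) < eps"
proof -
  define V where "V = {y \<in> carrier B. \<forall>d eps. co_contraction d \<longrightarrow> eps > 0 \<longrightarrow>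
    (\<exists>e. co_contraction e \<and> nrm B (resB e (resB d y)) < eps)}"
  have VD: "\<exists>e. co_contraction e \<and> nrm B (resB e (resB d y)) < eps"
    if "y \<in> V" "co_contraction d" "eps > 0" for y d eps using that unfolding V_def by blast
  have VI: "y \<in> V" if "y \<in> carrier B" "\<And>d eps. \<lbrakk>co_contraction d; eps > 0\<rbrakk> \<Longrightarrow>
    \<exists>e. co_contraction e \<and> nrm B (resB e (resB d y)) < eps" for y using that unfolding V_def by blast
  have VB: "V \<subseteq> carrier B" unfolding V_def by blast
  have rc: "resB e y \<in> carrier B" if "co_contraction e" "y \<in> carrier B" for e y
    using that co_contractionD(1)[OF that(1)] by simp
  have radd: "resB e (x \<oplus> y) = resB e x \<oplus> resB e y"
    if "co_contraction e" "x \<in> carrier B" "y \<in> carrier B" for e x y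
    using that f_closed[OF co_contractionD(1)[OF that(1)]]
    by (intro B.vec_eqI) (simp_all add: B.expand_simps B.functional_simps)
  have rscale: "resB e (c \<odot> x) = c \<odot> resB e x" if "co_contraction e" "x \<in> carrier B" for e c x
    using that f_closed[OF co_contractionD(1)[OF that(1)]] by (simp add: B.mult_scale_right B.scale_vdiff)
  have rr: "nrm B (resB e (resB d x)) \<le> nrm B x" if "co_contraction e" "co_contraction d" "x \<in> carrier B" for e d x
    using co_contractionD(3)[OF that(1) rc[OF that(2,3)]] co_contractionD(3)[OF that(2,3)] by simp
  have "closed_subspace B V"
  proof (rule B.closed_subspaceI[OF VB])
    show "\<zero> \<in> V"
      by (rule VI) (auto dest: co_contractionD(1) simp: B.mult_zero_right B.vdiff_zero B.N_zero
        intro!: exI[of _ "\<zero>\<^bsub>A\<^esub>"] co_contraction_zero)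
  next
    fix x y assume xy: "x \<in> V" "y \<in> V"
    then have c: "x \<in> carrier B" "y \<in> carrier B" using VB by auto
    show "x \<oplus> y \<in> V"
    proof (rule VI)
      fix d and eps :: real assume d: "co_contraction d" and "eps > 0"
      then have e2: "eps / 2 > 0" by simp
      obtain e where e: "co_contraction e" "nrm B (resB e (resB d x)) < eps / 2" using VD[OF xy(1) d e2] by blast
      let ?d = "e \<oplus>\<^bsub>A\<^esub> (d \<ominus>\<^bsub>A\<^esub> e \<otimes>\<^bsub>A\<^esub> d)"
      note cd = co_contraction_compose(1)[OF d e(1)]
      obtain e' where e': "co_contraction e'" "nrm B (resB e' (resB ?d y)) < eps / 2" using VD[OF xy(2) cd e2] by blast
      let ?e = "e' \<oplus>\<^bsub>A\<^esub> (e \<ominus>\<^bsub>A\<^esub> e' \<otimes>\<^bsub>A\<^esub> e)"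
      have eq: "resB ?e (resB d z) = resB e' (resB e (resB d z))" if "z \<in> carrier B" for z
        by (rule co_contraction_compose(2)[OF e(1) e'(1) rc[OF d that]])
      have "nrm B (resB ?e (resB d (x \<oplus> y))) \<le> nrm B (resB e' (resB e (resB d x))) + nrm B (resB e' (resB e (resB d y)))"
        unfolding eq[OF B.add_closed[OF c]] unfolding radd[OF d c] radd[OF e(1) rc[OF d c(1)] rc[OF d c(2)]]
          radd[OF e'(1) rc[OF e(1) rc[OF d c(1)]] rc[OF e(1) rc[OF d c(2)]]]
        by (rule B.norm_triangle[OF rc[OF e'(1) rc[OF e(1) rc[OF d c(1)]]] rc[OF e'(1) rc[OF e(1) rc[OF d c(2)]]]])
      moreover have "nrm B (resB e' (resB e (resB d x))) \<le> nrm B (resB e (resB d x))"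
        by (rule co_contractionD(3)[OF e'(1) rc[OF e(1) rc[OF d c(1)]]])
      moreover have "resB e (resB d y) = resB ?d y" by (rule co_contraction_compose(2)[OF d e(1) c(2), symmetric])
      ultimately have "nrm B (resB ?e (resB d (x \<oplus> y))) < eps" using e(2) e'(2) by simp
      then show "\<exists>e. co_contraction e \<and> nrm B (resB e (resB d (x \<oplus> y))) < eps"
        using co_contraction_compose(1)[OF e(1) e'(1)] by blast
    qed (use c in simp)
  next
    fix c x assume x: "x \<in> V"
    then have xc: "x \<in> carrier B" using VB by auto
    show "c \<odot> x \<in> V"
    proof (rule VI)
      fix d and eps :: real assume d: "co_contraction d" and "eps > 0"
      have pos: "0 < cmod c + 1" by (simp add: add_nonneg_pos)
      then have "0 < eps / (cmod c + 1)" using \<open>eps > 0\<close> by simp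
      from VD[OF x d this] obtain e where e: "co_contraction e" "nrm B (resB e (resB d x)) < eps / (cmod c + 1)" by blast
      note r = rc[OF e(1) rc[OF d xc]]
      have "nrm B (resB e (resB d (c \<odot> x))) = cmod c * nrm B (resB e (resB d x))"
        using r by (simp only: rscale[OF d xc] rscale[OF e(1) rc[OF d xc]] B.norm_scale)
      also have "\<dots> \<le> (cmod c + 1) * nrm B (resB e (resB d x))" by (rule mult_right_mono[OF _ B.norm_nonneg[OF r]]) simp
      also have "\<dots> < eps" using e(2) pos by (simp add: pos_less_divide_eq mult.commute)
      finally show "\<exists>e. co_contraction e \<and> nrm B (resB e (resB d (c \<odot> x))) < eps" using e(1) by blast
    qed (use xc in simp)
  next
    fix x assume x: "x \<in> carrier B" and ap: "\<And>eps. eps > 0 \<Longrightarrow> \<exists>w\<in>V. nrm B (x \<ominus> w) < eps"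
    show "x \<in> V"
    proof (rule VI[OF x])
      fix d and eps :: real assume d: "co_contraction d" and "eps > 0"
      then have e2: "eps / 2 > 0" by simp
      obtain y where y: "y \<in> V" "nrm B (x \<ominus> y) < eps / 2" using ap[OF e2] by blast
      have yc: "y \<in> carrier B" "x \<ominus> y \<in> carrier B" using x y VB by auto
      obtain e where e: "co_contraction e" "nrm B (resB e (resB d y)) < eps / 2" using VD[OF y(1) d e2] by blast
      have "(x \<ominus> y) \<oplus> y = x" using x yc by (intro B.vec_eqI) (simp_all add: B.functional_simps)
      then have "resB e (resB d x) = resB e (resB d (x \<ominus> y)) \<oplus> resB e (resB d y)"
        using radd[OF d yc(2,1)] radd[OF e(1) rc[OF d yc(2)] rc[OF d yc(1)]] by simp
      then have "nrm B (resB e (resB d x)) < eps"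
        using B.norm_triangle[OF rc[OF e(1) rc[OF d yc(2)]] rc[OF e(1) rc[OF d yc(1)]]]
          rr[OF e(1) d yc(2)] e(2) y(2) by simp
      then show "\<exists>e. co_contraction e \<and> nrm B (resB e (resB d x)) < eps" using e(1) by blast
    qed
  qed
  moreover have "{f a \<otimes> b | a b. a \<in> carrier A \<and> b \<in> carrier B} \<subseteq> V"
  proof clarify
    fix a b assume ab: "a \<in> carrier A" "b \<in> carrier B"
    show "f a \<otimes> b \<in> V"
    proof (rule VI)
      fix d and eps :: real assume d: "co_contraction d" and "eps > 0"
      have pos: "0 < nrm B b + 1" using B.norm_nonneg[OF ab(2)] by simp
      have dc: "d \<in> carrier A" "resA d a \<in> carrier A" using co_contractionD(1)[OF d] ab by simp_all
      obtain e where e: "co_contraction e" "nrm A (resA e (resA d a)) < eps / (nrm B b + 1)"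
        using approximate_unit[OF dc(2), of "eps / (nrm B b + 1)"] \<open>eps > 0\<close> pos by auto
      have ec: "e \<in> carrier A" "resA e (resA d a) \<in> carrier A" using co_contractionD(1)[OF e(1)] dc by simp_all
      have r: "resB c (f x \<otimes> b) = f (resA c x) \<otimes> b" if "c \<in> carrier A" "x \<in> carrier A" for c x
        using that ab by (simp add: f_simps f_vdiff B.mult_vdiff_left B.mult_assoc)
      have "nrm B (resB e (resB d (f a \<otimes> b))) \<le> nrm B (f (resA e (resA d a))) * nrm B b"
        unfolding r[OF dc(1) ab(1)] r[OF ec(1) dc(2)] by (rule B.norm_mult[OF f_closed[OF ec(2)] ab(2)])
      also have "\<dots> \<le> nrm A (resA e (resA d a)) * (nrm B b + 1)"
        using f_norm_le[OF ec(2)] A.norm_nonneg[OF ec(2)] B.norm_nonneg[OF ab(2)] by (intro mult_mono) auto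
      also have "\<dots> < eps" using e(2) pos by (simp add: pos_less_divide_eq)
      finally show "\<exists>e. co_contraction e \<and> nrm B (resB e (resB d (f a \<otimes> b))) < eps" using e(1) by blast
    qed (use ab in simp)
  qed
  ultimately have "closed_subspace B hull {f a \<otimes> b | a b. a \<in> carrier A \<and> b \<in> carrier B} \<subseteq> V"
    by (intro hull_minimal)
  then have "y \<in> V" using y nondegenerate unfolding nondegenerate_hom_def by auto
  from VD[OF this co_contraction_zero eps] show ?thesis
    using y by (simp add: f_zero B.mult_zero_left B.vdiff_zero)
qed

text \<open>Cohen factorisation. Starting from \<open>b\<^sub>0 = 1\<close>, put \<open>b\<^sub>n\<^sub>+\<^sub>1 = b\<^sub>n - 2\<^bsup>-n-1\<^esup> (1 - f(e\<^sub>n))\<close>, so that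
  \<open>b\<^sub>n = f(a\<^sub>n) + 2\<^bsup>-n\<^esup>\<close>. By induction \<open>b\<^sub>n\<close> is invertible with \<open>\<parallel>b\<^sub>n\<^sup>-\<^sup>1\<parallel> \<le> 2\<^sup>n\<close>, whatever the \<open>e\<^sub>n\<close> are;
  choosing \<open>e\<^sub>n\<close> as an approximate unit for \<open>z\<^sub>n = b\<^sub>n\<^sup>-\<^sup>1 w\<close> makes the \<open>z\<^sub>n\<close> converge.\<close>

lemma factorisation:
  assumes w: "w \<in> carrier B"
  shows "\<exists>a z. a \<in> carrier A \<and> z \<in> carrier B \<and> w = f a \<otimes> z"
proof -
  define r :: "nat \<Rightarrow> real" where "r = (\<lambda>n. (1/2) ^ n)"
  have r: "0 < r n" "r (Suc n) = r n / 2" for n by (simp_all add: r_def)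
  define b where "b = (\<lambda>n a z. f a \<otimes> z \<oplus> (of_real (r n) \<odot> z))"
  define P where "P = (\<lambda>n p. fst p \<in> carrier A \<and> snd p \<in> carrier B \<and> b n (fst p) (snd p) = w \<and>
    (\<forall>z\<in>carrier B. r n * nrm B z \<le> nrm B (b n (fst p) z)) \<and>
    (\<forall>y\<in>carrier B. \<exists>z\<in>carrier B. b n (fst p) z = y))"
  define Q where "Q = (\<lambda>n p p'. nrm A (fst p' \<ominus>\<^bsub>A\<^esub> fst p) \<le> r n \<and> nrm B (snd p' \<ominus> snd p) \<le> r n)"
  have bc: "b n a z \<in> carrier B" if "a \<in> carrier A" "z \<in> carrier B" for n a z
    using that by (simp add: b_def)
  have bdiff: "b n a (z \<ominus> z') = b n a z \<ominus> b n a z'"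
    if "a \<in> carrier A" "z \<in> carrier B" "z' \<in> carrier B" for n a z z'
    using that by (intro B.vec_eqI) (simp_all add: b_def B.expand_simps B.functional_simps algebra_simps)
  have b0: "b 0 \<zero>\<^bsub>A\<^esub> z = z" if "z \<in> carrier B" for z
    using that by (simp add: b_def r_def f_zero B.mult_zero_left B.scale_one B.zero_add)
  have "P 0 (\<zero>\<^bsub>A\<^esub>, w)"
    unfolding P_def using w by (auto simp: b0 r_def intro!: bexI)
  moreover have "\<exists>p'. P (Suc n) p' \<and> Q n p p'" if P: "P n p" for n p
  proof -
    obtain a z where p: "p = (a, z)" by (cases p)
    have a: "a \<in> carrier A" and z: "z \<in> carrier B" and bz: "b n a z = w"
      and low: "\<And>z. z \<in> carrier B \<Longrightarrow> r n * nrm B z \<le> nrm B (b n a z)"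
      and surj: "\<forall>y\<in>carrier B. \<exists>z\<in>carrier B. b n a z = y"
      using P by (auto simp: P_def p)
    obtain e where e: "co_contraction e" "nrm B (resB e z) < r n"
      using approximate_unit_range[OF z r(1)] by blast
    note ec = co_contractionD(1)[OF e(1)]
    define a' where "a' = a \<oplus>\<^bsub>A\<^esub> of_real (r (Suc n)) \<odot>\<^bsub>A\<^esub> e"
    have a': "a' \<in> carrier A" using a ec by (simp add: a'_def)
    have step: "b (Suc n) a' y = b n a y \<ominus> of_real (r (Suc n)) \<odot> (resB e y)"
      if "y \<in> carrier B" for y
      using a ec that by (intro B.vec_eqI)
        (simp_all add: b_def a'_def f_simps B.expand_simps B.functional_simps r(2) field_simps)
    have small: "nrm B (of_real (r (Suc n)) \<odot> (resB e y)) \<le> r (Suc n) * nrm B y"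
      if "y \<in> carrier B" for y
      using co_contractionD(3)[OF e(1) that] that ec r(1)[of "Suc n"] by (simp add: B.norm_scale)
    have low': "r (Suc n) * nrm B y \<le> nrm B (b (Suc n) a' y)" if y: "y \<in> carrier B" for y
    proof -
      let ?d = "of_real (r (Suc n)) \<odot> (resB e y)"
      have d: "?d \<in> carrier B" using y ec by simp
      have "b n a y \<ominus> b (Suc n) a' y = ?d"
        unfolding step[OF y] using bc[OF a y] d by (intro B.vec_eqI) (simp_all add: B.functional_simps)
      then have "nrm B (b n a y) \<le> nrm B (b (Suc n) a' y) + nrm B ?d"
        using B.N_le_add_vdiff[OF bc[OF a y] bc[OF a' y], of n "Suc n"] by simp
      moreover have "r (Suc n) * nrm B y + r (Suc n) * nrm B y = r n * nrm B y" by (simp add: r(2))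
      ultimately show ?thesis using low[OF y] small[OF y] by linarith
    qed
    have surj': "\<exists>x\<in>carrier B. b (Suc n) a' x = y" if y: "y \<in> carrier B" for y
    proof -
      have "\<exists>g. \<forall>y\<in>carrier B. g y \<in> carrier B \<and> b n a (g y) = y"
        using surj by (intro bchoice) blast
      then obtain g where g: "\<And>y. y \<in> carrier B \<Longrightarrow> g y \<in> carrier B" "\<And>y. y \<in> carrier B \<Longrightarrow> b n a (g y) = y"
        by blast
      let ?v = "\<lambda>x. y \<oplus> of_real (r (Suc n)) \<odot> (resB e x)"
      have v: "?v x \<in> carrier B" if "x \<in> carrier B" for x using that y ec by simp
      obtain x where x: "x \<in> carrier B" "g (?v x) = x"
      proof (rule B.contraction_fixed_point[where f = "\<lambda>x. g (?v x)" and r = "1/2", OF B.complete])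
        fix x x' assume xx: "x \<in> carrier B" "x' \<in> carrier B"
        have "r n * nrm B (g (?v x) \<ominus> g (?v x')) \<le> nrm B (b n a (g (?v x) \<ominus> g (?v x')))"
          using xx v g(1) by (intro low) auto
        also have "b n a (g (?v x) \<ominus> g (?v x')) = ?v x \<ominus> ?v x'"
          using bdiff[OF a g(1)[OF v[OF xx(1)]] g(1)[OF v[OF xx(2)]]] g(2)[OF v[OF xx(1)]] g(2)[OF v[OF xx(2)]] by simp
        also have "?v x \<ominus> ?v x' = of_real (r (Suc n)) \<odot> ((x \<ominus> x') \<ominus> f e \<otimes> (x \<ominus> x'))"
          using xx y ec by (intro B.vec_eqI) (simp_all add: B.expand_simps B.functional_simps algebra_simps)
        also have "nrm B \<dots> \<le> r (Suc n) * nrm B (x \<ominus> x')" using xx by (intro small) auto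
        finally have "r n * nrm B (g (?v x) \<ominus> g (?v x')) \<le> r n * (1/2 * nrm B (x \<ominus> x'))"
          by (simp add: r(2))
        then show "nrm B (g (?v x) \<ominus> g (?v x')) \<le> 1/2 * nrm B (x \<ominus> x')"
          using r(1)[of n] by (simp only: mult_le_cancel_left_pos)
      qed (use g(1) v in auto)
      have "b n a x = ?v x" using g(2)[OF v[OF x(1)]] x(2) by simp
      then have "b (Suc n) a' x = y"
        unfolding step[OF x(1)] using x(1) y ec by (intro B.vec_eqI) (simp_all add: B.functional_simps)
      then show ?thesis using x(1) by blast
    qed
    obtain z' where z': "z' \<in> carrier B" "b (Suc n) a' z' = w" using surj'[OF w] by blast
    have "r (Suc n) * nrm B (z' \<ominus> z) \<le> nrm B (b (Suc n) a' (z' \<ominus> z))"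
      using z z' by (intro low') auto
    also have "b (Suc n) a' (z' \<ominus> z) = of_real (r (Suc n)) \<odot> (resB e z)"
      using bdiff[OF a' z'(1) z, of "Suc n"] z'(2) step[OF z] bz w z ec
      by (simp) (intro B.vec_eqI, simp_all add: B.functional_simps)
    also have "nrm B \<dots> = r (Suc n) * nrm B (resB e z)"
      using z ec r(1)[of "Suc n"] by (simp add: B.norm_scale)
    finally have "nrm B (z' \<ominus> z) \<le> nrm B (resB e z)"
      using r(1)[of "Suc n"] by simp
    then have zz: "nrm B (z' \<ominus> z) \<le> r n" using e(2) by simp
    have "a' \<ominus>\<^bsub>A\<^esub> a = of_real (r (Suc n)) \<odot>\<^bsub>A\<^esub> e"
      using a ec by (intro A.vec_eqI) (simp_all add: a'_def A.functional_simps)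
    then have "nrm A (a' \<ominus>\<^bsub>A\<^esub> a) = r (Suc n) * nrm A e"
      using ec r(1)[of "Suc n"] by (simp add: A.norm_scale)
    also have "\<dots> \<le> r (Suc n) * 2" using co_contraction_norm[OF e(1)] r(1)[of "Suc n"] by simp
    finally have aa: "nrm A (a' \<ominus>\<^bsub>A\<^esub> a) \<le> r n" by (simp add: r(2))
    have "P (Suc n) (a', z')" unfolding P_def using a' z' low' surj' by simp
    moreover have "Q n p (a', z')" unfolding Q_def p using aa zz by simp
    ultimately show ?thesis by blast
  qed
  ultimately obtain p where p: "\<And>n. P n (p n)" "\<And>n. Q n (p n) (p (Suc n))"
    using dependent_nat_choice[of P Q] by blast
  define xs where "xs = (\<lambda>n. fst (p n))"
  define ys where "ys = (\<lambda>n. snd (p n))"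
  have s: "xs n \<in> carrier A" and t: "ys n \<in> carrier B" and bw: "b n (xs n) (ys n) = w" for n
    using p(1)[of n] by (simp_all add: P_def xs_def ys_def)
  have sd: "nrm A (xs (Suc n) \<ominus>\<^bsub>A\<^esub> xs n) \<le> r n" and td: "nrm B (ys (Suc n) \<ominus> ys n) \<le> r n" for n
    using p(2)[of n] by (simp_all add: Q_def xs_def ys_def)
  have summable: "summable r" unfolding r_def by (rule summable_geometric) simp
  have "\<exists>a. a \<in> carrier A \<and> A.vlim xs a"
    by (rule A.mcomplete_summable[where xs = xs, OF A.complete s sd summable]) auto
  then obtain a where a: "a \<in> carrier A" "A.vlim xs a" by blast
  have "\<exists>z. z \<in> carrier B \<and> B.vlim ys z"
    by (rule B.mcomplete_summable[where xs = ys, OF B.complete t td summable]) auto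
  then obtain z where z: "z \<in> carrier B" "B.vlim ys z" by blast
  have "B.vlim (\<lambda>n. f (xs n) \<otimes> ys n) (f a \<otimes> z)"
    by (rule B.vlim_mult[OF f_vlim[OF a(2) s a(1)] z(2)]) (use s t a z in auto)
  moreover have "B.vlim (\<lambda>n. f (xs n) \<otimes> ys n) w"
  proof (rule B.vlim_I)
    have "r \<longlonglongrightarrow> 0" using summable by (rule summable_LIMSEQ_zero)
    from tendsto_mult[OF this tendsto_add[OF z(2)[unfolded B.vlim_def] tendsto_const]]
    show "(\<lambda>n. r n * (nrm B (ys n \<ominus> z) + nrm B z)) \<longlonglongrightarrow> 0" by simp
    fix n
    have "f (xs n) \<otimes> ys n \<ominus> w = of_real (- r n) \<odot> ys n"
      unfolding bw[of n, symmetric] b_def using s t by (intro B.vec_eqI) (simp_all add: B.functional_simps)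
    then have "nrm B (f (xs n) \<otimes> ys n \<ominus> w) = r n * nrm B (ys n)"
      using t r(1)[of n] by (simp add: B.norm_scale)
    also have "\<dots> \<le> r n * (nrm B (ys n \<ominus> z) + nrm B z)"
      using B.N_le_add_vdiff[OF t[of n] z(1)] r(1)[of n] by (simp add: add.commute)
    finally show "nrm B (f (xs n) \<otimes> ys n \<ominus> w) \<le> r n * (nrm B (ys n \<ominus> z) + nrm B z)" .
  qed (use s t w in auto)
  ultimately have "f a \<otimes> z = w" using B.vlim_unique s t a z w by blast
  then show ?thesis using a(1) z(1) by blast
qed

end

section \<open>Extension of nondegenerate homomorphisms to multipliers\<close>

context nondegenerate_homomorphism
begin

lemma factorisation_right:
  assumes w: "w \<in> carrier B"
  shows "\<exists>a z. a \<in> carrier A \<and> z \<in> carrier B \<and> w = z \<otimes> f a"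
proof -
  obtain a z where az: "a \<in> carrier A" "z \<in> carrier B" "adj B w = f a \<otimes> z"
    using factorisation[of "adj B w"] w by auto
  have "w = adj B (f a \<otimes> z)" using w by (simp add: az(3)[symmetric] B.adj_adj)
  also have "\<dots> = adj B z \<otimes> f (adj A a)" using az by (simp add: B.adj_mult f_simps)
  finally show ?thesis using az(1,2) by blast
qed

text \<open>A multiplier \<open>m\<close> acts on \<open>B = f(A) B\<close> by \<open>f(a) z \<mapsto> f(m a) z\<close>. Every choice of factorisations
  yields a pair satisfying the centralizer identity, which already implies that the choices do
  not matter and that the maps are linear and bounded.\<close>

lemma multiplier_lift_exists:
  assumes m: "m \<in> carrier A.MA"
  shows "\<exists>n. n \<in> carrier B.MA \<and>
    (\<forall>a\<in>carrier A. \<forall>b\<in>carrier B. fst n (f a \<otimes> b) = f (fst m a) \<otimes> b)"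
proof -
  note mD = A.multiplier_carrierD[OF m]
  have "\<forall>w\<in>carrier B. \<exists>p. fst p \<in> carrier A \<and> snd p \<in> carrier B \<and> w = f (fst p) \<otimes> snd p"
    using factorisation by fastforce
  then have "\<exists>P. \<forall>w\<in>carrier B. fst (P w) \<in> carrier A \<and> snd (P w) \<in> carrier B \<and>
      w = f (fst (P w)) \<otimes> snd (P w)" by (rule bchoice)
  then obtain P where P: "\<And>w. w \<in> carrier B \<Longrightarrow> fst (P w) \<in> carrier A"
    "\<And>w. w \<in> carrier B \<Longrightarrow> snd (P w) \<in> carrier B"
    "\<And>w. w \<in> carrier B \<Longrightarrow> f (fst (P w)) \<otimes> snd (P w) = w" by metis
  have "\<forall>w\<in>carrier B. \<exists>p. fst p \<in> carrier A \<and> snd p \<in> carrier B \<and> w = snd p \<otimes> f (fst p)"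
    using factorisation_right by fastforce
  then have "\<exists>R. \<forall>w\<in>carrier B. fst (R w) \<in> carrier A \<and> snd (R w) \<in> carrier B \<and>
      w = snd (R w) \<otimes> f (fst (R w))" by (rule bchoice)
  then obtain R where R: "\<And>w. w \<in> carrier B \<Longrightarrow> fst (R w) \<in> carrier A"
    "\<And>w. w \<in> carrier B \<Longrightarrow> snd (R w) \<in> carrier B"
    "\<And>w. w \<in> carrier B \<Longrightarrow> snd (R w) \<otimes> f (fst (R w)) = w" by metis
  define l where "l = (\<lambda>w\<in>carrier B. f (fst m (fst (P w))) \<otimes> snd (P w))"
  define r where "r = (\<lambda>w\<in>carrier B. snd (R w) \<otimes> f (snd m (fst (R w))))"
  have key: "r x \<otimes> (f a \<otimes> z) = x \<otimes> (f (fst m a) \<otimes> z)"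
    if "x \<in> carrier B" "a \<in> carrier A" "z \<in> carrier B" for x a z
  proof -
    note c = that R(1,2)[OF that(1)]
    have "r x \<otimes> (f a \<otimes> z) = snd (R x) \<otimes> (f (snd m (fst (R x)) \<otimes>\<^bsub>A\<^esub> a) \<otimes> z)"
      using c mD(1,2) by (simp add: r_def B.mult_assoc f_simps)
    also have "\<dots> = snd (R x) \<otimes> (f (fst (R x) \<otimes>\<^bsub>A\<^esub> fst m a) \<otimes> z)" using c mD(5) by simp
    also have "\<dots> = (snd (R x) \<otimes> f (fst (R x))) \<otimes> (f (fst m a) \<otimes> z)"
      using c mD(1,2) by (simp add: B.mult_assoc f_simps)
    finally show ?thesis by (simp only: R(3)[OF that(1)])
  qed
  have rc: "r x \<in> carrier B" and lc: "l x \<in> carrier B" if "x \<in> carrier B" for x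
    using that P(1,2)[OF that] R(1,2)[OF that] mD(1,2) by (simp_all add: r_def l_def)
  have n: "(l, r) \<in> carrier B.MA"
  proof (rule B.multiplierI)
    fix x y assume xy: "x \<in> carrier B" "y \<in> carrier B"
    have "r x \<otimes> (f (fst (P y)) \<otimes> snd (P y)) = x \<otimes> l y"
      using key[OF xy(1) P(1,2)[OF xy(2)]] xy(2) by (simp add: l_def)
    then show "r x \<otimes> y = x \<otimes> l y" by (simp only: P(3)[OF xy(2)])
  qed (use rc lc in \<open>simp_all add: l_def r_def\<close>)
  have "l (f a \<otimes> b) = f (fst m a) \<otimes> b" if ab: "a \<in> carrier A" "b \<in> carrier B" for a b
  proof (rule B.eq_by_left_mult)
    fix x assume x: "x \<in> carrier B"
    have "x \<otimes> l (f a \<otimes> b) = r x \<otimes> (f a \<otimes> b)"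
      using B.multiplier_carrierD(5)[OF n x, of "f a \<otimes> b"] ab by simp
    then show "x \<otimes> l (f a \<otimes> b) = x \<otimes> (f (fst m a) \<otimes> b)" using key[OF x ab] by simp
  qed (use ab lc mD(1) in auto)
  then show ?thesis using n by (intro exI[of _ "(l, r)"]) simp
qed

lemma multiplier_lift_unique:
  assumes "n \<in> carrier B.MA" "n' \<in> carrier B.MA"
    "\<And>a b. \<lbrakk>a \<in> carrier A; b \<in> carrier B\<rbrakk> \<Longrightarrow> fst n (f a \<otimes> b) = fst n' (f a \<otimes> b)"
  shows "n = n'"
proof (rule B.multiplier_fst_eqI[OF assms(1,2)])
  fix w assume "w \<in> carrier B"
  then obtain a z where "a \<in> carrier A" "z \<in> carrier B" "w = f a \<otimes> z" using factorisation by blast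
  then show "fst n w = fst n' w" using assms(3) by simp
qed

definition lift :: "'a multiplier \<Rightarrow> 'b multiplier"
  where "lift m = (SOME n. n \<in> carrier B.MA \<and>
    (\<forall>a\<in>carrier A. \<forall>b\<in>carrier B. fst n (f a \<otimes> b) = f (fst m a) \<otimes> b))"

lemma lift:
  assumes "m \<in> carrier A.MA"
  shows "lift m \<in> carrier B.MA"
    "\<lbrakk>a \<in> carrier A; b \<in> carrier B\<rbrakk> \<Longrightarrow> fst (lift m) (f a \<otimes> b) = f (fst m a) \<otimes> b"
  using someI_ex[OF multiplier_lift_exists[OF assms]] unfolding lift_def by blast+

lemma lift_eqI:
  assumes "m \<in> carrier A.MA" "n \<in> carrier B.MA"
    "\<And>a b. \<lbrakk>a \<in> carrier A; b \<in> carrier B\<rbrakk> \<Longrightarrow> fst n (f a \<otimes> b) = f (fst m a) \<otimes> b"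
  shows "lift m = n"
  using assms lift[OF assms(1)] by (intro multiplier_lift_unique) auto

lemma lift_fst:
  assumes m: "m \<in> carrier A.MA" and a: "a \<in> carrier A"
  shows "fst (lift m) (f a) = f (fst m a)"
proof (rule B.eq_by_right_mult)
  note D = B.multiplier_carrierD[OF lift(1)[OF m]] and mD = A.multiplier_carrierD[OF m]
  show "fst (lift m) (f a) \<in> carrier B" "f (fst m a) \<in> carrier B" using a D(1) mD(1) by auto
  fix b assume b: "b \<in> carrier B"
  then show "fst (lift m) (f a) \<otimes> b = f (fst m a) \<otimes> b"
    using lift(2)[OF m a b] D(3)[of "f a" b] a by simp
qed

lemma lift_snd:
  assumes m: "m \<in> carrier A.MA" and a: "a \<in> carrier A"
  shows "snd (lift m) (f a) = f (snd m a)"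
proof (rule B.eq_by_right_mult)
  note D = B.multiplier_carrierD[OF lift(1)[OF m]] and mD = A.multiplier_carrierD[OF m]
  show "snd (lift m) (f a) \<in> carrier B" "f (snd m a) \<in> carrier B" using a D(2) mD(2) by auto
  fix b assume b: "b \<in> carrier B"
  then obtain c z where c: "c \<in> carrier A" "z \<in> carrier B" "b = f c \<otimes> z" using factorisation by blast
  have "snd (lift m) (f a) \<otimes> b = f a \<otimes> (f (fst m c) \<otimes> z)"
    using D(5)[of "f a" b] a b c lift(2)[OF m c(1,2)] by simp
  also have "\<dots> = f (a \<otimes>\<^bsub>A\<^esub> fst m c) \<otimes> z" using a c mD(1) by (simp add: f_simps B.mult_assoc)
  also have "\<dots> = f (snd m a) \<otimes> b"
    using mD(5)[OF a c(1), symmetric] a c mD(2) by (simp add: f_simps B.mult_assoc)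
  finally show "snd (lift m) (f a) \<otimes> b = f (snd m a) \<otimes> b" .
qed

lemma lift_mult_of: "a \<in> carrier A \<Longrightarrow> lift (mult_of A a) = mult_of B (f a)"
  by (rule lift_eqI) (simp_all add: A.multiplier_ops_closed B.multiplier_ops_closed
      A.multiplier_ops B.multiplier_ops f_simps B.mult_assoc)

lemma lift_one: "lift (mult_one A) = mult_one B"
  by (rule lift_eqI) (simp_all add: A.multiplier_ops_closed B.multiplier_ops_closed
      A.multiplier_ops B.multiplier_ops)

lemma lift_star_hom: "star_hom A.MA B.MA lift"
proof -
  note mc = A.multiplier_ops_closed and nc = B.multiplier_ops_closed
  have add: "lift (m \<oplus>\<^bsub>A.MA\<^esub> n) = lift m \<oplus>\<^bsub>B.MA\<^esub> lift n" if "m \<in> carrier A.MA" "n \<in> carrier A.MA" for m n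
    by (rule lift_eqI)
      (use that lift A.multiplier_carrierD(1)[OF that(1)] A.multiplier_carrierD(1)[OF that(2)] in
        \<open>simp_all add: mc nc A.multiplier_ops B.multiplier_ops f_simps B.mult_add_left\<close>)
  have scale: "lift (c \<odot>\<^bsub>A.MA\<^esub> m) = c \<odot>\<^bsub>B.MA\<^esub> lift m" if "m \<in> carrier A.MA" for c m
    by (rule lift_eqI)
      (use that lift A.multiplier_carrierD(1)[OF that(1)] in
        \<open>simp_all add: mc nc A.multiplier_ops B.multiplier_ops f_simps B.mult_scale_left\<close>)
  have mult: "lift (m \<otimes>\<^bsub>A.MA\<^esub> n) = lift m \<otimes>\<^bsub>B.MA\<^esub> lift n" if "m \<in> carrier A.MA" "n \<in> carrier A.MA" for m n
    by (rule lift_eqI)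
      (use that lift A.multiplier_carrierD(1)[OF that(1)] A.multiplier_carrierD(1)[OF that(2)] in
        \<open>simp_all add: mc nc A.multiplier_ops B.multiplier_ops\<close>)
  have adj: "lift (adj A.MA m) = adj B.MA (lift m)" if m: "m \<in> carrier A.MA" for m
  proof (rule lift_eqI)
    fix a b assume ab: "a \<in> carrier A" "b \<in> carrier B"
    note D = B.multiplier_carrierD[OF lift(1)[OF m]] and mD = A.multiplier_carrierD[OF m]
    have "fst (adj B.MA (lift m)) (f a \<otimes> b) = adj B (snd (lift m) (adj B b \<otimes> f (adj A a)))"
      using ab by (simp add: B.multiplier_ops B.adj_mult f_simps)
    also have "\<dots> = adj B (adj B b \<otimes> f (snd m (adj A a)))"
      using ab D(4) lift_snd[OF m] by simp
    also have "\<dots> = f (fst (adj A.MA m) a) \<otimes> b"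
      using ab mD(2) by (simp add: B.adj_mult B.adj_adj A.multiplier_ops f_simps)
    finally show "fst (adj B.MA (lift m)) (f a \<otimes> b) = f (fst (adj A.MA m) a) \<otimes> b" .
  qed (use m mc nc lift(1) in auto)
  show ?thesis unfolding star_hom_def linear_map_def using add scale mult adj lift(1) by auto
qed

text \<open>A homomorphism \<open>f'\<close> on \<open>M(A)\<close> that extends \<open>f\<close> satisfies \<open>f'(m) f(a) b = f(m a) b\<close>, which determines it.\<close>

lemma mult_extension_eq_lift:
  assumes "m \<in> carrier A.MA"
  shows "mult_extension A B f m = lift m"
proof -
  note mc = A.multiplier_ops_closed and nc = B.multiplier_ops_closed
  have "mult_extension A B f = restrict lift (carrier A.MA)"
    unfolding mult_extension_def
  proof (rule the_equality)
    show "restrict lift (carrier A.MA) \<in> extensional (carrier A.MA) \<and>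
      star_hom A.MA B.MA (restrict lift (carrier A.MA)) \<and>
      (\<forall>a\<in>carrier A. restrict lift (carrier A.MA) (mult_of A a) = mult_of B (f a))"
      using lift_star_hom mc lift_mult_of unfolding star_hom_def linear_map_def by auto
  next
    fix g assume g: "g \<in> extensional (carrier A.MA) \<and> star_hom A.MA B.MA g \<and>
      (\<forall>a\<in>carrier A. g (mult_of A a) = mult_of B (f a))"
    then have gh: "star_hom A.MA B.MA g" and ga: "\<And>a. a \<in> carrier A \<Longrightarrow> g (mult_of A a) = mult_of B (f a)"
      by auto
    note gD = star_homD[OF gh]
    show "g = restrict lift (carrier A.MA)"
    proof (rule extensionalityI[of _ "carrier A.MA"])
      fix m assume m: "m \<in> carrier A.MA"
      have "lift m = g m"
      proof (rule lift_eqI[OF m gD(2)[OF m]])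
        fix a b assume ab: "a \<in> carrier A" "b \<in> carrier B"
        note mD = A.multiplier_carrierD[OF m]
        have "m \<otimes>\<^bsub>A.MA\<^esub> mult_of A a = mult_of A (fst m a)"
          using m ab mD by (intro A.multiplier_fst_eqI mc) (simp_all add: A.multiplier_ops)
        then have "g m \<otimes>\<^bsub>B.MA\<^esub> mult_of B (f a) = mult_of B (f (fst m a))"
          using gD(5)[OF m mc(3)[OF ab(1)]] ga ab mD(1) by simp
        then have "fst (g m \<otimes>\<^bsub>B.MA\<^esub> mult_of B (f a)) b = fst (mult_of B (f (fst m a))) b" by simp
        then show "fst (g m) (f a \<otimes> b) = f (fst m a) \<otimes> b" using ab by (simp add: B.multiplier_ops)
      qed
      then show "g m = restrict lift (carrier A.MA) m" using m by simp
    qed (use g in auto)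
  qed
  then show ?thesis using assms by simp
qed


end

lemma nondegenerate_homI:
  assumes "cstar_algebra B" "star_hom A B f"
    "\<And>b eps. \<lbrakk>b \<in> carrier B; eps > 0\<rbrakk> \<Longrightarrow>
      \<exists>a\<in>carrier A. \<exists>b'\<in>carrier B. nrm B (b \<ominus>\<^bsub>B\<^esub> f a \<otimes>\<^bsub>B\<^esub> b') < eps"
  shows "nondegenerate_hom A B f"
proof -
  interpret B: cstar_algebra B by fact
  let ?S = "{f a \<otimes>\<^bsub>B\<^esub> b | a b. a \<in> carrier A \<and> b \<in> carrier B}"
  have S: "?S \<subseteq> carrier B" using star_homD(2)[OF assms(2)] by auto
  have "carrier B \<subseteq> closed_subspace B hull ?S"
  proof
    fix b assume b: "b \<in> carrier B"
    show "b \<in> closed_subspace B hull ?S"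
    proof (rule B.closed_subspaceD(6)[OF B.closed_subspace_hull[OF S] b])
      fix eps :: real assume "eps > 0"
      then obtain a b' where "a \<in> carrier A" "b' \<in> carrier B" "nrm B (b \<ominus>\<^bsub>B\<^esub> f a \<otimes>\<^bsub>B\<^esub> b') < eps"
        using assms(3)[OF b] by blast
      then show "\<exists>w\<in>closed_subspace B hull ?S. nrm B (b \<ominus>\<^bsub>B\<^esub> w) < eps"
        by (intro bexI[of _ "f a \<otimes>\<^bsub>B\<^esub> b'"] hull_inc) auto
    qed
  qed
  then show ?thesis
    unfolding nondegenerate_hom_def using assms(2) B.hull_closed_subspace_subset[OF S] by blast
qed

lemma nondegenerate_homomorphismI:
  assumes "cstar_algebra A" "cstar_algebra B" "nondegenerate_hom A B f"
  shows "nondegenerate_homomorphism A B f"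
proof -
  interpret A: cstar_algebra A by fact
  interpret B: cstar_algebra B by fact
  show ?thesis using assms(3) by unfold_locales (simp_all add: nondegenerate_hom_def)
qed

lemma star_homomorphismI:
  assumes "cstar_algebra A" "cstar_algebra B" "star_hom A B f"
  shows "star_homomorphism A B f"
proof -
  interpret A: cstar_algebra A by fact
  interpret B: cstar_algebra B by fact
  show ?thesis using assms(3) by unfold_locales
qed

lemma surjective_nondegenerate:
  assumes "cstar_algebra A" "cstar_algebra B" "star_hom A B f" "f ` carrier A = carrier B"
  shows "nondegenerate_hom A B f"
proof (rule nondegenerate_homI[OF assms(2,3)])
  interpret star_homomorphism A B f by (rule star_homomorphismI) fact+
  fix b eps assume "b \<in> carrier B" "(eps :: real) > 0"
  then obtain x where x: "x \<in> carrier A" "b = f x" using assms(4) by blast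
  obtain e where e: "co_contraction e" "nrm A (x \<ominus>\<^bsub>A\<^esub> e \<otimes>\<^bsub>A\<^esub> x) < eps"
    using approximate_unit[OF x(1) \<open>eps > 0\<close>] by blast
  note ec = co_contractionD(1)[OF e(1)]
  have "nrm B (b \<ominus>\<^bsub>B\<^esub> f e \<otimes>\<^bsub>B\<^esub> f x) < eps"
    using f_norm_le[of "x \<ominus>\<^bsub>A\<^esub> e \<otimes>\<^bsub>A\<^esub> x"] x ec e(2) by (simp add: f_vdiff f_simps)
  then show "\<exists>a\<in>carrier A. \<exists>b'\<in>carrier B. nrm B (b \<ominus>\<^bsub>B\<^esub> f a \<otimes>\<^bsub>B\<^esub> b') < eps"
    using ec x(1) by blast
qed

lemma star_hom_comp:
  assumes "star_hom A B f" "star_hom B C g"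
  shows "star_hom A C (g \<circ> f)"
  using star_homD(2-6)[OF assms(1)] star_homD(2-6)[OF assms(2)]
  by (simp add: star_hom_def linear_map_def Pi_iff)

lemma nondegenerate_comp:
  assumes "cstar_algebra A" "cstar_algebra B" "cstar_algebra C"
    "nondegenerate_hom A B f" "nondegenerate_hom B C g"
  shows "nondegenerate_hom A C (g \<circ> f)"
proof (rule nondegenerate_homI[OF assms(3)])
  interpret f: nondegenerate_homomorphism A B f by (rule nondegenerate_homomorphismI) fact+
  interpret g: nondegenerate_homomorphism B C g by (rule nondegenerate_homomorphismI) fact+
  show "star_hom A C (g \<circ> f)" by (rule star_hom_comp[OF f.hom g.hom])
  fix c eps assume c: "c \<in> carrier C" "(eps :: real) > 0"
  obtain b c' where b: "b \<in> carrier B" "c' \<in> carrier C" "c = g b \<otimes>\<^bsub>C\<^esub> c'" using g.factorisation[OF c(1)] by blast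
  obtain a b' where a: "a \<in> carrier A" "b' \<in> carrier B" "b = f a \<otimes>\<^bsub>B\<^esub> b'" using f.factorisation[OF b(1)] by blast
  have "c = (g \<circ> f) a \<otimes>\<^bsub>C\<^esub> (g b' \<otimes>\<^bsub>C\<^esub> c')" using a b by (simp add: g.f_simps g.B.mult_assoc)
  moreover from this have "nrm C (c \<ominus>\<^bsub>C\<^esub> (g \<circ> f) a \<otimes>\<^bsub>C\<^esub> (g b' \<otimes>\<^bsub>C\<^esub> c')) = 0"
    using c(1) by (metis g.B.vdiff_self g.B.N_zero)
  ultimately show "\<exists>a\<in>carrier A. \<exists>b'\<in>carrier C. nrm C (c \<ominus>\<^bsub>C\<^esub> (g \<circ> f) a \<otimes>\<^bsub>C\<^esub> b') < eps"
    using a b c(2) by (intro bexI[of _ a] bexI[of _ "g b' \<otimes>\<^bsub>C\<^esub> c'"]) auto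
qed

lemma mult_extension_comp:
  assumes "cstar_algebra A" "cstar_algebra B" "cstar_algebra C"
    "nondegenerate_hom A B f" "nondegenerate_hom B C g" "m \<in> carrier (multiplier_algebra A)"
  shows "mult_extension A C (g \<circ> f) m = mult_extension B C g (mult_extension A B f m)"
proof -
  interpret f: nondegenerate_homomorphism A B f by (rule nondegenerate_homomorphismI) fact+
  interpret g: nondegenerate_homomorphism B C g by (rule nondegenerate_homomorphismI) fact+
  interpret gf: nondegenerate_homomorphism A C "g \<circ> f"
    by (rule nondegenerate_homomorphismI[OF assms(1,3) nondegenerate_comp[OF assms(1-5)]])
  note m = assms(6)
  have "gf.lift m = g.lift (f.lift m)"
    by (rule gf.lift_eqI[OF m g.lift(1)[OF f.lift(1)[OF m]]])
      (use m in \<open>simp add: g.lift(2)[OF f.lift(1)] f.lift_fst\<close>)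
  then show ?thesis using m
    by (simp add: f.mult_extension_eq_lift g.mult_extension_eq_lift[OF f.lift(1)] gf.mult_extension_eq_lift)
qed

lemma mult_extension_id:
  assumes "cstar_algebra B" "m \<in> carrier (multiplier_algebra B)"
  shows "nondegenerate_hom B B id" "mult_extension B B id m = m"
proof -
  show nd: "nondegenerate_hom B B id"
    by (rule surjective_nondegenerate[OF assms(1,1)]) (auto simp: star_hom_def linear_map_def)
  interpret nondegenerate_homomorphism B B id by (rule nondegenerate_homomorphismI[OF assms(1,1) nd])
  show "mult_extension B B id m = m"
    unfolding mult_extension_eq_lift[OF assms(2)]
    by (rule lift_eqI[OF assms(2,2)]) (simp add: A.multiplier_carrierD(3)[OF assms(2)])
qed

lemma cstar_algebra_restrict:
  assumes "cstar_algebra A" "cstar_subalgebra A B"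
  shows "cstar_algebra (A\<lparr>carrier := B\<rparr>)"
proof -
  interpret A: cstar_algebra A by fact
  let ?B = "A\<lparr>carrier := B\<rparr>"
  have cs: "closed_subspace A B" and Bm: "\<And>x y. \<lbrakk>x \<in> B; y \<in> B\<rbrakk> \<Longrightarrow> x \<otimes>\<^bsub>A\<^esub> y \<in> B"
    and Ba: "\<And>x. x \<in> B \<Longrightarrow> adj A x \<in> B"
    using assms(2) unfolding cstar_subalgebra_def by auto
  note D = A.closed_subspaceD[OF cs]
  have BA: "x \<in> carrier A" if "x \<in> B" for x using that D(1) by blast
  have vd: "x \<ominus>\<^bsub>?B\<^esub> y = x \<ominus>\<^bsub>A\<^esub> y" for x y by (simp add: vdiff_def)
  interpret B: carrier_normed_space ?B "nrm A"
    by unfold_locales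
      (simp_all add: D(2-4) BA A.add_zero A.add_neg A.scale_one A.scale_scale A.scale_add_left
        A.scale_add_right A.norm_nonneg A.norm_eq_zero A.norm_triangle A.norm_scale A.add_ac)
  show ?thesis
  proof unfold_locales
    show "Metric_space.mcomplete (carrier ?B) (norm_dist ?B (nrm ?B))"
    proof -
      have "B.metric.mcomplete"
      proof (rule B.mcompleteI)
        fix xs :: "nat \<Rightarrow> 'a"
        assume s: "\<And>n. xs n \<in> carrier ?B"
          and c: "\<And>e. e > 0 \<Longrightarrow> \<exists>M. \<forall>m\<ge>M. \<forall>n\<ge>M. nrm A (xs m \<ominus>\<^bsub>?B\<^esub> xs n) < e"
        have sB: "xs n \<in> B" for n using s[of n] by simp
        then have sA: "xs n \<in> carrier A" for n using BA by blast
        have "\<exists>l. l \<in> carrier A \<and> A.vlim xs l"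
          by (rule A.mcomplete_vlim[where xs = xs, OF A.complete sA]) (use c in \<open>simp add: vd\<close>, blast)
        then obtain l where l: "l \<in> carrier A" "A.vlim xs l" by blast
        have "closedin (norm_topology A (nrm A)) B" using cs unfolding closed_subspace_def by blast
        then have "l \<in> B" using A.vlim_in_closed[OF l(2) sB l(1)] by blast
        moreover have "\<exists>M. \<forall>n\<ge>M. nrm A (xs n \<ominus>\<^bsub>?B\<^esub> l) \<le> e" if "e > 0" for e
          using A.vlim_D[OF l(2) that] unfolding vd by (auto intro: less_imp_le)
        ultimately show "\<exists>l\<in>carrier ?B. \<forall>e>0. \<exists>M. \<forall>n\<ge>M. nrm A (xs n \<ominus>\<^bsub>?B\<^esub> l) \<le> e" by auto
      qed
      then show ?thesis by simp
    qed
  qed (simp_all add: D(2-4) Bm Ba BA A.expand_simps A.norm_nonneg A.norm_eq_zero A.norm_triangle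
      A.norm_scale A.norm_mult A.cstar_identity)
qed

section \<open>Toeplitz-covariant representations\<close>

locale toeplitz_representation = nondegenerate_homomorphism A B \<pi>
  for A :: "'a cstar" and B :: "'b cstar" (structure) and \<pi> :: "'a \<Rightarrow> 'b" +
  fixes \<alpha> L :: "'a \<Rightarrow> 'a" and S :: "'b multiplier"
  assumes alpha_hom: "star_hom A A \<alpha>"
    and L_closed: "a \<in> carrier A \<Longrightarrow> L a \<in> carrier A"
    and L_alpha: "a \<in> carrier A \<Longrightarrow> L (\<alpha> a) = a"
    and rep: "toeplitz_rep A \<alpha> L B \<pi> S"
begin

lemmas alpha_simps = star_homD(3-6)[OF alpha_hom]

lemma alpha_closed [simp, intro]: "a \<in> carrier A \<Longrightarrow> \<alpha> a \<in> carrier A"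
  by (rule star_homD(2)[OF alpha_hom])

abbreviation "S' \<equiv> adj B.MA S"

lemma S_in: "S \<in> carrier B.MA"
  using rep unfolding toeplitz_rep_def by blast

lemma S'_in: "S' \<in> carrier B.MA"
  by (rule B.multiplier_ops_closed(7)[OF S_in])

lemmas SD = B.multiplier_carrierD[OF S_in] and S'D = B.multiplier_carrierD[OF S'_in]

declare SD(1,2) [simp, intro] S'D(1,2) [simp, intro]

lemma S_left:
  assumes "a \<in> carrier A" "b \<in> carrier B"
  shows "fst S (\<pi> a \<otimes> b) = \<pi> (\<alpha> a) \<otimes> fst S b"
proof -
  have "S \<otimes>\<^bsub>B.MA\<^esub> mult_of B (\<pi> a) = mult_of B (\<pi> (\<alpha> a)) \<otimes>\<^bsub>B.MA\<^esub> S"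
    using rep assms(1) unfolding toeplitz_rep_def by blast
  then have "fst (S \<otimes>\<^bsub>B.MA\<^esub> mult_of B (\<pi> a)) b = fst (mult_of B (\<pi> (\<alpha> a)) \<otimes>\<^bsub>B.MA\<^esub> S) b" by simp
  then show ?thesis using assms by (simp add: B.multiplier_ops)
qed

lemma S'_S_sandwich:
  assumes "a \<in> carrier A" "b \<in> carrier B"
  shows "fst S' (\<pi> a \<otimes> fst S b) = \<pi> (L a) \<otimes> b"
proof -
  have "S' \<otimes>\<^bsub>B.MA\<^esub> mult_of B (\<pi> a) \<otimes>\<^bsub>B.MA\<^esub> S = mult_of B (\<pi> (L a))"
    using rep assms(1) unfolding toeplitz_rep_def by blast
  then have "fst (S' \<otimes>\<^bsub>B.MA\<^esub> mult_of B (\<pi> a) \<otimes>\<^bsub>B.MA\<^esub> S) b = fst (mult_of B (\<pi> (L a))) b" by simp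
  then show ?thesis using assms by (simp add: B.multiplier_ops(5,13))
qed

lemma S_pi:
  assumes "a \<in> carrier A"
  shows "fst S (\<pi> a) = snd S (\<pi> (\<alpha> a))"
proof (rule B.eq_by_right_mult)
  fix b assume b: "b \<in> carrier B"
  have "fst S (\<pi> a) \<otimes> b = \<pi> (\<alpha> a) \<otimes> fst S b"
    using SD(3)[of "\<pi> a" b] S_left[OF assms b] b assms by simp
  then show "fst S (\<pi> a) \<otimes> b = snd S (\<pi> (\<alpha> a)) \<otimes> b"
    using SD(5)[of "\<pi> (\<alpha> a)" b] b assms by simp
qed (use assms in auto)

text \<open>Since \<open>L(\<alpha>(a)) = a\<close>, the second covariance relation makes \<open>S\<close> an isometry.\<close>

lemma S'_S: "b \<in> carrier B \<Longrightarrow> fst S' (fst S b) = b"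
proof -
  assume "b \<in> carrier B"
  then obtain a z where b: "a \<in> carrier A" "z \<in> carrier B" "b = \<pi> a \<otimes> z" using factorisation by blast
  then show ?thesis using S'_S_sandwich[of "\<alpha> a" z] by (simp add: S_left L_alpha)
qed

lemma isometry: "S' \<otimes>\<^bsub>B.MA\<^esub> S = mult_one B"
  using S'_S S_in S'_in
  by (intro B.multiplier_fst_eqI B.multiplier_ops_closed) (simp_all add: B.multiplier_ops(5,11))

lemma S_snd_S': "b \<in> carrier B \<Longrightarrow> snd S (snd S' b) = b"
proof -
  assume b: "b \<in> carrier B"
  have "snd (S' \<otimes>\<^bsub>B.MA\<^esub> S) b = snd (mult_one B) b" by (simp only: isometry)
  then show ?thesis using b by (simp only: B.multiplier_ops)
qed

lemma S'_left:
  assumes "a \<in> carrier A" "b \<in> carrier B"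
  shows "fst S' (\<pi> (\<alpha> a) \<otimes> b) = \<pi> a \<otimes> fst S' b"
proof -
  have "fst S' (\<pi> (\<alpha> a) \<otimes> b) = adj B (snd S (adj B b \<otimes> \<pi> (\<alpha> (adj A a))))"
    using assms by (simp add: B.multiplier_ops(7) B.adj_mult f_simps alpha_simps)
  also have "\<dots> = adj B (adj B b \<otimes> fst S (\<pi> (adj A a)))"
    using assms by (simp add: SD(4) S_pi)
  also have "\<dots> = adj B (snd S (adj B b) \<otimes> \<pi> (adj A a))" using assms by (simp add: SD(5))
  also have "\<dots> = \<pi> a \<otimes> fst S' b"
    using assms by (simp add: B.multiplier_ops(7) B.adj_mult f_simps B.adj_adj)
  finally show ?thesis .
qed

lemma adj_pi_S: "a \<in> carrier A \<Longrightarrow> adj B (snd S (\<pi> a)) = fst S' (\<pi> (adj A a))"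
  by (simp add: B.multiplier_ops(7) f_simps B.adj_adj)

lemma pi_S_inner:
  assumes "a \<in> carrier A" "b \<in> carrier A"
  shows "adj B (snd S (\<pi> a)) \<otimes> snd S (\<pi> b) = \<pi> (L (adj A a \<otimes>\<^bsub>A\<^esub> b))"
proof -
  have sandwich: "fst S' (snd S (\<pi> c)) = \<pi> (L c)" if c: "c \<in> carrier A" for c
  proof (rule B.eq_by_right_mult)
    fix y assume y: "y \<in> carrier B"
    have "fst S' (snd S (\<pi> c)) \<otimes> y = fst S' (snd S (\<pi> c) \<otimes> y)"
      using c y S'D(3)[of "snd S (\<pi> c)" y] by simp
    also have "snd S (\<pi> c) \<otimes> y = \<pi> c \<otimes> fst S y" using c y SD(5)[of "\<pi> c" y] by simp
    finally show "fst S' (snd S (\<pi> c)) \<otimes> y = \<pi> (L c) \<otimes> y" using c y S'_S_sandwich by simp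
  qed (use c L_closed in auto)
  have "fst S' (\<pi> (adj A a)) \<otimes> snd S (\<pi> b) = fst S' (\<pi> (adj A a) \<otimes> snd S (\<pi> b))"
    using assms S'D(3)[of "\<pi> (adj A a)" "snd S (\<pi> b)"] by simp
  also have "\<pi> (adj A a) \<otimes> snd S (\<pi> b) = snd S (\<pi> (adj A a \<otimes>\<^bsub>A\<^esub> b))"
    using assms SD(4)[of "\<pi> (adj A a)" "\<pi> b"] by (simp add: f_simps)
  finally show ?thesis using assms sandwich adj_pi_S by simp
qed

end

section \<open>The canonical map on the bimodule and on its compact operators\<close>

locale exel_representation = toeplitz_representation A B \<pi> \<alpha> L S
  for A :: "'a cstar" and B :: "'b cstar" (structure) and \<pi> :: "'a \<Rightarrow> 'b"
    and \<alpha> L :: "'a \<Rightarrow> 'a" and S :: "'b multiplier" +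
  fixes X :: "('a, 'x) bimodule" and q :: "'a \<Rightarrow> 'x"
  assumes bimodule: "exel_bimodule A \<alpha> L X q"
begin

sublocale X: cauchy_schwarz_module A X
  by (rule hilbert_module_cauchy_schwarz)
    (use bimodule in \<open>simp add: exel_bimodule_def right_hilbert_bimodule_def\<close>)

lemma q_linear: "linear_map A X q" and q_lact: "\<lbrakk>a \<in> carrier A; m \<in> carrier A\<rbrakk> \<Longrightarrow> lact X a (q m) = q (a \<otimes>\<^bsub>A\<^esub> m)"
  and q_ract: "\<lbrakk>m \<in> carrier A; b \<in> carrier A\<rbrakk> \<Longrightarrow> ract X (q m) b = q (m \<otimes>\<^bsub>A\<^esub> \<alpha> b)"
  and q_ip: "\<lbrakk>m \<in> carrier A; n \<in> carrier A\<rbrakk> \<Longrightarrow> ip X (q m) (q n) = L (adj A m \<otimes>\<^bsub>A\<^esub> n)"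
  and left_op_hom: "star_hom A (adjointables A X) (left_op X)"
  using bimodule unfolding exel_bimodule_def right_hilbert_bimodule_def by blast+

lemma q_closed [simp, intro]: "a \<in> carrier A \<Longrightarrow> q a \<in> carrier X"
  by (rule linear_mapD(1)[OF q_linear])

lemma q_dense: "\<lbrakk>x \<in> carrier X; e > 0\<rbrakk> \<Longrightarrow> \<exists>a\<in>carrier A. X.MN (x \<ominus>\<^bsub>X\<^esub> q a) < e"
proof -
  assume x: "x \<in> carrier X" and "e > 0"
  then have "x \<in> norm_topology X X.MN closure_of (q ` carrier A)"
    using bimodule unfolding exel_bimodule_def by blast
  then show ?thesis using \<open>e > 0\<close> by (auto simp: X.in_closure_norm_iff)
qed

lemma q_sequence: "x \<in> carrier X \<Longrightarrow> \<exists>xs. (\<forall>n. xs n \<in> carrier A) \<and> X.vlim (\<lambda>n. q (xs n)) x"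
proof -
  assume x: "x \<in> carrier X"
  have "\<exists>ys. (\<forall>n. ys n \<in> q ` carrier A) \<and> X.vlim ys x"
    by (rule X.approx_sequence[OF x]) (use q_dense[OF x] in auto)
  then obtain ys where t: "\<forall>n. ys n \<in> q ` carrier A" "X.vlim ys x" by blast
  then have "\<forall>n. \<exists>a. a \<in> carrier A \<and> ys n = q a" by blast
  then have "\<exists>xs. \<forall>n. xs n \<in> carrier A \<and> ys n = q (xs n)" by (rule choice)
  then obtain xs where s: "\<And>n. xs n \<in> carrier A" "\<And>n. ys n = q (xs n)" by blast
  then have "ys = (\<lambda>n. q (xs n))" by auto
  then show ?thesis using s(1) t(2) by auto
qed

definition is_psi :: "('x \<Rightarrow> 'b) \<Rightarrow> bool"
  where "is_psi \<psi> \<longleftrightarrow> \<psi> \<in> extensional (carrier X) \<and> linear_map X B \<psi> \<and>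
    (\<forall>a\<in>carrier A. \<psi> (q a) = mult_right (\<pi> a) S) \<and>
    (\<forall>m\<in>carrier X. \<forall>a\<in>carrier A. \<psi> (ract X m a) = \<psi> m \<otimes> \<pi> a) \<and>
    (\<forall>m\<in>carrier X. \<forall>n\<in>carrier X. adj B (\<psi> m) \<otimes> \<psi> n = \<pi> (ip X m n)) \<and>
    (\<forall>a\<in>carrier A. \<forall>m\<in>carrier X. \<psi> (lact X a m) = \<pi> a \<otimes> \<psi> m)"

lemma psi_contractive:
  assumes "linear_map X B \<psi>" "\<And>m. m \<in> carrier X \<Longrightarrow> adj B (\<psi> m) \<otimes> \<psi> m = \<pi> (ip X m m)"
    "m \<in> carrier X"
  shows "nrm B (\<psi> m) \<le> X.MN m"
proof -
  have c: "\<psi> m \<in> carrier B" by (rule linear_mapD(1)[OF assms(1,3)])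
  have "(nrm B (\<psi> m))\<^sup>2 = nrm B (\<pi> (ip X m m))" using B.cstar_identity[OF c] assms(2,3) by simp
  also have "\<dots> \<le> (X.MN m)\<^sup>2" using f_norm_le[of "ip X m m"] assms(3) by (simp add: X.MN_square)
  finally show ?thesis using X.MN_nonneg[OF assms(3)] by (rule power2_le_imp_le)
qed

lemma contractive_vlim:
  assumes "linear_map X B \<psi>" "\<And>m. m \<in> carrier X \<Longrightarrow> nrm B (\<psi> m) \<le> X.MN m"
    "X.vlim xs x" "\<And>n. xs n \<in> carrier X" "x \<in> carrier X"
  shows "B.vlim (\<lambda>n. \<psi> (xs n)) (\<psi> x)"
proof (rule B.vlim_I)
  show "(\<lambda>n. X.MN (xs n \<ominus>\<^bsub>X\<^esub> x)) \<longlonglongrightarrow> 0" using assms(3) by (simp add: X.vlim_def)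
  show "nrm B (\<psi> (xs n) \<ominus> \<psi> x) \<le> X.MN (xs n \<ominus>\<^bsub>X\<^esub> x)" for n
    using assms(2)[of "xs n \<ominus>\<^bsub>X\<^esub> x"] assms(4)[of n] assms(5)
      X.linear_vdiff[OF assms(1), of "xs n" x] by simp
qed (use linear_mapD(1)[OF assms(1)] assms(4,5) in auto)

text \<open>On the dense image of \<open>q\<close> put \<open>q(a) \<mapsto> \<pi>(a) S\<close>. This is contractive because
  \<open>(\<pi>(a) S)\<^sup>* \<pi>(b) S = \<pi>(L(a\<^sup>* b))\<close>, and so it extends. The identity for inner products and the one for
  the left action pass to the limit, and the one for the right action follows from inner products:
  \<open>z = \<psi>(m a) - \<psi>(m) \<pi>(a)\<close> satisfies \<open>z\<^sup>* z = 0\<close>.\<close>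

lemma psi_exists: "\<exists>\<psi>. is_psi \<psi>"
proof -
  define R where "R = (\<lambda>a. (q a, snd S (\<pi> a))) ` carrier A"
  note ql = linear_mapD[OF q_linear] and Sl = linear_mapD[OF SD(9)]
  obtain \<psi> where psi: "linear_map X B \<psi>" "\<And>x y. (x, y) \<in> R \<Longrightarrow> \<psi> x = y"
    "\<And>x. x \<in> carrier X \<Longrightarrow> nrm B (\<psi> x) \<le> X.MN x"
  proof (rule extend_bounded_relation[where V = X and W = B and N = X.MN and M = "nrm B" and R = R])
    show "carrier_normed_space X X.MN" by (rule X.carrier_normed_space_axioms)
    show "carrier_normed_space B (nrm B)" by (rule B.carrier_normed_space_axioms)
    show "Metric_space.mcomplete (carrier B) (norm_dist B (nrm B))" by (rule B.complete)
    show "x \<in> carrier X \<and> y \<in> carrier B" if "(x, y) \<in> R" for x y using that by (auto simp: R_def)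
    show "(x \<oplus>\<^bsub>X\<^esub> x', y \<oplus> y') \<in> R" if R1: "(x, y) \<in> R" "(x', y') \<in> R" for x y x' y'
    proof -
      obtain a a' where "a \<in> carrier A" "a' \<in> carrier A" "x = q a" "x' = q a'" "y = snd S (\<pi> a)" "y' = snd S (\<pi> a')"
        using R1 by (auto simp: R_def)
      then show ?thesis unfolding R_def
        by (intro image_eqI[of _ _ "a \<oplus>\<^bsub>A\<^esub> a'"]) (simp_all add: ql(2) Sl(2) f_simps)
    qed
    show "(c \<odot>\<^bsub>X\<^esub> x, c \<odot> y) \<in> R" if R1: "(x, y) \<in> R" for c x y
    proof -
      obtain a where "a \<in> carrier A" "x = q a" "y = snd S (\<pi> a)" using R1 by (auto simp: R_def)
      then show ?thesis unfolding R_def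
        by (intro image_eqI[of _ _ "c \<odot>\<^bsub>A\<^esub> a"]) (simp_all add: ql(3) Sl(3) f_simps)
    qed
    show "nrm B y \<le> X.MN x" if R1: "(x, y) \<in> R" for x y
    proof -
      obtain a where a: "a \<in> carrier A" "x = q a" "y = snd S (\<pi> a)" using R1 by (auto simp: R_def)
      have "(nrm B y)\<^sup>2 = nrm B (\<pi> (ip X x x))"
        using B.cstar_identity[of y] a by (simp add: pi_S_inner q_ip)
      also have "\<dots> \<le> (X.MN x)\<^sup>2" using f_norm_le[of "ip X x x"] a by (simp add: X.MN_square)
      finally show ?thesis by (rule power2_le_imp_le) (simp add: X.MN_nonneg a)
    qed
    show "\<exists>x' y'. (x', y') \<in> R \<and> X.MN (x \<ominus>\<^bsub>X\<^esub> x') < e" if "x \<in> carrier X" "e > 0" for x e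
      using q_dense[OF that] by (auto simp: R_def)
  qed blast
  have psiq: "\<psi> (q a) = snd S (\<pi> a)" if "a \<in> carrier A" for a
    using psi(2)[of "q a" "snd S (\<pi> a)"] that by (auto simp: R_def)
  note psic = linear_mapD(1)[OF psi(1)]
  note cont = contractive_vlim[OF psi(1,3)]
  have seq: "\<exists>xs. (\<forall>n. xs n \<in> carrier A) \<and> X.vlim (\<lambda>n. q (xs n)) x \<and> B.vlim (\<lambda>n. snd S (\<pi> (xs n))) (\<psi> x)"
    if x: "x \<in> carrier X" for x
  proof -
    obtain xs where s: "\<forall>n. xs n \<in> carrier A" "X.vlim (\<lambda>n. q (xs n)) x" using q_sequence[OF x] by blast
    have "B.vlim (\<lambda>n. \<psi> (q (xs n))) (\<psi> x)" by (rule cont[OF _ s(2)]) (use s(1) x in auto)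
    then show ?thesis using s psiq by auto
  qed
  have p2': "adj B (snd S (\<pi> a)) \<otimes> \<psi> n = \<pi> (ip X (q a) n)" if n: "n \<in> carrier X" and a: "a \<in> carrier A" for n a
  proof -
    obtain xs where s: "\<forall>k. xs k \<in> carrier A" "X.vlim (\<lambda>k. q (xs k)) n" "B.vlim (\<lambda>k. snd S (\<pi> (xs k))) (\<psi> n)"
      using seq[OF n] by blast
    have "B.vlim (\<lambda>k. \<pi> (ip X (q a) (q (xs k)))) (\<pi> (ip X (q a) n))"
      by (rule f_vlim[OF X.ip_vlim[OF s(2)]]) (use s(1) n a in auto)
    moreover have "B.vlim (\<lambda>k. adj B (snd S (\<pi> a)) \<otimes> snd S (\<pi> (xs k))) (adj B (snd S (\<pi> a)) \<otimes> \<psi> n)"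
      by (rule B.vlim_mult[OF B.vlim_const s(3)]) (use s(1) psic n a in auto)
    moreover have "\<pi> (ip X (q a) (q (xs k))) = adj B (snd S (\<pi> a)) \<otimes> snd S (\<pi> (xs k))" for k
      using s(1) a by (simp add: pi_S_inner q_ip)
    ultimately show ?thesis
      by (intro B.vlim_unique[of "\<lambda>k. \<pi> (ip X (q a) (q (xs k)))"]) (use s(1) psic n a in simp_all)
  qed
  have p2: "adj B (\<psi> m) \<otimes> \<psi> n = \<pi> (ip X m n)" if m: "m \<in> carrier X" and n: "n \<in> carrier X" for m n
  proof -
    obtain xs where s: "\<forall>k. xs k \<in> carrier A" "X.vlim (\<lambda>k. q (xs k)) m" "B.vlim (\<lambda>k. snd S (\<pi> (xs k))) (\<psi> m)"
      using seq[OF m] by blast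
    have "B.vlim (\<lambda>k. \<pi> (ip X (q (xs k)) n)) (\<pi> (ip X m n))"
      by (rule f_vlim[OF X.ip_vlim_left[OF s(2)]]) (use s(1) m n in auto)
    moreover have "B.vlim (\<lambda>k. adj B (snd S (\<pi> (xs k))) \<otimes> \<psi> n) (adj B (\<psi> m) \<otimes> \<psi> n)"
      by (rule B.vlim_mult[OF B.vlim_adj[OF s(3)] B.vlim_const]) (use s(1) psic m n in auto)
    moreover have "\<pi> (ip X (q (xs k)) n) = adj B (snd S (\<pi> (xs k))) \<otimes> \<psi> n" for k
      using s(1) p2'[OF n] by simp
    ultimately show ?thesis
      by (intro B.vlim_unique[of "\<lambda>k. \<pi> (ip X (q (xs k)) n)"]) (use s(1) psic m n in simp_all)
  qed
  have p1: "\<psi> (ract X m a) = \<psi> m \<otimes> \<pi> a" if m: "m \<in> carrier X" and a: "a \<in> carrier A" for m a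
  proof -
    have p2x: "adj B (\<psi> m) \<otimes> (\<psi> n \<otimes> x) = \<pi> (ip X m n) \<otimes> x"
      if "m \<in> carrier X" "n \<in> carrier X" "x \<in> carrier B" for m n x
      using p2[OF that(1,2)] psic that by (simp add: B.mult_assoc[symmetric])
    define z where "z = \<psi> (ract X m a) \<ominus> \<psi> m \<otimes> \<pi> a"
    have "adj B z \<otimes> z = \<zero>"
      using m a psic by (intro B.vec_eqI)
        (simp_all add: z_def B.expand_simps p2 p2x X.ip_simps f_simps B.functional_simps)
    then have "z = \<zero>" by (rule B.adj_mult_self_eq_zero[rotated]) (use m a psic in \<open>simp add: z_def\<close>)
    then show ?thesis using m a psic by (simp add: z_def B.vdiff_eq_zero)
  qed
  have p3: "\<psi> (lact X a m) = \<pi> a \<otimes> \<psi> m" if m: "m \<in> carrier X" and a: "a \<in> carrier A" for m a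
  proof -
    obtain xs where s: "\<forall>k. xs k \<in> carrier A" "X.vlim (\<lambda>k. q (xs k)) m" "B.vlim (\<lambda>k. snd S (\<pi> (xs k))) (\<psi> m)"
      using seq[OF m] by blast
    have R: "left_op X a \<in> carrier X.L" by (rule star_homD(2)[OF left_op_hom a])
    have la: "left_op X a x = lact X a x" if "x \<in> carrier X" for x using that by (simp add: left_op_def)
    have lc: "lact X a x \<in> carrier X" if "x \<in> carrier X" for x
      using X.adjointables_closed[OF R that] la[OF that] by simp
    have "X.vlim (\<lambda>k. lact X a (q (xs k))) (lact X a m)"
    proof (rule X.vlim_I)
      show "(\<lambda>n. nrm X.L (left_op X a) * X.MN (q (xs n) \<ominus>\<^bsub>X\<^esub> m)) \<longlonglongrightarrow> 0"
        using tendsto_mult_left[OF s(2)[unfolded X.vlim_def], of "nrm X.L (left_op X a)"] by simp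
      fix n
      have "lact X a (q (xs n)) \<ominus>\<^bsub>X\<^esub> lact X a m = left_op X a (q (xs n) \<ominus>\<^bsub>X\<^esub> m)"
        using s(1) m X.adjointables_linear(4)[OF R, of "q (xs n)" m] la by simp
      then show "X.MN (lact X a (q (xs n)) \<ominus>\<^bsub>X\<^esub> lact X a m) \<le> nrm X.L (left_op X a) * X.MN (q (xs n) \<ominus>\<^bsub>X\<^esub> m)"
        using X.opnorm_bound[OF R, of "q (xs n) \<ominus>\<^bsub>X\<^esub> m"] s(1) m by simp
    qed (use s(1) m lc in auto)
    then have "B.vlim (\<lambda>k. \<psi> (lact X a (q (xs k)))) (\<psi> (lact X a m))"
      by (rule cont[rotated]) (use s(1) m lc in auto)
    moreover have "\<psi> (lact X a (q (xs k))) = \<pi> a \<otimes> snd S (\<pi> (xs k))" for k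
      using s(1) a by (simp add: q_lact psiq f_simps SD(4))
    moreover have "B.vlim (\<lambda>k. \<pi> a \<otimes> snd S (\<pi> (xs k))) (\<pi> a \<otimes> \<psi> m)"
      by (rule B.vlim_mult[OF B.vlim_const s(3)]) (use s(1) psic m a in auto)
    ultimately show ?thesis
      by (intro B.vlim_unique[of "\<lambda>k. \<pi> a \<otimes> snd S (\<pi> (xs k))"]) (use s(1) psic m a lc in simp_all)
  qed
  have lc: "lact X a x \<in> carrier X" if "a \<in> carrier A" "x \<in> carrier X" for a x
    using X.adjointables_closed[OF star_homD(2)[OF left_op_hom that(1)] that(2)] that(2) by (simp add: left_op_def)
  have "is_psi (restrict \<psi> (carrier X))"
    unfolding is_psi_def using psi(1) psiq p1 p2 p3 lc by (simp add: mult_right_def linear_map_def Pi_iff)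
  then show ?thesis by (rule exI[of is_psi])
qed

lemma psi_unique:
  assumes "is_psi \<psi>" "is_psi \<psi>'"
  shows "\<psi> = \<psi>'"
proof (rule extensionalityI[of _ "carrier X"])
  fix x assume x: "x \<in> carrier X"
  have l: "linear_map X B \<psi>" "linear_map X B \<psi>'" using assms by (auto simp: is_psi_def)
  have eq: "\<psi> (q a) = \<psi>' (q a)" if "a \<in> carrier A" for a using assms that by (simp add: is_psi_def)
  have ip: "adj B (\<psi> m) \<otimes> \<psi> m = \<pi> (ip X m m)" "adj B (\<psi>' m) \<otimes> \<psi>' m = \<pi> (ip X m m)"
    if "m \<in> carrier X" for m
    using assms that by (simp_all add: is_psi_def)
  obtain xs where s: "\<forall>n. xs n \<in> carrier A" "X.vlim (\<lambda>n. q (xs n)) x" using q_sequence[OF x] by blast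
  have "B.vlim (\<lambda>n. \<psi> (q (xs n))) (\<psi> x)"
    by (rule contractive_vlim[OF l(1) psi_contractive[OF l(1) ip(1)] s(2)]) (use s(1) x in auto)
  moreover have "B.vlim (\<lambda>n. \<psi>' (q (xs n))) (\<psi>' x)"
    by (rule contractive_vlim[OF l(2) psi_contractive[OF l(2) ip(2)] s(2)]) (use s(1) x in auto)
  moreover have "\<psi> (q (xs n)) = \<psi>' (q (xs n))" for n using s(1) eq by simp
  ultimately show "\<psi> x = \<psi>' x"
    using B.vlim_unique[of "\<lambda>n. \<psi> (q (xs n))" "\<psi> x" "\<psi>' x"] s(1) x l[THEN linear_mapD(1)] by simp
qed (use assms in \<open>auto simp: is_psi_def\<close>)

abbreviation "\<psi> \<equiv> psi A X q B \<pi> S"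

lemma is_psi_psi: "is_psi \<psi>"
  unfolding psi_def is_psi_def[symmetric]
proof (rule theI'[of is_psi])
  show "\<exists>!\<psi>. is_psi \<psi>" using psi_exists psi_unique by (intro ex_ex1I)
qed

lemma psi_linear: "linear_map X B \<psi>"
  and psi_q: "a \<in> carrier A \<Longrightarrow> \<psi> (q a) = snd S (\<pi> a)"
  and psi_ract: "\<lbrakk>m \<in> carrier X; a \<in> carrier A\<rbrakk> \<Longrightarrow> \<psi> (ract X m a) = \<psi> m \<otimes> \<pi> a"
  and psi_ip: "\<lbrakk>m \<in> carrier X; n \<in> carrier X\<rbrakk> \<Longrightarrow> adj B (\<psi> m) \<otimes> \<psi> n = \<pi> (ip X m n)"
  using is_psi_psi by (simp_all add: is_psi_def mult_right_def)

lemma psi_norm_le: "m \<in> carrier X \<Longrightarrow> nrm B (\<psi> m) \<le> X.MN m"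
  by (rule psi_contractive[OF psi_linear psi_ip])

lemma psi_closed [simp, intro]: "m \<in> carrier X \<Longrightarrow> \<psi> m \<in> carrier B"
  by (rule linear_mapD(1)[OF psi_linear])

end

lemma double_power_growth:
  fixes a b C :: real
  assumes a: "a > 0" and b: "b > 0" and le: "\<And>n. a ^ (2 ^ Suc n) * b \<le> C * b ^ (2 ^ Suc n)"
  shows "a \<le> b"
proof (rule ccontr)
  assume "\<not> a \<le> b"
  then have t: "a / b > 1" using b by simp
  obtain n where n: "C / b < (a / b) ^ n" using real_arch_pow[OF t] by blast
  have "(a / b) ^ n \<le> (a / b) ^ (2 ^ Suc n)" using t less_exp[of "Suc n"] by (intro power_increasing) simp_all
  also have "\<dots> \<le> C / b" using le[of n] b by (simp add: power_divide field_simps)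
  finally show False using n by simp
qed

context exel_representation
begin

text \<open>The pairs of a finite-rank operator on \<open>M\<^sub>L\<close> and the corresponding element of \<open>B\<close>. A relation
  is used because the same operator may be written as a sum of \<open>\<Theta>\<^bsub>m,n\<^esub>\<close> in many ways.\<close>

inductive_set finite_rank :: "(('x \<Rightarrow> 'x) \<times> 'b) set" where
  fr_theta: "\<lbrakk>m \<in> carrier X; n \<in> carrier X\<rbrakk> \<Longrightarrow> (theta X m n, \<psi> m \<otimes> adj B (\<psi> n)) \<in> finite_rank"
| fr_add: "\<lbrakk>(k, x) \<in> finite_rank; (l, y) \<in> finite_rank\<rbrakk> \<Longrightarrow> (k \<oplus>\<^bsub>X.L\<^esub> l, x \<oplus> y) \<in> finite_rank"
| fr_scale: "(k, x) \<in> finite_rank \<Longrightarrow> (c \<odot>\<^bsub>X.L\<^esub> k, c \<odot> x) \<in> finite_rank"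

lemma theta_in: "\<lbrakk>m \<in> carrier X; n \<in> carrier X\<rbrakk> \<Longrightarrow> theta X m n \<in> carrier X.L"
  by (rule X.adjointablesI[where S = "theta X n m"]) (simp_all add: theta_def X.ip_simps X.ip_adj)

lemma adj_theta: "\<lbrakk>m \<in> carrier X; n \<in> carrier X\<rbrakk> \<Longrightarrow> adj X.L (theta X m n) = theta X n m"
  by (rule X.adj_adjointables_eqI) (simp_all add: theta_in, simp_all add: theta_def X.ip_simps X.ip_adj)

lemma finite_rank_in: "(k, x) \<in> finite_rank \<Longrightarrow> k \<in> carrier X.L \<and> x \<in> carrier B"
  by (induction rule: finite_rank.induct) (simp_all add: theta_in X.adjointables_ops_closed)

lemma finite_rank_act:
  assumes "(k, x) \<in> finite_rank" "m \<in> carrier X"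
  shows "x \<otimes> \<psi> m = \<psi> (k m)"
  using assms(1)
proof (induction rule: finite_rank.induct)
  case (fr_theta m' n)
  then show ?case using assms(2) by (simp add: B.mult_assoc psi_ip theta_def psi_ract)
next
  case (fr_add k x l y)
  then show ?case
    using assms(2) finite_rank_in[OF fr_add(1)] finite_rank_in[OF fr_add(2)] linear_mapD(2)[OF psi_linear]
    by (simp add: B.mult_add_left X.adjointables_ops X.adjointables_closed)
next
  case (fr_scale k x c)
  then show ?case
    using assms(2) finite_rank_in[OF fr_scale(1)] linear_mapD(3)[OF psi_linear]
    by (simp add: B.mult_scale_left X.adjointables_ops X.adjointables_closed)
qed

lemma finite_rank_mult:
  assumes "(l, y) \<in> finite_rank" "(k, x) \<in> finite_rank"
  shows "(l \<otimes>\<^bsub>X.L\<^esub> k, y \<otimes> x) \<in> finite_rank"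
  using assms(2)
proof (induction rule: finite_rank.induct)
  interpret LX: cstar_algebra X.L by (rule X.adjointables_cstar_algebra)
  note ly = finite_rank_in[OF assms(1)]
  {
    case (fr_theta m n)
    have lm: "l m \<in> carrier X" using ly fr_theta X.adjointables_closed by blast
    have "l \<otimes>\<^bsub>X.L\<^esub> theta X m n = theta X (l m) n"
      using ly lm fr_theta
      by (intro X.adjointables_eqI X.adjointables_ops_closed theta_in)
        (simp_all add: X.adjointables_ops theta_def X.adjointables_linear)
    moreover have "y \<otimes> (\<psi> m \<otimes> adj B (\<psi> n)) = \<psi> (l m) \<otimes> adj B (\<psi> n)"
      using ly fr_theta finite_rank_act[OF assms(1), of m] by (simp add: B.mult_assoc[symmetric])
    ultimately show ?case using finite_rank.fr_theta[OF lm fr_theta(2)] by simp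
  next
    case (fr_add k x k' x')
    then show ?case
      using finite_rank.fr_add[OF fr_add.IH] ly finite_rank_in[OF fr_add.hyps(1)] finite_rank_in[OF fr_add.hyps(2)]
      by (simp add: LX.mult_add_right B.mult_add_right)
  next
    case (fr_scale k x c)
    then show ?case
      using finite_rank.fr_scale[OF fr_scale.IH, of c] ly finite_rank_in[OF fr_scale.hyps(1)]
      by (simp add: LX.mult_scale_right B.mult_scale_right)
  }
qed

lemma finite_rank_adj:
  assumes "(k, x) \<in> finite_rank"
  shows "(adj X.L k, adj B x) \<in> finite_rank"
  using assms
proof (induction rule: finite_rank.induct)
  interpret LX: cstar_algebra X.L by (rule X.adjointables_cstar_algebra)
  {
    case (fr_theta m n)
    then show ?case using finite_rank.fr_theta[of n m] by (simp add: adj_theta B.adj_mult B.adj_adj)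
  next
    case (fr_add k x k' x')
    then show ?case
      using finite_rank.fr_add[OF fr_add.IH] finite_rank_in[OF fr_add.hyps(1)] finite_rank_in[OF fr_add.hyps(2)]
      by (simp add: LX.adj_add B.adj_add)
  next
    case (fr_scale k x c)
    then show ?case
      using finite_rank.fr_scale[OF fr_scale.IH, of "cnj c"] finite_rank_in[OF fr_scale.hyps(1)]
      by (simp add: LX.adj_scale B.adj_scale)
  }
qed

text \<open>If \<open>x = \<psi>(m) \<psi>(n)\<^sup>*\<close>, then \<open>y x = \<psi>(l m) \<psi>(n)\<^sup>*\<close>, and \<open>\<psi>\<close> is contractive.\<close>

lemma finite_rank_mult_bound:
  assumes "(k, x) \<in> finite_rank"
  shows "\<exists>C\<ge>0. \<forall>l y. (l, y) \<in> finite_rank \<longrightarrow> nrm B (y \<otimes> x) \<le> C * nrm X.L l"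
  using assms
proof (induction rule: finite_rank.induct)
  case (fr_theta m n)
  let ?C = "X.MN m * X.MN n"
  have "nrm B (y \<otimes> (\<psi> m \<otimes> adj B (\<psi> n))) \<le> ?C * nrm X.L l" if ly: "(l, y) \<in> finite_rank" for l y
  proof -
    note lyc = finite_rank_in[OF ly]
    have lm: "l m \<in> carrier X" using lyc fr_theta X.adjointables_closed by blast
    have "y \<otimes> (\<psi> m \<otimes> adj B (\<psi> n)) = \<psi> (l m) \<otimes> adj B (\<psi> n)"
      using lyc fr_theta finite_rank_act[OF ly, of m] by (simp add: B.mult_assoc[symmetric])
    then have "nrm B (y \<otimes> (\<psi> m \<otimes> adj B (\<psi> n))) \<le> nrm B (\<psi> (l m)) * nrm B (\<psi> n)"
      using B.norm_mult[of "\<psi> (l m)" "adj B (\<psi> n)"] lm fr_theta by (simp add: B.norm_adj)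
    also have "\<dots> \<le> X.MN (l m) * X.MN n"
      using lm fr_theta psi_norm_le[OF lm] psi_norm_le[OF fr_theta(2)]
        B.norm_nonneg[of "\<psi> n"] X.MN_nonneg[OF lm] by (intro mult_mono) auto
    also have "\<dots> \<le> (nrm X.L l * X.MN m) * X.MN n"
      using X.opnorm_bound[OF _ fr_theta(1), of l] lyc X.MN_nonneg[OF fr_theta(2)] by (intro mult_right_mono) auto
    finally show ?thesis by (simp add: mult_ac)
  qed
  then show ?case
    using X.MN_nonneg[OF fr_theta(1)] X.MN_nonneg[OF fr_theta(2)] by (intro exI[of _ ?C]) auto
next
  case (fr_add k x k' x')
  obtain C C' where C: "C \<ge> 0" "\<forall>l y. (l, y) \<in> finite_rank \<longrightarrow> nrm B (y \<otimes> x) \<le> C * nrm X.L l"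
    and C': "C' \<ge> 0" "\<forall>l y. (l, y) \<in> finite_rank \<longrightarrow> nrm B (y \<otimes> x') \<le> C' * nrm X.L l"
    using fr_add.IH by blast
  have "nrm B (y \<otimes> (x \<oplus> x')) \<le> (C + C') * nrm X.L l" if ly: "(l, y) \<in> finite_rank" for l y
  proof -
    have "nrm B (y \<otimes> (x \<oplus> x')) \<le> nrm B (y \<otimes> x) + nrm B (y \<otimes> x')"
      using finite_rank_in[OF ly] finite_rank_in[OF fr_add.hyps(1)] finite_rank_in[OF fr_add.hyps(2)]
      by (simp add: B.mult_add_right B.norm_triangle)
    also have "\<dots> \<le> C * nrm X.L l + C' * nrm X.L l" using C(2) C'(2) ly by (intro add_mono) auto
    finally show ?thesis by (simp add: distrib_right)
  qed
  then show ?case using C(1) C'(1) by (intro exI[of _ "C + C'"]) auto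
next
  case (fr_scale k x c)
  obtain C where C: "C \<ge> 0" "\<forall>l y. (l, y) \<in> finite_rank \<longrightarrow> nrm B (y \<otimes> x) \<le> C * nrm X.L l"
    using fr_scale.IH by blast
  have "nrm B (y \<otimes> (c \<odot> x)) \<le> (cmod c * C) * nrm X.L l" if ly: "(l, y) \<in> finite_rank" for l y
  proof -
    have "nrm B (y \<otimes> (c \<odot> x)) = cmod c * nrm B (y \<otimes> x)"
      using finite_rank_in[OF ly] finite_rank_in[OF fr_scale.hyps(1)] by (simp add: B.mult_scale_right B.norm_scale)
    also have "\<dots> \<le> cmod c * (C * nrm X.L l)" using C(2) ly by (intro mult_left_mono) auto
    finally show ?thesis by (simp add: mult.assoc)
  qed
  then show ?case using C(1) by (intro exI[of _ "cmod c * C"]) auto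
qed

text \<open>For self-adjoint \<open>y\<close> corresponding to \<open>h\<close>, the pairs \<open>(l, w)\<close> below are \<open>(h\<^bsup>N-1\<^esup>, y\<^bsup>N-1\<^esup>)\<close> for
  powers \<open>N\<close> of two. Then \<open>\<parallel>y\<parallel>\<^sup>N = \<parallel>w y\<parallel> \<le> C \<parallel>h\<parallel>\<^bsup>N-1\<^esup>\<close> with \<open>C\<close> independent of \<open>N\<close>, which forces
  \<open>\<parallel>y\<parallel> \<le> \<parallel>h\<parallel>\<close>.\<close>

lemma finite_rank_norm_selfadjoint:
  assumes "(h, y) \<in> finite_rank" "adj B y = y"
  shows "nrm B y \<le> nrm X.L h"
proof (cases "nrm B y = 0")
  case False
  interpret LX: cstar_algebra X.L by (rule X.adjointables_cstar_algebra)
  note hy = finite_rank_in[OF assms(1)]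
  have pos: "0 < nrm B y" using False B.norm_nonneg hy by fastforce
  obtain C where C: "C \<ge> 0" "\<And>l z. (l, z) \<in> finite_rank \<Longrightarrow> nrm B (z \<otimes> y) \<le> C * nrm X.L l"
    using finite_rank_mult_bound[OF assms(1)] by blast
  have pos': "0 < nrm X.L h"
  proof (rule ccontr)
    assume "\<not> ?thesis"
    then have "nrm X.L h = 0" using LX.norm_nonneg[of h] hy by simp
    then show False using C(2)[OF assms(1)] B.cstar_identity[of y] hy assms(2) pos by simp
  qed
  have pw: "r ^ (2 ^ Suc (Suc n)) = (r ^ (2 ^ Suc n))\<^sup>2" for r :: real and n
    by (simp add: power_mult[symmetric] mult.commute)
  have ex: "\<exists>l w. (l, w) \<in> finite_rank \<and> adj B (w \<otimes> y) = w \<otimes> y \<and> nrm B (w \<otimes> y) = nrm B y ^ (2 ^ Suc n) \<and>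
      nrm X.L l * nrm X.L h \<le> nrm X.L h ^ (2 ^ Suc n)" for n
  proof (induction n)
    case 0
    show ?case
      using assms hy B.cstar_identity[of y] by (intro exI[of _ h] exI[of _ y]) (simp add: B.adj_mult power2_eq_square)
  next
    case (Suc n)
    then obtain l w where w: "(l, w) \<in> finite_rank" "adj B (w \<otimes> y) = w \<otimes> y"
      "nrm B (w \<otimes> y) = nrm B y ^ (2 ^ Suc n)" "nrm X.L l * nrm X.L h \<le> nrm X.L h ^ (2 ^ Suc n)" by blast
    note lw = finite_rank_in[OF w(1)]
    let ?l = "l \<otimes>\<^bsub>X.L\<^esub> (h \<otimes>\<^bsub>X.L\<^esub> l)" and ?w = "w \<otimes> (y \<otimes> w)"
    have wy: "w \<otimes> y \<in> carrier B" and hl: "h \<otimes>\<^bsub>X.L\<^esub> l \<in> carrier X.L" using lw hy by simp_all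
    have eq: "?w \<otimes> y = (w \<otimes> y) \<otimes> (w \<otimes> y)" using lw hy by (simp add: B.mult_assoc)
    have "nrm X.L ?l * nrm X.L h \<le> (nrm X.L l * (nrm X.L h * nrm X.L l)) * nrm X.L h"
      using LX.norm_mult[of l "h \<otimes>\<^bsub>X.L\<^esub> l"] LX.norm_mult[of h l] lw hy hl LX.norm_nonneg[of l] pos'
      by (intro mult_right_mono) (auto intro: order_trans mult_left_mono)
    also have "\<dots> = (nrm X.L l * nrm X.L h)\<^sup>2" by (simp add: power2_eq_square)
    also have "\<dots> \<le> (nrm X.L h ^ (2 ^ Suc n))\<^sup>2" using w(4) LX.norm_nonneg[of l] lw pos' by (intro power_mono) auto
    finally have "nrm X.L ?l * nrm X.L h \<le> nrm X.L h ^ (2 ^ Suc (Suc n))" by (simp only: pw)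
    moreover have "nrm B (?w \<otimes> y) = nrm B y ^ (2 ^ Suc (Suc n))"
      using B.cstar_identity[OF wy] w(2,3) by (simp only: pw eq)
    moreover have "adj B (?w \<otimes> y) = ?w \<otimes> y" unfolding eq B.adj_mult[OF wy wy] w(2) by (rule refl)
    moreover have "(?l, ?w) \<in> finite_rank" by (intro finite_rank_mult w(1) assms(1))
    ultimately show ?case by blast
  qed
  show ?thesis
  proof (rule double_power_growth[OF pos pos'])
    fix n
    obtain l w where w: "(l, w) \<in> finite_rank" "nrm B (w \<otimes> y) = nrm B y ^ (2 ^ Suc n)"
      "nrm X.L l * nrm X.L h \<le> nrm X.L h ^ (2 ^ Suc n)" using ex[of n] by blast
    have "nrm B (w \<otimes> y) * nrm X.L h \<le> (C * nrm X.L l) * nrm X.L h" using C(2)[OF w(1)] pos' by (intro mult_right_mono) auto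
    also have "\<dots> \<le> C * nrm X.L h ^ (2 ^ Suc n)" using mult_left_mono[OF w(3) C(1)] by (simp only: mult.assoc)
    finally show "nrm B y ^ (2 ^ Suc n) * nrm X.L h \<le> C * nrm X.L h ^ (2 ^ Suc n)" by (simp only: w(2))
  qed
next
  case True
  then show ?thesis using X.opnorm_nonneg finite_rank_in[OF assms(1)] by simp
qed

lemma finite_rank_norm:
  assumes "(k, x) \<in> finite_rank"
  shows "nrm B x \<le> nrm X.L k"
proof -
  interpret LX: cstar_algebra X.L by (rule X.adjointables_cstar_algebra)
  note kx = finite_rank_in[OF assms]
  have "nrm B (adj B x \<otimes> x) \<le> nrm X.L (adj X.L k \<otimes>\<^bsub>X.L\<^esub> k)"
    using kx by (intro finite_rank_norm_selfadjoint finite_rank_mult finite_rank_adj assms)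
      (simp add: B.adj_mult B.adj_adj)
  then have "(nrm B x)\<^sup>2 \<le> (nrm X.L k)\<^sup>2" using kx by (simp add: B.cstar_identity LX.cstar_identity)
  then show ?thesis by (rule power2_le_imp_le) (simp add: LX.norm_nonneg kx)
qed

abbreviation "KX \<equiv> compacts A X"

lemma compacts_carrier: "carrier KX = closed_subspace X.L hull {theta X m n | m n. m \<in> carrier X \<and> n \<in> carrier X}"
  by (simp add: compacts_def)

lemma compacts_ops:
  "vadd KX = vadd X.L" "vscale KX = vscale X.L" "cmul KX = cmul X.L" "adj KX = adj X.L" "nrm KX = nrm X.L"
  "vzero KX = vzero X.L" "k \<ominus>\<^bsub>KX\<^esub> l = k \<ominus>\<^bsub>X.L\<^esub> l"
  by (simp_all add: compacts_def vdiff_def)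

lemma compacts_closed_subspace: "closed_subspace X.L (carrier KX)"
proof -
  interpret LX: cstar_algebra X.L by (rule X.adjointables_cstar_algebra)
  show ?thesis unfolding compacts_carrier by (rule LX.closed_subspace_hull) (use theta_in in auto)
qed

lemma finite_rank_compact: "(k, x) \<in> finite_rank \<Longrightarrow> k \<in> carrier KX"
proof (induction rule: finite_rank.induct)
  interpret LX: cstar_algebra X.L by (rule X.adjointables_cstar_algebra)
  {
    case (fr_theta m n)
    then show ?case unfolding compacts_carrier by (intro hull_inc) blast
  next
    case (fr_add k x l y)
    then show ?case using LX.closed_subspaceD(3)[OF compacts_closed_subspace] by blast
  next
    case (fr_scale k x c)
    then show ?case using LX.closed_subspaceD(4)[OF compacts_closed_subspace] by blast
  }
qed

lemma compacts_approx:
  assumes "k \<in> carrier KX" "e > 0"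
  shows "\<exists>l y. (l, y) \<in> finite_rank \<and> nrm X.L (k \<ominus>\<^bsub>X.L\<^esub> l) < e"
proof -
  interpret LX: cstar_algebra X.L by (rule X.adjointables_cstar_algebra)
  have "linear_subspace X.L (Domain finite_rank)"
    unfolding linear_subspace_def
  proof (intro conjI ballI allI)
    show "Domain finite_rank \<subseteq> carrier X.L" using finite_rank_in by blast
    have "(0 \<odot>\<^bsub>X.L\<^esub> theta X \<zero>\<^bsub>X\<^esub> \<zero>\<^bsub>X\<^esub>, 0 \<odot> (\<psi> \<zero>\<^bsub>X\<^esub> \<otimes> adj B (\<psi> \<zero>\<^bsub>X\<^esub>))) \<in> finite_rank"
      by (intro fr_scale fr_theta) auto
    then have "0 \<odot>\<^bsub>X.L\<^esub> theta X \<zero>\<^bsub>X\<^esub> \<zero>\<^bsub>X\<^esub> \<in> Domain finite_rank" by blast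
    then show "\<zero>\<^bsub>X.L\<^esub> \<in> Domain finite_rank" using LX.scale_0[OF theta_in] by simp
    show "k \<oplus>\<^bsub>X.L\<^esub> l \<in> Domain finite_rank" if "k \<in> Domain finite_rank" "l \<in> Domain finite_rank" for k l
      using that fr_add by blast
    show "c \<odot>\<^bsub>X.L\<^esub> k \<in> Domain finite_rank" if "k \<in> Domain finite_rank" for c k
      using that fr_scale by blast
  qed
  note cl = LX.closed_subspace_closure[OF this]
  let ?C = "{x \<in> carrier X.L. \<forall>e>0. \<exists>w\<in>Domain finite_rank. nrm X.L (x \<ominus>\<^bsub>X.L\<^esub> w) < e}"
  have "{theta X m n | m n. m \<in> carrier X \<and> n \<in> carrier X} \<subseteq> ?C"
  proof clarify
    fix m n assume mn: "m \<in> carrier X" "n \<in> carrier X"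
    have "theta X m n \<in> Domain finite_rank" using fr_theta[OF mn] by blast
    moreover have "nrm X.L (theta X m n \<ominus>\<^bsub>X.L\<^esub> theta X m n) = 0" using theta_in[OF mn] by (simp add: LX.vdiff_self LX.N_zero)
    ultimately show "theta X m n \<in> carrier X.L \<and> (\<forall>e>0. \<exists>w\<in>Domain finite_rank. nrm X.L (theta X m n \<ominus>\<^bsub>X.L\<^esub> w) < e)"
      using theta_in[OF mn] by (auto intro!: bexI[of _ "theta X m n"])
  qed
  then have "carrier KX \<subseteq> ?C" unfolding compacts_carrier by (rule hull_minimal) (rule cl)
  then have "\<exists>w\<in>Domain finite_rank. nrm X.L (k \<ominus>\<^bsub>X.L\<^esub> w) < e" using assms by blast
  then show ?thesis by blast
qed

lemma compacts_in_adjointables: "k \<in> carrier KX \<Longrightarrow> k \<in> carrier X.L"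
proof -
  interpret LX: cstar_algebra X.L by (rule X.adjointables_cstar_algebra)
  show "k \<in> carrier KX \<Longrightarrow> k \<in> carrier X.L" using LX.closed_subspaceD(1)[OF compacts_closed_subspace] by blast
qed

lemma compacts_cstar_algebra: "cstar_algebra KX"
proof -
  interpret LX: cstar_algebra X.L by (rule X.adjointables_cstar_algebra)
  have cl: "closedin (norm_topology X.L (nrm X.L)) (carrier KX)"
    using compacts_closed_subspace unfolding closed_subspace_def by blast
  have seq: "\<exists>xs. (\<forall>n. xs n \<in> Domain finite_rank) \<and> LX.vlim xs k" if k: "k \<in> carrier KX" for k
    by (rule LX.approx_sequence[OF compacts_in_adjointables[OF k]])
      (use finite_rank_in compacts_approx[OF k] in blast)+
  have D: "Domain finite_rank \<subseteq> carrier KX" "Domain finite_rank \<subseteq> carrier X.L"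
    using finite_rank_compact finite_rank_in by blast+
  have "cstar_subalgebra X.L (carrier KX)"
    unfolding cstar_subalgebra_def
  proof (intro conjI ballI compacts_closed_subspace)
    fix k l assume kl: "k \<in> carrier KX" "l \<in> carrier KX"
    obtain xs ys where s: "\<forall>n. xs n \<in> Domain finite_rank" "LX.vlim xs k" and t: "\<forall>n. ys n \<in> Domain finite_rank" "LX.vlim ys l"
      using seq[OF kl(1)] seq[OF kl(2)] by blast
    have sc: "xs n \<in> carrier X.L" and tc: "ys n \<in> carrier X.L" for n using s(1) t(1) D(2) by blast+
    have "LX.vlim (\<lambda>n. xs n \<otimes>\<^bsub>X.L\<^esub> ys n) (k \<otimes>\<^bsub>X.L\<^esub> l)"
      by (rule LX.vlim_mult[OF s(2) t(2) sc tc]) (use kl compacts_in_adjointables in auto)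
    moreover have "xs n \<otimes>\<^bsub>X.L\<^esub> ys n \<in> carrier KX" for n
    proof -
      obtain x y where "(xs n, x) \<in> finite_rank" "(ys n, y) \<in> finite_rank" using s(1) t(1) by blast
      then show ?thesis using finite_rank_mult finite_rank_compact by blast
    qed
    ultimately show "k \<otimes>\<^bsub>X.L\<^esub> l \<in> carrier KX"
      by (rule LX.vlim_in_closed[OF _ _ _ cl]) (use kl compacts_in_adjointables in auto)
  next
    fix k assume k: "k \<in> carrier KX"
    obtain xs where s: "\<forall>n. xs n \<in> Domain finite_rank" "LX.vlim xs k" using seq[OF k] by blast
    have sc: "xs n \<in> carrier X.L" for n using s(1) D(2) by blast
    have "LX.vlim (\<lambda>n. adj X.L (xs n)) (adj X.L k)"
      by (rule LX.vlim_adj[OF s(2) sc]) (use k compacts_in_adjointables in auto)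
    moreover have "adj X.L (xs n) \<in> carrier KX" for n
    proof -
      obtain x where "(xs n, x) \<in> finite_rank" using s(1) by blast
      then show ?thesis using finite_rank_adj finite_rank_compact by blast
    qed
    ultimately show "adj X.L k \<in> carrier KX"
      by (rule LX.vlim_in_closed[OF _ _ _ cl]) (use k compacts_in_adjointables in auto)
  qed
  then have "cstar_algebra (X.L\<lparr>carrier := carrier KX\<rparr>)"
    by (rule cstar_algebra_restrict[OF X.adjointables_cstar_algebra])
  then show ?thesis by (simp add: compacts_def)
qed

definition is_psi_compacts :: "(('x \<Rightarrow> 'x) \<Rightarrow> 'b) \<Rightarrow> bool"
  where "is_psi_compacts \<Psi> \<longleftrightarrow> \<Psi> \<in> extensional (carrier KX) \<and> star_hom KX B \<Psi> \<and>
    (\<forall>m\<in>carrier X. \<forall>n\<in>carrier X. \<Psi> (theta X m n) = \<psi> m \<otimes> adj B (\<psi> n))"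

lemma compacts_sequence:
  assumes "k \<in> carrier KX"
  shows "\<exists>xs ys. (\<forall>n. (xs n, ys n) \<in> finite_rank) \<and>
    carrier_normed_space.vlim KX (nrm KX) xs k"
proof -
  interpret K: cstar_algebra KX by (rule compacts_cstar_algebra)
  have "\<exists>xs. (\<forall>n. xs n \<in> Domain finite_rank) \<and> K.vlim xs k"
  proof (rule K.approx_sequence[OF assms])
    show "Domain finite_rank \<subseteq> carrier KX" using finite_rank_compact by blast
    show "\<exists>w\<in>Domain finite_rank. nrm KX (k \<ominus>\<^bsub>KX\<^esub> w) < e" if "e > 0" for e
      using compacts_approx[OF assms that] by (auto simp: compacts_ops)
  qed
  then obtain xs where s: "\<forall>n. xs n \<in> Domain finite_rank" "K.vlim xs k" by blast
  then have "\<forall>n. \<exists>y. (xs n, y) \<in> finite_rank" by blast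
  then have "\<exists>ys. \<forall>n. (xs n, ys n) \<in> finite_rank" by (rule choice)
  then show ?thesis using s(2) by blast
qed

lemma psi_compacts_exists: "\<exists>\<Psi>. is_psi_compacts \<Psi>"
proof -
  interpret K: cstar_algebra KX by (rule compacts_cstar_algebra)
  obtain \<Psi> where P: "linear_map KX B \<Psi>" "\<And>k x. (k, x) \<in> finite_rank \<Longrightarrow> \<Psi> k = x"
    "\<And>k. k \<in> carrier KX \<Longrightarrow> nrm B (\<Psi> k) \<le> nrm KX k"
  proof (rule extend_bounded_relation[where V = KX and W = B and N = "nrm KX" and M = "nrm B" and R = finite_rank])
    show "carrier_normed_space KX (nrm KX)" by (rule K.carrier_normed_space_axioms)
    show "carrier_normed_space B (nrm B)" by (rule B.carrier_normed_space_axioms)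
    show "Metric_space.mcomplete (carrier B) (norm_dist B (nrm B))" by (rule B.complete)
    show "k \<in> carrier KX \<and> x \<in> carrier B" if "(k, x) \<in> finite_rank" for k x
      using finite_rank_compact[OF that] finite_rank_in[OF that] by simp
    show "nrm B x \<le> nrm KX k" if "(k, x) \<in> finite_rank" for k x
      using finite_rank_norm[OF that] by (simp add: compacts_ops)
    show "\<exists>l y. (l, y) \<in> finite_rank \<and> nrm KX (k \<ominus>\<^bsub>KX\<^esub> l) < e" if "k \<in> carrier KX" "e > 0" for k e
      using compacts_approx[OF that] by (simp add: compacts_ops)
  qed (use fr_add fr_scale in \<open>auto simp: compacts_ops\<close>)
  note Pc = linear_mapD(1)[OF P(1)]
  have cont: "B.vlim (\<lambda>n. \<Psi> (xs n)) (\<Psi> k)" if "K.vlim xs k" "\<And>n. xs n \<in> carrier KX" "k \<in> carrier KX" for xs k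
  proof (rule B.vlim_I)
    show "(\<lambda>n. nrm KX (xs n \<ominus>\<^bsub>KX\<^esub> k)) \<longlonglongrightarrow> 0" using that(1) by (simp add: K.vlim_def)
    show "nrm B (\<Psi> (xs n) \<ominus> \<Psi> k) \<le> nrm KX (xs n \<ominus>\<^bsub>KX\<^esub> k)" for n
      using P(3)[of "xs n \<ominus>\<^bsub>KX\<^esub> k"] that(2)[of n] that(3)
        K.linear_vdiff[OF P(1), of "xs n" k] by simp
  qed (use Pc that in auto)
  have mult: "\<Psi> (k \<otimes>\<^bsub>KX\<^esub> l) = \<Psi> k \<otimes> \<Psi> l" if kl: "k \<in> carrier KX" "l \<in> carrier KX" for k l
  proof -
    obtain xs ys where s: "\<forall>n. (xs n, ys n) \<in> finite_rank" "K.vlim xs k" using compacts_sequence[OF kl(1)] by blast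
    obtain xs' ys' where s': "\<forall>n. (xs' n, ys' n) \<in> finite_rank" "K.vlim xs' l" using compacts_sequence[OF kl(2)] by blast
    have c: "xs n \<in> carrier KX" "xs' n \<in> carrier KX" for n using s(1) s'(1) finite_rank_compact by blast+
    have "B.vlim (\<lambda>n. \<Psi> (xs n \<otimes>\<^bsub>KX\<^esub> xs' n)) (\<Psi> (k \<otimes>\<^bsub>KX\<^esub> l))"
      by (rule cont[OF K.vlim_mult[OF s(2) s'(2) c kl]]) (use c kl in auto)
    moreover have "\<Psi> (xs n \<otimes>\<^bsub>KX\<^esub> xs' n) = \<Psi> (xs n) \<otimes> \<Psi> (xs' n)" for n
      using P(2)[OF finite_rank_mult[OF s(1)[rule_format, of n] s'(1)[rule_format, of n]]]
        P(2)[OF s(1)[rule_format, of n]] P(2)[OF s'(1)[rule_format, of n]] by (simp add: compacts_ops)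
    moreover have "B.vlim (\<lambda>n. \<Psi> (xs n) \<otimes> \<Psi> (xs' n)) (\<Psi> k \<otimes> \<Psi> l)"
      by (rule B.vlim_mult[OF cont[OF s(2) c(1) kl(1)] cont[OF s'(2) c(2) kl(2)]]) (use c kl Pc in auto)
    ultimately show ?thesis
      by (intro B.vlim_unique[of "\<lambda>n. \<Psi> (xs n) \<otimes> \<Psi> (xs' n)"]) (use c kl Pc in simp_all)
  qed
  have adj: "\<Psi> (adj KX k) = adj B (\<Psi> k)" if k: "k \<in> carrier KX" for k
  proof -
    obtain xs ys where s: "\<forall>n. (xs n, ys n) \<in> finite_rank" "K.vlim xs k" using compacts_sequence[OF k] by blast
    have c: "xs n \<in> carrier KX" for n using s(1) finite_rank_compact by blast
    have "B.vlim (\<lambda>n. \<Psi> (adj KX (xs n))) (\<Psi> (adj KX k))"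
      by (rule cont[OF K.vlim_adj[OF s(2) c k]]) (use c k in auto)
    moreover have "\<Psi> (adj KX (xs n)) = adj B (\<Psi> (xs n))" for n
      using P(2)[OF finite_rank_adj[OF s(1)[rule_format, of n]]]
        P(2)[OF s(1)[rule_format, of n]] by (simp add: compacts_ops)
    moreover have "B.vlim (\<lambda>n. adj B (\<Psi> (xs n))) (adj B (\<Psi> k))"
      by (rule B.vlim_adj[OF cont[OF s(2) c k]]) (use c k Pc in auto)
    ultimately show ?thesis
      by (intro B.vlim_unique[of "\<lambda>n. adj B (\<Psi> (xs n))"]) (use c k Pc in simp_all)
  qed
  have th: "theta X m n \<in> carrier KX" "\<Psi> (theta X m n) = \<psi> m \<otimes> adj B (\<psi> n)"
    if "m \<in> carrier X" "n \<in> carrier X" for m n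
    using P(2)[OF fr_theta[OF that]] finite_rank_compact[OF fr_theta[OF that]] by auto
  have "star_hom KX B (restrict \<Psi> (carrier KX))"
    unfolding star_hom_def using P(1) mult adj by (simp add: linear_map_def Pi_iff)
  then have "is_psi_compacts (restrict \<Psi> (carrier KX))"
    unfolding is_psi_compacts_def using th by simp
  then show ?thesis by blast
qed

lemma is_psi_compacts_finite_rank:
  assumes "is_psi_compacts \<Psi>" "(k, x) \<in> finite_rank"
  shows "\<Psi> k = x"
  using assms(2)
proof (induction rule: finite_rank.induct)
  note h = star_homD(3,4)[of KX B \<Psi>] and P = assms(1)[unfolded is_psi_compacts_def]
  {
    case (fr_theta m n)
    then show ?case using P by simp
  next
    case (fr_add k x l y)
    then show ?case using h(1)[of k l] P finite_rank_compact by (simp add: compacts_ops)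
  next
    case (fr_scale k x c)
    then show ?case using h(2)[of k c] P finite_rank_compact by (simp add: compacts_ops)
  }
qed

lemma psi_compacts_unique:
  assumes "is_psi_compacts \<Psi>" "is_psi_compacts \<Psi>'"
  shows "\<Psi> = \<Psi>'"
proof (rule extensionalityI[of _ "carrier KX"])
  interpret K: cstar_algebra KX by (rule compacts_cstar_algebra)
  interpret P: star_homomorphism KX B \<Psi>
    using assms(1) by unfold_locales (simp add: is_psi_compacts_def)
  interpret P': star_homomorphism KX B \<Psi>'
    using assms(2) by unfold_locales (simp add: is_psi_compacts_def)
  fix k assume k: "k \<in> carrier KX"
  obtain xs ys where s: "\<forall>n. (xs n, ys n) \<in> finite_rank" "K.vlim xs k" using compacts_sequence[OF k] by blast
  have c: "xs n \<in> carrier KX" for n using s(1) finite_rank_compact by blast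
  have "\<Psi> (xs n) = \<Psi>' (xs n)" for n
    using is_psi_compacts_finite_rank[OF assms(1)] is_psi_compacts_finite_rank[OF assms(2)] s(1) by metis
  then show "\<Psi> k = \<Psi>' k"
    using P.f_vlim[OF s(2) c k] P'.f_vlim[OF s(2) c k]
      B.vlim_unique[of "\<lambda>n. \<Psi> (xs n)" "\<Psi> k" "\<Psi>' k"] c k by simp
qed (use assms in \<open>auto simp: is_psi_compacts_def\<close>)

lemma is_psi_compacts: "is_psi_compacts (psi_compacts A X q B \<pi> S)"
proof -
  have "\<exists>!\<Psi>. is_psi_compacts \<Psi>" using psi_compacts_exists psi_compacts_unique by (intro ex_ex1I)
  from theI'[OF this] show ?thesis unfolding psi_compacts_def is_psi_compacts_def .
qed

text \<open>The operators \<open>\<Theta>\<close> formed from vectors in the image of \<open>q\<close> span a dense subspace of the compact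
  operators, and \<open>(\<psi>, \<pi>)\<^sup>(\<^sup>1\<^sup>)\<close> is contractive.\<close>

lemma psi_compacts_mem:
  assumes k: "k \<in> carrier KX" and W: "closed_subspace B W"
    and gen: "\<And>a b. \<lbrakk>a \<in> carrier A; b \<in> carrier A\<rbrakk> \<Longrightarrow> snd S (\<pi> a) \<otimes> adj B (snd S (\<pi> b)) \<in> W"
  shows "psi_compacts A X q B \<pi> S k \<in> W"
proof -
  let ?P = "psi_compacts A X q B \<pi> S"
  interpret K: cstar_algebra KX by (rule compacts_cstar_algebra)
  interpret P: star_homomorphism KX B ?P
    using is_psi_compacts by unfold_locales (simp add: is_psi_compacts_def)
  note WD = B.closed_subspaceD[OF W]
  have cl: "closedin (norm_topology B (nrm B)) W" using W unfolding closed_subspace_def by blast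
  have th: "\<psi> m \<otimes> adj B (\<psi> n) \<in> W" if mn: "m \<in> carrier X" "n \<in> carrier X" for m n
  proof -
    obtain xs where s: "\<forall>n. xs n \<in> carrier A" "X.vlim (\<lambda>n. q (xs n)) m" using q_sequence[OF mn(1)] by blast
    obtain ys where t: "\<forall>n. ys n \<in> carrier A" "X.vlim (\<lambda>n. q (ys n)) n" using q_sequence[OF mn(2)] by blast
    have "B.vlim (\<lambda>k. \<psi> (q (xs k))) (\<psi> m)"
      by (rule contractive_vlim[OF psi_linear psi_norm_le s(2)]) (use s(1) mn in auto)
    moreover have "B.vlim (\<lambda>k. \<psi> (q (ys k))) (\<psi> n)"
      by (rule contractive_vlim[OF psi_linear psi_norm_le t(2)]) (use t(1) mn in auto)
    ultimately have "B.vlim (\<lambda>k. \<psi> (q (xs k)) \<otimes> adj B (\<psi> (q (ys k)))) (\<psi> m \<otimes> adj B (\<psi> n))"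
      using s(1) t(1) mn by (intro B.vlim_mult B.vlim_adj) auto
    moreover have "\<psi> (q (xs k)) \<otimes> adj B (\<psi> (q (ys k))) \<in> W" for k
      using s(1) t(1) gen psi_q by simp
    ultimately show ?thesis by (rule B.vlim_in_closed[OF _ _ _ cl]) (use mn in auto)
  qed
  have fr: "x \<in> W" if "(l, x) \<in> finite_rank" for l x
    using that by (induction rule: finite_rank.induct) (use th WD(3,4) in auto)
  obtain xs ys where s: "\<forall>n. (xs n, ys n) \<in> finite_rank" "K.vlim xs k" using compacts_sequence[OF k] by blast
  have c: "xs n \<in> carrier KX" for n using s(1) finite_rank_compact by blast
  show ?thesis
  proof (rule B.vlim_in_closed[OF P.f_vlim[OF s(2) c k] _ _ cl])
    show "?P (xs n) \<in> W" for n
      using fr is_psi_compacts_finite_rank[OF is_psi_compacts] s(1) by metis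
  qed (use k in auto)
qed

lemma psi_compacts_closed: "k \<in> carrier KX \<Longrightarrow> psi_compacts A X q B \<pi> S k \<in> carrier B"
  by (rule psi_compacts_mem[OF _ B.closed_subspace_carrier]) auto

end

section \<open>The Exel crossed product and its dual action\<close>

lemma (in cstar_algebra) adj_multiplier_apply:
  assumes "m \<in> carrier MA" "a \<in> carrier A"
  shows "adj A (fst m a) = snd (adj MA m) (adj A a)" "adj A (snd m a) = fst (adj MA m) (adj A a)"
  using assms by (simp_all add: multiplier_ops(7,8) adj_adj)

lemma star_hom_equalizer:
  assumes "cstar_algebra B" "cstar_algebra C" "star_hom B C f" "star_hom B C g"
  shows "cstar_subalgebra B {x \<in> carrier B. f x = g x}" (is "cstar_subalgebra B ?W")
proof -
  interpret f: star_homomorphism B C f by (rule star_homomorphismI) fact+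
  interpret g: star_homomorphism B C g by (rule star_homomorphismI) fact+
  have "closed_subspace B ?W"
  proof (rule f.A.closed_subspaceI)
    fix x assume x: "x \<in> carrier B" and ap: "\<And>e. e > 0 \<Longrightarrow> \<exists>w\<in>?W. nrm B (x \<ominus>\<^bsub>B\<^esub> w) < e"
    have "\<exists>xs. (\<forall>n. xs n \<in> ?W) \<and> f.A.vlim xs x"
      by (rule f.A.approx_sequence[OF x _ ap]) auto
    then obtain xs where s: "\<forall>n. xs n \<in> ?W" "f.A.vlim xs x" by blast
    have c: "xs n \<in> carrier B" and eq: "f (xs n) = g (xs n)" for n using s(1) by auto
    have "f x = g x"
      using f.f_vlim[OF s(2) c x] g.f_vlim[OF s(2) c x] f.B.vlim_unique[of "\<lambda>n. f (xs n)" "f x" "g x"] c x eq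
      by simp
    then show "x \<in> ?W" using x by simp
  qed (auto simp: f.f_simps g.f_simps f.f_zero g.f_zero)
  then show ?thesis unfolding cstar_subalgebra_def by (auto simp: f.f_simps g.f_simps)
qed

lemma star_homs_eq_on_generated:
  assumes "cstar_algebra B" "cstar_algebra C" "nondegenerate_hom B C f" "nondegenerate_hom B C g"
    and gen: "generated_by_rep A B k v" and k: "\<And>a. a \<in> carrier A \<Longrightarrow> k a \<in> carrier B"
    and v: "v \<in> carrier (multiplier_algebra B)"
    and eq: "\<And>a. a \<in> carrier A \<Longrightarrow> f (k a) = g (k a)" "mult_extension B C f v = mult_extension B C g v"
    and x: "x \<in> carrier B"
  shows "f x = g x"
proof -
  interpret f: nondegenerate_homomorphism B C f by (rule nondegenerate_homomorphismI) fact+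
  interpret g: nondegenerate_homomorphism B C g by (rule nondegenerate_homomorphismI) fact+
  have lift: "f.lift v = g.lift v" using eq(2) v by (simp add: f.mult_extension_eq_lift g.mult_extension_eq_lift)
  have "f (snd v (k a)) = g (snd v (k a))" if "a \<in> carrier A" for a
    using f.lift_snd[OF v k[OF that]] g.lift_snd[OF v k[OF that]] lift eq(1)[OF that] by simp
  then have "k ` carrier A \<union> {mult_right (k a) v | a. a \<in> carrier A} \<subseteq> {x \<in> carrier B. f x = g x}"
    using k eq(1) f.A.multiplier_carrierD(2)[OF v] by (auto simp: mult_right_def)
  then have "cstar_subalgebra B hull (k ` carrier A \<union> {mult_right (k a) v | a. a \<in> carrier A})
      \<subseteq> {x \<in> carrier B. f x = g x}"
    using star_hom_equalizer[OF assms(1,2) f.hom g.hom] by (rule hull_minimal)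
  then show ?thesis using gen x unfolding generated_by_rep_def by blast
qed

lemma star_hom_kernel_ideal:
  assumes "cstar_algebra B" "cstar_algebra C" "star_hom B C f"
  shows "closed_ideal B {x \<in> carrier B. f x = \<zero>\<^bsub>C\<^esub>}" (is "closed_ideal B ?W")
proof -
  interpret f: star_homomorphism B C f by (rule star_homomorphismI) fact+
  have "closed_subspace B ?W"
  proof (rule f.A.closed_subspaceI)
    fix x assume x: "x \<in> carrier B" and ap: "\<And>e. e > 0 \<Longrightarrow> \<exists>w\<in>?W. nrm B (x \<ominus>\<^bsub>B\<^esub> w) < e"
    have "nrm C (f x \<ominus>\<^bsub>C\<^esub> \<zero>\<^bsub>C\<^esub>) \<le> e" if e: "e > 0" for e
    proof -
      obtain w where w: "w \<in> carrier B" "f w = \<zero>\<^bsub>C\<^esub>" "nrm B (x \<ominus>\<^bsub>B\<^esub> w) < e" using ap[OF e] by blast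
      then show ?thesis using f.f_norm_le[of "x \<ominus>\<^bsub>B\<^esub> w"] x by (simp add: f.f_vdiff)
    qed
    then have "f x = \<zero>\<^bsub>C\<^esub>" using x by (intro f.B.N_eqI) auto
    then show "x \<in> ?W" using x by simp
  qed (auto simp: f.f_simps f.f_zero f.B.add_zero f.B.scale_zero)
  then show ?thesis unfolding closed_ideal_def by (auto simp: f.f_simps f.B.mult_zero_left f.B.mult_zero_right)
qed

lemma toeplitz_rep_image:
  assumes "cstar_algebra A" "cstar_algebra B" "cstar_algebra C" "toeplitz_rep A \<alpha> L B \<pi> S"
    "nondegenerate_hom B C f" "\<And>a. a \<in> carrier A \<Longrightarrow> \<alpha> a \<in> carrier A" "\<And>a. a \<in> carrier A \<Longrightarrow> L a \<in> carrier A"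
  shows "toeplitz_rep A \<alpha> L C (f \<circ> \<pi>) (mult_extension B C f S)"
proof -
  have pi: "nondegenerate_hom A B \<pi>" and S: "S \<in> carrier (multiplier_algebra B)"
    and r: "\<And>a. a \<in> carrier A \<Longrightarrow> S \<otimes>\<^bsub>multiplier_algebra B\<^esub> mult_of B (\<pi> a) =
        mult_of B (\<pi> (\<alpha> a)) \<otimes>\<^bsub>multiplier_algebra B\<^esub> S"
      "\<And>a. a \<in> carrier A \<Longrightarrow> adj (multiplier_algebra B) S \<otimes>\<^bsub>multiplier_algebra B\<^esub> mult_of B (\<pi> a)
        \<otimes>\<^bsub>multiplier_algebra B\<^esub> S = mult_of B (\<pi> (L a))"
    using assms(4) unfolding toeplitz_rep_def by blast+
  interpret p: nondegenerate_homomorphism A B \<pi> by (rule nondegenerate_homomorphismI) fact+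
  interpret f: nondegenerate_homomorphism B C f by (rule nondegenerate_homomorphismI) fact+
  note lf = star_homD[OF f.lift_star_hom] and mc = p.B.multiplier_ops_closed
  show ?thesis
    unfolding toeplitz_rep_def f.mult_extension_eq_lift[OF S]
  proof (intro conjI ballI)
    show "nondegenerate_hom A C (f \<circ> \<pi>)" using assms pi by (intro nondegenerate_comp)
    show "f.lift S \<in> carrier f.B.MA" by (rule f.lift(1)[OF S])
    fix a assume a: "a \<in> carrier A"
    have "f.lift (S \<otimes>\<^bsub>p.B.MA\<^esub> mult_of B (\<pi> a)) = f.lift (mult_of B (\<pi> (\<alpha> a)) \<otimes>\<^bsub>p.B.MA\<^esub> S)"
      using r(1)[OF a] by simp
    then show "f.lift S \<otimes>\<^bsub>f.B.MA\<^esub> mult_of C ((f \<circ> \<pi>) a) = mult_of C ((f \<circ> \<pi>) (\<alpha> a)) \<otimes>\<^bsub>f.B.MA\<^esub> f.lift S"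
      using a assms(6)[OF a] S mc(3) by (simp add: lf(5) f.lift_mult_of)
    have "f.lift (adj p.B.MA S \<otimes>\<^bsub>p.B.MA\<^esub> mult_of B (\<pi> a) \<otimes>\<^bsub>p.B.MA\<^esub> S) = f.lift (mult_of B (\<pi> (L a)))"
      using r(2)[OF a] by simp
    then show "adj f.B.MA (f.lift S) \<otimes>\<^bsub>f.B.MA\<^esub> mult_of C ((f \<circ> \<pi>) a) \<otimes>\<^bsub>f.B.MA\<^esub> f.lift S
        = mult_of C ((f \<circ> \<pi>) (L a))"
      using a assms(7)[OF a] S mc(3,6,7) by (simp add: lf(5,6) f.lift_mult_of)
  qed
qed

locale exel_crossed_product =
  fixes A :: "'a cstar" and \<alpha> L :: "'a \<Rightarrow> 'a" and X :: "('a, 'x) bimodule" and q :: "'a \<Rightarrow> 'x"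
    and T :: "'u cstar" and E :: "'u cstar" (structure) and i :: "'a \<Rightarrow> 'u" and s :: "'u multiplier" and Q :: "'u \<Rightarrow> 'u"
  assumes exel: "exel_system A \<alpha> L" and bim: "exel_bimodule A \<alpha> L X q"
    and top: "toeplitz_crossed_product A \<alpha> L T i s"
    and quo: "cstar_quotient T (exel_ideal A \<alpha> X q T i s) E Q"
begin

lemma algebras: "cstar_algebra A" "cstar_algebra T" "cstar_algebra E"
  using exel top quo by (simp_all add: exel_system_def toeplitz_crossed_product_def cstar_quotient_def)

lemma transfer_operator: "a \<in> carrier A \<Longrightarrow> L a \<in> carrier A" "a \<in> carrier A \<Longrightarrow> L (\<alpha> a) = a"
  and alpha_star_hom: "star_hom A A \<alpha>"
proof -
  interpret A: cstar_algebra A by (rule algebras)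
  show L: "L a \<in> carrier A" if "a \<in> carrier A" for a
    using exel that unfolding exel_system_def positive_linear_map_def by (auto dest: linear_mapD(1))
  show al: "star_hom A A \<alpha>" using exel unfolding exel_system_def by blast
  show "L (\<alpha> a) = a" if a: "a \<in> carrier A"
  proof -
    obtain L' where L': "\<forall>a\<in>carrier A. \<forall>m\<in>carrier A.MA. L (mult_right (\<alpha> a) m) = mult_right a (L' m)"
      "L' (mult_one A) = mult_one A"
      using exel unfolding exel_system_def by blast
    have "L (mult_right (\<alpha> a) (mult_one A)) = mult_right a (L' (mult_one A))"
      using L'(1) a A.multiplier_ops_closed(2) by blast
    then show ?thesis using a star_homD(2)[OF al a] by (simp add: L'(2) mult_right_def A.multiplier_ops)
  qed
qed

sublocale TR: exel_representation A T i \<alpha> L s X q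
proof -
  have rep: "toeplitz_rep A \<alpha> L T i s" using top unfolding toeplitz_crossed_product_def by blast
  interpret nondegenerate_homomorphism A T i
    by (rule nondegenerate_homomorphismI) (use algebras rep in \<open>auto simp: toeplitz_rep_def\<close>)
  show "exel_representation A T i \<alpha> L s X q"
    by unfold_locales (use transfer_operator alpha_star_hom rep bim in auto)
qed

lemma quotient: "star_hom T E Q" "Q ` carrier T = carrier E"
  "{x \<in> carrier T. Q x = \<zero>} = exel_ideal A \<alpha> X q T i s"
  using quo by (auto simp: cstar_quotient_def)

sublocale Q: nondegenerate_homomorphism T E Q
  by (rule nondegenerate_homomorphismI[OF algebras(2,3)
        surjective_nondegenerate[OF algebras(2,3) quotient(1,2)]])

abbreviation j :: "'a \<Rightarrow> 'u" where "j \<equiv> Q \<circ> i"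
abbreviation t :: "'u multiplier" where "t \<equiv> mult_extension T E Q s"
abbreviation t' :: "'u multiplier" where "t' \<equiv> adj (multiplier_algebra E) t"

lemma t_eq: "t = Q.lift s" by (rule Q.mult_extension_eq_lift[OF TR.S_in])

sublocale J: toeplitz_representation A E j \<alpha> L t
proof -
  have rep: "toeplitz_rep A \<alpha> L E j t"
    by (rule toeplitz_rep_image[OF algebras TR.rep Q.nondegenerate]) (use transfer_operator in auto)
  interpret nondegenerate_homomorphism A E j
    by (rule nondegenerate_homomorphismI) (use algebras rep in \<open>auto simp: toeplitz_rep_def\<close>)
  show "toeplitz_representation A E j \<alpha> L t"
    by unfold_locales (use transfer_operator alpha_star_hom rep in auto)
qed

lemma generated: "generated_by_rep A E j t"
proof -
  let ?G = "j ` carrier A \<union> {mult_right (j a) t | a. a \<in> carrier A}"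
  have G: "?G \<subseteq> carrier E" by (auto simp: mult_right_def)
  have "carrier E \<subseteq> cstar_subalgebra E hull ?G"
    unfolding hull_def
  proof (intro Inter_greatest; clarify)
    fix W x assume W: "cstar_subalgebra E W" "?G \<subseteq> W" and x: "x \<in> carrier E"
    let ?V = "{x \<in> carrier T. Q x \<in> W}"
    have cs: "closed_subspace E W" using W(1) by (simp add: cstar_subalgebra_def)
    note D = Q.B.closed_subspaceD[OF cs]
    have "closed_subspace T ?V"
    proof (rule TR.B.closed_subspaceI)
      fix y assume y: "y \<in> carrier T" and ap: "\<And>e. e > 0 \<Longrightarrow> \<exists>w\<in>?V. nrm T (y \<ominus>\<^bsub>T\<^esub> w) < e"
      have "Q y \<in> W"
      proof (rule D(6))
        fix e :: real assume "e > 0"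
        then obtain w where w: "w \<in> carrier T" "Q w \<in> W" "nrm T (y \<ominus>\<^bsub>T\<^esub> w) < e" using ap by blast
        then show "\<exists>w\<in>W. nrm E (Q y \<ominus> w) < e"
          using Q.f_norm_le[of "y \<ominus>\<^bsub>T\<^esub> w"] y by (intro bexI[of _ "Q w"]) (simp_all add: Q.f_vdiff)
      qed (use y in simp)
      then show "y \<in> ?V" using y by simp
    qed (auto simp: Q.f_simps Q.f_zero D(2-4))
    then have V: "cstar_subalgebra T ?V"
      using W(1) unfolding cstar_subalgebra_def by (auto simp: Q.f_simps)
    have "i ` carrier A \<union> {mult_right (i a) s | a. a \<in> carrier A} \<subseteq> ?V"
    proof -
      have "Q (snd s (i a)) = snd t (j a)" if "a \<in> carrier A" for a
        using Q.lift_snd[OF TR.S_in, of "i a"] that by (simp add: t_eq)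
      then show ?thesis using W(2) by (auto simp: mult_right_def)
    qed
    then have "cstar_subalgebra T hull (i ` carrier A \<union> {mult_right (i a) s | a. a \<in> carrier A}) \<subseteq> ?V"
      using V by (rule hull_minimal)
    then have "carrier T \<subseteq> ?V"
      using top unfolding toeplitz_crossed_product_def generated_by_rep_def by blast
    moreover have "x \<in> Q ` carrier T" using x by (simp add: quotient(2))
    ultimately show "x \<in> W" by auto
  qed
  moreover have "cstar_subalgebra E hull ?G \<subseteq> carrier E"
    using hull_minimal[of ?G "carrier E" "cstar_subalgebra E"] G Q.B.cstar_subalgebra_carrier by blast
  ultimately show ?thesis unfolding generated_by_rep_def by blast
qed

text \<open>The universal property of the quotient, in a form that never mentions the ideal: the operator
  \<open>(\<psi>\<^sub>s, i)\<^sup>(\<^sup>1\<^sup>) (\<phi>(a))\<close> lies in every closed subspace containing the elements \<open>i(a) s s\<^sup>* i(b)\<^sup>*\<close>, so it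
  suffices to compare the kernels on such a subspace.\<close>

lemma crossed_product_factor:
  fixes D :: "'u cstar"
  assumes D: "cstar_algebra D" and rep: "toeplitz_rep A \<alpha> L D \<rho> W"
    and ker: "\<And>\<Phi>. integrated_form A T i s D \<rho> W \<Phi> \<Longrightarrow> \<exists>V. closed_subspace T V \<and>
      (\<forall>a\<in>carrier A. i a \<in> V) \<and>
      (\<forall>a\<in>carrier A. \<forall>b\<in>carrier A. snd s (i a) \<otimes>\<^bsub>T\<^esub> adj T (snd s (i b)) \<in> V) \<and>
      (\<forall>x\<in>V. Q x = \<zero> \<longrightarrow> \<Phi> x = \<zero>\<^bsub>D\<^esub>)"
  obtains \<Psi> where "nondegenerate_hom E D \<Psi>" "\<And>a. a \<in> carrier A \<Longrightarrow> \<Psi> (j a) = \<rho> a"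
    "mult_extension E D \<Psi> t = W"
proof -
  obtain \<Phi> where Phi: "integrated_form A T i s D \<rho> W \<Phi>"
    using top D rep unfolding toeplitz_crossed_product_def by blast
  then have nd: "nondegenerate_hom T D \<Phi>" and Pi: "\<And>a. a \<in> carrier A \<Longrightarrow> \<Phi> (i a) = \<rho> a"
    and PW: "mult_extension T D \<Phi> s = W"
    unfolding integrated_form_def by blast+
  interpret P: nondegenerate_homomorphism T D \<Phi> by (rule nondegenerate_homomorphismI[OF algebras(2) D nd])
  obtain V where V: "closed_subspace T V" "\<And>a. a \<in> carrier A \<Longrightarrow> i a \<in> V"
    "\<And>a b. \<lbrakk>a \<in> carrier A; b \<in> carrier A\<rbrakk> \<Longrightarrow> snd s (i a) \<otimes>\<^bsub>T\<^esub> adj T (snd s (i b)) \<in> V"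
    "\<And>x. \<lbrakk>x \<in> V; Q x = \<zero>\<rbrakk> \<Longrightarrow> \<Phi> x = \<zero>\<^bsub>D\<^esub>"
    using ker[OF Phi] by blast
  let ?K = "{x \<in> carrier T. \<Phi> x = \<zero>\<^bsub>D\<^esub>}"
  let ?G = "{i a \<ominus>\<^bsub>T\<^esub> psi_compacts A X q T i s (left_op X a) | a. a \<in> K_alpha A \<alpha> X}"
  have "?G \<subseteq> ?K"
  proof clarify
    fix a assume a: "a \<in> K_alpha A \<alpha> X"
    then have ac: "a \<in> carrier A" "left_op X a \<in> carrier (compacts A X)" by (auto simp: K_alpha_def)
    let ?g = "i a \<ominus>\<^bsub>T\<^esub> psi_compacts A X q T i s (left_op X a)"
    have pc: "psi_compacts A X q T i s (left_op X a) \<in> carrier T" by (rule TR.psi_compacts_closed[OF ac(2)])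
    have "psi_compacts A X q T i s (left_op X a) \<in> V" by (rule TR.psi_compacts_mem[OF ac(2) V(1,3)])
    then have gV: "?g \<in> V" using TR.B.closed_subspaceD(5)[OF V(1)] V(2) ac(1) by blast
    have "?g \<in> exel_ideal A \<alpha> X q T i s" unfolding exel_ideal_def using a by (intro hull_inc) blast
    then have "Q ?g = \<zero>" using quotient(3) by blast
    then show "?g \<in> carrier T \<and> \<Phi> ?g = \<zero>\<^bsub>D\<^esub>" using V(4)[OF gV] ac(1) pc by simp
  qed
  then have "closed_ideal T hull ?G \<subseteq> ?K"
    by (rule hull_minimal) (rule star_hom_kernel_ideal[OF algebras(2) D P.hom])
  then have kerQ: "\<Phi> x = \<zero>\<^bsub>D\<^esub>" if "x \<in> carrier T" "Q x = \<zero>" for x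
    using that quotient(3) unfolding exel_ideal_def by blast
  have fib: "\<Phi> x = \<Phi> y" if "x \<in> carrier T" "y \<in> carrier T" "Q x = Q y" for x y
  proof -
    have "Q (x \<ominus>\<^bsub>T\<^esub> y) = \<zero>" using that by (simp add: Q.f_vdiff Q.B.vdiff_self)
    then have "\<Phi> (x \<ominus>\<^bsub>T\<^esub> y) = \<zero>\<^bsub>D\<^esub>" using kerQ that by simp
    then show ?thesis using that by (simp add: P.f_vdiff P.B.vdiff_eq_zero)
  qed
  define \<Psi> where "\<Psi> = (\<lambda>y. \<Phi> (SOME x. x \<in> carrier T \<and> Q x = y))"
  have PsiQ: "\<Psi> (Q x) = \<Phi> x" if x: "x \<in> carrier T" for x
  proof -
    have "\<exists>y. y \<in> carrier T \<and> Q y = Q x" using x by blast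
    from someI_ex[OF this] show ?thesis unfolding \<Psi>_def using fib x by blast
  qed
  have surj: "\<exists>x\<in>carrier T. y = Q x" if "y \<in> carrier E" for y using that quotient(2) by blast
  have hom: "star_hom E D \<Psi>"
    unfolding star_hom_def linear_map_def
  proof (intro conjI ballI allI Pi_I)
    fix y assume "y \<in> carrier E"
    then obtain x where x: "x \<in> carrier T" "y = Q x" using surj by blast
    show "\<Psi> y \<in> carrier D" using x PsiQ by simp
    show "\<Psi> (c \<odot> y) = c \<odot>\<^bsub>D\<^esub> \<Psi> y" for c
      using x PsiQ PsiQ[of "c \<odot>\<^bsub>T\<^esub> x"] by (simp add: Q.f_simps P.f_simps)
    show "\<Psi> (adj E y) = adj D (\<Psi> y)" using x PsiQ PsiQ[of "adj T x"] by (simp add: Q.f_simps P.f_simps)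
    fix z assume "z \<in> carrier E"
    then obtain w where w: "w \<in> carrier T" "z = Q w" using surj by blast
    show "\<Psi> (y \<oplus> z) = \<Psi> y \<oplus>\<^bsub>D\<^esub> \<Psi> z"
      using x w PsiQ PsiQ[of "x \<oplus>\<^bsub>T\<^esub> w"] by (simp add: Q.f_simps P.f_simps)
    show "\<Psi> (y \<otimes> z) = \<Psi> y \<otimes>\<^bsub>D\<^esub> \<Psi> z"
      using x w PsiQ PsiQ[of "x \<otimes>\<^bsub>T\<^esub> w"] by (simp add: Q.f_simps P.f_simps)
  qed
  have nondeg: "nondegenerate_hom E D \<Psi>"
  proof (rule nondegenerate_homI[OF D hom])
    fix d eps assume d: "d \<in> carrier D" "(eps :: real) > 0"
    obtain x z where x: "x \<in> carrier T" "z \<in> carrier D" "d = \<Phi> x \<otimes>\<^bsub>D\<^esub> z" using P.factorisation[OF d(1)] by blast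
    then have "nrm D (d \<ominus>\<^bsub>D\<^esub> \<Psi> (Q x) \<otimes>\<^bsub>D\<^esub> z) < eps"
      using PsiQ[OF x(1)] d by (simp add: P.B.vdiff_self P.B.N_zero)
    then show "\<exists>a\<in>carrier E. \<exists>b\<in>carrier D. nrm D (d \<ominus>\<^bsub>D\<^esub> \<Psi> a \<otimes>\<^bsub>D\<^esub> b) < eps" using x by blast
  qed
  interpret Psi: nondegenerate_homomorphism E D \<Psi> by (rule nondegenerate_homomorphismI[OF algebras(3) D nondeg])
  have "P.lift s = Psi.lift t"
  proof (rule P.lift_eqI[OF TR.S_in Psi.lift(1)[OF J.S_in]])
    fix a b assume ab: "a \<in> carrier T" "b \<in> carrier D"
    have "fst (Psi.lift t) (\<Psi> (Q a) \<otimes>\<^bsub>D\<^esub> b) = \<Psi> (fst t (Q a)) \<otimes>\<^bsub>D\<^esub> b"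
      using ab by (intro Psi.lift(2)[OF J.S_in]) auto
    also have "fst t (Q a) = Q (fst s a)" using Q.lift_fst[OF TR.S_in ab(1)] by (simp add: t_eq)
    finally show "fst (Psi.lift t) (\<Phi> a \<otimes>\<^bsub>D\<^esub> b) = \<Phi> (fst s a) \<otimes>\<^bsub>D\<^esub> b" using ab PsiQ by simp
  qed
  then have "mult_extension E D \<Psi> t = W"
    using PW by (simp add: P.mult_extension_eq_lift[OF TR.S_in] Psi.mult_extension_eq_lift[OF J.S_in])
  then show ?thesis using that[OF nondeg] PsiQ Pi by simp
qed

abbreviation ME where "ME \<equiv> multiplier_algebra E"

abbreviation is_gauge :: "complex \<Rightarrow> ('u \<Rightarrow> 'u) \<Rightarrow> bool"
  where "is_gauge z \<gamma> \<equiv> nondegenerate_hom E E \<gamma> \<and> (\<forall>a\<in>carrier A. \<gamma> (j a) = j a) \<and>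
    mult_extension E E \<gamma> t = z \<odot>\<^bsub>ME\<^esub> t"

text \<open>The pair \<open>(j, z t)\<close> is covariant, and its integrated form agrees with \<open>Q\<close> on the elements
  \<open>i(a)\<close> and \<open>i(a) s s\<^sup>* i(b)\<^sup>*\<close> because the scalars \<open>z\<close> and \<open>cnj z\<close> cancel.\<close>

lemma gauge_exists:
  assumes z: "cmod z = 1"
  shows "\<exists>\<gamma>. is_gauge z \<gamma>"
proof -
  interpret M: cstar_algebra ME by (rule Q.B.multiplier_cstar_algebra)
  have zz: "cnj z * z = 1" using z by (metis complex_cnj_mult complex_norm_square mult.commute of_real_1 power_one)
  let ?W = "z \<odot>\<^bsub>ME\<^esub> t"
  have rep: "toeplitz_rep A \<alpha> L E j ?W"
    unfolding toeplitz_rep_def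
  proof (intro conjI ballI)
    show "nondegenerate_hom A E j" by (rule J.nondegenerate)
    show "?W \<in> carrier ME" using J.S_in by simp
    fix a assume a: "a \<in> carrier A"
    have r: "t \<otimes>\<^bsub>ME\<^esub> mult_of E (j a) = mult_of E (j (\<alpha> a)) \<otimes>\<^bsub>ME\<^esub> t"
      "t' \<otimes>\<^bsub>ME\<^esub> mult_of E (j a) \<otimes>\<^bsub>ME\<^esub> t = mult_of E (j (L a))"
      using J.rep a unfolding toeplitz_rep_def by blast+
    have c: "t \<in> carrier ME" "mult_of E (j a) \<in> carrier ME" "mult_of E (j (\<alpha> a)) \<in> carrier ME"
      "mult_of E (j (L a)) \<in> carrier ME"
      using a J.S_in transfer_operator(1)[OF a] J.f_closed[OF a] J.f_closed[OF J.alpha_closed[OF a]]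
        J.f_closed[OF transfer_operator(1)[OF a]] Q.B.multiplier_ops_closed(3) by auto
    show "?W \<otimes>\<^bsub>ME\<^esub> mult_of E (j a) = mult_of E (j (\<alpha> a)) \<otimes>\<^bsub>ME\<^esub> ?W"
      using c r(1) by (simp only: M.mult_scale_left M.mult_scale_right)
    have "adj ME ?W \<otimes>\<^bsub>ME\<^esub> mult_of E (j a) \<otimes>\<^bsub>ME\<^esub> ?W
      = (cnj z * z) \<odot>\<^bsub>ME\<^esub> (t' \<otimes>\<^bsub>ME\<^esub> mult_of E (j a) \<otimes>\<^bsub>ME\<^esub> t)"
      using c by (simp add: M.adj_scale M.mult_scale_left M.mult_scale_right Q.B.M.scale_scale mult.commute)
    then show "adj ME ?W \<otimes>\<^bsub>ME\<^esub> mult_of E (j a) \<otimes>\<^bsub>ME\<^esub> ?W = mult_of E (j (L a))"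
      using c by (simp only: r(2) zz Q.B.M.scale_one)
  qed
  obtain \<Psi> where "nondegenerate_hom E E \<Psi>" "\<And>a. a \<in> carrier A \<Longrightarrow> \<Psi> (j a) = j a" "mult_extension E E \<Psi> t = ?W"
  proof (rule crossed_product_factor[OF algebras(3) rep])
    fix \<Phi> assume "integrated_form A T i s E j ?W \<Phi>"
    then have nd: "nondegenerate_hom T E \<Phi>" and Pi: "\<And>a. a \<in> carrier A \<Longrightarrow> \<Phi> (i a) = j a"
      and PW: "mult_extension T E \<Phi> s = ?W"
      unfolding integrated_form_def by blast+
    interpret P: nondegenerate_homomorphism T E \<Phi> by (rule nondegenerate_homomorphismI[OF algebras(2,3) nd])
    have lift: "P.lift s = ?W" using PW by (simp add: P.mult_extension_eq_lift[OF TR.S_in])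
    have g: "\<Phi> (snd s (i a)) = z \<odot> Q (snd s (i a))" if a: "a \<in> carrier A" for a
    proof -
      have "\<Phi> (snd s (i a)) = snd ?W (j a)" using P.lift_snd[OF TR.S_in, of "i a"] lift a Pi by simp
      also have "\<dots> = z \<odot> snd t (j a)" using J.f_closed[OF a] by (simp only: Q.B.multiplier_ops)
      also have "snd t (j a) = Q (snd s (i a))" using Q.lift_snd[OF TR.S_in, of "i a"] a by (simp add: t_eq)
      finally show ?thesis .
    qed
    let ?V = "{x \<in> carrier T. \<Phi> x = Q x}"
    have "closed_subspace T ?V"
      using star_hom_equalizer[OF algebras(2,3) P.hom Q.hom] by (simp add: cstar_subalgebra_def)
    moreover have "\<forall>a\<in>carrier A. i a \<in> ?V" using Pi by simp
    moreover have "\<forall>a\<in>carrier A. \<forall>b\<in>carrier A. snd s (i a) \<otimes>\<^bsub>T\<^esub> adj T (snd s (i b)) \<in> ?V"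
    proof (intro ballI)
      fix a b assume ab: "a \<in> carrier A" "b \<in> carrier A"
      have "\<Phi> (snd s (i a) \<otimes>\<^bsub>T\<^esub> adj T (snd s (i b)))
        = (cnj z * z) \<odot> (Q (snd s (i a)) \<otimes> adj E (Q (snd s (i b))))"
        using ab by (simp add: P.f_simps g Q.B.expand_simps Q.B.scale_scale)
      then show "snd s (i a) \<otimes>\<^bsub>T\<^esub> adj T (snd s (i b)) \<in> ?V"
        using ab by (simp add: zz Q.B.scale_one Q.f_simps)
    qed
    ultimately show "\<exists>V. closed_subspace T V \<and> (\<forall>a\<in>carrier A. i a \<in> V) \<and>
      (\<forall>a\<in>carrier A. \<forall>b\<in>carrier A. snd s (i a) \<otimes>\<^bsub>T\<^esub> adj T (snd s (i b)) \<in> V) \<and>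
      (\<forall>x\<in>V. Q x = \<zero> \<longrightarrow> \<Phi> x = \<zero>)"
      by (intro exI[of _ ?V]) simp
  qed blast
  then show ?thesis by blast
qed

lemma homs_eq:
  assumes "cstar_algebra D" "nondegenerate_hom E D f" "nondegenerate_hom E D g"
    "\<And>a. a \<in> carrier A \<Longrightarrow> f (j a) = g (j a)" "mult_extension E D f t = mult_extension E D g t" "x \<in> carrier E"
  shows "f x = g x"
  by (rule star_homs_eq_on_generated[OF algebras(3) assms(1-3) generated _ J.S_in assms(4-6)]) auto

lemma gauge_inverse:
  assumes "is_gauge z \<gamma>" "is_gauge (cnj z) \<gamma>'" "cmod z = 1" "x \<in> carrier E"
  shows "\<gamma> (\<gamma>' x) = x"
proof -
  have nd: "nondegenerate_hom E E \<gamma>" "nondegenerate_hom E E \<gamma>'" using assms by auto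
  interpret g: nondegenerate_homomorphism E E \<gamma> by (rule nondegenerate_homomorphismI[OF algebras(3,3) nd(1)])
  note id = mult_extension_id[OF algebras(3) J.S_in]
  interpret M: cstar_algebra ME by (rule Q.B.multiplier_cstar_algebra)
  have zz: "cnj z * z = 1" using assms(3) by (metis complex_cnj_mult complex_norm_square mult.commute of_real_1 power_one)
  have "(\<gamma> \<circ> \<gamma>') x = id x"
  proof (rule homs_eq[OF algebras(3) _ id(1)])
    show "nondegenerate_hom E E (\<gamma> \<circ> \<gamma>')" by (rule nondegenerate_comp[OF algebras(3,3,3) nd(2,1)])
    show "(\<gamma> \<circ> \<gamma>') (j a) = id (j a)" if "a \<in> carrier A" for a using assms(1,2) that by simp
    have "mult_extension E E (\<gamma> \<circ> \<gamma>') t = mult_extension E E \<gamma> (cnj z \<odot>\<^bsub>ME\<^esub> t)"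
      using mult_extension_comp[OF algebras(3,3,3) nd(2,1) J.S_in] assms(2) by simp
    also have "\<dots> = cnj z \<odot>\<^bsub>ME\<^esub> mult_extension E E \<gamma> t"
      using star_homD(4)[OF g.lift_star_hom J.S_in] J.S_in by (simp add: g.mult_extension_eq_lift)
    also have "\<dots> = t" using assms(1) J.S_in zz by (simp add: Q.B.M.scale_scale Q.B.M.scale_one)
    finally show "mult_extension E E (\<gamma> \<circ> \<gamma>') t = mult_extension E E id t" by (simp only: id(2))
  qed (rule assms(4))
  then show ?thesis by simp
qed

abbreviation "G \<equiv> dual_action A E j t"

lemma gauge:
  assumes z: "cmod z = 1"
  shows "is_gauge z (G z)"
proof -
  obtain \<gamma> where g: "is_gauge z \<gamma>" using gauge_exists[OF z] by blast
  obtain \<gamma>' where g': "is_gauge (cnj z) \<gamma>'" using gauge_exists[of "cnj z"] z by auto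
  have c: "\<And>x. x \<in> carrier E \<Longrightarrow> \<gamma> x \<in> carrier E" "\<And>x. x \<in> carrier E \<Longrightarrow> \<gamma>' x \<in> carrier E"
    using g g' unfolding nondegenerate_hom_def by (auto dest: star_homD(2))
  have g2: "is_gauge (cnj (cnj z)) \<gamma>" and z2: "cmod (cnj z) = 1" using g z by simp_all
  have inv: "\<gamma> (\<gamma>' x) = x" "\<gamma>' (\<gamma> x) = x" if "x \<in> carrier E" for x
    using gauge_inverse[OF g g' z that] gauge_inverse[OF g' g2 z2 that] by auto
  let ?\<gamma> = "restrict \<gamma> (carrier E)"
  have hom: "star_hom E E ?\<gamma>"
    using g unfolding nondegenerate_hom_def star_hom_def linear_map_def by (simp add: Pi_iff)
  have img: "?\<gamma> ` carrier E = carrier E" using c inv by (auto simp: image_iff) (metis inv(1) c(2))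
  have bij: "bij_betw ?\<gamma> (carrier E) (carrier E)"
    unfolding bij_betw_def using img inv(2) by (auto intro!: inj_onI) (metis inv(2))
  have nd: "nondegenerate_hom E E ?\<gamma>" by (rule surjective_nondegenerate[OF algebras(3,3) hom img])
  interpret g: nondegenerate_homomorphism E E \<gamma>
    using g by (intro nondegenerate_homomorphismI[OF algebras(3,3)]) blast
  interpret r: nondegenerate_homomorphism E E ?\<gamma> by (rule nondegenerate_homomorphismI[OF algebras(3,3) nd])
  have "r.lift t = g.lift t"
    by (rule r.lift_eqI[OF J.S_in g.lift(1)[OF J.S_in]]) (use g.lift(2)[OF J.S_in] in simp)
  then have ext: "mult_extension E E ?\<gamma> t = z \<odot>\<^bsub>ME\<^esub> t"
    using g by (simp add: r.mult_extension_eq_lift[OF J.S_in] g.mult_extension_eq_lift[OF J.S_in])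
  have jj: "?\<gamma> (j a) = j a" if "a \<in> carrier A" for a using g that J.f_closed[OF that] by simp
  have "G z = ?\<gamma>"
    unfolding dual_action_def
  proof (rule the_equality)
    show "?\<gamma> \<in> extensional (carrier E) \<and> star_iso E E ?\<gamma> \<and> (\<forall>a\<in>carrier A. ?\<gamma> (j a) = j a) \<and>
      mult_extension E E ?\<gamma> t = z \<odot>\<^bsub>ME\<^esub> t"
      using hom bij jj ext by (simp add: star_iso_def)
  next
    fix eta assume d: "eta \<in> extensional (carrier E) \<and> star_iso E E eta \<and> (\<forall>a\<in>carrier A. eta (j a) = j a) \<and>
      mult_extension E E eta t = z \<odot>\<^bsub>ME\<^esub> t"
    have dn: "nondegenerate_hom E E eta"
      by (rule surjective_nondegenerate[OF algebras(3,3)]) (use d in \<open>auto simp: star_iso_def bij_betw_def\<close>)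
    have dj: "eta (j a) = ?\<gamma> (j a)" if "a \<in> carrier A" for a using d jj[OF that] that by simp
    have dt: "mult_extension E E eta t = mult_extension E E ?\<gamma> t" using d ext by simp
    have "eta x = ?\<gamma> x" if "x \<in> carrier E" for x
      by (rule homs_eq[OF algebras(3) dn nd dj dt that])
    then show "eta = ?\<gamma>" using d by (intro extensionalityI[of _ "carrier E"]) auto
  qed
  then show ?thesis using nd jj ext by simp
qed

end

section \<open>The endomorphism of the fixed-point algebra\<close>

lemma (in cstar_algebra) mult_power_apply:
  assumes "m \<in> carrier MA" "a \<in> carrier A"
  shows "mult_power A m n \<in> carrier MA" "fst (mult_power A m n) a = (fst m ^^ n) a"
proof (induction n)
  case 0
  show "mult_power A m 0 \<in> carrier MA" "fst (mult_power A m 0) a = (fst m ^^ 0) a"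
    using assms by (simp_all add: mult_power_def multiplier_ops_closed multiplier_ops)
next
  case (Suc n)
  have eq: "mult_power A m (Suc n) = m \<otimes>\<^bsub>MA\<^esub> mult_power A m n" by (simp add: mult_power_def)
  show "mult_power A m (Suc n) \<in> carrier MA" "fst (mult_power A m (Suc n)) a = (fst m ^^ Suc n) a"
    unfolding eq using Suc assms by (simp_all add: multiplier_ops_closed multiplier_ops)
qed

context exel_crossed_product
begin

abbreviation "F \<equiv> fixed_point_algebra A E j t"

lemma t_in: "t \<in> carrier ME" "t' \<in> carrier ME"
  by (rule J.S_in, rule J.S'_in)

lemmas tD = J.SD and t'D = J.S'D

lemma t_closed [simp]:
  "x \<in> carrier E \<Longrightarrow> fst t x \<in> carrier E" "x \<in> carrier E \<Longrightarrow> snd t x \<in> carrier E"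
  "x \<in> carrier E \<Longrightarrow> fst t' x \<in> carrier E" "x \<in> carrier E \<Longrightarrow> snd t' x \<in> carrier E"
  using tD(1,2) t'D(1,2) by blast+

lemma j_closed [simp]: "a \<in> carrier A \<Longrightarrow> Q (i a) \<in> carrier E"
  using J.f_closed by simp

lemma G_hom: "cmod z = 1 \<Longrightarrow> star_hom E E (G z)"
  using gauge by (simp add: nondegenerate_hom_def)

lemma G_closed: "\<lbrakk>cmod z = 1; x \<in> carrier E\<rbrakk> \<Longrightarrow> G z x \<in> carrier E"
  by (rule star_homD(2)[OF G_hom])

lemma G_lift:
  assumes z: "cmod z = 1" and x: "x \<in> carrier E"
  shows "G z (fst t x) = z \<odot> fst t (G z x)" "G z (snd t x) = z \<odot> snd t (G z x)"
    "G z (fst t' x) = cnj z \<odot> fst t' (G z x)" "G z (snd t' x) = cnj z \<odot> snd t' (G z x)"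
proof -
  interpret M: cstar_algebra ME by (rule Q.B.multiplier_cstar_algebra)
  interpret g: nondegenerate_homomorphism E E "G z"
    using gauge[OF z] by (intro nondegenerate_homomorphismI[OF algebras(3,3)]) blast
  have lt: "g.lift t = z \<odot>\<^bsub>ME\<^esub> t" using gauge[OF z] by (simp add: g.mult_extension_eq_lift[OF t_in(1)])
  have lt': "g.lift t' = cnj z \<odot>\<^bsub>ME\<^esub> t'"
    using star_homD(6)[OF g.lift_star_hom t_in(1)] t_in lt by (simp add: M.adj_scale)
  note c = G_closed[OF z x]
  show "G z (fst t x) = z \<odot> fst t (G z x)" using g.lift_fst[OF t_in(1) x] c by (simp add: lt Q.B.multiplier_ops(3))
  show "G z (snd t x) = z \<odot> snd t (G z x)" using g.lift_snd[OF t_in(1) x] c by (simp add: lt Q.B.multiplier_ops(4))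
  show "G z (fst t' x) = cnj z \<odot> fst t' (G z x)" using g.lift_fst[OF t_in(2) x] c by (simp add: lt' Q.B.multiplier_ops(3))
  show "G z (snd t' x) = cnj z \<odot> snd t' (G z x)" using g.lift_snd[OF t_in(2) x] c by (simp add: lt' Q.B.multiplier_ops(4))
qed

lemma multiplier_scale_apply:
  assumes "m \<in> carrier ME" "x \<in> carrier E"
  shows "fst m (c \<odot> x) = c \<odot> fst m x" "snd m (c \<odot> x) = c \<odot> snd m x"
  using linear_mapD(3)[OF Q.B.multiplier_carrierD(8)[OF assms(1)] assms(2)]
    linear_mapD(3)[OF Q.B.multiplier_carrierD(9)[OF assms(1)] assms(2)] by simp_all

lemma F_iff: "x \<in> carrier F \<longleftrightarrow> x \<in> carrier E \<and> (\<forall>z. cmod z = 1 \<longrightarrow> G z x = x)"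
  unfolding fixed_point_algebra_def by simp

lemma F_E [simp]: "x \<in> carrier F \<Longrightarrow> x \<in> carrier E"
  by (simp add: F_iff)

lemma F_fixed: "\<lbrakk>x \<in> carrier F; cmod z = 1\<rbrakk> \<Longrightarrow> G z x = x"
  by (simp add: F_iff)

lemma F_ops [simp]:
  "vzero F = vzero E" "vadd F = vadd E" "vscale F = vscale E" "cmul F = cmul E" "adj F = adj E" "nrm F = nrm E"
  "x \<ominus>\<^bsub>F\<^esub> y = x \<ominus> y"
  unfolding vdiff_def fixed_point_algebra_def by simp_all

lemma F_subalgebra: "cstar_subalgebra E (carrier F)"
proof -
  have W: "cstar_subalgebra E {x \<in> carrier E. G z x = id x}" if z: "cmod z = 1" for z
    by (rule star_hom_equalizer[OF algebras(3,3) G_hom[OF z]]) (simp add: star_hom_def linear_map_def)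
  have cs: "closed_subspace E (carrier F)"
  proof (rule Q.B.closed_subspaceI)
    fix x assume x: "x \<in> carrier E" and ap: "\<And>e. e > 0 \<Longrightarrow> \<exists>w\<in>carrier F. nrm E (x \<ominus> w) < e"
    have "G z x = x" if z: "cmod z = 1" for z
    proof -
      have cz: "closed_subspace E {x \<in> carrier E. G z x = id x}" using W[OF z] by (simp add: cstar_subalgebra_def)
      have "x \<in> {x \<in> carrier E. G z x = id x}"
      proof (rule Q.B.closed_subspaceD(6)[OF cz x])
        fix e :: real assume "e > 0"
        then obtain w where "w \<in> carrier F" "nrm E (x \<ominus> w) < e" using ap by blast
        then show "\<exists>w\<in>{x \<in> carrier E. G z x = id x}. nrm E (x \<ominus> w) < e"
          using z by (intro bexI[of _ w]) (simp_all add: F_iff)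
      qed
      then show ?thesis by simp
    qed
    then show "x \<in> carrier F" using x by (simp add: F_iff)
  next
    have "G z \<zero> = \<zero>" if "cmod z = 1" for z
      using Q.B.linear_map_zero[OF Q.B.complex_vector_space_axioms star_homD(1)[OF G_hom[OF that]]] .
    then show "\<zero> \<in> carrier F" by (simp add: F_iff)
  next
    fix x y assume "x \<in> carrier F" "y \<in> carrier F"
    then show "x \<oplus> y \<in> carrier F" using star_homD(3)[OF G_hom] by (simp add: F_iff)
  next
    fix c x assume "x \<in> carrier F"
    then show "c \<odot> x \<in> carrier F" using star_homD(4)[OF G_hom] by (simp add: F_iff)
  qed auto
  show ?thesis
    unfolding cstar_subalgebra_def using cs star_homD(5,6)[OF G_hom] by (simp add: F_iff)
qed

lemma F_cstar_algebra: "cstar_algebra F"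
proof -
  have "F = E\<lparr>carrier := carrier F\<rparr>" unfolding fixed_point_algebra_def by simp
  then show ?thesis by (metis cstar_algebra_restrict[OF algebras(3) F_subalgebra])
qed

lemma F_closed [simp]:
  "\<lbrakk>x \<in> carrier F; y \<in> carrier F\<rbrakk> \<Longrightarrow> x \<otimes> y \<in> carrier F" "x \<in> carrier F \<Longrightarrow> adj E x \<in> carrier F"
  "\<lbrakk>x \<in> carrier F; y \<in> carrier F\<rbrakk> \<Longrightarrow> x \<ominus> y \<in> carrier F"
  using F_subalgebra Q.B.closed_subspaceD(5)[of "carrier F"] unfolding cstar_subalgebra_def by blast+

lemma j_in_F [simp]: "a \<in> carrier A \<Longrightarrow> Q (i a) \<in> carrier F"
  using gauge by (simp add: F_iff)

sublocale FE: nondegenerate_homomorphism F E id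
proof (rule nondegenerate_homomorphismI[OF F_cstar_algebra algebras(3) nondegenerate_homI[OF algebras(3)]])
  show "star_hom F E id" by (simp add: star_hom_def linear_map_def Pi_iff)
  fix b eps assume b: "b \<in> carrier E" "(eps :: real) > 0"
  obtain a z where a: "a \<in> carrier A" "z \<in> carrier E" "b = j a \<otimes> z" using J.factorisation[OF b(1)] by blast
  then have "nrm E (b \<ominus> id (j a) \<otimes> z) < eps" using b by (simp add: Q.B.vdiff_self Q.B.N_zero)
  then show "\<exists>a\<in>carrier F. \<exists>b'\<in>carrier E. nrm E (b \<ominus> id a \<otimes> b') < eps"
    using a by (intro bexI[of _ "j a"] bexI[of _ z]) simp_all
qed

lemma unit_scalars: "cmod z = 1 \<Longrightarrow> cnj z * z = 1" "cmod z = 1 \<Longrightarrow> z * cnj z = 1"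
  by (metis complex_cnj_mult complex_norm_square mult.commute of_real_1 power_one)+

text \<open>Conjugation by \<open>t\<close> and compression by \<open>t\<close>, in terms of double centralizers.\<close>

definition beta :: "'u \<Rightarrow> 'u" where "beta x = snd t' (fst t x)"

definition compress :: "'u \<Rightarrow> 'u" where "compress x = snd t (fst t' x)"

lemma beta_closed [simp]: "x \<in> carrier E \<Longrightarrow> beta x \<in> carrier E"
  by (simp add: beta_def)

lemma compress_closed [simp]: "x \<in> carrier E \<Longrightarrow> compress x \<in> carrier E"
  by (simp add: compress_def)

lemma commute_t:
  assumes "x \<in> carrier E" "m \<in> carrier ME" "n \<in> carrier ME"
  shows "snd n (fst m x) = fst m (snd n x)"
  using Q.B.multiplier_fst_snd_commute[OF assms(2,3,1)] by simp

lemma beta_F: "x \<in> carrier F \<Longrightarrow> beta x \<in> carrier F"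
  unfolding F_iff by (simp add: beta_def G_lift multiplier_scale_apply[OF t_in(2)] Q.B.scale_scale unit_scalars Q.B.scale_one)

lemma compress_F: "x \<in> carrier F \<Longrightarrow> compress x \<in> carrier F"
  unfolding F_iff by (simp add: compress_def G_lift multiplier_scale_apply[OF t_in(1)] Q.B.scale_scale unit_scalars Q.B.scale_one)

lemma projection_F: "x \<in> carrier F \<Longrightarrow> fst t (fst t' x) \<in> carrier F"
  unfolding F_iff by (simp add: G_lift multiplier_scale_apply[OF t_in(1)] Q.B.scale_scale unit_scalars Q.B.scale_one)

lemma compress_beta: "x \<in> carrier E \<Longrightarrow> compress (beta x) = x"
  by (simp add: compress_def beta_def commute_t[OF _ t_in(1) t_in(2), symmetric] commute_t[OF _ t_in(2) t_in(1)] J.S'_S J.S_snd_S')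

lemma beta_mult_left: "\<lbrakk>x \<in> carrier E; y \<in> carrier E\<rbrakk> \<Longrightarrow> beta x \<otimes> y = fst t (x \<otimes> fst t' y)"
  by (simp add: beta_def t'D(5) tD(3))

lemma beta_star_hom: "star_hom F F beta"
  unfolding star_hom_def linear_map_def
proof (intro conjI ballI allI)
  show "beta \<in> carrier F \<rightarrow> carrier F" using beta_F by blast
  show "beta (x \<oplus>\<^bsub>F\<^esub> y) = beta x \<oplus>\<^bsub>F\<^esub> beta y" if "x \<in> carrier F" "y \<in> carrier F" for x y
    using that linear_mapD(2)[OF tD(8)] linear_mapD(2)[OF t'D(9)] by (simp add: beta_def)
  show "beta (c \<odot>\<^bsub>F\<^esub> x) = c \<odot>\<^bsub>F\<^esub> beta x" if "x \<in> carrier F" for c x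
    using that linear_mapD(3)[OF tD(8)] linear_mapD(3)[OF t'D(9)] by (simp add: beta_def)
  show "beta (x \<otimes>\<^bsub>F\<^esub> y) = beta x \<otimes>\<^bsub>F\<^esub> beta y" if xy: "x \<in> carrier F" "y \<in> carrier F" for x y
  proof -
    have "fst t' (beta y) = snd t' y"
      using xy by (simp add: beta_def commute_t[OF _ t_in(1) t_in(2)] J.S'_S)
    then have "beta x \<otimes> beta y = fst t (x \<otimes> snd t' y)" using xy by (simp add: beta_mult_left)
    also have "\<dots> = beta (x \<otimes> y)"
      using xy by (simp add: beta_def commute_t[OF _ t_in(1) t_in(2)] t'D(4))
    finally show ?thesis by simp
  qed
  show "beta (adj F x) = adj F (beta x)" if "x \<in> carrier F" for x
  proof -
    have a: "adj ME t' = t" using cstar_algebra.adj_adj[OF Q.B.multiplier_cstar_algebra t_in(1)] .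
    have "adj E (snd t' (fst t x)) = fst t (snd t' (adj E x))"
      using that Q.B.adj_multiplier_apply(2)[OF t_in(2), of "fst t x"] Q.B.adj_multiplier_apply(1)[OF t_in(1), of x]
      by (simp add: a)
    then show ?thesis using that by (simp add: beta_def commute_t[OF _ t_in(1) t_in(2)])
  qed
qed

lemma beta_inj: "inj_on beta (carrier F)"
  by (rule inj_on_inverseI[of _ compress]) (simp add: compress_beta)

lemma snd_t'_j: "a \<in> carrier A \<Longrightarrow> snd t' (Q (i a)) = fst t' (Q (i (\<alpha> a)))"
proof -
  assume a: "a \<in> carrier A"
  have adj_j: "adj E (Q (i b)) = Q (i (adj A b))" if "b \<in> carrier A" for b
    using J.f_simps(4)[OF that] by simp
  have "adj E (fst t (Q (i (adj A a)))) = adj E (snd t (Q (i (\<alpha> (adj A a)))))"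
    using J.S_pi[of "adj A a"] a by simp
  then show ?thesis
    using a Q.B.adj_multiplier_apply(1)[OF t_in(1), of "Q (i (adj A a))"]
      Q.B.adj_multiplier_apply(2)[OF t_in(1), of "Q (i (\<alpha> (adj A a)))"]
    by (simp add: adj_j TR.A.adj_adj J.alpha_simps)
qed

lemma funpow_closed: "x \<in> carrier E \<Longrightarrow> (fst t ^^ n) x \<in> carrier E" "x \<in> carrier E \<Longrightarrow> (fst t' ^^ n) x \<in> carrier E"
  "x \<in> carrier E \<Longrightarrow> (snd t ^^ n) x \<in> carrier E" "x \<in> carrier E \<Longrightarrow> (snd t' ^^ n) x \<in> carrier E"
  by (induction n) auto

lemma core_element_eq:
  assumes "a \<in> carrier A" "b \<in> carrier A"
  shows "core_element E j t a n b = j a \<otimes> (fst t ^^ n) ((fst t' ^^ n) (j b))"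
proof -
  let ?P = "mult_power E t n \<otimes>\<^bsub>ME\<^esub> mult_power E t' n"
  have jb: "j a \<in> carrier E" "j b \<in> carrier E" using assms by simp_all
  have c: "mult_power E t n \<in> carrier ME" "mult_power E t' n \<in> carrier ME"
    using Q.B.mult_power_apply(1)[OF t_in(1) jb(1)] Q.B.mult_power_apply(1)[OF t_in(2) jb(1)] by auto
  then have P: "?P \<in> carrier ME" by (rule Q.B.multiplier_ops_closed(6))
  have "core_element E j t a n b = j a \<otimes> fst ?P (j b)"
    using Q.B.multiplier_carrierD(5)[OF P jb] by (simp add: core_element_def mult_right_def)
  also have "fst ?P (j b) = fst (mult_power E t n) (fst (mult_power E t' n) (j b))"
    using jb by (simp only: Q.B.multiplier_ops(5))
  also have "fst (mult_power E t' n) (j b) = (fst t' ^^ n) (j b)" by (rule Q.B.mult_power_apply(2)[OF t_in(2) jb(2)])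
  also have "fst (mult_power E t n) ((fst t' ^^ n) (j b)) = (fst t ^^ n) ((fst t' ^^ n) (j b))"
    by (rule Q.B.mult_power_apply(2)[OF t_in(1) funpow_closed(2)[OF jb(2)]])
  finally show ?thesis .
qed

lemma snd_funpow_commute:
  assumes "m \<in> carrier ME" "n \<in> carrier ME" "x \<in> carrier E"
  shows "snd n ((fst m ^^ k) x) = (fst m ^^ k) (snd n x)"
proof -
  note mD = Q.B.multiplier_carrierD(1)[OF assms(1)]
  have "(fst m ^^ k) x \<in> carrier E \<and> snd n ((fst m ^^ k) x) = (fst m ^^ k) (snd n x)"
    by (induction k) (use assms mD in \<open>simp_all add: commute_t[OF _ assms(1,2)]\<close>)
  then show ?thesis ..
qed

lemma beta_core_element:
  assumes "a \<in> carrier A" "b \<in> carrier A"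
  shows "beta (core_element E j t a n b) = core_element E j t (\<alpha> a) (n + 1) (\<alpha> b)"
proof -
  let ?y = "(fst t ^^ n) ((fst t' ^^ n) (j b))"
  have jb: "j b \<in> carrier E" using assms by simp
  have y: "?y \<in> carrier E" by (intro funpow_closed jb)
  have "snd t' ?y = (fst t ^^ n) ((fst t' ^^ n) (snd t' (j b)))"
    using jb by (simp only: snd_funpow_commute[OF t_in funpow_closed(2)[OF jb]] snd_funpow_commute[OF t_in(2,2) jb])
  also have "\<dots> = (fst t ^^ n) ((fst t' ^^ Suc n) (j (\<alpha> b)))"
    using assms(2) by (simp add: snd_t'_j funpow_swap1)
  finally have sy: "snd t' ?y = (fst t ^^ n) ((fst t' ^^ Suc n) (j (\<alpha> b)))" .
  have "beta (core_element E j t a n b) = snd t' (j (\<alpha> a) \<otimes> fst t ?y)"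
    using J.S_left[OF assms(1) y] by (simp only: beta_def core_element_eq[OF assms])
  also have "\<dots> = j (\<alpha> a) \<otimes> snd t' (fst t ?y)" using assms y by (simp add: t'D(4))
  also have "snd t' (fst t ?y) = fst t (snd t' ?y)" by (rule commute_t[OF y t_in])
  also have "\<dots> = (fst t ^^ Suc n) ((fst t' ^^ Suc n) (j (\<alpha> b)))" using arg_cong[OF sy, of "fst t"] by simp
  finally show ?thesis using assms by (simp only: core_element_eq J.alpha_closed Suc_eq_plus1[symmetric])
qed

abbreviation "p \<equiv> t \<otimes>\<^bsub>ME\<^esub> t'"

lemma p_apply: "x \<in> carrier E \<Longrightarrow> fst p x = fst t (fst t' x)" "x \<in> carrier E \<Longrightarrow> snd p x = snd t' (snd t x)"
  by (simp_all only: Q.B.multiplier_ops)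

lemma p_in: "p \<in> carrier ME"
  by (rule Q.B.multiplier_ops_closed(6)[OF t_in])

lemma beta_range: "beta ` carrier F = {mult_right (mult_left p x) p | x. x \<in> carrier F}"
proof -
  have sandwich: "mult_right (mult_left p x) p = beta (compress x)" if x: "x \<in> carrier F" for x
  proof -
    have xE: "x \<in> carrier E" using x by simp
    have "mult_right (mult_left p x) p = snd t' (snd t (fst t (fst t' x)))"
      using xE by (simp add: mult_right_def mult_left_def p_apply)
    then show ?thesis using xE by (simp add: beta_def compress_def commute_t[OF _ t_in(1,1)])
  qed
  show ?thesis
  proof (intro subset_antisym subsetI)
    fix y assume "y \<in> beta ` carrier F"
    then obtain x where x: "x \<in> carrier F" "y = beta x" by blast
    then have "y = mult_right (mult_left p y) p" using sandwich[of y] beta_F compress_beta by simp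
    then show "y \<in> {mult_right (mult_left p x) p | x. x \<in> carrier F}" using x beta_F by blast
  next
    fix y assume "y \<in> {mult_right (mult_left p x) p | x. x \<in> carrier F}"
    then show "y \<in> beta ` carrier F" using sandwich compress_F by auto
  qed
qed

lemma stacey_rep_id: "stacey_rep F beta E id t"
  unfolding stacey_rep_def
proof (intro conjI ballI)
  show "nondegenerate_hom F E id" by (rule FE.nondegenerate)
  show "t' \<otimes>\<^bsub>ME\<^esub> t = mult_one E" by (rule J.isometry)
  fix x assume x: "x \<in> carrier F"
  note mc = Q.B.multiplier_ops_closed
  have xE: "x \<in> carrier E" "beta x \<in> carrier E" using x by simp_all
  show "mult_of E (id (beta x)) = t \<otimes>\<^bsub>ME\<^esub> mult_of E (id x) \<otimes>\<^bsub>ME\<^esub> t'"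
    by (rule Q.B.multiplier_fst_eqI)
      (use xE t_in mc in \<open>simp_all add: Q.B.multiplier_ops(5,13) beta_mult_left\<close>)
qed (rule t_in)

text \<open>The extension of \<open>\<beta>\<close> to \<open>M(F)\<close> is \<open>m \<mapsto> t m t\<^sup>*\<close>, where \<open>m\<close> acts on \<open>E = F E\<close>. It maps into
  \<open>M(F)\<close> because multipliers of \<open>F\<close> are invariant under the dual action.\<close>

lemma lift_gauge:
  assumes m: "m \<in> carrier (multiplier_algebra F)" and z: "cmod z = 1" and y: "y \<in> carrier E"
  shows "G z (fst (FE.lift m) y) = fst (FE.lift m) (G z y)" "G z (snd (FE.lift m) y) = snd (FE.lift m) (G z y)"
proof -
  note Gm = star_homD(5)[OF G_hom[OF z]] and mD = FE.A.multiplier_carrierD[OF m]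
    and lD = Q.B.multiplier_carrierD[OF FE.lift(1)[OF m]]
  obtain x w where x: "x \<in> carrier F" "w \<in> carrier E" "y = id x \<otimes> w" using FE.factorisation[OF y] by blast
  have lift_x: "fst (FE.lift m) (x \<otimes> v) = fst m x \<otimes> v" if "v \<in> carrier E" for v
    using FE.lift(2)[OF m x(1) that] by simp
  show "G z (fst (FE.lift m) y) = fst (FE.lift m) (G z y)"
    using x z mD(1)[OF x(1)] G_closed[OF z x(2)] by (simp add: lift_x Gm F_fixed)
  obtain x' w' where x': "x' \<in> carrier F" "w' \<in> carrier E" "y = w' \<otimes> id x'" using FE.factorisation_right[OF y] by blast
  have lift_x': "snd (FE.lift m) (v \<otimes> x') = v \<otimes> snd m x'" if "v \<in> carrier E" for v
    using lD(4)[OF that, of x'] FE.lift_snd[OF m x'(1)] x'(1) by simp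
  show "G z (snd (FE.lift m) y) = snd (FE.lift m) (G z y)"
    using x' z mD(2)[OF x'(1)] G_closed[OF z x'(2)] by (simp add: lift_x' Gm F_fixed)
qed

definition beta_mult :: "'u multiplier \<Rightarrow> 'u multiplier"
  where "beta_mult m = (\<lambda>x\<in>carrier F. fst t (fst (FE.lift m) (fst t' x)),
    \<lambda>x\<in>carrier F. snd t' (snd (FE.lift m) (snd t x)))"

lemma lift_closed:
  assumes "m \<in> carrier (multiplier_algebra F)" "y \<in> carrier E"
  shows "fst (FE.lift m) y \<in> carrier E" "snd (FE.lift m) y \<in> carrier E"
  using Q.B.multiplier_carrierD(1,2)[OF FE.lift(1)[OF assms(1)] assms(2)] .

lemma beta_mult_F:
  assumes m: "m \<in> carrier (multiplier_algebra F)" and x: "x \<in> carrier F"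
  shows "fst t (fst (FE.lift m) (fst t' x)) \<in> carrier F" "snd t' (snd (FE.lift m) (snd t x)) \<in> carrier F"
  using x lift_closed[OF m] unfolding F_iff
  by (simp_all add: G_lift lift_gauge[OF m] multiplier_scale_apply[OF t_in(1)] multiplier_scale_apply[OF t_in(2)]
      multiplier_scale_apply[OF FE.lift(1)[OF m]] Q.B.scale_scale unit_scalars Q.B.scale_one)

lemma beta_mult_closed:
  assumes m: "m \<in> carrier (multiplier_algebra F)"
  shows "beta_mult m \<in> carrier (multiplier_algebra F)"
  unfolding beta_mult_def
proof (rule FE.A.multiplierI)
  note lD = Q.B.multiplier_carrierD[OF FE.lift(1)[OF m]]
  fix a b assume ab: "a \<in> carrier F" "b \<in> carrier F"
  then have "snd t' (snd (FE.lift m) (snd t a)) \<otimes> b = a \<otimes> fst t (fst (FE.lift m) (fst t' b))"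
    using lift_closed[OF m] by (simp add: t'D(5) lD(5) tD(5))
  then show "(\<lambda>x\<in>carrier F. snd t' (snd (FE.lift m) (snd t x))) a \<otimes>\<^bsub>F\<^esub> b
      = a \<otimes>\<^bsub>F\<^esub> (\<lambda>x\<in>carrier F. fst t (fst (FE.lift m) (fst t' x))) b" using ab by simp
qed (use beta_mult_F[OF m] in simp_all)

lemma beta_mult_apply:
  assumes "x \<in> carrier F"
  shows "fst (beta_mult m) x = fst t (fst (FE.lift m) (fst t' x))"
    "snd (beta_mult m) x = snd t' (snd (FE.lift m) (snd t x))"
  using assms by (simp_all add: beta_mult_def)

lemma beta_mult_star_hom: "star_hom (multiplier_algebra F) (multiplier_algebra F) beta_mult"
  unfolding star_hom_def linear_map_def
proof (intro conjI ballI allI)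
  let ?M = "multiplier_algebra F"
  note lh = star_homD[OF FE.lift_star_hom] and mc = FE.A.multiplier_ops_closed
  show "beta_mult \<in> carrier ?M \<rightarrow> carrier ?M" using beta_mult_closed by blast
  fix m assume m: "m \<in> carrier ?M"
  show "beta_mult (c \<odot>\<^bsub>?M\<^esub> m) = c \<odot>\<^bsub>?M\<^esub> beta_mult m" for c
    by (rule FE.A.multiplier_fst_eqI)
      (use m lift_closed[OF m] in \<open>simp_all add: beta_mult_closed mc FE.A.multiplier_ops(3) beta_mult_apply lh(4)
        Q.B.multiplier_ops(3) multiplier_scale_apply[OF t_in(1)]\<close>)
  show "beta_mult (adj ?M m) = adj ?M (beta_mult m)"
  proof (rule FE.A.multiplier_fst_eqI)
    fix x assume x: "x \<in> carrier F"
    then have xE: "x \<in> carrier E" by simp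
    interpret M: cstar_algebra ME by (rule Q.B.multiplier_cstar_algebra)
    have a: "adj ME t' = t" using M.adj_adj[OF t_in(1)] .
    have "fst (adj ?M (beta_mult m)) x = adj E (snd t' (snd (FE.lift m) (snd t (adj E x))))"
      using x by (simp add: FE.A.multiplier_ops(7) beta_mult_apply)
    also have "\<dots> = fst t (adj E (snd (FE.lift m) (snd t (adj E x))))"
      using xE lift_closed[OF m] Q.B.adj_multiplier_apply(2)[OF t_in(2)] a by simp
    also have "adj E (snd (FE.lift m) (snd t (adj E x))) = fst (adj ME (FE.lift m)) (adj E (snd t (adj E x)))"
      using xE by (intro Q.B.adj_multiplier_apply(2)[OF FE.lift(1)[OF m]]) simp
    also have "adj E (snd t (adj E x)) = fst t' x"
      using xE Q.B.adj_multiplier_apply(2)[OF t_in(1), of "adj E x"] by (simp add: Q.B.adj_adj)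
    finally have "fst (adj ?M (beta_mult m)) x = fst t (fst (FE.lift (adj ?M m)) (fst t' x))"
      by (simp only: lh(6)[OF m])
    then show "fst (beta_mult (adj ?M m)) x = fst (adj ?M (beta_mult m)) x"
      by (simp only: beta_mult_apply(1)[OF x])
  qed (use m in \<open>simp_all add: beta_mult_closed mc\<close>)
  fix n assume n: "n \<in> carrier ?M"
  show "beta_mult (m \<oplus>\<^bsub>?M\<^esub> n) = beta_mult m \<oplus>\<^bsub>?M\<^esub> beta_mult n"
    by (rule FE.A.multiplier_fst_eqI)
      (use m n lift_closed[OF m] lift_closed[OF n] in \<open>simp_all add: beta_mult_closed mc FE.A.multiplier_ops(1)
        beta_mult_apply lh(3) Q.B.multiplier_ops(1) linear_mapD(2)[OF tD(8)]\<close>)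
  show "beta_mult (m \<otimes>\<^bsub>?M\<^esub> n) = beta_mult m \<otimes>\<^bsub>?M\<^esub> beta_mult n"
    by (rule FE.A.multiplier_fst_eqI)
      (use m n lift_closed[OF m] lift_closed[OF n] beta_mult_F[OF n] in \<open>simp_all add: beta_mult_closed mc
        FE.A.multiplier_ops(5) beta_mult_apply lh(5) Q.B.multiplier_ops(5) J.S'_S\<close>)
qed

lemma beta_mult_mult_of:
  assumes x: "x \<in> carrier F"
  shows "beta_mult (mult_of F x) = mult_of F (beta x)"
proof (rule FE.A.multiplier_fst_eqI)
  note mc = FE.A.multiplier_ops_closed
  show "beta_mult (mult_of F x) \<in> carrier (multiplier_algebra F)" using beta_mult_closed mc(3)[OF x] by blast
  show "mult_of F (beta x) \<in> carrier (multiplier_algebra F)" by (rule mc(3)[OF beta_F[OF x]])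
  fix y assume y: "y \<in> carrier F"
  have "FE.lift (mult_of F x) = mult_of E x" using FE.lift_mult_of[OF x] by simp
  then show "fst (beta_mult (mult_of F x)) y = fst (mult_of F (beta x)) y"
    using x y by (simp add: beta_mult_apply FE.A.multiplier_ops(13) Q.B.multiplier_ops(13) beta_mult_left)
qed

lemma lift_beta_mult_one: "mult_extension F E id (beta_mult (mult_one F)) = p"
proof -
  note mc = FE.A.multiplier_ops_closed
  have b: "beta_mult (mult_one F) \<in> carrier (multiplier_algebra F)" using beta_mult_closed mc(2) by blast
  have "FE.lift (beta_mult (mult_one F)) = p"
  proof (rule FE.lift_eqI[OF b p_in])
    fix x y assume xy: "x \<in> carrier F" "y \<in> carrier E"
    have "fst (beta_mult (mult_one F)) x = fst t (fst t' x)"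
      using xy by (simp add: beta_mult_apply FE.lift_one Q.B.multiplier_ops(11))
    then show "fst p (id x \<otimes> y) = id (fst (beta_mult (mult_one F)) x) \<otimes> y"
      using xy by (simp add: p_apply t'D(3) tD(3))
  qed
  then show ?thesis by (simp add: FE.mult_extension_eq_lift[OF b])
qed

text \<open>Strict continuity rests on exact factorisation: to control \<open>t m t\<^sup>* a\<close>, write \<open>t\<^sup>* a = y w\<close> with
  \<open>y \<in> F\<close> and \<open>w \<in> E\<close>, so that \<open>t m t\<^sup>* a = t (m y) w\<close>. An approximate factorisation would not
  do, since strictly convergent nets need not be bounded.\<close>

lemma beta_mult_continuous: "continuous_map (strict_topology F) (strict_topology F) beta_mult"
proof -
  let ?MF = "carrier (multiplier_algebra F)"
  define U where "U = (\<lambda>m a e. {n \<in> ?MF. nrm F (mult_left n a \<ominus>\<^bsub>F\<^esub> mult_left m a) < e \<and>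
        nrm F (mult_right a n \<ominus>\<^bsub>F\<^esub> mult_right a m) < e})"
  define \<S> where "\<S> = {U m a e | m a e. m \<in> ?MF \<and> a \<in> carrier F \<and> 0 < e}"
  have strict: "strict_topology F = topology_generated_by \<S>"
    by (simp add: strict_topology_def \<S>_def U_def)
  have self: "m \<in> U m a e" if "m \<in> ?MF" "a \<in> carrier F" "0 < e" for m a e
    using that FE.A.multiplier_carrierD(1,2)[OF that(1,2)]
    by (simp add: U_def mult_left_def mult_right_def Q.B.vdiff_self Q.B.N_zero)
  have topspace: "topspace (strict_topology F) = ?MF"
  proof -
    have "\<Union>\<S> = ?MF"
    proof
      show "\<Union>\<S> \<subseteq> ?MF" by (auto simp: \<S>_def U_def)
      show "?MF \<subseteq> \<Union>\<S>"
      proof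
        fix m assume m: "m \<in> ?MF"
        have "U m \<zero>\<^bsub>F\<^esub> 1 \<in> \<S>" unfolding \<S>_def using m FE.A.zero_closed by fastforce
        then show "m \<in> \<Union>\<S>" using self[OF m FE.A.zero_closed, of 1] by auto
      qed
    qed
    then show ?thesis by (simp add: strict)
  qed
  have opn: "openin (strict_topology F) (U m a e)" if "m \<in> ?MF" "a \<in> carrier F" "0 < e" for m a e
    unfolding strict by (rule topology_generated_by_Basis, unfold \<S>_def) (use that in blast)
  have nt: "nrm E (fst t y) \<le> nrm ME t * nrm E y" "nrm E (snd t' y) \<le> nrm ME t' * nrm E y" if "y \<in> carrier E" for y
    using Q.B.multiplier_norm_le(1)[OF t_in(1) that] Q.B.multiplier_norm_le(2)[OF t_in(2) that] .
  have nt0: "0 \<le> nrm ME t" "0 \<le> nrm ME t'"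
    using cstar_algebra.norm_nonneg[OF Q.B.multiplier_cstar_algebra] t_in by auto
  have "openin (strict_topology F) (beta_mult -` U m a e \<inter> topspace (strict_topology F))"
    if mae: "m \<in> ?MF" "a \<in> carrier F" "0 < e" for m a e
    unfolding topspace
  proof (subst openin_subopen, intro ballI)
    fix k assume k: "k \<in> beta_mult -` U m a e \<inter> ?MF"
    then have kM: "k \<in> ?MF" and bk: "beta_mult k \<in> U m a e" by auto
    have aE: "a \<in> carrier E" using mae by simp
    obtain y w where y: "y \<in> carrier F" "w \<in> carrier E" "fst t' a = y \<otimes> w"
      using FE.factorisation[of "fst t' a"] aE by auto
    obtain y' w' where y': "y' \<in> carrier F" "w' \<in> carrier E" "snd t a = w' \<otimes> y'"
      using FE.factorisation_right[of "snd t a"] aE by auto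
    have l: "fst (beta_mult n) a = fst t (fst n y \<otimes> w)" if "n \<in> ?MF" for n
      using FE.lift(2)[OF that y(1,2)] mae y by (simp add: beta_mult_apply)
    have r: "snd (beta_mult n) a = snd t' (w' \<otimes> snd n y')" if n: "n \<in> ?MF" for n
      using FE.lift_snd[OF n y'(1)] Q.B.multiplier_carrierD(4)[OF FE.lift(1)[OF n] y'(2), of y'] mae y'
      by (simp add: beta_mult_apply)
    define K where "K = nrm ME t * nrm E w + nrm ME t' * nrm E w' + 1"
    have K: "nrm ME t * nrm E w \<le> K" "nrm ME t' * nrm E w' \<le> K" "0 < K"
      using nt0 Q.B.norm_nonneg[OF y(2)] Q.B.norm_nonneg[OF y'(2)]
      by (auto simp: K_def intro: add_nonneg_pos add_nonneg_nonneg)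
    define d1 where "d1 = nrm E (fst (beta_mult k) a \<ominus> fst m a)"
    define d2 where "d2 = nrm E (snd (beta_mult k) a \<ominus> snd m a)"
    have d: "d1 < e" "d2 < e" using bk by (auto simp: U_def mult_left_def mult_right_def d1_def d2_def)
    define eta where "eta = (e - max d1 d2) / K"
    have delta: "0 < eta" "K * eta + d1 \<le> e" "K * eta + d2 \<le> e" using d K(3) by (auto simp: eta_def)
    let ?V = "U k y eta \<inter> U k y' eta"
    have "openin (strict_topology F) ?V" using opn[OF kM] y(1) y'(1) delta(1) by (intro openin_Int) auto
    moreover have "k \<in> ?V" using self[OF kM] y(1) y'(1) delta(1) by auto
    moreover have "?V \<subseteq> beta_mult -` U m a e \<inter> ?MF"
    proof
      fix n assume n: "n \<in> ?V"
      then have nM: "n \<in> ?MF" by (simp add: U_def)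
      note nD = FE.A.multiplier_carrierD(1,2)[OF nM] and kD = FE.A.multiplier_carrierD(1,2)[OF kM]
        and mD = FE.A.multiplier_carrierD(1,2)[OF mae(1)]
      have n1: "nrm E (fst n y \<ominus> fst k y) < eta" using n by (simp add: U_def mult_left_def)
      have n2: "nrm E (snd n y' \<ominus> snd k y') < eta" using n by (simp add: U_def mult_right_def)
      have cl: "fst n y \<in> carrier E" "fst k y \<in> carrier E" "snd n y' \<in> carrier E" "snd k y' \<in> carrier E"
        "fst m a \<in> carrier E" "snd m a \<in> carrier E"
        using nD(1)[OF y(1)] kD(1)[OF y(1)] nD(2)[OF y'(1)] kD(2)[OF y'(1)] mD(1)[OF mae(2)] mD(2)[OF mae(2)] by simp_all
      have "fst (beta_mult n) a \<ominus> fst (beta_mult k) a = fst t ((fst n y \<ominus> fst k y) \<otimes> w)"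
        using cl y Q.B.linear_vdiff[OF tD(8)]
        by (simp add: l[OF nM] l[OF kM] Q.B.mult_vdiff_left)
      also have "nrm E \<dots> \<le> nrm ME t * nrm E ((fst n y \<ominus> fst k y) \<otimes> w)"
        using cl y by (intro nt) auto
      also have "\<dots> \<le> nrm ME t * (nrm E (fst n y \<ominus> fst k y) * nrm E w)"
        using cl y nt0 by (intro mult_left_mono Q.B.norm_mult) auto
      also have "\<dots> = (nrm ME t * nrm E w) * nrm E (fst n y \<ominus> fst k y)" by simp
      also have "\<dots> \<le> K * nrm E (fst n y \<ominus> fst k y)"
        using K(1) Q.B.norm_nonneg[of "fst n y \<ominus> fst k y"] cl by (intro mult_right_mono) auto
      also have "\<dots> < K * eta" using n1 K(3) by simp
      finally have b1: "nrm E (fst (beta_mult n) a \<ominus> fst (beta_mult k) a) < K * eta" .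
      have "snd (beta_mult n) a \<ominus> snd (beta_mult k) a = snd t' (w' \<otimes> (snd n y' \<ominus> snd k y'))"
        using cl y' Q.B.linear_vdiff[OF t'D(9)]
        by (simp add: r[OF nM] r[OF kM] Q.B.mult_vdiff_right)
      also have "nrm E \<dots> \<le> nrm ME t' * nrm E (w' \<otimes> (snd n y' \<ominus> snd k y'))"
        using cl y' by (intro nt) auto
      also have "\<dots> \<le> nrm ME t' * (nrm E w' * nrm E (snd n y' \<ominus> snd k y'))"
        using cl y' nt0 by (intro mult_left_mono Q.B.norm_mult) auto
      also have "\<dots> = (nrm ME t' * nrm E w') * nrm E (snd n y' \<ominus> snd k y')" by simp
      also have "\<dots> \<le> K * nrm E (snd n y' \<ominus> snd k y')"
        using K(2) Q.B.norm_nonneg[of "snd n y' \<ominus> snd k y'"] cl by (intro mult_right_mono) auto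
      also have "\<dots> < K * eta" using n2 K(3) by simp
      finally have b2: "nrm E (snd (beta_mult n) a \<ominus> snd (beta_mult k) a) < K * eta" .
      have bc: "fst (beta_mult n) a \<in> carrier E" "fst (beta_mult k) a \<in> carrier E"
        "snd (beta_mult n) a \<in> carrier E" "snd (beta_mult k) a \<in> carrier E"
        using FE.A.multiplier_carrierD(1,2)[OF beta_mult_closed[OF nM] mae(2)]
          FE.A.multiplier_carrierD(1,2)[OF beta_mult_closed[OF kM] mae(2)] by simp_all
      have "nrm E (fst (beta_mult n) a \<ominus> fst m a) < e"
        using Q.B.N_triangle_vdiff[OF bc(1,2) cl(5)] b1 delta(2) by (simp add: d1_def)
      moreover have "nrm E (snd (beta_mult n) a \<ominus> snd m a) < e"
        using Q.B.N_triangle_vdiff[OF bc(3,4) cl(6)] b2 delta(3) by (simp add: d2_def)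
      ultimately show "n \<in> beta_mult -` U m a e \<inter> ?MF"
        using nM beta_mult_closed[OF nM] by (simp add: U_def mult_left_def mult_right_def)
    qed
    ultimately show "\<exists>V. openin (strict_topology F) V \<and> k \<in> V \<and> V \<subseteq> beta_mult -` U m a e \<inter> ?MF" by blast
  qed
  then have op: "openin (strict_topology F) (beta_mult -` W \<inter> topspace (strict_topology F))" if "W \<in> \<S>" for W
    using that unfolding \<S>_def by blast
  have img: "beta_mult ` topspace (strict_topology F) \<subseteq> \<Union>\<S>"
    using topspace beta_mult_closed by (simp add: strict image_subset_iff)
  show ?thesis
    using continuous_on_generated_topo[of \<S> "strict_topology F" beta_mult] op img by (simp only: strict)
qed

lemma beta_strict_extension: "strict_extension F beta beta_mult"
  unfolding strict_extension_def using beta_mult_star_hom beta_mult_continuous beta_mult_mult_of by blast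

end

section \<open>The fixed-point algebra as a minimal invariant subalgebra\<close>

context cstar_algebra
begin

lemma closed_subspace_preimage:
  assumes W: "closed_subspace A W" and f: "linear_map A A f"
    and bd: "\<And>x. x \<in> carrier A \<Longrightarrow> nrm A (f x) \<le> K * nrm A x"
  shows "closed_subspace A {x \<in> carrier A. f x \<in> W}"
proof (rule closed_subspaceI)
  note D = closed_subspaceD[OF W] and fD = linear_mapD[OF f]
  show "\<zero> \<in> {x \<in> carrier A. f x \<in> W}"
    using D(2) linear_map_zero[OF complex_vector_space_axioms f] by simp
  fix x assume x: "x \<in> carrier A" and ap: "\<And>e. e > 0 \<Longrightarrow> \<exists>w\<in>{x \<in> carrier A. f x \<in> W}. nrm A (x \<ominus> w) < e"
  have "f x \<in> W"
  proof (rule D(6)[OF fD(1)[OF x]])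
    fix e :: real assume e: "e > 0"
    then have "e / (\<bar>K\<bar> + 1) > 0" by simp
    from ap[OF this] obtain w where w: "w \<in> carrier A" "f w \<in> W" "nrm A (x \<ominus> w) < e / (\<bar>K\<bar> + 1)" by blast
    have n0: "0 \<le> nrm A (x \<ominus> w)" by (rule norm_nonneg) (use x w in simp)
    have "nrm A (f x \<ominus> f w) = nrm A (f (x \<ominus> w))"
      using linear_vdiff[OF f x w(1)] by simp
    also have "\<dots> \<le> K * nrm A (x \<ominus> w)" by (rule bd) (use x w in simp)
    also have "\<dots> \<le> (\<bar>K\<bar> + 1) * nrm A (x \<ominus> w)" by (rule mult_right_mono[OF _ n0]) simp
    also have "\<dots> < e" using w(3) by (simp add: pos_less_divide_eq mult.commute)
    finally show "\<exists>w\<in>W. nrm A (f x \<ominus> w) < e" using w(2) by blast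
  qed
  then show "x \<in> {x \<in> carrier A. f x \<in> W}" using x by simp
qed (use closed_subspaceD(3,4)[OF W] linear_mapD[OF f] in auto)

text \<open>Whether a closed subspace is a left ideal can therefore be checked on generators of the algebra.\<close>

lemma left_idealiser_subalgebra:
  assumes W: "closed_subspace A W"
  shows "cstar_subalgebra A {x \<in> carrier A. \<forall>y\<in>W. x \<otimes> y \<in> W \<and> adj A x \<otimes> y \<in> W}" (is "cstar_subalgebra A ?N")
proof -
  note D = closed_subspaceD[OF W]
  have Wc: "y \<in> carrier A" if "y \<in> W" for y using D(1) that by blast
  have lim: "z \<otimes> y \<in> W" if z: "z \<in> carrier A" and y: "y \<in> W"
    and ap: "\<And>e. e > 0 \<Longrightarrow> \<exists>w\<in>carrier A. w \<otimes> y \<in> W \<and> nrm A (z \<ominus> w) < e" for z y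
  proof -
    have "closed_subspace A {x \<in> carrier A. x \<otimes> y \<in> W}"
      by (rule closed_subspace_preimage[OF W, where f = "\<lambda>x. x \<otimes> y" and K = "nrm A y"])
        (use Wc[OF y] norm_mult in \<open>simp_all add: linear_map_def expand_simps mult.commute\<close>)
    from closed_subspaceD(6)[OF this z] ap show ?thesis by fastforce
  qed
  have "closed_subspace A ?N"
  proof (rule closed_subspaceI)
    fix x assume x: "x \<in> carrier A" and ap: "\<And>e. e > 0 \<Longrightarrow> \<exists>w\<in>?N. nrm A (x \<ominus> w) < e"
    show "x \<in> ?N"
    proof (intro CollectI conjI ballI x)
      fix y assume y: "y \<in> W"
      show "x \<otimes> y \<in> W"
      proof (rule lim[OF x y])
        fix e :: real assume "e > 0"
        from ap[OF this] obtain w where "w \<in> ?N" "nrm A (x \<ominus> w) < e" by blast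
        then show "\<exists>w\<in>carrier A. w \<otimes> y \<in> W \<and> nrm A (x \<ominus> w) < e" using y by blast
      qed
      show "adj A x \<otimes> y \<in> W"
      proof (rule lim[OF _ y])
        fix e :: real assume "e > 0"
        from ap[OF this] obtain w where w: "w \<in> ?N" "nrm A (x \<ominus> w) < e" by blast
        then have "nrm A (adj A x \<ominus> adj A w) < e" using x norm_adj[of "x \<ominus> w"] by (simp add: adj_vdiff)
        then show "\<exists>w\<in>carrier A. w \<otimes> y \<in> W \<and> nrm A (adj A x \<ominus> w) < e"
          using w y by (intro bexI[of _ "adj A w"]) auto
      qed (use x in simp)
    qed
  next
    show "\<zero> \<in> ?N" using D(2) Wc by (simp add: adj_zero mult_zero_left)
    fix x y assume "x \<in> ?N" "y \<in> ?N"
    then show "x \<oplus> y \<in> ?N" using Wc D(3) by (simp add: adj_add mult_add_left)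
  next
    fix c x assume "x \<in> ?N"
    then show "c \<odot> x \<in> ?N" using Wc D(4) by (simp add: adj_scale mult_scale_left)
  qed auto
  then show ?thesis
    unfolding cstar_subalgebra_def using Wc by (simp add: adj_mult mult_assoc adj_adj)
qed

lemma multiplier_isometry_norm:
  assumes m: "m \<in> carrier MA" and iso: "adj MA m \<otimes>\<^bsub>MA\<^esub> m = mult_one A" and a: "a \<in> carrier A"
  shows "nrm A (fst m a) \<le> nrm A a" "nrm A (fst (adj MA m) a) \<le> nrm A a"
proof -
  interpret M: cstar_algebra MA by (rule multiplier_cstar_algebra)
  note mD = multiplier_carrierD[OF m]
  have m': "adj MA m \<in> carrier MA" using m by simp
  have le: "nrm A (fst m b) \<le> nrm A b" if b: "b \<in> carrier A" for b
  proof (rule power2_le_imp_le)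
    have "fst (adj MA m) (fst m b) = fst (adj MA m \<otimes>\<^bsub>MA\<^esub> m) b" using b by (simp add: multiplier_ops(5))
    then have "adj A (fst m b) \<otimes> fst m b = adj A b \<otimes> b"
      using b mD(1)[OF b] adj_multiplier_apply(1)[OF m b] multiplier_carrierD(5)[OF m', of "adj A b" "fst m b"]
      by (simp add: iso multiplier_ops(11))
    then show "(nrm A (fst m b))\<^sup>2 \<le> (nrm A b)\<^sup>2"
      using cstar_identity[OF mD(1)[OF b]] cstar_identity[OF b] by simp
  qed (use b in \<open>simp add: norm_nonneg\<close>)
  show "nrm A (fst m a) \<le> nrm A a" by (rule le[OF a])
  have "nrm MA m \<le> 1" by (rule multiplier_norm_leI[OF m]) (use le in simp_all)
  then have "nrm MA (adj MA m) \<le> 1" using M.norm_adj[OF m] by simp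
  then have "nrm MA (adj MA m) * nrm A a \<le> 1 * nrm A a" by (rule mult_right_mono) (rule norm_nonneg[OF a])
  then show "nrm A (fst (adj MA m) a) \<le> nrm A a" using multiplier_norm_le(1)[OF m' a] by simp
qed

end

context exel_crossed_product
begin

text \<open>Averages of the dual action over the \<open>2\<^sup>n\<close>-th roots of unity.\<close>

primrec dyadic_mean :: "nat \<Rightarrow> 'u \<Rightarrow> 'u" where
  "dyadic_mean 0 y = y"
| "dyadic_mean (Suc n) y = (1 / 2) \<odot> (dyadic_mean n y \<oplus> G (cis (pi / 2 ^ n)) (dyadic_mean n y))"

lemma dyadic_mean_closed [simp]: "y \<in> carrier E \<Longrightarrow> dyadic_mean n y \<in> carrier E"
  by (induction n) (simp_all add: G_closed)

lemma dyadic_mean_linear: "linear_map E E (dyadic_mean n)"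
proof (induction n)
  case 0
  show ?case by (simp add: linear_map_def)
next
  case (Suc n)
  note D = linear_mapD[OF Suc] and g = star_homD(2-4)[OF G_hom[of "cis (pi / 2 ^ n)"]]
  show ?case
    unfolding linear_map_def
  proof (intro conjI ballI allI)
    show "dyadic_mean (Suc n) \<in> carrier E \<rightarrow> carrier E" using dyadic_mean_closed by blast
    fix x assume x: "x \<in> carrier E"
    show "dyadic_mean (Suc n) (c \<odot> x) = c \<odot> dyadic_mean (Suc n) x" for c
      using x by (intro Q.B.vec_eqI) (simp_all add: D(3) g Q.B.functional_simps algebra_simps)
    fix y assume y: "y \<in> carrier E"
    show "dyadic_mean (Suc n) (x \<oplus> y) = dyadic_mean (Suc n) x \<oplus> dyadic_mean (Suc n) y"
      using x y by (intro Q.B.vec_eqI) (simp_all add: D(2) g Q.B.functional_simps algebra_simps)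
  qed
qed

lemma dyadic_mean_norm_le: "y \<in> carrier E \<Longrightarrow> nrm E (dyadic_mean n y) \<le> nrm E y"
proof (induction n)
  case (Suc n)
  let ?x = "dyadic_mean n y" and ?g = "G (cis (pi / 2 ^ n))"
  have x: "?x \<in> carrier E" "?g ?x \<in> carrier E" using Suc.prems by (simp_all add: G_closed)
  have "nrm E (?x \<oplus> ?g ?x) \<le> nrm E ?x + nrm E (?g ?x)" by (rule Q.B.norm_triangle[OF x])
  also have "\<dots> \<le> nrm E ?x + nrm E ?x"
    by (rule add_left_mono) (rule star_hom_norm_le[OF algebras(3,3) G_hom x(1)], simp)
  finally show ?case using Suc x by (simp add: Q.B.norm_scale)
qed simp

lemma dyadic_mean_fixed:
  assumes "x \<in> carrier F"
  shows "dyadic_mean n x = x"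
proof (induction n)
  case (Suc n)
  have "(1 / 2) \<odot> (x \<oplus> x) = x"
    using F_E[OF assms] by (intro Q.B.vec_eqI) (simp_all add: Q.B.functional_simps)
  then show ?case by (simp add: Suc F_fixed[OF assms])
qed simp

text \<open>If \<open>d = 2\<^sup>v m\<close> with \<open>m\<close> odd, the rotation by \<open>cis (\<pi>/2\<^sup>v)\<close> multiplies an element of degree \<open>d\<close> by \<open>-1\<close>,
  and averaging over it kills the element.\<close>

lemma dyadic_mean_homogeneous:
  assumes y: "y \<in> carrier E" and d: "d > 0"
    and hom: "(\<forall>z. cmod z = 1 \<longrightarrow> G z y = z ^ d \<odot> y) \<or> (\<forall>z. cmod z = 1 \<longrightarrow> G z y = cnj z ^ d \<odot> y)"
  shows "\<exists>K. \<forall>n\<ge>K. dyadic_mean n y = \<zero>"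
proof -
  have "\<exists>v m. d = 2 ^ v * m \<and> odd m" using d
  proof (induction d rule: less_induct)
    case (less d)
    show ?case
    proof (cases "even d")
      case True
      then obtain e where e: "d = 2 * e" by blast
      then obtain v m where "e = 2 ^ v * m" "odd m" using less.IH[of e] less.prems by auto
      then have "d = 2 ^ Suc v * m \<and> odd m" using e by simp
      then show ?thesis by blast
    next
      case False
      then have "d = 2 ^ 0 * d \<and> odd d" by simp
      then show ?thesis by blast
    qed
  qed
  then obtain v m where vm: "d = 2 ^ v * m" "odd m" by blast
  let ?z = "cis (pi / 2 ^ v)"
  have "?z ^ (2 ^ v) = -1" by (simp add: Complex.DeMoivre)
  then have z: "?z ^ d = -1" using vm by (simp add: power_mult)
  then have zc: "cnj ?z ^ d = -1" by (metis complex_cnj_power complex_cnj_minus complex_cnj_one)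
  obtain ch where chi: "\<And>z. cmod z = 1 \<Longrightarrow> G z y = ch z \<odot> y" "ch ?z = -1"
  proof (cases "\<forall>z. cmod z = 1 \<longrightarrow> G z y = z ^ d \<odot> y")
    case True
    show ?thesis by (rule that[of "\<lambda>z. z ^ d"]) (use True z in auto)
  next
    case False
    show ?thesis by (rule that[of "\<lambda>z. cnj z ^ d"]) (use False hom zc in auto)
  qed
  have mean: "\<exists>c. dyadic_mean n y = c \<odot> y" for n
  proof (induction n)
    case 0
    show ?case using Q.B.scale_one[OF y] by (intro exI[of _ 1]) simp
  next
    case (Suc n)
    then obtain c where c: "dyadic_mean n y = c \<odot> y" by blast
    have "dyadic_mean (Suc n) y = (1 / 2 * (c + c * ch (cis (pi / 2 ^ n)))) \<odot> y"
      using y star_homD(4)[OF G_hom[of "cis (pi / 2 ^ n)"] y] chi(1)[of "cis (pi / 2 ^ n)"]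
      by (intro Q.B.vec_eqI) (simp_all add: c Q.B.functional_simps algebra_simps)
    then show ?case by blast
  qed
  have "dyadic_mean n y = \<zero>" if "n \<ge> Suc v" for n
    using that
  proof (induction n rule: dec_induct)
    case base
    obtain c where c: "dyadic_mean v y = c \<odot> y" using mean by blast
    show ?case
      using y star_homD(4)[OF G_hom[of ?z] y] chi(1)[of ?z] chi(2)
      by (intro Q.B.vec_eqI) (simp_all add: c Q.B.functional_simps algebra_simps)
  next
    case (step n)
    have "G (cis (pi / 2 ^ n)) \<zero> = \<zero>"
      by (rule Q.B.linear_map_zero[OF Q.B.complex_vector_space_axioms star_homD(1)[OF G_hom]]) simp
    then show ?case using step by (simp add: Q.B.add_zero Q.B.scale_zero)
  qed
  then show ?thesis by blast
qed

lemma G_funpow: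
  assumes u: "u \<in> carrier F" and z: "cmod z = 1"
  shows "G z ((snd t ^^ d) u) = z ^ d \<odot> (snd t ^^ d) u"
    "G z ((fst t' ^^ d) u) = cnj z ^ d \<odot> (fst t' ^^ d) u"
proof -
  have uE: "u \<in> carrier E" using u by simp
  note c = funpow_closed[OF uE]
  define g where "g = G z"
  note g = F_fixed[OF u z, folded g_def] G_lift(2)[OF z c(3), folded g_def] G_lift(3)[OF z c(2), folded g_def]
  show "G z ((snd t ^^ d) u) = z ^ d \<odot> (snd t ^^ d) u"
    unfolding g_def[symmetric]
    by (induction d) (simp_all add: g Q.B.scale_one[OF uE] multiplier_scale_apply(2)[OF t_in(1) c(3)] Q.B.scale_scale c)
  show "G z ((fst t' ^^ d) u) = cnj z ^ d \<odot> (fst t' ^^ d) u"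
    unfolding g_def[symmetric]
    by (induction d) (simp_all add: g Q.B.scale_one[OF uE] multiplier_scale_apply(1)[OF t_in(2) c(2)] Q.B.scale_scale c)
qed

lemma t_norm: "x \<in> carrier E \<Longrightarrow> nrm E (fst t x) \<le> nrm E x" "x \<in> carrier E \<Longrightarrow> nrm E (fst t' x) \<le> nrm E x"
  using Q.B.multiplier_isometry_norm[OF t_in(1) J.isometry] by blast+

lemma funpow_norm:
  assumes x: "x \<in> carrier E"
  shows "nrm E ((fst t ^^ n) x) \<le> nrm E x" "nrm E ((fst t' ^^ n) x) \<le> nrm E x"
  by (induction n) (use order_trans[OF t_norm(1)[OF funpow_closed(1)[OF x]]]
    order_trans[OF t_norm(2)[OF funpow_closed(2)[OF x]]] in simp_all)

text \<open>Let \<open>S\<close> consist of the elements \<open>u t\<^sup>d\<close> and \<open>t\<^sup>*\<^sup>d u\<close> with \<open>u \<in> W\<close>. Left multiplication by \<open>j(a)\<close>, \<open>t\<close>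
  and \<open>t\<^sup>*\<close> preserves \<open>S\<close>; for \<open>t\<close> this uses \<open>t\<^sup>n t\<^sup>*\<^sup>n u \<in> W\<close>. So the closed span of \<open>S\<close> is a left
  ideal, and since it contains \<open>E j(A)\<close>, it is \<open>E\<close>. The dyadic averages of an element of \<open>S\<close> lie in \<open>W\<close>
  from some stage on, are contractive and fix \<open>F\<close> pointwise; hence \<open>F\<close> lies in the closure of \<open>W\<close>.\<close>

lemma fixed_point_algebra_minimal:
  assumes W: "cstar_subalgebra F W" and jW: "\<And>a. a \<in> carrier A \<Longrightarrow> Q (i a) \<in> W"
    and b: "\<And>x. x \<in> W \<Longrightarrow> beta x \<in> W" "\<And>x. \<lbrakk>x \<in> carrier F; beta x \<in> W\<rbrakk> \<Longrightarrow> x \<in> W"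
  shows "carrier F \<subseteq> W"
proof -
  have cs: "closed_subspace F W" and Wm: "\<And>x y. \<lbrakk>x \<in> W; y \<in> W\<rbrakk> \<Longrightarrow> x \<otimes> y \<in> W"
    and Wa: "\<And>x. x \<in> W \<Longrightarrow> adj E x \<in> W"
    using W unfolding cstar_subalgebra_def by auto
  have Fs: "closed_subspace E (carrier F)" using F_subalgebra by (simp add: cstar_subalgebra_def)
  note D = FE.A.closed_subspaceD[OF cs, unfolded F_ops]
  have WF: "x \<in> carrier F" if "x \<in> W" for x using D(1) that by blast
  have WE: "x \<in> carrier E" if "x \<in> W" for x using WF[OF that] by simp
  have W_lim: "x \<in> W" if x: "x \<in> carrier E" and ap: "\<And>e. e > 0 \<Longrightarrow> \<exists>w\<in>W. nrm E (x \<ominus> w) < e" for x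
  proof (rule D(6)[OF _ ap])
    show "x \<in> carrier F" by (rule Q.B.closed_subspaceD(6)[OF Fs x]) (use ap WF in blast)
  qed
  \<comment> \<open>Since \<open>a t\<^sup>* u\<close> is close to \<open>t\<^sup>* u\<close> for a suitable \<open>a \<in> j(A)\<close>, the element \<open>t\<^sup>n\<^sup>+\<^sup>1 t\<^sup>*\<^sup>n\<^sup>+\<^sup>1 u\<close> is close to
    \<open>t (t\<^sup>n t\<^sup>*\<^sup>n a) t\<^sup>* u = \<beta>(t\<^sup>n t\<^sup>*\<^sup>n a) u\<close>.\<close>
  have Wp: "(fst t ^^ n) ((fst t' ^^ n) u) \<in> W" if "u \<in> W" for n u
    using that
  proof (induction n arbitrary: u)
    case (Suc n)
    let ?P = "\<lambda>x. (fst t ^^ n) ((fst t' ^^ n) x)" and ?m = "mult_power E t n \<otimes>\<^bsub>ME\<^esub> mult_power E t' n"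
    have u: "u \<in> carrier E" "fst t' u \<in> carrier E" using WE[OF Suc.prems] by simp_all
    have m: "?m \<in> carrier ME" using Q.B.mult_power_apply(1)[OF _ u(1)] t_in by (intro Q.B.multiplier_ops_closed(6))
    have P: "fst ?m x = ?P x" if x: "x \<in> carrier E" for x
      using x funpow_closed(2)[OF x] Q.B.mult_power_apply(2)[OF t_in(1)] Q.B.mult_power_apply(2)[OF t_in(2)]
      by (simp add: Q.B.multiplier_ops(5))
    note mD = Q.B.multiplier_carrierD[OF m]
    have eq: "(fst t ^^ Suc n) ((fst t' ^^ Suc n) u) = fst t (?P (fst t' u))" by (simp add: funpow_swap1)
    show ?case
    proof (rule W_lim)
      fix e :: real assume e: "e > 0"
      obtain a where a: "a \<in> carrier A" "nrm E (fst t' u \<ominus> j a \<otimes> fst t' u) < e"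
        using J.approximate_unit_range[OF u(2) e] J.co_contractionD(1) by blast
      have ja: "j a \<in> carrier E" "j a \<otimes> fst t' u \<in> carrier E" "fst t' u \<ominus> j a \<otimes> fst t' u \<in> carrier E"
        using a u by simp_all
      let ?w = "beta (?P (j a)) \<otimes> u"
      have "?w = fst t (fst ?m (j a) \<otimes> fst t' u)"
        using beta_mult_left[OF mD(1)[OF ja(1)] u(1)] P[OF ja(1)] by simp
      also have "\<dots> = fst t (fst ?m (j a \<otimes> fst t' u))" using mD(3)[OF ja(1) u(2)] by simp
      finally have "fst t (?P (fst t' u)) \<ominus> ?w = fst t (fst ?m (fst t' u) \<ominus> fst ?m (j a \<otimes> fst t' u))"
        using Q.B.linear_vdiff[OF tD(8) mD(1)[OF u(2)] mD(1)[OF ja(2)]] by (simp add: P u(2))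
      also have "\<dots> = fst t (?P (fst t' u \<ominus> j a \<otimes> fst t' u))"
        using Q.B.linear_vdiff[OF mD(8) u(2) ja(2)] P[OF ja(3)] by simp
      also have "nrm E \<dots> \<le> nrm E (fst t' u \<ominus> j a \<otimes> fst t' u)"
        using t_norm(1)[OF funpow_closed(1)[OF funpow_closed(2)[OF ja(3)]], of n n] funpow_norm(1)[OF funpow_closed(2)[OF ja(3)], of n n]
          funpow_norm(2)[OF ja(3), of n] by linarith
      finally have "nrm E ((fst t ^^ Suc n) ((fst t' ^^ Suc n) u) \<ominus> ?w) < e" unfolding eq using a(2) by simp
      moreover have "?w \<in> W" using Wm[OF b(1)[OF Suc.IH[of "j a"]] Suc.prems] jW[OF a(1)] by simp
      ultimately show "\<exists>w\<in>W. nrm E ((fst t ^^ Suc n) ((fst t' ^^ Suc n) u) \<ominus> w) < e" by blast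
    qed (intro funpow_closed u)
  qed simp
  have Wc: "compress u \<in> W" if u: "u \<in> W" for u
  proof (rule b(2))
    show "compress u \<in> carrier F" by (rule compress_F[OF WF[OF u]])
    have uE: "u \<in> carrier E" by (rule WE[OF u])
    have p: "fst t (fst t' x) \<in> W" if "x \<in> W" for x using Wp[OF that, of 1] by simp
    have a: "adj ME t' = t" using cstar_algebra.adj_adj[OF Q.B.multiplier_cstar_algebra t_in(1)] .
    let ?v = "fst t (fst t' u)"
    have "adj E (fst t (fst t' (adj E ?v))) = snd t' (snd t ?v)"
      using uE Q.B.adj_multiplier_apply(1)[OF t_in(1), of "fst t' (adj E ?v)"]
        Q.B.adj_multiplier_apply(1)[OF t_in(2), of "adj E ?v"] by (simp add: a Q.B.adj_adj)
    also have "\<dots> = beta (compress u)" using uE by (simp add: beta_def compress_def commute_t[OF _ t_in(1,1)])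
    finally show "beta (compress u) \<in> W" using Wa[OF p[OF Wa[OF p[OF u]]]] by simp
  qed
  define S where "S = {(snd t ^^ d) u | d u. u \<in> W} \<union> {(fst t' ^^ d) u | d u. u \<in> W}"
  have S1: "(snd t ^^ d) u \<in> S" and S2: "(fst t' ^^ d) u \<in> S" if "u \<in> W" for d u using that by (auto simp: S_def)
  have SE: "S \<subseteq> carrier E" using WE funpow_closed by (auto simp: S_def)
  have S_t: "fst t y \<in> S" if y: "y \<in> S" for y
  proof -
    obtain d u where u: "u \<in> W" "y = (snd t ^^ d) u \<or> y = (fst t' ^^ d) u" using y unfolding S_def by blast
    have "\<exists>d. y = (snd t ^^ d) u \<or> y = (fst t' ^^ Suc d) u"
    proof (cases d)
      case 0
      then have "y = (snd t ^^ 0) u" using u(2) by auto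
      then show ?thesis by blast
    qed (use u(2) in blast)
    then consider d where "u \<in> W" "y = (snd t ^^ d) u" | d where "u \<in> W" "y = (fst t' ^^ Suc d) u"
      using u(1) by blast
    then show ?thesis
    proof cases
      case 1
      have c: "(snd t ^^ d) (fst t u) = (snd t ^^ Suc d) (beta u)" using WE[OF 1(1)]
        by (simp add: beta_def J.S_snd_S' funpow_swap1)
      have "(snd t ^^ d) u \<in> carrier E \<and> fst t ((snd t ^^ d) u) = (snd t ^^ d) (fst t u)"
        by (induction d) (use WE[OF 1(1)] in \<open>simp_all add: commute_t[OF _ t_in(1,1), symmetric]\<close>)
      then have "fst t y = (snd t ^^ Suc d) (beta u)" using c 1(2) by simp
      then show ?thesis by (simp only: S1[OF b(1)[OF 1(1)]])
    next
      case 2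
      have "(fst t' ^^ d) ((fst t ^^ d) x) = x" if "x \<in> carrier E" for x d using that
        by (induction d arbitrary: x) (simp_all add: J.S'_S funpow_swap1)
      from this[of "fst t ((fst t' ^^ Suc d) u)" d]
      have "(fst t' ^^ d) ((fst t ^^ Suc d) ((fst t' ^^ Suc d) u)) = fst t ((fst t' ^^ Suc d) u)"
        using funpow_closed(2)[OF WE[OF 2(1)], of "Suc d"] by (simp add: funpow_swap1)
      then show ?thesis using S2[OF Wp[OF 2(1), of "Suc d"], of d] 2(2) by simp
    qed
  qed
  have S_t': "fst t' y \<in> S" if y: "y \<in> S" for y
  proof -
    obtain d u where u: "u \<in> W" "y = (snd t ^^ d) u \<or> y = (fst t' ^^ d) u" using y unfolding S_def by blast
    have "\<exists>d. y = (snd t ^^ Suc d) u \<or> y = (fst t' ^^ d) u"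
    proof (cases d)
      case 0
      then have "y = (fst t' ^^ 0) u" using u(2) by auto
      then show ?thesis by blast
    qed (use u(2) in blast)
    then consider d where "u \<in> W" "y = (snd t ^^ Suc d) u" | d where "u \<in> W" "y = (fst t' ^^ d) u"
      using u(1) by blast
    then show ?thesis
    proof cases
      case 1
      have "(snd t ^^ d) u \<in> carrier E \<and> fst t' ((snd t ^^ d) u) = (snd t ^^ d) (fst t' u)" for d
        by (induction d) (use WE[OF 1(1)] in \<open>simp_all add: commute_t[OF _ t_in(2,1), symmetric]\<close>)
      from this[of "Suc d"] have "fst t' y = (snd t ^^ d) (compress u)"
        using 1(2) by (simp add: compress_def funpow_swap1)
      then show ?thesis using S1[OF Wc[OF 1(1)]] by simp
    next
      case 2
      then show ?thesis using S2[OF 2(1), of "Suc d"] by simp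
    qed
  qed
  have S_j: "j a \<otimes> y \<in> S" if a: "a \<in> carrier A" and y: "y \<in> S" for a y
  proof -
    consider d u where "u \<in> W" "y = (snd t ^^ d) u" | d u where "u \<in> W" "y = (fst t' ^^ d) u"
      using y unfolding S_def by auto
    then show ?thesis
    proof cases
      case 1
      have "(snd t ^^ d) u \<in> carrier E \<and> j a \<otimes> (snd t ^^ d) u = (snd t ^^ d) (j a \<otimes> u)"
        by (induction d) (use WE[OF 1(1)] a in \<open>simp_all add: tD(4)[symmetric]\<close>)
      then show ?thesis using S1[OF Wm[OF jW[OF a] 1(1)]] 1(2) by simp
    next
      case 2
      have ac: "(\<alpha> ^^ d) a \<in> carrier A" for d by (induction d) (use a in simp_all)
      have "j a \<otimes> (fst t' ^^ d) u = (fst t' ^^ d) (j ((\<alpha> ^^ d) a) \<otimes> u)" if "u \<in> carrier E" for u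
        using that
      proof (induction d arbitrary: u)
        case (Suc d)
        then show ?case using J.S'_left[OF ac[of d], of u] by (simp add: funpow_swap1)
      qed simp
      then show ?thesis using S2[OF Wm[OF jW[OF ac] 2(1)]] WE[OF 2(1)] 2(2) by simp
    qed
  qed
  define H where "H = closed_subspace E hull S"
  have H: "closed_subspace E H" unfolding H_def by (rule Q.B.closed_subspace_hull[OF SE])
  have SH: "S \<subseteq> H" unfolding H_def by (rule hull_subset)
  note HD = Q.B.closed_subspaceD[OF H]
  have H_left: "x \<otimes> y \<in> H" if x: "x \<in> carrier E" "\<And>w. w \<in> S \<Longrightarrow> x \<otimes> w \<in> S" and y: "y \<in> H" for x y
  proof -
    have "closed_subspace E {y \<in> carrier E. x \<otimes> y \<in> H}"
      by (rule Q.B.closed_subspace_preimage[OF H, where K = "nrm E x"])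
        (use x(1) Q.B.norm_mult in \<open>simp_all add: linear_map_def Q.B.expand_simps\<close>)
    moreover have "S \<subseteq> {y \<in> carrier E. x \<otimes> y \<in> H}" using SE SH x(2) by blast
    ultimately have "H \<subseteq> {y \<in> carrier E. x \<otimes> y \<in> H}" unfolding H_def by (intro hull_minimal)
    then show ?thesis using y by blast
  qed
  let ?N = "{x \<in> carrier E. \<forall>y\<in>H. x \<otimes> y \<in> H \<and> adj E x \<otimes> y \<in> H}"
  have "carrier E \<subseteq> ?N"
  proof -
    have adj_j: "adj E (j a) = j (adj A a)" if "a \<in> carrier A" for a using J.f_simps(4)[OF that] by simp
    have left_t: "snd t (j a) \<otimes> w \<in> S" "adj E (snd t (j a)) \<otimes> w \<in> S" if a: "a \<in> carrier A" and w: "w \<in> S" for a w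
    proof -
      have wE: "w \<in> carrier E" using SE w by blast
      have "snd t (j a) \<otimes> w = j a \<otimes> fst t w" using a wE by (simp add: tD(5))
      then show "snd t (j a) \<otimes> w \<in> S" using S_j[OF a S_t[OF w]] by simp
      have "adj E (snd t (j a)) \<otimes> w = fst t' (j (adj A a) \<otimes> w)"
        using J.adj_pi_S[OF a] a wE by (simp add: t'D(3))
      then show "adj E (snd t (j a)) \<otimes> w \<in> S" using S_t'[OF S_j[OF TR.A.adj_closed[OF a] w]] by simp
    qed
    have "j a \<in> ?N" if a: "a \<in> carrier A" for a
    proof (intro CollectI conjI ballI)
      show "j a \<in> carrier E" using a by simp
      fix y assume y: "y \<in> H"
      show "j a \<otimes> y \<in> H" by (rule H_left[OF _ S_j[OF a] y]) (use a in simp)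
      show "adj E (j a) \<otimes> y \<in> H"
        unfolding adj_j[OF a] by (rule H_left[OF _ S_j[OF TR.A.adj_closed[OF a]] y]) (use a in simp)
    qed
    moreover have "snd t (j a) \<in> ?N" if a: "a \<in> carrier A" for a
    proof (intro CollectI conjI ballI)
      show c: "snd t (j a) \<in> carrier E" using a by simp
      fix y assume y: "y \<in> H"
      show "snd t (j a) \<otimes> y \<in> H" by (rule H_left[OF c left_t(1)[OF a] y])
      show "adj E (snd t (j a)) \<otimes> y \<in> H" by (rule H_left[OF _ left_t(2)[OF a] y]) (use c in simp)
    qed
    ultimately have "j ` carrier A \<union> {mult_right (j a) t | a. a \<in> carrier A} \<subseteq> ?N"
      by (auto simp: mult_right_def)
    then have "cstar_subalgebra E hull (j ` carrier A \<union> {mult_right (j a) t | a. a \<in> carrier A}) \<subseteq> ?N"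
      using Q.B.left_idealiser_subalgebra[OF H] by (rule hull_minimal)
    then show ?thesis using generated unfolding generated_by_rep_def by blast
  qed
  then have EH: "x \<otimes> y \<in> H" if "x \<in> carrier E" "y \<in> H" for x y using that by blast
  have H_all: "y \<in> H" if y: "y \<in> carrier E" for y
  proof -
    obtain a w where w: "a \<in> carrier A" "w \<in> carrier E" "y = w \<otimes> j a" using J.factorisation_right[OF y] by blast
    have "j a \<in> S" using S1[OF jW[OF w(1)], of 0] by simp
    then show ?thesis using EH[OF w(2)] SH w(3) by blast
  qed
  let ?Y = "{y \<in> carrier E. \<exists>K. \<forall>n\<ge>K. dyadic_mean n y \<in> W}"
  let ?C = "{x \<in> carrier E. \<forall>e>0. \<exists>w\<in>?Y. nrm E (x \<ominus> w) < e}"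
  have "linear_subspace E ?Y"
    unfolding linear_subspace_def
  proof (intro conjI ballI allI)
    note L = linear_mapD[OF dyadic_mean_linear]
    show "\<zero> \<in> ?Y" using D(2) dyadic_mean_fixed[OF WF[OF D(2)]] by simp
    fix x assume x: "x \<in> ?Y"
    then show "c \<odot> x \<in> ?Y" for c using D(4) L(3) by (simp, metis)
    fix y assume "y \<in> ?Y"
    then obtain K K' where c: "x \<in> carrier E" "y \<in> carrier E"
      and K: "\<And>n. n \<ge> K \<Longrightarrow> dyadic_mean n x \<in> W" "\<And>n. n \<ge> K' \<Longrightarrow> dyadic_mean n y \<in> W" using x by blast
    have "dyadic_mean n (x \<oplus> y) \<in> W" if "n \<ge> max K K'" for n
      using D(3)[OF K(1) K(2)] L(2)[OF c] that by simp
    then show "x \<oplus> y \<in> ?Y" using c by blast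
  qed blast
  then have C: "closed_subspace E ?C" by (rule Q.B.closed_subspace_closure)
  have SC: "S \<subseteq> ?C"
  proof
    fix y assume y: "y \<in> S"
    then obtain d u where u: "u \<in> W" "y = (snd t ^^ d) u \<or> y = (fst t' ^^ d) u" unfolding S_def by blast
    have yE: "y \<in> carrier E" using y SE by blast
    have "\<exists>K. \<forall>n\<ge>K. dyadic_mean n y \<in> W"
    proof (cases "d = 0")
      case True
      then have "y = u" using u(2) by auto
      then show ?thesis using dyadic_mean_fixed[OF WF[OF u(1)]] u(1) by simp
    next
      case False
      then have "\<exists>K. \<forall>n\<ge>K. dyadic_mean n y = \<zero>"
        using G_funpow[OF WF[OF u(1)]] u(2) by (intro dyadic_mean_homogeneous[OF yE, of d]) auto
      then show ?thesis using D(2) by metis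
    qed
    then have "y \<in> ?Y" using yE by blast
    then show "y \<in> ?C" using Q.B.vdiff_self[OF yE] Q.B.N_zero yE by (intro CollectI conjI allI impI bexI[of _ y]) simp_all
  qed
  have "H \<subseteq> ?C" unfolding H_def using SC C by (rule hull_minimal)
  then have all: "x \<in> ?C" if "x \<in> carrier E" for x using H_all[OF that] by blast
  show ?thesis
  proof
    fix x assume x: "x \<in> carrier F"
    then have xE: "x \<in> carrier E" by simp
    show "x \<in> W"
    proof (rule W_lim[OF xE])
      fix e :: real assume "e > 0"
      then obtain y K where y: "y \<in> carrier E" "dyadic_mean K y \<in> W" "nrm E (x \<ominus> y) < e" using all[OF xE] by blast
      have "dyadic_mean K (x \<ominus> y) = x \<ominus> dyadic_mean K y"
        using Q.B.linear_vdiff[OF dyadic_mean_linear xE y(1)] dyadic_mean_fixed[OF x] by simp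
      then show "\<exists>w\<in>W. nrm E (x \<ominus> w) < e"
        using dyadic_mean_norm_le[of "x \<ominus> y" K] xE y by (intro bexI[of _ "dyadic_mean K y"]) simp_all
    qed
  qed
qed

end

section \<open>The universal property of the Stacey crossed product\<close>

locale stacey_target = exel_crossed_product A \<alpha> L X q T E i s Q
  for A :: "'a cstar" and \<alpha> L :: "'a \<Rightarrow> 'a" and X :: "('a, 'x) bimodule" and q :: "'a \<Rightarrow> 'x"
    and T :: "'u cstar" and E :: "'u cstar" (structure)
    and i :: "'a \<Rightarrow> 'u" and s :: "'u multiplier" and Q :: "'u \<Rightarrow> 'u" +
  fixes D :: "'u cstar" and \<pi> :: "'u \<Rightarrow> 'u" and W :: "'u multiplier"
  assumes target: "cstar_algebra D" and stacey: "stacey_rep F beta D \<pi> W"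
begin

sublocale P: nondegenerate_homomorphism F D \<pi>
  by (rule nondegenerate_homomorphismI[OF F_cstar_algebra target]) (use stacey in \<open>simp add: stacey_rep_def\<close>)

abbreviation "W' \<equiv> adj P.B.MA W"

lemma W_in: "W \<in> carrier P.B.MA" "W' \<in> carrier P.B.MA"
proof -
  show "W \<in> carrier P.B.MA" using stacey by (simp add: stacey_rep_def)
  then show "W' \<in> carrier P.B.MA" by (rule P.B.multiplier_ops_closed(7))
qed

lemmas WD = P.B.multiplier_carrierD[OF W_in(1)] and W'D = P.B.multiplier_carrierD[OF W_in(2)]

lemma W_closed [simp]:
  "x \<in> carrier D \<Longrightarrow> fst W x \<in> carrier D" "x \<in> carrier D \<Longrightarrow> snd W x \<in> carrier D"
  "x \<in> carrier D \<Longrightarrow> fst W' x \<in> carrier D" "x \<in> carrier D \<Longrightarrow> snd W' x \<in> carrier D"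
  using WD(1,2) W'D(1,2) by blast+

lemma W_isometry: "W' \<otimes>\<^bsub>P.B.MA\<^esub> W = mult_one D"
  using stacey by (simp add: stacey_rep_def)

lemma W'_W: "y \<in> carrier D \<Longrightarrow> fst W' (fst W y) = y" "y \<in> carrier D \<Longrightarrow> snd W (snd W' y) = y"
  using arg_cong[OF W_isometry, of "\<lambda>m. fst m y"] arg_cong[OF W_isometry, of "\<lambda>m. snd m y"]
  by (simp_all add: P.B.multiplier_ops(5,6,11,12))

lemma W_norm: "y \<in> carrier D \<Longrightarrow> nrm D (fst W y) \<le> nrm D y" "y \<in> carrier D \<Longrightarrow> nrm D (fst W' y) \<le> nrm D y"
  using P.B.multiplier_isometry_norm[OF W_in(1) W_isometry] by blast+

lemma pi_beta:
  assumes x: "x \<in> carrier F" and y: "y \<in> carrier D"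
  shows "\<pi> (beta x) \<otimes>\<^bsub>D\<^esub> y = fst W (\<pi> x \<otimes>\<^bsub>D\<^esub> fst W' y)"
proof -
  have "mult_of D (\<pi> (beta x)) = W \<otimes>\<^bsub>P.B.MA\<^esub> mult_of D (\<pi> x) \<otimes>\<^bsub>P.B.MA\<^esub> W'"
    using stacey x by (simp add: stacey_rep_def)
  then have "fst (mult_of D (\<pi> (beta x))) y = fst (W \<otimes>\<^bsub>P.B.MA\<^esub> mult_of D (\<pi> x) \<otimes>\<^bsub>P.B.MA\<^esub> W') y" by simp
  then show ?thesis using y by (simp add: P.B.multiplier_ops(5,13))
qed

lemma W_pi:
  assumes "x \<in> carrier F" "y \<in> carrier D"
  shows "fst W (\<pi> x \<otimes>\<^bsub>D\<^esub> y) = \<pi> (beta x) \<otimes>\<^bsub>D\<^esub> fst W y"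
  using pi_beta[of x "fst W y"] assms by (simp add: W'_W)

lemma pi_W':
  assumes x: "x \<in> carrier F" and y: "y \<in> carrier D"
  shows "\<pi> x \<otimes>\<^bsub>D\<^esub> fst W' y = fst W' (\<pi> (beta x) \<otimes>\<^bsub>D\<^esub> y)"
  using x y by (simp add: pi_beta W'_W)

lemma pi_beta_eq: "x \<in> carrier F \<Longrightarrow> \<pi> (beta x) = snd W' (fst W (\<pi> x))"
  by (rule P.B.eq_by_right_mult) (use beta_F in \<open>simp_all add: pi_beta W'D(5) WD(3)\<close>)

text \<open>Elements of \<open>D\<close> are determined by their products with \<open>\<pi>(F)\<close> from the left.\<close>

lemma eq_by_pi_mult:
  assumes "x \<in> carrier D" "y \<in> carrier D" "\<And>v. v \<in> carrier F \<Longrightarrow> \<pi> v \<otimes>\<^bsub>D\<^esub> x = \<pi> v \<otimes>\<^bsub>D\<^esub> y"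
  shows "x = y"
proof (rule P.B.eq_by_left_mult[OF assms(1,2)])
  fix z assume "z \<in> carrier D"
  then obtain v w where "v \<in> carrier F" "w \<in> carrier D" "z = w \<otimes>\<^bsub>D\<^esub> \<pi> v" using P.factorisation_right by blast
  then show "z \<otimes>\<^bsub>D\<^esub> x = z \<otimes>\<^bsub>D\<^esub> y" using assms by (simp add: P.B.mult_assoc)
qed

text \<open>The relation \<open>\<beta>(v) (x - t t\<^sup>* x) = 0\<close> for all \<open>v \<in> F\<close> yields \<open>W\<^sup>* \<pi>(x - t t\<^sup>* x) = 0\<close>. On the other
  hand \<open>t t\<^sup>* x\<close> is a limit of elements \<open>\<beta>(v) x\<close>, whose images \<open>W \<pi>(v) W\<^sup>* \<pi>(x)\<close> are fixed by \<open>W W\<^sup>*\<close>.\<close>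

lemma pi_projection:
  assumes x: "x \<in> carrier F"
  shows "\<pi> (fst t (fst t' x)) = fst W (fst W' (\<pi> x))"
proof -
  let ?y = "fst t (fst t' x)"
  have xE: "x \<in> carrier E" using x by simp
  have y: "?y \<in> carrier F" by (rule projection_F[OF x])
  have px: "\<pi> x \<in> carrier D" "\<pi> ?y \<in> carrier D" using P.f_closed[OF x] P.f_closed[OF y] by auto
  have sub: "fst W (fst W' u) \<ominus>\<^bsub>D\<^esub> fst W (fst W' v) = fst W (fst W' (u \<ominus>\<^bsub>D\<^esub> v))"
    if "u \<in> carrier D" "v \<in> carrier D" for u v
    using that P.B.linear_vdiff[OF WD(8)]
      P.B.linear_vdiff[OF W'D(8)] by simp
  have "fst W' (\<pi> x \<ominus>\<^bsub>D\<^esub> \<pi> ?y) = \<zero>\<^bsub>D\<^esub>"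
  proof (rule eq_by_pi_mult)
    fix v assume v: "v \<in> carrier F"
    let ?d = "x \<ominus> ?y"
    have "fst t' ?d = \<zero>"
      using xE Q.B.linear_vdiff[OF t'D(8) xE, of ?y]
      by (simp add: J.S'_S Q.B.vdiff_self)
    then have "beta v \<otimes> ?d = \<zero>"
      using v xE Q.B.linear_map_zero[OF Q.B.complex_vector_space_axioms tD(8)]
      by (simp add: beta_mult_left Q.B.mult_zero_right)
    moreover have "\<pi> (beta v) \<otimes>\<^bsub>D\<^esub> (\<pi> x \<ominus>\<^bsub>D\<^esub> \<pi> ?y) = \<pi> (beta v \<otimes> ?d)"
      using P.f_simps(3)[OF beta_F[OF v], of ?d] P.f_vdiff[OF x y] x y by simp
    ultimately have z: "\<pi> (beta v) \<otimes>\<^bsub>D\<^esub> (\<pi> x \<ominus>\<^bsub>D\<^esub> \<pi> ?y) = \<zero>\<^bsub>D\<^esub>" using P.f_zero by simp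
    have "\<pi> v \<otimes>\<^bsub>D\<^esub> fst W' (\<pi> x \<ominus>\<^bsub>D\<^esub> \<pi> ?y) = fst W' \<zero>\<^bsub>D\<^esub>"
      using pi_W'[OF v, of "\<pi> x \<ominus>\<^bsub>D\<^esub> \<pi> ?y"] px z by simp
    then show "\<pi> v \<otimes>\<^bsub>D\<^esub> fst W' (\<pi> x \<ominus>\<^bsub>D\<^esub> \<pi> ?y) = \<pi> v \<otimes>\<^bsub>D\<^esub> \<zero>\<^bsub>D\<^esub>"
      using P.f_closed[OF v] P.B.linear_map_zero[OF P.B.complex_vector_space_axioms W'D(8)]
      by (simp add: P.B.mult_zero_right)
  qed (use px in simp_all)
  then have "fst W (fst W' (\<pi> x)) \<ominus>\<^bsub>D\<^esub> fst W (fst W' (\<pi> ?y)) = \<zero>\<^bsub>D\<^esub>"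
    using sub[OF px] P.B.linear_map_zero[OF P.B.complex_vector_space_axioms WD(8)] by simp
  then have eq: "fst W (fst W' (\<pi> x)) = fst W (fst W' (\<pi> ?y))" using px by (simp add: P.B.vdiff_eq_zero)
  have "\<pi> ?y = fst W (fst W' (\<pi> ?y))"
  proof (rule P.B.N_eqI)
    fix eps :: real assume e: "eps > 0"
    obtain v where v: "v \<in> carrier F" "nrm E (fst t' x \<ominus> v \<otimes> fst t' x) < eps / 2"
      using FE.approximate_unit_range[of "fst t' x" "eps / 2"] FE.co_contractionD(1) xE e by auto
    let ?w = "beta v \<otimes> x"
    have vE: "v \<in> carrier E" and w: "?w \<in> carrier F" using v x beta_F by simp_all
    have pw: "\<pi> ?w \<in> carrier D" by (rule P.f_closed[OF w])
    have "?y \<ominus> ?w = fst t (fst t' x \<ominus> v \<otimes> fst t' x)"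
      using vE xE Q.B.linear_vdiff[OF tD(8), of "fst t' x" "v \<otimes> fst t' x"]
      by (simp add: beta_mult_left)
    then have "nrm E (?y \<ominus> ?w) < eps / 2"
      using t_norm(1)[of "fst t' x \<ominus> v \<otimes> fst t' x"] v(2) vE xE by simp
    then have d: "nrm D (\<pi> ?y \<ominus>\<^bsub>D\<^esub> \<pi> ?w) < eps / 2"
      using P.f_norm_le[of "?y \<ominus> ?w"] P.f_vdiff[OF y w] y w by simp
    have "\<pi> ?w = fst W (\<pi> v \<otimes>\<^bsub>D\<^esub> fst W' (\<pi> x))"
      using P.f_simps(3)[OF beta_F[OF v(1)] x] pi_beta[OF v(1) px(1)] by simp
    then have fw: "fst W (fst W' (\<pi> ?w)) = \<pi> ?w" using P.f_closed[OF v(1)] px by (simp add: W'_W)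
    have "nrm D (fst W (fst W' (\<pi> ?y)) \<ominus>\<^bsub>D\<^esub> \<pi> ?w) \<le> nrm D (\<pi> ?y \<ominus>\<^bsub>D\<^esub> \<pi> ?w)"
      using sub[OF px(2) pw] fw W_norm(1)[of "fst W' (\<pi> ?y \<ominus>\<^bsub>D\<^esub> \<pi> ?w)"] W_norm(2)[of "\<pi> ?y \<ominus>\<^bsub>D\<^esub> \<pi> ?w"] px pw
      by simp
    then have "nrm D (\<pi> ?w \<ominus>\<^bsub>D\<^esub> fst W (fst W' (\<pi> ?y))) < eps / 2"
      using d P.B.N_vdiff_commute[of "\<pi> ?w" "fst W (fst W' (\<pi> ?y))"] px pw by simp
    then show "nrm D (\<pi> ?y \<ominus>\<^bsub>D\<^esub> fst W (fst W' (\<pi> ?y))) \<le> eps"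
      using d P.B.N_triangle_vdiff[of "\<pi> ?y" "\<pi> ?w" "fst W (fst W' (\<pi> ?y))"] px pw by simp
  qed (use px in simp_all)
  then show ?thesis using eq by simp
qed

abbreviation "\<rho> \<equiv> \<pi> \<circ> j"

lemma rho_star_hom: "star_hom A D \<rho>"
proof (rule star_hom_comp[OF _ P.hom])
  have "j \<in> carrier A \<rightarrow> carrier F" using j_in_F by auto
  then show "star_hom A F j" using J.hom unfolding star_hom_def linear_map_def by simp
qed

lemma rho_closed: "a \<in> carrier A \<Longrightarrow> \<pi> (Q (i a)) \<in> carrier D"
  by (rule P.f_closed[OF j_in_F])

lemma rho_nondegenerate: "nondegenerate_hom A D \<rho>"
proof (rule nondegenerate_homI[OF target rho_star_hom])
  fix b eps assume b: "b \<in> carrier D" "(eps :: real) > 0"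
  obtain x z where x: "x \<in> carrier F" "z \<in> carrier D" "b = \<pi> x \<otimes>\<^bsub>D\<^esub> z" using P.factorisation[OF b(1)] by blast
  define eta where "eta = eps / (nrm D z + 1)"
  have z0: "0 \<le> nrm D z" by (rule P.B.norm_nonneg[OF x(2)])
  have del: "0 < eta" using b z0 by (simp add: eta_def)
  obtain a where a: "a \<in> carrier A" "nrm E (x \<ominus> j a \<otimes> x) < eta"
    using J.approximate_unit_range[OF F_E[OF x(1)] del] J.co_contractionD(1) by blast
  have jx: "j a \<otimes> x \<in> carrier F" using a x by simp
  have c: "\<pi> x \<in> carrier D" "\<rho> a \<in> carrier D" using P.f_closed[OF x(1)] rho_closed[OF a(1)] by simp_all
  have "b \<ominus>\<^bsub>D\<^esub> \<rho> a \<otimes>\<^bsub>D\<^esub> b = \<pi> (x \<ominus> j a \<otimes> x) \<otimes>\<^bsub>D\<^esub> z"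
    using c x a P.f_vdiff[OF x(1), of "j a \<otimes> x"] P.f_simps(3)[OF j_in_F[OF a(1)] x(1)]
    by (simp add: P.B.mult_vdiff_left P.B.mult_assoc)
  also have "nrm D \<dots> \<le> nrm D (\<pi> (x \<ominus> j a \<otimes> x)) * nrm D z"
    by (rule P.B.norm_mult[OF P.f_closed x(2)]) (use x jx in simp)
  also have "\<dots> \<le> eta * nrm D z"
    using P.f_norm_le[of "x \<ominus> j a \<otimes> x"] a(2) x jx by (intro mult_right_mono[OF _ z0]) simp
  also have "\<dots> < eta * (nrm D z + 1)" using del by simp
  also have "\<dots> = eps" using z0 by (simp add: eta_def)
  finally show "\<exists>a\<in>carrier A. \<exists>b'\<in>carrier D. nrm D (b \<ominus>\<^bsub>D\<^esub> \<rho> a \<otimes>\<^bsub>D\<^esub> b') < eps" using a(1) b(1) by blast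
qed

lemma beta_j_mult:
  assumes "a \<in> carrier A" "x \<in> carrier E"
  shows "beta (j a \<otimes> x) = j (\<alpha> a) \<otimes> beta x"
  using assms J.S_left[OF assms] by (simp add: beta_def t'D(4))

lemma beta_sandwich:
  assumes a: "a \<in> carrier A" and vx: "v \<in> carrier E" "x \<in> carrier E"
  shows "beta v \<otimes> (j a \<otimes> beta x) = beta (v \<otimes> (j (L a) \<otimes> x))"
proof -
  have La: "L a \<in> carrier A" by (rule transfer_operator(1)[OF a])
  have bx: "beta x = fst t (snd t' x)" using vx by (simp add: beta_def commute_t[OF _ t_in])
  have "beta v \<otimes> (j a \<otimes> beta x) = fst t (v \<otimes> fst t' (j a \<otimes> beta x))"
    using a vx by (simp add: beta_mult_left)
  also have "fst t' (j a \<otimes> beta x) = j (L a) \<otimes> snd t' x"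
    unfolding bx by (rule J.S'_S_sandwich[OF a]) (use vx in simp)
  also have "v \<otimes> (j (L a) \<otimes> snd t' x) = snd t' (v \<otimes> (j (L a) \<otimes> x))"
    using vx La by (simp add: t'D(4))
  finally show ?thesis using vx La by (simp add: beta_def commute_t[OF _ t_in])
qed

text \<open>As \<open>D = \<pi>(F) D\<close>, the relations may be tested on products with \<open>\<pi>(F)\<close>. There \<open>W \<pi>(x) = \<pi>(\<beta>(x)) W\<close>
  reduces them to \<open>\<beta>(j(a) x) = j(\<alpha>(a)) \<beta>(x)\<close> and \<open>\<beta>(v) j(a) \<beta>(x) = \<beta>(v j(L(a)) x)\<close>.\<close>

lemma rho_toeplitz: "toeplitz_rep A \<alpha> L D \<rho> W"
  unfolding toeplitz_rep_def
proof (intro conjI ballI)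
  show "nondegenerate_hom A D \<rho>" by (rule rho_nondegenerate)
  show "W \<in> carrier P.B.MA" by (rule W_in)
  note mc = P.B.multiplier_ops_closed
  fix a assume a: "a \<in> carrier A"
  have La: "L a \<in> carrier A" by (rule transfer_operator(1)[OF a])
  have c: "\<pi> (Q (i a)) \<in> carrier D" "\<pi> (Q (i (\<alpha> a))) \<in> carrier D" "\<pi> (Q (i (L a))) \<in> carrier D"
    using rho_closed a La by simp_all
  have rel1: "fst W (\<rho> a \<otimes>\<^bsub>D\<^esub> y) = \<rho> (\<alpha> a) \<otimes>\<^bsub>D\<^esub> fst W y" if y: "y \<in> carrier D" for y
  proof -
    obtain x d where x: "x \<in> carrier F" "d \<in> carrier D" "y = \<pi> x \<otimes>\<^bsub>D\<^esub> d" using P.factorisation[OF y] by blast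
    have px: "\<pi> x \<in> carrier D" "\<pi> (beta x) \<in> carrier D" using P.f_closed[OF x(1)] P.f_closed[OF beta_F[OF x(1)]] by auto
    have "fst W (\<rho> a \<otimes>\<^bsub>D\<^esub> y) = fst W (\<pi> (j a \<otimes> x) \<otimes>\<^bsub>D\<^esub> d)"
      using P.f_simps(3)[OF j_in_F[OF a] x(1)] px c x by (simp add: P.B.mult_assoc)
    also have "\<dots> = \<pi> (beta (j a \<otimes> x)) \<otimes>\<^bsub>D\<^esub> fst W d" by (rule W_pi) (use a x in simp_all)
    also have "\<pi> (beta (j a \<otimes> x)) = \<rho> (\<alpha> a) \<otimes>\<^bsub>D\<^esub> \<pi> (beta x)"
      using beta_j_mult[OF a F_E[OF x(1)]] P.f_simps(3)[OF j_in_F[OF J.alpha_closed[OF a]] beta_F[OF x(1)]] by simp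
    finally show ?thesis using x px c W_pi[OF x(1,2)] by (simp add: P.B.mult_assoc)
  qed
  show "W \<otimes>\<^bsub>P.B.MA\<^esub> mult_of D (\<rho> a) = mult_of D (\<rho> (\<alpha> a)) \<otimes>\<^bsub>P.B.MA\<^esub> W"
    by (rule P.B.multiplier_fst_eqI)
      (use W_in c rel1 in \<open>simp_all add: mc(3,6) P.B.multiplier_ops(5,13)\<close>)
  have rel2: "fst W' (\<rho> a \<otimes>\<^bsub>D\<^esub> fst W y) = \<rho> (L a) \<otimes>\<^bsub>D\<^esub> y" if y: "y \<in> carrier D" for y
  proof (rule eq_by_pi_mult)
    obtain x d where x: "x \<in> carrier F" "d \<in> carrier D" "y = \<pi> x \<otimes>\<^bsub>D\<^esub> d" using P.factorisation[OF y] by blast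
    have px: "\<pi> x \<in> carrier D" "\<pi> (beta x) \<in> carrier D" using P.f_closed[OF x(1)] P.f_closed[OF beta_F[OF x(1)]] by auto
    fix v assume v: "v \<in> carrier F"
    have pv: "\<pi> v \<in> carrier D" "\<pi> (beta v) \<in> carrier D" using P.f_closed[OF v] P.f_closed[OF beta_F[OF v]] by auto
    let ?g = "v \<otimes> (j (L a) \<otimes> x)"
    have jx: "j (L a) \<otimes> x \<in> carrier F" "j a \<otimes> beta x \<in> carrier F" using a La x beta_F by simp_all
    have g: "?g \<in> carrier F" using jx v by simp
    have "\<pi> v \<otimes>\<^bsub>D\<^esub> fst W' (\<rho> a \<otimes>\<^bsub>D\<^esub> fst W y) = fst W' (\<pi> (beta v) \<otimes>\<^bsub>D\<^esub> (\<rho> a \<otimes>\<^bsub>D\<^esub> fst W y))"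
      by (rule pi_W'[OF v]) (use c y in simp)
    also have "fst W y = \<pi> (beta x) \<otimes>\<^bsub>D\<^esub> fst W d" unfolding x(3) by (rule W_pi[OF x(1,2)])
    also have "\<pi> (beta v) \<otimes>\<^bsub>D\<^esub> (\<rho> a \<otimes>\<^bsub>D\<^esub> (\<pi> (beta x) \<otimes>\<^bsub>D\<^esub> fst W d))
        = (\<pi> (beta v) \<otimes>\<^bsub>D\<^esub> (\<rho> a \<otimes>\<^bsub>D\<^esub> \<pi> (beta x))) \<otimes>\<^bsub>D\<^esub> fst W d"
      using pv px c x by (simp add: P.B.mult_assoc)
    also have "\<pi> (beta v) \<otimes>\<^bsub>D\<^esub> (\<rho> a \<otimes>\<^bsub>D\<^esub> \<pi> (beta x)) = \<pi> (beta v \<otimes> (j a \<otimes> beta x))"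
      using P.f_simps(3)[OF beta_F[OF v] jx(2)] P.f_simps(3)[OF j_in_F[OF a] beta_F[OF x(1)]] by simp
    also have "beta v \<otimes> (j a \<otimes> beta x) = beta ?g" by (rule beta_sandwich[OF a F_E[OF v] F_E[OF x(1)]])
    also have "\<pi> (beta ?g) \<otimes>\<^bsub>D\<^esub> fst W d = fst W (\<pi> ?g \<otimes>\<^bsub>D\<^esub> d)" by (rule W_pi[OF g x(2), symmetric])
    also have "fst W' (fst W (\<pi> ?g \<otimes>\<^bsub>D\<^esub> d)) = \<pi> ?g \<otimes>\<^bsub>D\<^esub> d" by (rule W'_W(1)) (use P.f_closed[OF g] x in simp)
    also have "\<pi> ?g = \<pi> v \<otimes>\<^bsub>D\<^esub> (\<rho> (L a) \<otimes>\<^bsub>D\<^esub> \<pi> x)"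
      using P.f_simps(3)[OF v jx(1)] P.f_simps(3)[OF j_in_F[OF La] x(1)] by simp
    finally show "\<pi> v \<otimes>\<^bsub>D\<^esub> fst W' (\<rho> a \<otimes>\<^bsub>D\<^esub> fst W y) = \<pi> v \<otimes>\<^bsub>D\<^esub> (\<rho> (L a) \<otimes>\<^bsub>D\<^esub> y)"
      using pv px c x W_pi[OF x(1,2)] by (simp add: P.B.mult_assoc)
  qed (use c y in simp_all)
  show "W' \<otimes>\<^bsub>P.B.MA\<^esub> mult_of D (\<rho> a) \<otimes>\<^bsub>P.B.MA\<^esub> W = mult_of D (\<rho> (L a))"
    by (rule P.B.multiplier_fst_eqI)
      (use W_in c rel2 in \<open>simp_all add: mc(3,6) P.B.multiplier_ops(5,13)\<close>)
qed

text \<open>By \<open>pi_projection\<close> the integrated form of \<open>(\<rho>, W)\<close> agrees with \<open>\<pi> \<circ> Q\<close> on \<open>i(a) s s\<^sup>* i(b)\<^sup>*\<close> and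
  therefore factors through \<open>E\<close>. The factor agrees with \<open>\<pi>\<close> on \<open>j(A)\<close>, and the set where it does so
  satisfies the hypotheses of \<open>fixed_point_algebra_minimal\<close>.\<close>

lemma integrated_form_exists: "\<exists>\<Psi>. integrated_form F E id t D \<pi> W \<Psi>"
proof -
  obtain \<Psi> where nd: "nondegenerate_hom E D \<Psi>" and Psi_j: "\<And>a. a \<in> carrier A \<Longrightarrow> \<Psi> (j a) = \<rho> a"
    and ext: "mult_extension E D \<Psi> t = W"
  proof (rule crossed_product_factor[OF target rho_toeplitz])
    fix \<Phi> assume "integrated_form A T i s D \<rho> W \<Phi>"
    then have nd: "nondegenerate_hom T D \<Phi>" and Pi: "\<And>a. a \<in> carrier A \<Longrightarrow> \<Phi> (i a) = \<rho> a"
      and PW: "mult_extension T D \<Phi> s = W"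
      unfolding integrated_form_def by blast+
    interpret Phi: nondegenerate_homomorphism T D \<Phi> by (rule nondegenerate_homomorphismI[OF algebras(2) target nd])
    have lift: "Phi.lift s = W" using PW by (simp add: Phi.mult_extension_eq_lift[OF TR.S_in])
    let ?V = "{x \<in> carrier T. Q x \<in> carrier F \<and> \<Phi> x = \<pi> (Q x)}"
    have Fs: "closed_subspace E (carrier F)" using F_subalgebra by (simp add: cstar_subalgebra_def)
    note FD = Q.B.closed_subspaceD[OF Fs]
    have "closed_subspace T ?V"
    proof (rule TR.B.closed_subspaceI)
      fix x assume x: "x \<in> carrier T" and ap: "\<And>e. e > 0 \<Longrightarrow> \<exists>w\<in>?V. nrm T (x \<ominus>\<^bsub>T\<^esub> w) < e"
      have near: "nrm E (Q x \<ominus> Q w) \<le> nrm T (x \<ominus>\<^bsub>T\<^esub> w)" "nrm D (\<Phi> x \<ominus>\<^bsub>D\<^esub> \<Phi> w) \<le> nrm T (x \<ominus>\<^bsub>T\<^esub> w)"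
        if "w \<in> carrier T" for w
        using Q.f_norm_le[of "x \<ominus>\<^bsub>T\<^esub> w"] Phi.f_norm_le[of "x \<ominus>\<^bsub>T\<^esub> w"] x that
        by (simp_all add: Q.f_vdiff Phi.f_vdiff)
      have Qx: "Q x \<in> carrier F"
      proof (rule FD(6))
        fix e :: real assume "e > 0"
        from ap[OF this] obtain w where "w \<in> ?V" "nrm T (x \<ominus>\<^bsub>T\<^esub> w) < e" by blast
        then show "\<exists>y\<in>carrier F. nrm E (Q x \<ominus> y) < e" using near(1)[of w] by (intro bexI[of _ "Q w"]) simp_all
      qed (use x in simp)
      have "\<Phi> x = \<pi> (Q x)"
      proof (rule P.B.N_eqI)
        fix e :: real assume "e > 0"
        then have "e / 2 > 0" by simp
        from ap[OF this] obtain w where w: "w \<in> carrier T" "Q w \<in> carrier F" "\<Phi> w = \<pi> (Q w)"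
          "nrm T (x \<ominus>\<^bsub>T\<^esub> w) < e / 2" by blast
        have "nrm E (Q w \<ominus> Q x) < e / 2"
          using near(1)[OF w(1)] w(4) Q.B.N_vdiff_commute[of "Q w" "Q x"] w(1) x by simp
        then have "nrm D (\<pi> (Q w) \<ominus>\<^bsub>D\<^esub> \<pi> (Q x)) < e / 2"
          using P.f_norm_le[of "Q w \<ominus> Q x"] P.f_vdiff[OF w(2) Qx] w(2) Qx by simp
        then show "nrm D (\<Phi> x \<ominus>\<^bsub>D\<^esub> \<pi> (Q x)) \<le> e"
          using near(2)[OF w(1)] w(3,4) P.B.N_triangle_vdiff[of "\<Phi> x" "\<Phi> w" "\<pi> (Q x)"] x w(1)
            P.f_closed[OF w(2)] P.f_closed[OF Qx] by simp
      qed (use x P.f_closed[OF Qx] in simp_all)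
      then show "x \<in> ?V" using x Qx by simp
    next
      show "\<zero>\<^bsub>T\<^esub> \<in> ?V" using FD(2) P.f_zero by (simp add: Q.f_zero Phi.f_zero)
      fix x y assume "x \<in> ?V" "y \<in> ?V"
      then show "x \<oplus>\<^bsub>T\<^esub> y \<in> ?V" using FD(3) P.f_simps(1) by (simp add: Q.f_simps Phi.f_simps)
    next
      fix c x assume "x \<in> ?V"
      then show "c \<odot>\<^bsub>T\<^esub> x \<in> ?V" using FD(4) P.f_simps(2) by (simp add: Q.f_simps Phi.f_simps)
    qed auto
    moreover have "\<forall>a\<in>carrier A. i a \<in> ?V" using Pi by simp
    moreover have "snd s (i a) \<otimes>\<^bsub>T\<^esub> adj T (snd s (i b)) \<in> ?V" if a: "a \<in> carrier A" and b: "b \<in> carrier A" for a b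
    proof -
      let ?b = "j (adj A b)"
      have b': "adj A b \<in> carrier A" using b by (rule TR.A.adj_closed)
      have jj: "j a \<in> carrier F" "?b \<in> carrier F" "?b \<in> carrier E" using a b' by simp_all
      have rr: "\<pi> (j a) \<in> carrier D" "\<pi> (j b) \<in> carrier D" "\<pi> ?b \<in> carrier D"
        using rho_closed[OF a] rho_closed[OF b] rho_closed[OF b'] by simp_all
      have Qs: "Q (snd s (i c)) = snd t (j c)" if "c \<in> carrier A" for c
        using Q.lift_snd[OF TR.S_in, of "i c"] that by (simp add: t_eq)
      have "Q (snd s (i a) \<otimes>\<^bsub>T\<^esub> adj T (snd s (i b))) = snd t (j a) \<otimes> adj E (snd t (j b))"
        using a b by (simp add: Q.f_simps Qs)
      also have "\<dots> = j a \<otimes> fst t (fst t' ?b)" using J.adj_pi_S[OF b] a jj by (simp add: tD(5))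
      finally have eqQ: "Q (snd s (i a) \<otimes>\<^bsub>T\<^esub> adj T (snd s (i b))) = j a \<otimes> fst t (fst t' ?b)" .
      have Phis: "\<Phi> (snd s (i c)) = snd W (\<pi> (j c))" if "c \<in> carrier A" for c
        using Phi.lift_snd[OF TR.S_in, of "i c"] that Pi[OF that] by (simp add: lift)
      have "\<Phi> (snd s (i a) \<otimes>\<^bsub>T\<^esub> adj T (snd s (i b))) = snd W (\<pi> (j a)) \<otimes>\<^bsub>D\<^esub> adj D (snd W (\<pi> (j b)))"
        using a b by (simp add: Phi.f_simps Phis)
      also have "adj D (snd W (\<pi> (j b))) = fst W' (adj D (\<pi> (j b)))" by (rule P.B.adj_multiplier_apply(2)[OF W_in(1) rr(2)])
      also have "adj D (\<pi> (j b)) = \<pi> ?b" using star_homD(6)[OF rho_star_hom b] by simp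
      also have "snd W (\<pi> (j a)) \<otimes>\<^bsub>D\<^esub> fst W' (\<pi> ?b) = \<pi> (j a) \<otimes>\<^bsub>D\<^esub> \<pi> (fst t (fst t' ?b))"
        unfolding pi_projection[OF jj(2)] by (rule WD(5)[OF rr(1)]) (use rr(3) in simp)
      also have "\<dots> = \<pi> (j a \<otimes> fst t (fst t' ?b))"
        using P.f_simps(3)[OF jj(1) projection_F[OF jj(2)]] by simp
      finally show ?thesis using eqQ projection_F[OF jj(2)] jj a b by simp
    qed
    moreover have "\<forall>x\<in>?V. Q x = \<zero> \<longrightarrow> \<Phi> x = \<zero>\<^bsub>D\<^esub>" using P.f_zero by simp
    ultimately show "\<exists>V. closed_subspace T V \<and> (\<forall>a\<in>carrier A. i a \<in> V) \<and>
      (\<forall>a\<in>carrier A. \<forall>b\<in>carrier A. snd s (i a) \<otimes>\<^bsub>T\<^esub> adj T (snd s (i b)) \<in> V) \<and>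
      (\<forall>x\<in>V. Q x = \<zero> \<longrightarrow> \<Phi> x = \<zero>\<^bsub>D\<^esub>)"
      by (intro exI[of _ ?V]) blast
  qed blast
  interpret Psi: nondegenerate_homomorphism E D \<Psi> by (rule nondegenerate_homomorphismI[OF algebras(3) target nd])
  have lift: "Psi.lift t = W" "Psi.lift t' = W'"
    using ext star_homD(6)[OF Psi.lift_star_hom t_in(1)] by (simp_all add: Psi.mult_extension_eq_lift[OF t_in(1)])
  have Psi_beta: "\<Psi> (beta x) = snd W' (fst W (\<Psi> x))" if "x \<in> carrier E" for x
    using that Psi.lift_snd[OF t_in(2), of "fst t x"] Psi.lift_fst[OF t_in(1) that] by (simp add: beta_def lift)
  have "carrier F \<subseteq> {x \<in> carrier F. \<Psi> x = \<pi> x}"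
  proof (rule fixed_point_algebra_minimal)
    have "star_hom F D \<Psi>" using star_hom_comp[OF FE.hom Psi.hom] by simp
    then show "cstar_subalgebra F {x \<in> carrier F. \<Psi> x = \<pi> x}"
      by (rule star_hom_equalizer[OF F_cstar_algebra target _ P.hom])
    show "Q (i a) \<in> {x \<in> carrier F. \<Psi> x = \<pi> x}" if "a \<in> carrier A" for a using Psi_j[OF that] that by simp
    show "beta x \<in> {x \<in> carrier F. \<Psi> x = \<pi> x}" if "x \<in> {x \<in> carrier F. \<Psi> x = \<pi> x}" for x
      using that beta_F pi_beta_eq Psi_beta by simp
    show "x \<in> {x \<in> carrier F. \<Psi> x = \<pi> x}" if x: "x \<in> carrier F" "beta x \<in> {x \<in> carrier F. \<Psi> x = \<pi> x}" for x
    proof -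
      have c: "\<Psi> x \<in> carrier D" "\<pi> x \<in> carrier D" using P.f_closed[OF x(1)] x(1) by simp_all
      have "snd W (snd W' (fst W (\<Psi> x))) = snd W (snd W' (fst W (\<pi> x)))"
        using x pi_beta_eq[OF x(1)] Psi_beta[OF F_E[OF x(1)]] by simp
      then have "fst W (\<Psi> x) = fst W (\<pi> x)" using c by (simp add: W'_W)
      then have "\<Psi> x = \<pi> x" using c W'_W(1) by metis
      then show ?thesis using x by simp
    qed
  qed
  then have "integrated_form F E id t D \<pi> W \<Psi>" unfolding integrated_form_def using nd ext by auto
  then show ?thesis by blast
qed

end

context exel_crossed_product
begin

lemma generated_by_fixed_points: "generated_by_rep F E id t"
proof -
  let ?G = "id ` carrier F \<union> {mult_right (id a) t | a. a \<in> carrier F}"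
  have "?G \<subseteq> carrier E" by (auto simp: mult_right_def)
  then have "cstar_subalgebra E hull ?G \<subseteq> carrier E"
    using hull_minimal[of ?G "carrier E" "cstar_subalgebra E"] Q.B.cstar_subalgebra_carrier by blast
  moreover have "j ` carrier A \<union> {mult_right (j a) t | a. a \<in> carrier A} \<subseteq> ?G" by auto
  then have "carrier E \<subseteq> cstar_subalgebra E hull ?G"
    using hull_mono generated unfolding generated_by_rep_def by blast
  ultimately show ?thesis unfolding generated_by_rep_def by blast
qed

lemma stacey_crossed_product_fixed_points: "stacey_crossed_product F beta E id t"
  unfolding stacey_crossed_product_def
proof (intro conjI allI impI)
  fix D :: "'u cstar" and \<pi> W
  assume "cstar_algebra D" "stacey_rep F beta D \<pi> W"
  then interpret stacey_target A \<alpha> L X q T E i s Q D \<pi> W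
    by (intro stacey_target.intro exel_crossed_product_axioms stacey_target_axioms.intro)
  show "\<exists>\<Phi>. integrated_form F E id t D \<pi> W \<Phi>" by (rule integrated_form_exists)
qed (rule algebras stacey_rep_id generated_by_fixed_points)+

end

text \<open>Two Stacey crossed products are isomorphic through their integrated forms.\<close>

lemma stacey_crossed_product_unique:
  fixes C E :: "'u cstar"
  assumes F: "cstar_algebra F" and C: "stacey_crossed_product F \<beta> C k v" and E: "stacey_crossed_product F \<beta> E l w"
  shows "\<exists>\<Phi>. integrated_form F C k v E l w \<Phi> \<and> star_iso C E \<Phi>"
proof -
  have inv: "g (f x) = x"
    if C: "stacey_crossed_product F \<beta> C k v" and E: "stacey_crossed_product F \<beta> E l w"
      and f: "integrated_form F C k v E l w f" and g: "integrated_form F E l w C k v g" and x: "x \<in> carrier C"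
    for C E :: "'u cstar" and k v l w f g x
  proof -
    have alg: "cstar_algebra C" "cstar_algebra E" and gen: "generated_by_rep F C k v"
      and rep: "stacey_rep F \<beta> C k v"
      using C E by (simp_all add: stacey_crossed_product_def)
    have kn: "nondegenerate_hom F C k" and v: "v \<in> carrier (multiplier_algebra C)"
      using rep by (simp_all add: stacey_rep_def)
    have fD: "nondegenerate_hom C E f" "\<And>a. a \<in> carrier F \<Longrightarrow> f (k a) = l a" "mult_extension C E f v = w"
      and gD: "nondegenerate_hom E C g" "\<And>a. a \<in> carrier F \<Longrightarrow> g (l a) = k a" "mult_extension E C g w = v"
      using f g unfolding integrated_form_def by blast+
    have "(g \<circ> f) x = id x"
    proof (rule star_homs_eq_on_generated[OF alg(1,1) nondegenerate_comp[OF alg(1,2,1) fD(1) gD(1)]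
          mult_extension_id(1)[OF alg(1) v] gen _ v _ _ x])
      show "k a \<in> carrier C" if "a \<in> carrier F" for a
        using kn that by (auto simp: nondegenerate_hom_def dest: star_homD(2))
      show "(g \<circ> f) (k a) = id (k a)" if "a \<in> carrier F" for a using fD(2)[OF that] gD(2)[OF that] by simp
      show "mult_extension C C (g \<circ> f) v = mult_extension C C id v"
        using mult_extension_comp[OF alg(1,2,1) fD(1) gD(1) v] fD(3) gD(3) mult_extension_id(2)[OF alg(1) v] by simp
    qed
    then show ?thesis by simp
  qed
  have algs: "cstar_algebra C" "cstar_algebra E" using C E by (simp_all add: stacey_crossed_product_def)
  obtain f where f: "integrated_form F C k v E l w f"
    using C E unfolding stacey_crossed_product_def by blast
  obtain g where g: "integrated_form F E l w C k v g"
    using C E unfolding stacey_crossed_product_def by blast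
  have hom: "star_hom C E f" "star_hom E C g"
    using f g by (simp_all add: integrated_form_def nondegenerate_hom_def)
  have "bij_betw f (carrier C) (carrier E)"
    by (rule bij_betw_byWitness[of _ g])
      (use inv[OF C E f g] inv[OF E C g f] star_homD(2)[OF hom(1)] star_homD(2)[OF hom(2)] in auto)
  then show ?thesis using f hom by (auto simp: star_iso_def)
qed

theorem corollary4p1:
  fixes A :: "'a cstar" and \<alpha> L :: "'a \<Rightarrow> 'a"
    and X :: "('a, 'x) bimodule" and q :: "'a \<Rightarrow> 'x"
    and T E F :: "'u cstar" and i j :: "'a \<Rightarrow> 'u" and s t p :: "'u multiplier" and Q :: "'u \<Rightarrow> 'u"
  assumes "exel_system A \<alpha> L"
    and "exel_bimodule A \<alpha> L X q"
    and "toeplitz_crossed_product A \<alpha> L T i s"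
    and "cstar_quotient T (exel_ideal A \<alpha> X q T i s) E Q"
  defines "j \<equiv> Q \<circ> i"
    and "t \<equiv> mult_extension T E Q s"
    and "F \<equiv> fixed_point_algebra A E j t"
    and "p \<equiv> t \<otimes>\<^bsub>multiplier_algebra E\<^esub> adj (multiplier_algebra E) t"
  shows "\<exists>\<beta>. star_hom F F \<beta> \<and> inj_on \<beta> (carrier F) \<and>
    (\<forall>a\<in>carrier A. \<forall>b\<in>carrier A. \<forall>n.
      \<beta> (core_element E j t a n b) = core_element E j t (\<alpha> a) (n + 1) (\<alpha> b)) \<and>
    (\<exists>\<beta>'. strict_extension F \<beta> \<beta>' \<and> mult_extension F E id (\<beta>' (mult_one F)) = p) \<and>
    \<beta> ` carrier F = {mult_right (mult_left p x) p | x. x \<in> carrier F} \<and>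
    stacey_rep F \<beta> E id t \<and>
    (\<exists>(C :: 'u cstar) k v. stacey_crossed_product F \<beta> C k v) \<and>
    (\<forall>(C :: 'u cstar) k v. stacey_crossed_product F \<beta> C k v \<longrightarrow>
      (\<exists>\<Phi>. integrated_form F C k v E id t \<Phi> \<and> star_iso C E \<Phi>))"
proof -
  interpret N: exel_crossed_product A \<alpha> L X q T E i s Q
    by unfold_locales fact+
  note scp = N.stacey_crossed_product_fixed_points
  have "\<forall>(C :: 'u cstar) k v. stacey_crossed_product N.F N.beta C k v \<longrightarrow>
      (\<exists>\<Phi>. integrated_form N.F C k v E id N.t \<Phi> \<and> star_iso C E \<Phi>)"
    by (intro allI impI stacey_crossed_product_unique[OF N.F_cstar_algebra _ scp])
  moreover have "\<exists>\<beta>'. strict_extension N.F N.beta \<beta>' \<and> mult_extension N.F E id (\<beta>' (mult_one N.F)) = N.p"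
    using N.beta_strict_extension N.lift_beta_mult_one by blast
  moreover have "\<forall>a\<in>carrier A. \<forall>b\<in>carrier A. \<forall>n.
      N.beta (core_element E N.j N.t a n b) = core_element E N.j N.t (\<alpha> a) (n + 1) (\<alpha> b)"
    using N.beta_core_element by blast
  moreover have "\<exists>(C :: 'u cstar) k v. stacey_crossed_product N.F N.beta C k v" using scp by blast
  ultimately show ?thesis
    unfolding j_def t_def F_def p_def
    using N.beta_star_hom N.beta_inj N.beta_range N.stacey_rep_id
    by (intro exI[of _ N.beta] conjI)
qed

end
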